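(* Let $n\ge 2$, let $\Omega\subset\mathbb{R}^n$ be a bounded open domain, let $0<\alpha<1$ and $0<\mu<1$, and let $P$ be an $N$-function satisfying: (P1) $P(st)\sim P(s)P(t)$, $\tilde P(st)\sim\tilde P(s)\tilde P(t)$, and $t\mapsto P(t)/t^2$ is monotone increasing on $(0,\infty)$; (P2) there is a constant $\hat C>0$ such that for all $\xi,\eta\in\mathbb{R}^n$ with $\xi\neq\eta$, $$\hat C^{-1}\frac{P\big[(\mu^2+|\xi|^2+|\eta|^2)^{1/2}\big]}{\mu^2+|\xi|^2+|\eta|^2}\le\frac{|V_P(\xi)-V_P(\eta)|^2}{|\xi-\eta|^2}\le\hat C\,\frac{P\big[(\mu^2+|\xi|^2+|\eta|^2)^{1/2}\big]}{\mu^2+|\xi|^2+|\eta|^2},$$ where $V_P(\xi)=\left[\frac{P[(\mu^2+|\xi|^2)^{1/2}]}{\mu^2+|\xi|^2}\right]^{1/2}\xi$. Let $A:\Omega\times\mathbb{R}^n\to\mathbb{R}^n$ be a Carathéodory vector field for which there are constants $\upsilon,L,\kappa>0$ such that for all $\xi,\eta\in\mathbb{R}^n$ and almost every $x\in\Omega$: (A1) $[A(x,\xi)-A(x,\eta)]\cdot(\xi-\eta)\ge\upsilon\,\frac{P[(\mu^2+|\xi|^2+|\eta|^2)^{1/2}]}{\mu^2+|\xi|^2+|\eta|^2}\,|\xi-\eta|^2$; (A2) $|A(x,\xi)-A(x,\eta)|\le L\,\frac{P[(\mu^2+|\xi|^2+|\eta|^2)^{1/2}]}{\mu^2+|\xi|^2+|\eta|^2}\,|\xi-\eta|$;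 (A3) $|A(x,\xi)|\le\kappa\,\frac{P[(\mu^2+|\xi|^2)^{1/2}]}{(\mu^2+|\xi|^2)^{1/2}}$. Assume moreover that there exists a function $g\in L^{n/\alpha}(\Omega)$ such that $$|A(x,\xi)-A(y,\xi)|\le|x-y|^\alpha\,(g(x)+g(y))\,\frac{P[(\mu^2+|\xi|^2)^{1/2}]}{(\mu^2+|\xi|^2)^{1/2}}$$ for almost every $x,y\in\Omega$ and all $\xi\in\mathbb{R}^n$. If $u\in W^{1,P}_{\mathrm{loc}}(\Omega)$ is a weak solution to $\operatorname{div}A(x,\nabla u)=0$ in $\Omega$, then $V_P(\nabla u)\in B^\alpha_{2,\infty}(\Omega)$ locally.
   Context: **$N$-function.** A function $P:[0,\infty)\to[0,\infty)$ is an $N$-function if (1) the derivatives $P'$ and $P''$ exist, $P(0)=0$, $P(1)=1$, and $P'(t)>0$, $P''(t)>0$ for $t>0$; (2) ($\Delta_2$-condition) there is $c_1>0$ with $P(2t)\le c_1P(t)$ for all $t\ge0$. The complementary function is $\tilde P(s)=\sup_{t\ge0}\{st-P(t)\}$. We write $f\sim g$ if there are constants $C_1,C_2>0$ with $C_1f\le g\le C_2f$ (uniformly in the arguments). **Orlicz–Sobolev spaces.** $L^P(\Omega)=\{u\in L^1(\Omega):\int_\Omega P(|u|)\,dx<\infty\}$ and $W^{1,P}(\Omega)=\{u\in L^P(\Omega):|\nabla u|\in L^P(\Omega)\}$; $u\in W^{1,P}_{\mathrm{loc}}(\Omega)$ means $u\in W^{1,P}(\Omega_0)$ for every $\Omega_0\Subset\Omega$.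 **Weak solution.** $u\in W^{1,P}_{\mathrm{loc}}(\Omega)$, $u:\Omega\to\mathbb{R}$, is a weak solution to $\operatorname{div}A(x,\nabla u)=0$ in $\Omega$ if $\int_\Omega A(x,\nabla u)\cdot\nabla\varphi\,dx=0$ for all $\varphi\in C_0^\infty(\Omega)$. **Besov space.** For $0<\alpha<1$, $1\le p<\infty$, $B^\alpha_{p,\infty}(\mathbb{R}^n)$ is the set of $v\in L^p(\mathbb{R}^n)$ with $\sup_{h\in\mathbb{R}^n,\,h\ne0}\left(\int_{\mathbb{R}^n}\frac{|\Delta_hv|^p}{|h|^{\alpha p}}\,dx\right)^{1/p}<\infty$, where $\Delta_hv(x)=v(x+h)-v(x)$. A (vector-valued) function $v$ on $\Omega$ belongs to $B^\alpha_{p,\infty}(\Omega)$ locally if $\phi v$ (extended by zero) belongs to $B^\alpha_{p,\infty}(\mathbb{R}^n)$ for every $\phi\in C_0^\infty(\Omega)$. *)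

theory Defs
  imports "HOL-Analysis.Analysis"
begin

section \<open>N-functions\<close>

text \<open>
  Functions on \<open>[0,\<infinity>)\<close> are rendered as functions on the reals of which only the values at
  nonnegative arguments matter.
\<close>

text \<open>
  The second derivative is only required at positive arguments, so that \<open>t powr p\<close> is an
  N-function for every \<open>p > 1\<close>, also when \<open>p < 2\<close>.
\<close>

definition N_function :: "(real \<Rightarrow> real) \<Rightarrow> bool" where
  "N_function P \<longleftrightarrow>
     (\<forall>t\<ge>0. 0 \<le> P t) \<and> P 0 = 0 \<and> P 1 = 1 \<and>
     (\<exists>P' P''. (\<forall>t\<ge>0. (P has_real_derivative P' t) (at t within {0..})) \<and>
               (\<forall>t>0. (P' has_real_derivative P'' t) (at t)) \<and>
               (\<forall>t>0. P' t > 0 \<and> P'' t > 0)) \<and>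
     (\<exists>c\<^sub>1>0. \<forall>t\<ge>0. P (2 * t) \<le> c\<^sub>1 * P t)"

text \<open>
  The supremum is taken in the reals, hence is meaningful only when it is finite. This is the
  case if \<open>P t / t\<^sup>2\<close> is increasing and \<open>P 1 = 1\<close>, since then \<open>P t \<ge> t\<^sup>2\<close> for \<open>t \<ge> 1\<close>.
\<close>

definition complementary :: "(real \<Rightarrow> real) \<Rightarrow> real \<Rightarrow> real" where
  "complementary P s = (SUP t\<in>{0..}. s * t - P t)"

definition comparable_on :: "'a set \<Rightarrow> ('a \<Rightarrow> real) \<Rightarrow> ('a \<Rightarrow> real) \<Rightarrow> bool" where
  "comparable_on D f g \<longleftrightarrow>
     (\<exists>C\<^sub>1>0. \<exists>C\<^sub>2>0. \<forall>x\<in>D. C\<^sub>1 * f x \<le> g x \<and> g x \<le> C\<^sub>2 * f x)"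

definition V_P :: "real \<Rightarrow> (real \<Rightarrow> real) \<Rightarrow> 'a::real_normed_vector \<Rightarrow> 'a" where
  "V_P \<mu> P \<xi> =
     sqrt (P (sqrt (\<mu>\<^sup>2 + (norm \<xi>)\<^sup>2)) / (\<mu>\<^sup>2 + (norm \<xi>)\<^sup>2)) *\<^sub>R \<xi>"


section \<open>Test functions and weak gradients\<close>

text \<open>
  \<open>C_k\<close> is \<open>k\<close>-fold continuous differentiability on the whole space: in the successor case all
  first order directional derivatives are again of class \<open>C_k\<close>.
\<close>

primrec C_k :: "nat \<Rightarrow> ('a::euclidean_space \<Rightarrow> real) \<Rightarrow> bool" where
  "C_k 0 f \<longleftrightarrow> continuous_on UNIV f"
| "C_k (Suc k) f \<longleftrightarrow>
     f differentiable_on UNIV \<and> (\<forall>v. C_k k (\<lambda>x. frechet_derivative f (at x) v))"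

text \<open>
  Elements of \<open>C\<^sub>0\<^sup>\<infinity>(\<Omega>)\<close> are identified with their extensions by zero to the whole space.
\<close>

definition test_functions :: "'a::euclidean_space set \<Rightarrow> ('a \<Rightarrow> real) set" where
  "test_functions \<Omega> =
     {\<phi>. (\<forall>k. C_k k \<phi>) \<and> compact (closure {x. \<phi> x \<noteq> 0}) \<and> closure {x. \<phi> x \<noteq> 0} \<subseteq> \<Omega>}"

definition grad :: "(real^'n \<Rightarrow> real) \<Rightarrow> real^'n \<Rightarrow> real^'n" where
  "grad \<phi> x = (\<chi> i. frechet_derivative \<phi> (at x) (axis i 1))"

definition locally_integrable :: "'a::euclidean_space set \<Rightarrow> ('a \<Rightarrow> 'b::euclidean_space) \<Rightarrow> bool"
  where "locally_integrable \<Omega> f \<longleftrightarrow>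
           (\<forall>K. compact K \<and> K \<subseteq> \<Omega> \<longrightarrow> f absolutely_integrable_on K)"

definition has_weak_gradient ::
    "(real^'n) set \<Rightarrow> (real^'n \<Rightarrow> real) \<Rightarrow> (real^'n \<Rightarrow> real^'n) \<Rightarrow> bool" where
  "has_weak_gradient \<Omega> u Du \<longleftrightarrow>
     locally_integrable \<Omega> u \<and> locally_integrable \<Omega> Du \<and>
     (\<forall>\<phi>\<in>test_functions \<Omega>.
        (LINT x|lebesgue_on \<Omega>. u x *\<^sub>R grad \<phi> x) = - (LINT x|lebesgue_on \<Omega>. \<phi> x *\<^sub>R Du x))"


section \<open>Function spaces\<close>

text \<open>Elements of function spaces are functions rather than equivalence classes.\<close>

definition Lp_space :: "real \<Rightarrow> 'a::euclidean_space set \<Rightarrow> ('a \<Rightarrow> 'b::euclidean_space) set" where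
  "Lp_space p \<Omega> =
     {f \<in> borel_measurable (lebesgue_on \<Omega>). integrable (lebesgue_on \<Omega>) (\<lambda>x. norm (f x) powr p)}"

definition Orlicz_space :: "(real \<Rightarrow> real) \<Rightarrow> 'a::euclidean_space set \<Rightarrow> ('a \<Rightarrow> real) set" where
  "Orlicz_space P \<Omega> =
     {u. u absolutely_integrable_on \<Omega> \<and> (\<lambda>x. P \<bar>u x\<bar>) absolutely_integrable_on \<Omega>}"

definition W1P :: "(real \<Rightarrow> real) \<Rightarrow> (real^'n) set \<Rightarrow> (real^'n \<Rightarrow> real) set" where
  "W1P P \<Omega> =
     {u \<in> Orlicz_space P \<Omega>. \<exists>Du. has_weak_gradient \<Omega> u Du \<and> (\<lambda>x. norm (Du x)) \<in> Orlicz_space P \<Omega>}"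

definition W1P_loc :: "(real \<Rightarrow> real) \<Rightarrow> (real^'n) set \<Rightarrow> (real^'n \<Rightarrow> real) set" where
  "W1P_loc P \<Omega> =
     {u. \<forall>\<Omega>\<^sub>0. open \<Omega>\<^sub>0 \<and> compact (closure \<Omega>\<^sub>0) \<and> closure \<Omega>\<^sub>0 \<subseteq> \<Omega> \<longrightarrow> u \<in> W1P P \<Omega>\<^sub>0}"

definition Besov :: "real \<Rightarrow> real \<Rightarrow> ('a::euclidean_space \<Rightarrow> 'b::euclidean_space) set" where
  "Besov \<alpha> p =
     {v \<in> Lp_space p UNIV.
        bdd_above ((\<lambda>h. (LINT x|lebesgue. norm (v (x + h) - v x) powr p / norm h powr (\<alpha> * p))
                          powr (1 / p)) ` (- {0}))}"

text \<open>
  A test function of \<open>\<Omega>\<close> vanishes off \<open>\<Omega>\<close>, so the product below is the extension by zero,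
  regardless of the values of \<open>v\<close> off \<open>\<Omega>\<close>.
\<close>

definition Besov_loc ::
    "real \<Rightarrow> real \<Rightarrow> 'a::euclidean_space set \<Rightarrow> ('a \<Rightarrow> 'b::euclidean_space) set" where
  "Besov_loc \<alpha> p \<Omega> = {v. \<forall>\<phi>\<in>test_functions \<Omega>. (\<lambda>x. \<phi> x *\<^sub>R v x) \<in> Besov \<alpha> p}"


section \<open>The equation\<close>

definition Caratheodory ::
    "'a::euclidean_space set \<Rightarrow> ('a \<Rightarrow> 'b::euclidean_space \<Rightarrow> 'c::euclidean_space) \<Rightarrow> bool" where
  "Caratheodory \<Omega> A \<longleftrightarrow>
     (\<forall>\<xi>. (\<lambda>x. A x \<xi>) \<in> borel_measurable (lebesgue_on \<Omega>)) \<and>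
     (AE x in lebesgue_on \<Omega>. continuous_on UNIV (A x))"

text \<open>
  The weak gradient is unique up to a null set, so its choice is immaterial. Every
  \<open>u \<in> W1P_loc P \<Omega>\<close> has a weak gradient on all of \<open>\<Omega>\<close>, glued from the local ones.
\<close>

definition weak_solution ::
    "(real \<Rightarrow> real) \<Rightarrow> (real^'n \<Rightarrow> real^'n \<Rightarrow> real^'n) \<Rightarrow> (real^'n) set \<Rightarrow> (real^'n \<Rightarrow> real) \<Rightarrow> bool"
  where "weak_solution P A \<Omega> u \<longleftrightarrow>
     u \<in> W1P_loc P \<Omega> \<and>
     (\<exists>Du. has_weak_gradient \<Omega> u Du \<and>
           (\<forall>\<phi>\<in>test_functions \<Omega>. (LINT x|lebesgue_on \<Omega>. A x (Du x) \<bullet> grad \<phi> x) = 0))"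

end

(*
  Testing the equation with second differences of the solution bounds the integral over a ball of
  radius R of |V(x + h) - V(x)|^2, where V = V_P(Du), by the integral of G_h^2 P(|Du|) plus (|h|/R)^2
  times that of P(|Du|) over a larger ball. Here G_h is bounded and is at most |h|^alpha times values and
  local averages of g, so its L^(n/alpha) norm is of order |h|^alpha. By Hoelder's inequality it remains to show that
  P(|Du|) is locally in L^(n/(n - 2 alpha)).

  Caccioppoli's inequality and bounds on difference quotients give a reverse Hoelder inequality for
  P(|Du|), so that small parts of a ball carry a small fraction of the integral. As g has small norm
  on small balls, the G_h term becomes a small multiple of the integral of P(|Du|), for all |h| <= R.
  A telescoping sum of averages of V over dyadic balls, started at the radius where the average of
  P(|Du|) reaches a given level, then yields decay of the superlevel sets and the integrability.
*)
theory Submission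
  imports Defs
begin

text \<open>The decisive numbers are those of the dyadic sum. Halving the radius multiplies the
  normalisation of mean values by 2^n, while the term quadratic in h gains a factor 1/4. So over K
  halvings the means of V grow at most like b^K, with b^2 at least 2^(n - 2), while the mass of f,
  the energy density, above a level of order b^(2K) shrinks like 4^(-K). This gives f in L^(1 + p)
  as soon as (b^2)^p < 4, hence for n > 2 whenever p < 2/(n - 2); the exponent 1 + p = n/(n - 2
  alpha) is of this kind because alpha < 1. The G_h term only has to stay below 4^(-K) for one fixed
  K, so smallness on small balls without any rate is enough to start; the rate |h|^alpha is used
  once, at the end.

  The solution lives on Omega and is known almost everywhere only. It is therefore cut off once and
  replaced by Borel functions on the whole space, where translations and mollifications are
  unrestricted; the equation and the structure conditions stay confined to an open set D on which
  the cut-off changes nothing.\<close>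

hide_fact (open)
  Henstock_Kurzweil_Integration.integrable_add Henstock_Kurzweil_Integration.integrable_diff
  Henstock_Kurzweil_Integration.integrable_sum Henstock_Kurzweil_Integration.integral_add
  Henstock_Kurzweil_Integration.integral_cong Henstock_Kurzweil_Integration.integral_diff
  Henstock_Kurzweil_Integration.integral_nonneg Henstock_Kurzweil_Integration.integral_norm_bound_integral
  Henstock_Kurzweil_Integration.integrable_bound

section \<open>Smooth functions\<close>

text \<open>Derivatives are unique, so any explicit derivative may stand for the operator
  \<open>frechet_derivative\<close> in \<open>C_k\<close>. Most smoothness proofs below go through
  this rule by induction or case distinction on \<open>k\<close>.\<close>

lemma C_k_I:
  assumes "\<And>x. (f has_derivative f' x) (at x)" "\<And>v. C_k k (\<lambda>x. f' x v)"
  shows "C_k (Suc k) f"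
proof -
  have "frechet_derivative f (at x) = f' x" for x
    using assms(1) by (simp add: frechet_derivative_at[symmetric])
  then show ?thesis
    using assms by (auto simp: differentiable_on_def differentiable_def)
qed

lemma C_k_D:
  assumes "C_k (Suc k) f"
  shows "(f has_derivative frechet_derivative f (at x)) (at x)"
  using assms by (simp add: differentiable_on_def frechet_derivative_works)

lemma C_k_Suc_imp: "C_k (Suc k) f \<Longrightarrow> C_k k f"
proof (induction k arbitrary: f)
  case 0
  then show ?case by (auto intro: differentiable_imp_continuous_on)
next
  case (Suc k)
  then show ?case by (metis C_k.simps(2))
qed

lemma C_k_const: "C_k k (\<lambda>x. c)"
proof (induction k arbitrary: c)
  case (Suc k)
  show ?case by (rule C_k_I[where f'="\<lambda>_ _. 0"]) (auto intro: Suc)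
qed auto

lemma C_k_add: "C_k k f \<Longrightarrow> C_k k g \<Longrightarrow> C_k k (\<lambda>x. f x + g x)"
proof (induction k arbitrary: f g)
  case 0
  then show ?case by (auto intro: continuous_on_add)
next
  case (Suc k)
  show ?case
    by (rule C_k_I[OF has_derivative_add[OF C_k_D[OF Suc.prems(1)] C_k_D[OF Suc.prems(2)]]])
      (use Suc in auto)
qed

lemma C_k_mult: "C_k k f \<Longrightarrow> C_k k g \<Longrightarrow> C_k k (\<lambda>x. f x * g x)"
proof (induction k arbitrary: f g)
  case 0
  then show ?case by (auto intro: continuous_on_mult)
next
  case (Suc k)
  show ?case
    by (rule C_k_I[OF has_derivative_mult[OF C_k_D[OF Suc.prems(1)] C_k_D[OF Suc.prems(2)]]])
      (use Suc C_k_Suc_imp[OF Suc.prems(1)] C_k_Suc_imp[OF Suc.prems(2)] in \<open>auto intro!: C_k_add\<close>)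
qed

lemma C_k_power: "C_k k f \<Longrightarrow> C_k k (\<lambda>x. f x ^ m)"
  by (induction m) (auto intro: C_k_const C_k_mult)

lemma C_k_affine:
  fixes f :: "'a::euclidean_space \<Rightarrow> real"
  shows "C_k k f \<Longrightarrow> C_k k (\<lambda>x. f (c *\<^sub>R x + b))"
proof (induction k arbitrary: f)
  case 0
  then show ?case
    by (auto intro!: continuous_on_compose2[of UNIV f] continuous_intros)
next
  case (Suc k)
  have d: "((\<lambda>x. f (c *\<^sub>R x + b)) has_derivative
      (\<lambda>v. frechet_derivative f (at (c *\<^sub>R x + b)) (c *\<^sub>R v))) (at x)" for x
    by (rule has_derivative_compose[OF _ C_k_D[OF Suc.prems]]) (auto intro!: derivative_eq_intros)
  show ?case
    by (rule C_k_I[OF d]) (use Suc in auto)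
qed

lemma C_k_inner: "C_k k (\<lambda>x. x \<bullet> v)"
proof (cases k)
  case (Suc l)
  have d: "((\<lambda>x. x \<bullet> v) has_derivative (\<lambda>w. w \<bullet> v)) (at x)" for x
    by (auto intro!: derivative_eq_intros)
  show ?thesis unfolding Suc by (rule C_k_I[OF d]) (rule C_k_const)
qed (auto intro!: continuous_intros)

lemma C_k_norm2: "C_k k (\<lambda>x::'a::euclidean_space. (norm x)\<^sup>2)"
proof (cases k)
  case 0
  then show ?thesis by (auto intro!: continuous_intros)
next
  case (Suc l)
  have d: "((\<lambda>x::'a. (norm x)\<^sup>2) has_derivative (\<lambda>v. x \<bullet> v + x \<bullet> v)) (at x)" for x
    unfolding power2_norm_eq_inner by (auto intro!: derivative_eq_intros simp: inner_commute)
  show ?thesis unfolding Suc by (rule C_k_I[OF d]) (intro C_k_add C_k_inner)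
qed

section \<open>Flat functions: exp(-1/t) continued by zero\<close>

definition expm :: "nat \<Rightarrow> real \<Rightarrow> real" where
  "expm m t = (if t > 0 then exp (- inverse t) * inverse t ^ m else 0)"

lemma exp_ge_power_div_fact:
  assumes "x \<ge> (0::real)" shows "x ^ m / fact m \<le> exp x"
proof -
  have "(\<Sum>n\<in>{m}. x ^ n /\<^sub>R fact n) \<le> (\<Sum>n. x ^ n /\<^sub>R fact n)"
    by (rule sum_le_suminf) (use assms summable_exp_generic[of x] in auto)
  then show ?thesis by (simp add: exp_def divide_inverse mult.commute)
qed

text \<open>One term of the exponential series at 1/t beats the power \<open>inverse t ^ m\<close>
  with two powers of t to spare. At 0 this makes the difference quotients of \<open>expm m\<close>
  of order |h|.\<close>

lemma expm_bound: "t > 0 \<Longrightarrow> expm m t \<le> fact (m + 2) * t\<^sup>2"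
proof -
  assume t: "t > 0"
  have "inverse t ^ (m + 2) / fact (m + 2) \<le> exp (inverse t)"
    by (rule exp_ge_power_div_fact) (use t in auto)
  then have "inverse t ^ (m + 2) \<le> fact (m + 2) * exp (inverse t)"
    by (simp add: divide_le_eq mult.commute)
  then have "exp (- inverse t) * inverse t ^ (m + 2) * t\<^sup>2 \<le> fact (m + 2) * t\<^sup>2"
    using t by (intro mult_right_mono) (simp_all add: exp_minus field_simps)
  then show ?thesis using t by (simp add: expm_def power_add field_simps power2_eq_square)
qed

text \<open>Differentiating exp(-1/t) produces powers of 1/t. The family over all \<open>m\<close>
  is closed under differentiation up to linear combinations, which carries the induction in
  \<open>C_k_expm_comp\<close>.\<close>

lemma expm_deriv: "(expm m has_real_derivative (expm (m + 2) t - m * expm (Suc m) t)) (at t)"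
proof -
  consider "t > 0" | "t < 0" | "t = 0" by linarith
  then show ?thesis
  proof cases
    case 1
    have "((\<lambda>t. exp (- inverse t) * inverse t ^ m) has_real_derivative
        (expm (m + 2) t - m * expm (Suc m) t)) (at t)"
      using 1 by (auto intro!: derivative_eq_intros simp: expm_def power2_eq_square power_add
          algebra_simps) (cases m; simp)
    then show ?thesis
      by (rule has_field_derivative_transform_within_open[of _ _ _ "{0<..}"]) (use 1 in \<open>auto simp: expm_def\<close>)
  next
    case 2
    have "((\<lambda>t. 0) has_real_derivative (expm (m + 2) t - m * expm (Suc m) t)) (at t)"
      using 2 by (auto simp: expm_def)
    then show ?thesis
      by (rule has_field_derivative_transform_within_open[of _ _ _ "{..<0}"]) (use 2 in \<open>auto simp: expm_def\<close>)
  next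
    case 3
    have "((\<lambda>h. (expm m (0 + h) - expm m 0) / h) \<longlongrightarrow> 0) (at 0)"
    proof (rule Lim_null_comparison)
      have "norm ((expm m (0 + h) - expm m 0) / h) \<le> fact (m + 2) * \<bar>h\<bar>" for h
      proof (cases "h > 0")
        case True
        then show ?thesis using expm_bound[OF True, of m]
          by (simp add: expm_def[of m 0] divide_le_eq power2_eq_square algebra_simps)
             (simp add: expm_def)
      next
        case False
        have "0 \<le> fact (m + 2) * \<bar>h\<bar>" by (intro mult_nonneg_nonneg) (auto simp del: fact_Suc)
        with False show ?thesis by (simp only: expm_def) simp
      qed
      then show "\<forall>\<^sub>F h in at 0. norm ((expm m (0 + h) - expm m 0) / h) \<le> fact (m + 2) * \<bar>h\<bar>"
        by auto
      show "((\<lambda>h. fact (m + 2) * \<bar>h\<bar>) \<longlongrightarrow> (0::real)) (at 0)"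
        by (auto intro!: tendsto_eq_intros)
    qed
    then show ?thesis unfolding 3 DERIV_def by (simp add: expm_def)
  qed
qed

lemma C_k_expm_comp: 
  assumes "\<And>k. C_k k p"
  shows "C_k k (\<lambda>x. expm m (p x))"
proof (induction k arbitrary: m)
  case 0
  have "continuous_on UNIV (expm m)"
    by (meson DERIV_continuous_on expm_deriv has_field_derivative_at_within)
  then show ?case
    using assms[of 0] by (auto intro: continuous_on_compose2)
next
  case (Suc k)
  have d: "((\<lambda>x. expm m (p x)) has_derivative
     (\<lambda>v. frechet_derivative p (at x) v * (expm (m + 2) (p x) + (- real m) * expm (Suc m) (p x)))) (at x)" for x
    using DERIV_compose_FDERIV[OF expm_deriv[of m "p x"] C_k_D[OF assms[of 1, unfolded One_nat_def], of x]]
    by simp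
  show ?case
    by (rule C_k_I[OF d]) (intro C_k_mult C_k_add C_k_const Suc C_k.simps(2)[THEN iffD1, THEN conjunct2, rule_format] assms)
qed

definition smooth :: "('a::euclidean_space \<Rightarrow> real) \<Rightarrow> bool" where
  "smooth f \<longleftrightarrow> (\<forall>k. C_k k f)"

abbreviation dd :: "('a::euclidean_space \<Rightarrow> real) \<Rightarrow> 'a \<Rightarrow> 'a \<Rightarrow> real" where
  "dd f x v \<equiv> frechet_derivative f (at x) v"

lemma smooth_has_derivative: "smooth f \<Longrightarrow> (f has_derivative frechet_derivative f (at x)) (at x)"
  unfolding smooth_def by (metis C_k_D)

lemma smooth_dd: "smooth f \<Longrightarrow> smooth (\<lambda>x. dd f x v)"
  unfolding smooth_def by (metis C_k.simps(2))

lemma smooth_cont: "smooth f \<Longrightarrow> continuous_on A f"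
  unfolding smooth_def by (metis C_k.simps(1) continuous_on_subset top_greatest)

lemma smooth_borel[measurable_dest]: "smooth f \<Longrightarrow> f \<in> borel_measurable borel"
  by (intro borel_measurable_continuous_onI smooth_cont)

lemma smooth_const [simp]: "smooth (\<lambda>x. c)"
  and smooth_add: "smooth f \<Longrightarrow> smooth g \<Longrightarrow> smooth (\<lambda>x. f x + g x)"
  and smooth_mult: "smooth f \<Longrightarrow> smooth g \<Longrightarrow> smooth (\<lambda>x. f x * g x)"
  and smooth_power: "smooth f \<Longrightarrow> smooth (\<lambda>x. f x ^ m)"
  and smooth_affine: "smooth f \<Longrightarrow> smooth (\<lambda>x. f (c *\<^sub>R x + b))"
  by (auto simp: smooth_def intro: C_k_const C_k_add C_k_mult C_k_power C_k_affine)

lemma dd_eq: "(f has_derivative f') (at x) \<Longrightarrow> dd f x v = f' v"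
  by (metis frechet_derivative_at)

lemma dd_mult: "smooth f \<Longrightarrow> smooth g \<Longrightarrow> dd (\<lambda>x. f x * g x) x v = f x * dd g x v + dd f x v * g x"
  by (rule dd_eq) (intro has_derivative_mult smooth_has_derivative)

lemma dd_affine: "smooth f \<Longrightarrow> dd (\<lambda>x. f (c *\<^sub>R x + b)) x v = c * dd f (c *\<^sub>R x + b) v"
proof -
  assume f: "smooth f"
  have "((\<lambda>x. f (c *\<^sub>R x + b)) has_derivative
      (\<lambda>v. frechet_derivative f (at (c *\<^sub>R x + b)) (c *\<^sub>R v))) (at x)"
    by (rule has_derivative_compose[OF _ smooth_has_derivative[OF f]]) (auto intro!: derivative_eq_intros)
  from dd_eq[OF this] show ?thesis
    using linear_scale[OF has_derivative_linear[OF smooth_has_derivative[OF f]]] by simp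
qed

definition bump :: "'a::euclidean_space \<Rightarrow> real" where "bump x = expm 0 (1 - (norm x)\<^sup>2)"

lemma bump_smooth: "smooth bump"
proof -
  have "C_k k (\<lambda>x::'a. 1 + (-1) * (norm x)\<^sup>2)" for k
    by (intro C_k_add C_k_mult C_k_const C_k_norm2)
  from C_k_expm_comp[OF this] show ?thesis
    unfolding smooth_def bump_def by auto
qed

lemma bump_pos: "norm x < 1 \<Longrightarrow> bump x > 0"
  by (simp add: bump_def expm_def abs_square_less_1)

lemma bump_0: "norm x \<ge> 1 \<Longrightarrow> bump x = 0"
  by (simp add: bump_def expm_def abs_square_less_1)

lemma bump_nonneg: "bump x \<ge> 0" by (auto simp: bump_def expm_def)

section \<open>Integrals over sets and translations\<close>

lemma integrable_borel: "integrable lborel f \<Longrightarrow> f \<in> borel_measurable borel"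
  by (auto dest: borel_measurable_integrable)

lemma lborel_distr_shift: "distr lborel borel (\<lambda>x. x + h) = (lborel :: 'a::euclidean_space measure)"
  using lborel_distr_plus[of h] by (simp add: add.commute[of _ h])

lemma lborel_distr_reflect: "distr lborel borel (\<lambda>x. h - x) = (lborel :: 'a::euclidean_space measure)"
  using lborel_affine[of "-1" h] by (simp add: density_1)

lemma nn_integral_shift:
  fixes f :: "'a::euclidean_space \<Rightarrow> ennreal"
  shows "f \<in> borel_measurable borel \<Longrightarrow> (\<integral>\<^sup>+x. f (x + h) \<partial>lborel) = (\<integral>\<^sup>+x. f x \<partial>lborel)"
  by (subst (2) lborel_distr_shift[of h, symmetric]) (simp add: nn_integral_distr)

lemma nn_integral_reflect:
  fixes f :: "'a::euclidean_space \<Rightarrow> ennreal"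
  shows "f \<in> borel_measurable borel \<Longrightarrow> (\<integral>\<^sup>+x. f (h - x) \<partial>lborel) = (\<integral>\<^sup>+x. f x \<partial>lborel)"
  by (subst (2) lborel_distr_reflect[of h, symmetric]) (simp add: nn_integral_distr)

lemma integral_shift:
  fixes f :: "'a::euclidean_space \<Rightarrow> 'b::euclidean_space"
  shows "f \<in> borel_measurable borel \<Longrightarrow> (\<integral>x. f (x + h) \<partial>lborel) = (\<integral>x. f x \<partial>lborel)"
  by (subst (2) lborel_distr_shift[of h, symmetric]) (simp add: integral_distr)

lemma integral_reflect:
  fixes f :: "'a::euclidean_space \<Rightarrow> 'b::euclidean_space"
  shows "f \<in> borel_measurable borel \<Longrightarrow> (\<integral>x. f (h - x) \<partial>lborel) = (\<integral>x. f x \<partial>lborel)"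
  by (subst (2) lborel_distr_reflect[of h, symmetric]) (simp add: integral_distr)

lemma integrable_shift:
  fixes f :: "'a::euclidean_space \<Rightarrow> 'b::euclidean_space"
  assumes "integrable lborel f" shows "integrable lborel (\<lambda>x. f (x + h))"
proof -
  have "integrable (distr lborel borel (\<lambda>x. x + h)) f" using assms by (simp add: lborel_distr_shift)
  then show ?thesis by (rule integrable_distr[rotated]) simp
qed

lemma integrable_reflect:
  fixes f :: "'a::euclidean_space \<Rightarrow> 'b::euclidean_space"
  assumes "integrable lborel f" shows "integrable lborel (\<lambda>x. f (h - x))"
proof -
  have "integrable (distr lborel borel (\<lambda>x. h - x)) f" using assms by (simp add: lborel_distr_reflect)
  then show ?thesis by (rule integrable_distr[rotated]) simp
qed

lemma AE_shift:
  assumes "AE x in lborel. Q (x::'a::euclidean_space)" shows "AE x in lborel. Q (x + h)"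
proof -
  obtain N where N: "N \<in> null_sets lborel" "{x. \<not> Q x} \<subseteq> N"
    using assms by (auto simp: eventually_ae_filter)
  show ?thesis
    by (rule AE_I'[OF null_sets_translation[OF N(1), of "- h"]]) (use N in auto)
qed

text \<open>With values in \<open>ennreal\<close>, estimates can be chained before finiteness is
  known. The coercion cuts off the negative part of \<open>f\<close>, so additivity asks for
  nonnegative summands.\<close>

definition SI :: "'a::euclidean_space set \<Rightarrow> ('a \<Rightarrow> real) \<Rightarrow> ennreal" where
  "SI A f = (\<integral>\<^sup>+x. ennreal (f x) * indicator A x \<partial>lborel)"

lemma SI_mono_AE: "AE x in lborel. x \<in> A \<longrightarrow> x \<in> B \<and> f x \<le> g x \<Longrightarrow> SI A f \<le> SI B g"
  unfolding SI_def
  by (rule nn_integral_mono_AE, erule eventually_mono) (auto simp: indicator_def intro: ennreal_leI)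

lemma SI_mono: "(\<And>x. x \<in> A \<Longrightarrow> x \<in> B \<and> f x \<le> g x) \<Longrightarrow> SI A f \<le> SI B g"
  by (rule SI_mono_AE) auto

lemma SI_cong: "(\<And>x. x \<in> A \<Longrightarrow> f x = g x) \<Longrightarrow> SI A f = SI A g"
  unfolding SI_def by (rule nn_integral_cong) (auto simp: indicator_def)

lemma SI_subset: "A \<subseteq> B \<Longrightarrow> SI A f \<le> SI B f"
  by (rule SI_mono) auto

lemma SI_cmult:
  assumes "c \<ge> 0" and [measurable]: "f \<in> borel_measurable borel" "A \<in> sets borel"
  shows "SI A (\<lambda>x. c * f x) = ennreal c * SI A f"
  unfolding SI_def using assms(1)
  by (simp add: ennreal_mult' mult.assoc nn_integral_cmult)

lemma SI_add:
  assumes [measurable]: "f \<in> borel_measurable borel" "g \<in> borel_measurable borel" "A \<in> sets borel"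
    and "\<And>x. x \<in> A \<Longrightarrow> f x \<ge> 0" "\<And>x. x \<in> A \<Longrightarrow> g x \<ge> 0"
  shows "SI A (\<lambda>x. f x + g x) = SI A f + SI A g"
proof -
  have "SI A (\<lambda>x. f x + g x) = (\<integral>\<^sup>+x. ennreal (f x) * indicator A x + ennreal (g x) * indicator A x \<partial>lborel)"
    unfolding SI_def by (rule nn_integral_cong) (use assms in \<open>auto simp: indicator_def\<close>)
  then show ?thesis unfolding SI_def by (simp add: nn_integral_add)
qed

text \<open>No sign conditions are imposed because cutting off negative parts is itself
  subadditive.\<close>

lemma SI_add_le:
  assumes [measurable]: "f \<in> borel_measurable borel" "g \<in> borel_measurable borel" "A \<in> sets borel"
  shows "SI A (\<lambda>x. f x + g x) \<le> SI A f + SI A g"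
proof -
  have e: "ennreal (a + b) \<le> ennreal a + ennreal b" for a b
    by (cases "a \<ge> 0"; cases "b \<ge> 0")
      (auto simp: ennreal_neg simp flip: ennreal_plus intro!: ennreal_leI)
  have "SI A (\<lambda>x. f x + g x) \<le> (\<integral>\<^sup>+x. ennreal (f x) * indicator A x + ennreal (g x) * indicator A x \<partial>lborel)"
    unfolding SI_def by (rule nn_integral_mono) (use e in \<open>auto simp: indicator_def\<close>)
  then show ?thesis unfolding SI_def by (simp add: nn_integral_add)
qed

lemma SI_const: "A \<in> sets borel \<Longrightarrow> SI A (\<lambda>_. c) = ennreal c * emeasure lborel A"
  by (simp add: SI_def nn_integral_cmult)

lemma SI_integrable:
  assumes "integrable lborel f" "\<And>x. f x \<ge> 0"
  shows "SI UNIV f = ennreal (\<integral>x. f x \<partial>lborel)"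
  unfolding SI_def using assms by (simp add: nn_integral_eq_integral)

lemma SI_shift:
  assumes [measurable]: "f \<in> borel_measurable borel" "A \<in> sets borel"
  shows "SI {x. x + h \<in> A} (\<lambda>x. f (x + h)) = SI A f"
proof -
  have "(\<integral>\<^sup>+x. ennreal (f (x + h)) * indicator A (x + h) \<partial>lborel) = SI A f"
    unfolding SI_def by (rule nn_integral_shift[of "\<lambda>x. ennreal (f x) * indicator A x"]) measurable
  moreover have "indicator {x. x + h \<in> A} x = (indicator A (x + h) :: ennreal)" for x
    by (auto simp: indicator_def)
  ultimately show ?thesis by (simp add: SI_def)
qed

lemma SI_cball_shift_le:
  assumes [measurable]: "f \<in> borel_measurable borel"
  shows "SI (cball x r) (\<lambda>y. f (y + h)) \<le> SI (cball x (r + norm h)) f"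
proof -
  have "SI (cball x r) (\<lambda>y. f (y + h)) \<le> SI {y. y + h \<in> cball x (r + norm h)} (\<lambda>y. f (y + h))"
  proof (rule SI_subset, safe)
    fix y assume "y \<in> cball x r"
    then show "y + h \<in> cball x (r + norm h)"
      using norm_triangle_ineq4[of "x - y" h] by (simp add: dist_norm algebra_simps)
  qed
  then show ?thesis using SI_shift[OF assms, of "cball x (r + norm h)" h] by (simp del: mem_cball)
qed

section \<open>Continuity of translations in the mean\<close>

lemma measure_lt_lborel:
  assumes "A \<in> sets borel" "emeasure lebesgue A < ennreal e" "0 < e"
  shows "measure lborel A < e" "emeasure lborel A < \<infinity>"
proof -
  have "emeasure lborel A < ennreal e" using assms by simp
  then show "emeasure lborel A < \<infinity>" by (rule less_trans) simp
  with \<open>emeasure lborel A < ennreal e\<close> show "measure lborel A < e"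
    using assms(3) by (simp add: emeasure_eq_ennreal_measure ennreal_less_iff)
qed

text \<open>Inner regularity gives a closed set; intersecting it with a large ball makes it compact,
  and the finite measure of \<open>A\<close> makes the part outside that ball small. Three errors
  occur, hence \<open>e / 3\<close>.\<close>

lemma compact_open_approx:
  assumes [measurable]: "A \<in> sets (borel :: 'a::euclidean_space measure)"
    and fin: "emeasure lborel A < \<infinity>" and "e > 0"
  obtains K S where "compact K" "open S" "K \<subseteq> A" "A \<subseteq> S"
    "emeasure lborel (S - K) < \<infinity>" "measure lborel (S - K) < e"
proof -
  have e: "e / 3 > 0" using assms by simp
  obtain T where T: "closed T" "T \<subseteq> A" "A - T \<in> lmeasurable" "emeasure lebesgue (A - T) < ennreal (e/3)"
    by (rule sets_lebesgue_inner_closed[of A, OF _ e]) auto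
  obtain S where S: "open S" "A \<subseteq> S" "S - A \<in> lmeasurable" "emeasure lebesgue (S - A) < ennreal (e/3)"
    by (rule sets_lebesgue_outer_open[of A, OF _ e]) auto
  have [measurable]: "T \<in> sets borel" "S \<in> sets borel" using T S by auto
  have "(\<lambda>k. emeasure lborel (A - cball 0 (real k))) \<longlonglongrightarrow> emeasure lborel (\<Inter>k. A - cball 0 (real k))"
  proof (rule Lim_emeasure_decseq)
    show "emeasure lborel (A - cball 0 (real i)) \<noteq> \<infinity>" for i
      using fin emeasure_mono[of "A - cball 0 (real i)" A lborel] by (auto simp: top_unique)
  qed (auto simp: decseq_def)
  also have "(\<Inter>k. A - cball 0 (real k)) = {}"
    using real_arch_simple by (auto simp: not_le)
  finally have "\<forall>\<^sub>F k in sequentially. emeasure lborel (A - cball 0 (real k)) < ennreal (e/3)"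
    by (rule order_tendstoD) (use e in auto)
  then obtain k where k: "emeasure lborel (A - cball 0 (real k)) < ennreal (e/3)"
    by (auto simp: eventually_sequentially)
  define K where "K = T \<inter> cball 0 (real k)"
  have K: "compact K" unfolding K_def using T by (intro closed_Int_compact) auto
  have [measurable]: "K \<in> sets borel" using K by (simp add: borel_compact)
  note m = measure_lt_lborel[OF _ T(4) e] measure_lt_lborel[OF _ S(4) e] measure_lt_lborel[of "A - cball 0 (real k)", OF _ _ e]
  have sub: "S - K \<subseteq> ((S - A) \<union> (A - T)) \<union> (A - cball 0 (real k))" by (auto simp: K_def)
  have f: "emeasure lborel (((S - A) \<union> (A - T)) \<union> (A - cball 0 (real k))) < \<infinity>"
    using m k by (auto intro!: order_le_less_trans[OF emeasure_subadditive])
  have "emeasure lborel (S - K) < \<infinity>"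
    by (rule le_less_trans[OF emeasure_mono[OF sub] f]) auto
  moreover have "measure lborel (S - K) < e"
  proof -
    have "measure lborel (S - K) \<le> measure lborel (((S - A) \<union> (A - T)) \<union> (A - cball 0 (real k)))"
      by (rule measure_mono_fmeasurable[OF sub]) (use f in \<open>auto simp: fmeasurable_def\<close>)
    also have "\<dots> \<le> measure lborel (S - A) + measure lborel (A - T) + measure lborel (A - cball 0 (real k))"
      by (rule order_trans[OF measure_Un_le]) (auto intro!: add_right_mono measure_Un_le)
    also have "\<dots> < e/3 + e/3 + e/3"
      using m k by (intro add_strict_mono) auto
    finally show ?thesis by simp
  qed
  moreover have "K \<subseteq> A" using T by (auto simp: K_def)
  ultimately show thesis using that K S by blast
qed

text \<open>The property is closed under sums and dominated limits, so only indicator functions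
  remain; for these, a compact inner approximation turns short shifts into small errors.\<close>

lemma translation_L1:
  fixes f :: "'a::euclidean_space \<Rightarrow> 'b::euclidean_space"
  assumes "integrable lborel f" "e > 0"
  shows "\<exists>d>0. \<forall>h. norm h < d \<longrightarrow> (\<integral>x. norm (f (x + h) - f x) \<partial>lborel) < e"
  using assms
proof (induction arbitrary: e rule: integrable_induct)
  case (base A c)
  let ?e = "e / (2 * (norm c + 1))"
  have [measurable]: "A \<in> sets borel" using base by simp
  have e: "?e > 0" using base by (simp add: add_nonneg_pos)
  obtain K S where KS: "compact K" "open S" "K \<subseteq> A" "A \<subseteq> S"
    "emeasure lborel (S - K) < \<infinity>" "measure lborel (S - K) < ?e"
    using compact_open_approx[OF _ _ e, of A] base by auto
  have [measurable]: "K \<in> sets borel" "S \<in> sets borel" using KS by (auto simp: borel_compact)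
  \<comment> \<open>A shift shorter than \<open>d\<close> keeps \<open>K\<close> inside
    \<open>S\<close>. Hence the indicators of \<open>A\<close> at \<open>x\<close> and at
    \<open>x + h\<close> can differ only if one of the two points lies in
    \<open>S - K\<close>.\<close>
  obtain d where d: "d > 0" "(\<Union>x\<in>K. cball x d) \<subseteq> S"
    by (rule compact_subset_open_imp_cball_epsilon_subset[of K S]) (use KS in auto)
  have "(\<integral>x. norm (indicator A (x + h) *\<^sub>R c - indicator A x *\<^sub>R c) \<partial>lborel) < e" if h: "norm h < d" for h
  proof -
    let ?i = "\<lambda>x. indicat_real (S - K) x"
    have ii: "integrable lborel ?i" using KS by (simp add: integrable_indicator_iff)
    have "(\<integral>x. norm (indicator A (x + h) *\<^sub>R c - indicator A x *\<^sub>R c) \<partial>lborel)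
       \<le> (\<integral>x. norm c * (?i (x + h) + ?i x) \<partial>lborel)"
    proof (rule integral_mono)
      show "integrable lborel (\<lambda>x. norm (indicator A (x + h) *\<^sub>R c - indicator A x *\<^sub>R c))"
        using base by (intro integrable_norm integrable_diff
            integrable_shift[of "\<lambda>x. indicator A x *\<^sub>R c"]) auto
      show "integrable lborel (\<lambda>x. norm c * (?i (x + h) + ?i x))"
        by (intro integrable_mult_right integrable_add integrable_shift ii)
      fix x
      have "x + h \<in> S" if "x \<in> K"
        using d that h by (auto simp: dist_norm intro!: subsetD[OF d(2)])
      moreover have "x \<in> S" if "x + h \<in> K"
      proof -
        have "x \<in> cball (x + h) d" using h by (simp add: dist_norm)
        then show ?thesis using that d(2) by blast
      qed
      ultimately have "\<bar>indicat_real A (x + h) - indicat_real A x\<bar> \<le> ?i (x + h) + ?i x"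
        using KS by (auto simp: indicator_def)
      then have "\<bar>indicat_real A (x + h) - indicat_real A x\<bar> * norm c \<le> (?i (x + h) + ?i x) * norm c"
        by (rule mult_right_mono) simp
      then show "norm (indicator A (x + h) *\<^sub>R c - indicator A x *\<^sub>R c) \<le> norm c * (?i (x + h) + ?i x)"
        by (simp add: mult.commute flip: scaleR_diff_left)
    qed
    also have "\<dots> = norm c * (2 * measure lborel (S - K))"
      using integral_shift[of ?i h] ii integrable_shift[OF ii, of h] by simp
    also have "\<dots> \<le> norm c * (2 * ?e)"
      using KS(6) by (intro mult_left_mono) auto
    also have "\<dots> = e * (norm c / (norm c + 1))" by (simp add: field_simps add_nonneg_eq_0_iff)
    also have "\<dots> < e * 1"
      using base by (intro mult_strict_left_mono) (auto simp: divide_less_eq add_nonneg_pos)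
    also have "\<dots> = e" by simp
    finally show ?thesis .
  qed
  with d(1) show ?case by blast
next
  case (add f g)
  have "e / 2 > 0" using add.prems by simp
  from add.IH(1)[OF this] obtain d1 where d1: "d1 > 0"
    "\<And>h. norm h < d1 \<Longrightarrow> (\<integral>x. norm (f (x + h) - f x) \<partial>lborel) < e/2" by blast
  from add.IH(2)[OF \<open>e / 2 > 0\<close>] obtain d2 where d2: "d2 > 0"
    "\<And>h. norm h < d2 \<Longrightarrow> (\<integral>x. norm (g (x + h) - g x) \<partial>lborel) < e/2" by blast
  have "(\<integral>x. norm (f (x + h) + g (x + h) - (f x + g x)) \<partial>lborel) < e" if "norm h < min d1 d2" for h
  proof -
    have "(\<integral>x. norm (f (x + h) + g (x + h) - (f x + g x)) \<partial>lborel)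
      \<le> (\<integral>x. norm (f (x + h) - f x) + norm (g (x + h) - g x) \<partial>lborel)"
      using add.hyps by (intro integral_mono integrable_norm integrable_add
          integrable_diff integrable_shift) (auto intro: norm_diff_triangle_ineq)
    also have "\<dots> = (\<integral>x. norm (f (x + h) - f x) \<partial>lborel) + (\<integral>x. norm (g (x + h) - g x) \<partial>lborel)"
      using add.hyps by (intro integral_add integrable_norm
          integrable_diff integrable_shift) auto
    also have "\<dots> < e/2 + e/2" using d1(2) d2(2) that by (intro add_strict_mono) auto
    finally show ?thesis by simp
  qed
  then show ?case using d1(1) d2(1) by (intro exI[of _ "min d1 d2"]) auto
next
  case (lim f s)
  have "(\<lambda>i. \<integral>x. norm (s i x - f x) \<partial>lborel) \<longlonglongrightarrow> integral\<^sup>L (lborel :: 'a measure) (\<lambda>x. 0)"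
  proof (rule integral_dominated_convergence[where s="\<lambda>i x. norm (s i x - f x)" and f="\<lambda>x. 0" and w="\<lambda>x. 3 * norm (f x)"])
    show "AE x in lborel. (\<lambda>i. norm (s i x - f x)) \<longlonglongrightarrow> 0"
      using lim by (auto intro!: tendsto_norm_zero LIM_zero)
    show "AE x in lborel. norm (norm (s i x - f x)) \<le> 3 * norm (f x)" for i
    proof (rule AE_I2)
      fix x
      show "norm (norm (s i x - f x)) \<le> 3 * norm (f x)"
        using norm_triangle_ineq4[of "s i x" "f x"] lim(3)[of x i] by simp
    qed
  qed (use lim in auto)
  then have "\<forall>\<^sub>F i in sequentially. (\<integral>x. norm (s i x - f x) \<partial>lborel) < e / 3"
    using lim.prems by (intro order_tendstoD(2)[of _ 0]) auto
  then obtain i where i: "(\<integral>x. norm (s i x - f x) \<partial>lborel) < e / 3"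
    by (auto simp: eventually_sequentially)
  have "e / 3 > 0" using lim.prems by simp
  from lim.IH[OF this, of i] obtain d where d: "d > 0"
    "\<And>h. norm h < d \<Longrightarrow> (\<integral>x. norm (s i (x + h) - s i x) \<partial>lborel) < e/3" by blast
  have "(\<integral>x. norm (f (x + h) - f x) \<partial>lborel) < e" if "norm h < d" for h
  proof -
    have sh: "(\<integral>x. norm (s i (x + h) - f (x + h)) \<partial>lborel) = (\<integral>x. norm (s i x - f x) \<partial>lborel)"
      by (rule integral_shift[of "\<lambda>x. norm (s i x - f x)"])
        (use lim.hyps(1)[of i] lim.hyps(4) in \<open>simp add: borel_measurable_integrable\<close>)
    have "(\<integral>x. norm (f (x + h) - f x) \<partial>lborel)
      \<le> (\<integral>x. norm (s i (x + h) - s i x) + (norm (s i (x + h) - f (x + h)) + norm (s i x - f x)) \<partial>lborel)"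
    proof (intro integral_mono integrable_norm integrable_add
          integrable_diff integrable_shift)
      fix x
      have "norm (f (x + h) - f x) = norm ((s i (x + h) - s i x) - (s i (x + h) - f (x + h)) + (s i x - f x))"
        by simp
      also have "\<dots> \<le> norm (s i (x + h) - s i x) + norm (s i (x + h) - f (x + h)) + norm (s i x - f x)"
        by (rule order_trans[OF norm_triangle_ineq]) (intro add_right_mono norm_triangle_ineq4)
      finally show "norm (f (x + h) - f x) \<le> norm (s i (x + h) - s i x) + (norm (s i (x + h) - f (x + h)) + norm (s i x - f x))"
        by simp
    qed (use lim.hyps in auto)
    also have "\<dots> = (\<integral>x. norm (s i (x + h) - s i x) \<partial>lborel) + ((\<integral>x. norm (s i (x + h) - f (x + h)) \<partial>lborel) + (\<integral>x. norm (s i x - f x) \<partial>lborel))"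
      using lim.hyps by (subst integral_add; (intro integrable_norm
          integrable_diff integrable_add integrable_shift)?; simp?)+
    also have "\<dots> < e/3 + (e/3 + e/3)" unfolding sh using d(2)[OF that] i by linarith
    finally show ?thesis by simp
  qed
  with d(1) show ?case by blast
qed

section \<open>Mollification\<close>

definition csupp :: "('a::euclidean_space \<Rightarrow> real) \<Rightarrow> bool" where
  "csupp f \<longleftrightarrow> (\<exists>r. \<forall>x. norm x > r \<longrightarrow> f x = 0)"

lemma csupp_dd:
  assumes "csupp f" shows "csupp (\<lambda>x. dd f x v)"
proof -
  obtain r where r: "\<And>x. norm x > r \<Longrightarrow> f x = 0" using assms by (auto simp: csupp_def)
  have "dd f x v = 0" if x: "norm x > r" for x
  proof -
    have "open {x::'a. norm x > r}" by (intro open_Collect_less continuous_intros)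
    then have "(f has_derivative (\<lambda>v. 0)) (at x)"
      by (rule has_derivative_transform_within_open[OF has_derivative_const]) (use x r in auto)
    then show ?thesis by (rule dd_eq)
  qed
  then show ?thesis by (auto simp: csupp_def)
qed

lemma csupp_uniform:
  assumes "csupp f" "continuous_on UNIV f"
  shows "uniformly_continuous_on UNIV f"
proof -
  obtain r where r: "\<And>x. norm x > r \<Longrightarrow> f x = 0" using assms by (auto simp: csupp_def)
  have u: "uniformly_continuous_on (cball 0 (r + 1)) f"
    by (rule compact_uniformly_continuous) (use assms in \<open>auto intro: continuous_on_subset\<close>)
  show ?thesis
    unfolding uniformly_continuous_on_def
  proof safe
    fix e :: real assume "e > 0"
    then obtain d where d: "d > 0" "\<And>x y. x \<in> cball 0 (r + 1) \<Longrightarrow> y \<in> cball 0 (r + 1) \<Longrightarrow> dist y x < d \<Longrightarrow> dist (f y) (f x) < e"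
      using u unfolding uniformly_continuous_on_def by metis
    have "dist (f y) (f x) < e" if "dist y x < min d 1" for x y
    proof (cases "norm x \<le> r + 1 \<and> norm y \<le> r + 1")
      case True then show ?thesis using d(2)[of x y] that by auto
    next
      case False
      have "\<bar>norm x - norm y\<bar> < 1" using that norm_triangle_ineq3[of x y] by (simp add: dist_norm norm_minus_commute)
      then have "norm x > r" "norm y > r" using False by auto
      then show ?thesis using r \<open>e > 0\<close> by simp
    qed
    then show "\<exists>d>0. \<forall>x\<in>UNIV. \<forall>x'\<in>UNIV. dist x' x < d \<longrightarrow> dist (f x') (f x) < e"
      using d(1) by (intro exI[of _ "min d 1"]) auto
  qed
qed

lemma csupp_bounded:
  assumes "csupp f" "continuous_on UNIV f"
  obtains B where "B > 0" "\<And>x. \<bar>f x\<bar> \<le> B"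
proof -
  obtain r where r: "\<And>x. norm x > r \<Longrightarrow> f x = 0" using assms by (auto simp: csupp_def)
  have "bounded (f ` cball 0 r)"
    by (intro compact_imp_bounded compact_continuous_image) (use assms in \<open>auto intro: continuous_on_subset\<close>)
  then obtain B where B: "B > 0" "\<And>x. x \<in> cball 0 r \<Longrightarrow> norm (f x) \<le> B" by (auto simp: bounded_pos)
  have "\<bar>f x\<bar> \<le> B" for x
    using B(2)[of x] r[of x] B(1) by (cases "norm x > r") auto
  then show thesis using that B by blast
qed

text \<open>The partial derivatives are uniformly continuous, so the first order remainder is
  uniform in \<open>x\<close>. This uniformity is what lets derivatives pass under integral signs in
  \<open>conv_smooth_aux\<close> and \<open>integral_dd\<close>.\<close>

lemma csupp_linearization:
  assumes f: "smooth f" "csupp f" and "e > 0"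
  shows "\<exists>d>0. \<forall>x v. norm v < d \<longrightarrow> \<bar>f (x + v) - f x - dd f x v\<bar> \<le> e * norm v"
proof -
  let ?n = "real DIM('a)"
  have "\<exists>d>0. \<forall>x y. dist y x < d \<longrightarrow> dist (dd f y b) (dd f x b) < e / ?n" if "b \<in> Basis" for b
    using csupp_uniform[OF csupp_dd[OF f(2)] smooth_cont[OF smooth_dd[OF f(1)]], of b] \<open>e > 0\<close>
    unfolding uniformly_continuous_on_def by (metis DIM_positive UNIV_I divide_pos_pos of_nat_0_less_iff)
  then obtain D where D: "\<And>b. b \<in> Basis \<Longrightarrow> D b > 0"
    "\<And>b x y. b \<in> Basis \<Longrightarrow> dist y x < D b \<Longrightarrow> dist (dd f y b) (dd f x b) < e / ?n" by metis
  let ?d = "Min (D ` Basis)"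
  have d: "?d > 0" using D(1) by (subst Min_gr_iff) auto
  have "\<bar>f (x + v) - f x - dd f x v\<bar> \<le> e * norm v" if v: "norm v < ?d" for x v
  proof -
    have bl: "bounded_linear (dd f x)" for x using smooth_has_derivative[OF f(1)] by (rule has_derivative_bounded_linear)
    have o: "onorm (\<lambda>w. dd f y w - dd f x w) \<le> e" if y: "norm (y - x) < ?d" for y
    proof -
      have "onorm (\<lambda>w. dd f y w - dd f x w) \<le> (\<Sum>b\<in>Basis. norm (dd f y b - dd f x b))"
        by (rule onorm_componentwise) (intro bounded_linear_sub bl)
      also have "\<dots> \<le> (\<Sum>b\<in>(Basis::'a set). e / ?n)"
      proof (rule sum_mono)
        fix b :: 'a assume b: "b \<in> Basis"
        have "dist y x < D b" using y b by (auto simp: dist_norm)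
        from D(2)[OF b this] show "norm (dd f y b - dd f x b) \<le> e / ?n" by (simp add: dist_norm)
      qed
      finally show ?thesis by simp
    qed
    have "norm (f (x + v) - f x - dd f x ((x + v) - x)) \<le> norm ((x + v) - x) * e"
    proof (rule differentiable_bound_linearization[where S="ball x ?d"])
      show "x + t *\<^sub>R (x + v - x) \<in> ball x ?d" if "t \<in> {0..1}" for t
      proof -
        have "norm (t *\<^sub>R v) \<le> 1 * norm v" unfolding norm_scaleR by (rule mult_right_mono) (use that in auto)
        then show ?thesis using v by (simp add: dist_norm del: Min_gr_iff)
      qed
      show "(f has_derivative dd f y) (at y within ball x ?d)" for y
        using smooth_has_derivative[OF f(1)] by (rule has_derivative_at_withinI)
      show "onorm (dd f y - dd f x) \<le> e" if "y \<in> ball x ?d" for y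
        using o[of y] that by (simp add: dist_norm fun_diff_def norm_minus_commute del: Min_gr_iff)
      show "x \<in> ball x ?d" using d by (simp del: Min_gr_iff)
    qed
    then show ?thesis by (simp add: mult.commute)
  qed
  then show ?thesis using d by blast
qed

definition conv :: "('a::euclidean_space \<Rightarrow> real) \<Rightarrow> ('a \<Rightarrow> 'b::euclidean_space) \<Rightarrow> 'a \<Rightarrow> 'b" where
  "conv r f x = (\<integral>y. r (x - y) *\<^sub>R f y \<partial>lborel)"

lemma conv_integrable_aux:
  fixes f :: "'a::euclidean_space \<Rightarrow> 'b::euclidean_space"
  assumes "continuous_on UNIV \<rho>" "csupp \<rho>" "integrable lborel f"
  shows "integrable lborel (\<lambda>y. \<rho> (x - y) *\<^sub>R f y)"
proof -
  obtain B where B: "B > 0" "\<And>x. \<bar>\<rho> x\<bar> \<le> B" by (rule csupp_bounded[OF assms(2,1)]) blast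
  have [measurable]: "\<rho> \<in> borel_measurable borel" using assms(1) by (rule borel_measurable_continuous_onI)
  have [measurable]: "f \<in> borel_measurable borel" using borel_measurable_integrable[OF assms(3)] by simp
  show ?thesis
  proof (rule integrable_bound)
    show "integrable lborel (\<lambda>y. B *\<^sub>R f y)" using assms by auto
    show "AE y in lborel. norm (\<rho> (x - y) *\<^sub>R f y) \<le> norm (B *\<^sub>R f y)"
      using B by (auto intro!: mult_right_mono order_trans[OF B(2)])
  qed measurable
qed

text \<open>The remainder of the kernel is uniformly small relative to the increment, and stays so
  after integration against |f|. The derivative is again a convolution with a smooth kernel of
  compact support, so \<open>conv_smooth\<close> follows by induction.\<close>

lemma conv_smooth_aux:
  fixes f :: "'a::euclidean_space \<Rightarrow> real"
  assumes \<rho>: "smooth \<rho>" "csupp \<rho>" and f: "integrable lborel f"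
  shows "(conv \<rho> f has_derivative (\<lambda>v. conv (\<lambda>z. dd \<rho> z v) f x)) (at x)"
proof -
  let ?F = "\<lambda>v. conv (\<lambda>z. dd \<rho> z v) f x"
  note ia = conv_integrable_aux[OF smooth_cont[OF smooth_dd[OF \<rho>(1)]] csupp_dd[OF \<rho>(2)] f]
  note ib = conv_integrable_aux[OF smooth_cont[OF \<rho>(1)] \<rho>(2) f]
  have lin: "linear (dd \<rho> z)" for z using smooth_has_derivative[OF \<rho>(1)] by (rule has_derivative_linear)
  have l: "linear ?F"
  proof (rule linearI)
    fix v w c
    show "?F (v + w) = ?F v + ?F w"
      unfolding conv_def linear_add[OF lin] scaleR_add_left by (rule integral_add[OF ia ia])
    show "?F (c *\<^sub>R v) = c *\<^sub>R ?F v"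
      unfolding conv_def linear_scale[OF lin] by (simp add: mult.assoc)
  qed
  \<comment> \<open>The summand 1 in \<open>?I + 1\<close> below covers the case that
    \<open>f\<close> vanishes almost everywhere.\<close>
  let ?I = "(\<integral>y. \<bar>f y\<bar> \<partial>lborel)"
  have I: "?I \<ge> 0" "?I + 1 > 0" by (auto intro!: add_nonneg_pos)
  show ?thesis
    unfolding has_derivative_at_alt
  proof (intro conjI allI impI)
    show "bounded_linear ?F" using l by (rule linear_conv_bounded_linear[THEN iffD1])
    fix e :: real assume e: "0 < e"
    then have e1: "e / (?I + 1) > 0" using I by (simp add: add_nonneg_pos)
    from csupp_linearization[OF \<rho> this] obtain d where d: "d > 0"
      "\<And>x v. norm v < d \<Longrightarrow> \<bar>\<rho> (x + v) - \<rho> x - dd \<rho> x v\<bar> \<le> e / (?I + 1) * norm v" by blast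
    have "norm (conv \<rho> f y - conv \<rho> f x - ?F (y - x)) \<le> e * norm (y - x)" if y: "norm (y - x) < d" for y
    proof -
      have "conv \<rho> f y - conv \<rho> f x - ?F (y - x)
         = (\<integral>z. (\<rho> (y - z) - \<rho> (x - z) - dd \<rho> (x - z) (y - x)) *\<^sub>R f z \<partial>lborel)"
        unfolding conv_def scaleR_diff_left
        by (subst integral_diff; (intro integrable_diff ia ib)?)+ simp
      also have "norm \<dots> \<le> (\<integral>z. e / (?I + 1) * norm (y - x) * \<bar>f z\<bar> \<partial>lborel)"
      proof (rule integral_norm_bound_integral)
        show "integrable lborel (\<lambda>z. (\<rho> (y - z) - \<rho> (x - z) - dd \<rho> (x - z) (y - x)) *\<^sub>R f z)"
          unfolding scaleR_diff_left by (intro integrable_diff ia ib)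
        show "integrable lborel (\<lambda>z. e / (?I + 1) * norm (y - x) * \<bar>f z\<bar>)" using f by auto
        fix z
        have "\<bar>\<rho> ((x - z) + (y - x)) - \<rho> (x - z) - dd \<rho> (x - z) (y - x)\<bar> \<le> e / (?I + 1) * norm (y - x)"
          using d(2)[OF y] .
        then show "norm ((\<rho> (y - z) - \<rho> (x - z) - dd \<rho> (x - z) (y - x)) *\<^sub>R f z) \<le> e / (?I + 1) * norm (y - x) * \<bar>f z\<bar>"
          unfolding real_scaleR_def real_norm_def abs_mult by (intro mult_right_mono) (simp_all add: algebra_simps)
      qed
      also have "\<dots> = (e * norm (y - x)) * (?I / (?I + 1))" by simp
      also have "\<dots> \<le> (e * norm (y - x)) * 1" using I e by (intro mult_left_mono divide_le_eq_1[THEN iffD2]) auto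
      finally show ?thesis by simp
    qed
    then show "\<exists>d>0. \<forall>y. norm (y - x) < d \<longrightarrow> norm (conv \<rho> f y - conv \<rho> f x - ?F (y - x)) \<le> e * norm (y - x)"
      using d(1) by blast
  qed
qed

lemma conv_smooth:
  assumes "smooth r" "csupp r" "integrable lborel f" shows "smooth (conv r f)"
proof -
  have "C_k k (conv r f)" for k
    using assms(1,2)
  proof (induction k arbitrary: r)
    case 0
    then show ?case
      using has_derivative_continuous[OF conv_smooth_aux[OF 0 assms(3)]]
      by (auto simp: continuous_on_eq_continuous_at)
  next
    case (Suc k)
    show ?case
      by (rule C_k_I[OF conv_smooth_aux[OF Suc.prems assms(3)]]) (intro Suc.IH smooth_dd csupp_dd Suc.prems)
  qed
  then show ?thesis by (simp add: smooth_def)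
qed

lemma dd_conv:
  assumes "smooth r" "csupp r" "integrable lborel f"
  shows "dd (conv r f) x v = conv (\<lambda>z. dd r z v) f x"
  by (rule dd_eq[OF conv_smooth_aux[OF assms]])

lemma conv_commute:
  fixes f :: "'a::euclidean_space \<Rightarrow> 'b::euclidean_space"
  assumes [measurable]: "r \<in> borel_measurable borel" "f \<in> borel_measurable borel"
  shows "conv r f x = (\<integral>z. r z *\<^sub>R f (x - z) \<partial>lborel)"
  unfolding conv_def using integral_reflect[of "\<lambda>z. r z *\<^sub>R f (x - z)" x] by simp

definition molk :: "real \<Rightarrow> 'a::euclidean_space \<Rightarrow> real" where
  "molk e x = bump ((1/e) *\<^sub>R x) / (\<integral>y. bump ((1/e) *\<^sub>R (y::'a)) \<partial>lborel)"

context
  fixes \<epsilon> :: real assumes eps: "\<epsilon> > 0"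
begin

lemma bump_scaled_smooth: "smooth (\<lambda>x::'a::euclidean_space. bump ((1/\<epsilon>) *\<^sub>R x))"
  using smooth_affine[OF bump_smooth, of "1/\<epsilon>" 0] by simp

lemma bump_scaled_0: "norm x \<ge> \<epsilon> \<Longrightarrow> bump ((1/\<epsilon>) *\<^sub>R x) = 0"
  by (rule bump_0) (use eps in \<open>simp add: divide_simps\<close>)

lemma bump_scaled_csupp: "csupp (\<lambda>x::'a::euclidean_space. bump ((1/\<epsilon>) *\<^sub>R x))"
  unfolding csupp_def by (intro exI[of _ \<epsilon>]) (auto intro: bump_scaled_0)

lemma smooth_csupp_integrable:
  assumes "smooth f" "csupp (f :: 'a::euclidean_space \<Rightarrow> real)" shows "integrable lborel f"
proof -
  obtain r where r: "\<And>x. norm x > r \<Longrightarrow> f x = 0" using assms by (auto simp: csupp_def)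
  have "integrable lborel (\<lambda>x. indicator (cball 0 r) x *\<^sub>R f x)"
    by (rule borel_integrable_compact) (use smooth_cont[OF assms(1)] in auto)
  also have "(\<lambda>x. indicator (cball 0 r) x *\<^sub>R f x) = f"
    using r by (auto simp: fun_eq_iff indicator_def not_le)
  finally show ?thesis .
qed

lemma bump_integral_pos: "(\<integral>y. bump ((1/\<epsilon>) *\<^sub>R (y::'a::euclidean_space)) \<partial>lborel) > 0"
proof -
  let ?b = "\<lambda>y::'a. bump ((1/\<epsilon>) *\<^sub>R y)"
  have i: "integrable lborel ?b" by (intro smooth_csupp_integrable bump_scaled_smooth bump_scaled_csupp)
  have "(\<integral>y. ?b y \<partial>lborel) \<noteq> 0"
  proof
    assume "(\<integral>y. ?b y \<partial>lborel) = 0"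
    then have "AE y in lborel. ?b y = 0"
      using integral_nonneg_eq_0_iff_AE[OF i] bump_nonneg by auto
    then have "AE y in lborel. y \<notin> ball (0::'a) \<epsilon>"
      by eventually_elim (use eps bump_pos[of "(1/\<epsilon>) *\<^sub>R _"] in \<open>force simp: divide_simps\<close>)
    then have "emeasure lborel (ball (0::'a) \<epsilon>) = 0"
      by (subst (asm) AE_iff_measurable[OF _ refl]) (auto simp: ball_def)
    then show False using eps unit_ball_vol_pos[of "real DIM('a)"] by (simp add: emeasure_ball)
  qed
  then show ?thesis using integral_nonneg_AE[of ?b lborel] bump_nonneg by fastforce
qed

lemma molk_smooth: "smooth (molk \<epsilon> :: 'a::euclidean_space \<Rightarrow> real)"
  unfolding molk_def[abs_def] divide_inverse[of "bump _"]
  by (intro smooth_mult smooth_const bump_scaled_smooth)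

lemma molk_0: "norm x \<ge> \<epsilon> \<Longrightarrow> molk \<epsilon> x = 0"
  unfolding molk_def by (simp add: bump_scaled_0 del: divide_eq_0_iff)

lemma molk_csupp: "csupp (molk \<epsilon> :: 'a::euclidean_space \<Rightarrow> real)"
  unfolding csupp_def by (intro exI[of _ \<epsilon>]) (auto intro: molk_0)

lemma molk_nonneg: "molk \<epsilon> (x::'a::euclidean_space) \<ge> 0"
  unfolding molk_def using bump_integral_pos[where 'a='a] by (intro divide_nonneg_pos bump_nonneg)

lemma molk_integrable: "integrable lborel (molk \<epsilon> :: 'a::euclidean_space \<Rightarrow> real)"
  by (intro smooth_csupp_integrable molk_smooth molk_csupp)

lemma molk_integral: "(\<integral>x. molk \<epsilon> (x::'a::euclidean_space) \<partial>lborel) = 1"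
  unfolding molk_def using bump_integral_pos[where 'a='a] by simp

lemma molk_borel: "molk \<epsilon> \<in> borel_measurable borel"
  by (rule smooth_borel[OF molk_smooth])

lemma molk_nn_integral: "(\<integral>\<^sup>+x. ennreal (molk \<epsilon> (x::'a::euclidean_space)) \<partial>lborel) = 1"
  using molk_integral[where 'a='a] molk_nonneg[where 'a='a] molk_integrable[where 'a='a]
  by (simp add: nn_integral_eq_integral)

end

section \<open>Approximate identities\<close>

lemma conv_borel[measurable]:
  fixes f :: "'a::euclidean_space \<Rightarrow> 'b::euclidean_space"
  assumes [measurable]: "r \<in> borel_measurable borel" "f \<in> borel_measurable borel"
  shows "conv r f \<in> borel_measurable borel"
  unfolding conv_def[abs_def] by measurable

lemma conv_nn:
  fixes f :: "'a::euclidean_space \<Rightarrow> real"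
  assumes "integrable lborel f" "\<And>x. f x \<ge> 0" and e: "e > 0"
  shows "ennreal (conv (molk e) f x) = (\<integral>\<^sup>+z. ennreal (molk e z) * ennreal (f (x - z)) \<partial>lborel)"
proof -
  note [measurable] = molk_borel[OF e]
  note [measurable] = integrable_borel[OF assms(1)]
  have i: "integrable lborel (\<lambda>y. molk e (x - y) *\<^sub>R f y)"
    by (intro conv_integrable_aux smooth_cont molk_smooth molk_csupp assms)
  have "ennreal (conv (molk e) f x) = (\<integral>\<^sup>+y. ennreal (molk e (x - y) * f y) \<partial>lborel)"
    unfolding conv_def using i assms by (subst nn_integral_eq_integral) (auto simp: molk_nonneg)
  also have "\<dots> = (\<integral>\<^sup>+z. ennreal (molk e z * f (x - z)) \<partial>lborel)"
    using nn_integral_reflect[of "\<lambda>z. ennreal (molk e z * f (x - z))" x] by simp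
  finally show ?thesis by (simp add: ennreal_mult' molk_nonneg[OF e])
qed

text \<open>Exchanging the integrations leaves, for each displacement \<open>z\<close> of length at
  most \<open>e\<close>, a translate of the integral of \<open>f\<close>; the kernel has mass
  one.\<close>

lemma SI_conv:
  fixes f :: "'a::euclidean_space \<Rightarrow> real"
  assumes f: "integrable lborel f" "\<And>x. f x \<ge> 0" and e: "e > 0" and [measurable]: "A \<in> sets borel" "B \<in> sets borel"
    and AB: "\<And>x z. x \<in> A \<Longrightarrow> norm z \<le> e \<Longrightarrow> x - z \<in> B"
  shows "SI A (conv (molk e) f) \<le> SI B f"
proof -
  note [measurable] = molk_borel[OF e]
  note [measurable] = integrable_borel[OF f(1)]
  have "SI A (conv (molk e) f) = (\<integral>\<^sup>+x. (\<integral>\<^sup>+z. ennreal (molk e z) * ennreal (f (x - z)) * indicator A x \<partial>lborel) \<partial>lborel)"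
    unfolding SI_def by (simp add: conv_nn[OF f e] nn_integral_multc)
  also have "\<dots> = (\<integral>\<^sup>+z. (\<integral>\<^sup>+x. ennreal (molk e z) * ennreal (f (x - z)) * indicator A x \<partial>lborel) \<partial>lborel)"
    by (rule lborel_pair.Fubini') measurable
  also have "\<dots> \<le> (\<integral>\<^sup>+z. ennreal (molk e (z::'a)) * SI B f \<partial>lborel)"
  proof (rule nn_integral_mono)
    fix z :: 'a
    have "(\<integral>\<^sup>+x. ennreal (f (x - z)) * indicator A x \<partial>lborel) \<le> SI B f" if z: "norm z \<le> e"
    proof -
      have "(\<integral>\<^sup>+x. ennreal (f (x - z)) * indicator A x \<partial>lborel) \<le> (\<integral>\<^sup>+x. ennreal (f (x + (- z))) * indicator B (x + (- z)) \<partial>lborel)"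
        by (rule nn_integral_mono) (use AB z in \<open>auto simp: indicator_def\<close>)
      also have "\<dots> = SI B f" unfolding SI_def by (rule nn_integral_shift) measurable
      finally show ?thesis .
    qed
    then show "(\<integral>\<^sup>+x. ennreal (molk e z) * ennreal (f (x - z)) * indicator A x \<partial>lborel) \<le> ennreal (molk e z) * SI B f"
      using molk_0[OF e, of z] molk_nonneg[OF e, of z]
      by (cases "norm z \<le> e") (auto simp: mult.assoc nn_integral_cmult intro!: mult_left_mono)
  qed
  also have "\<dots> = SI B f" by (simp add: nn_integral_multc molk_nn_integral[OF e, where 'a='a])
  finally show ?thesis .
qed

text \<open>Boundedness is asked instead of continuity so that normalised indicators of balls
  qualify beside mollifiers: one convergence proof serves both \<open>conv_L1\<close> and
  \<open>averages_AE\<close>.\<close>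

definition kernel :: "real \<Rightarrow> ('a::euclidean_space \<Rightarrow> real) \<Rightarrow> bool" where
  "kernel d k \<longleftrightarrow> k \<in> borel_measurable borel \<and> (\<forall>z. 0 \<le> k z) \<and> (\<exists>B. \<forall>z. k z \<le> B) \<and>
     (\<integral>\<^sup>+z. ennreal (k z) \<partial>lborel) = 1 \<and> (\<forall>z. norm z \<ge> d \<longrightarrow> k z = 0)"

lemma kernel_integrable:
  fixes f :: "'a::euclidean_space \<Rightarrow> 'b::euclidean_space"
  assumes k: "kernel d k" and f: "integrable lborel f"
  shows "integrable lborel (\<lambda>z. k z *\<^sub>R f (x - z))" "integrable lborel k"
proof -
  note [measurable] = integrable_borel[OF f(1)]
  have [measurable]: "k \<in> borel_measurable borel" using k by (simp add: kernel_def)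
  obtain B where B: "\<And>z. k z \<le> B" "\<And>z. 0 \<le> k z" using k by (auto simp: kernel_def)
  show "integrable lborel (\<lambda>z. k z *\<^sub>R f (x - z))"
  proof (rule integrable_bound)
    show "integrable lborel (\<lambda>z. B *\<^sub>R f (x - z))" using integrable_reflect[OF f] by auto
    have "0 \<le> B" using B[of 0] by linarith
    then show "AE z in lborel. norm (k z *\<^sub>R f (x - z)) \<le> norm (B *\<^sub>R f (x - z))"
      using B by (intro AE_I2) (auto intro!: mult_right_mono)
  qed measurable
  show "integrable lborel k"
    using k by (simp add: integrable_iff_bounded kernel_def)
qed

text \<open>As the kernel has mass one, \<open>conv k f - f\<close> is a mean of differences
  \<open>f (x - z) - f x\<close> over displacements shorter than \<open>d\<close>. After Fubini,
  continuity of translations bounds each of them, with a \<open>d\<close> that depends on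
  \<open>f\<close> and \<open>e\<close> only.\<close>

lemma kernel_L1:
  fixes f :: "'a::euclidean_space \<Rightarrow> 'b::euclidean_space"
  assumes f: "integrable lborel f" and e: "e > 0"
  shows "\<exists>d>0. \<forall>k. kernel d k \<longrightarrow> (\<integral>\<^sup>+x. ennreal (norm (conv k f x - f x)) \<partial>lborel) \<le> ennreal e"
proof -
  note [measurable] = integrable_borel[OF f(1)]
  obtain d where d: "d > 0" "\<And>h. norm h < d \<Longrightarrow> (\<integral>x. norm (f (x + h) - f x) \<partial>lborel) < e"
    using translation_L1[OF f e] by blast
  have "(\<integral>\<^sup>+x. ennreal (norm (conv k f x - f x)) \<partial>lborel) \<le> ennreal e" if k: "kernel d k" for k
  proof -
    have [measurable]: "k \<in> borel_measurable borel" using k by (simp add: kernel_def)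
    have k0: "0 \<le> k z" for z using k by (simp add: kernel_def)
    have ki: "(\<integral>\<^sup>+z. ennreal (k z) \<partial>lborel) = 1" using k by (simp add: kernel_def)
    have ki': "integral\<^sup>L lborel k = 1"
      using ki kernel_integrable(2)[OF k f] k0 by (simp add: nn_integral_eq_integral)
    have 1: "ennreal (norm (conv k f x - f x)) \<le> (\<integral>\<^sup>+z. ennreal (k z) * ennreal (norm (f (x - z) - f x)) \<partial>lborel)" for x
    proof -
      note i1 = kernel_integrable(1)[OF k f, of x]
      have i2: "integrable lborel (\<lambda>z. k z *\<^sub>R f x)" using kernel_integrable(2)[OF k f] by (rule integrable_scaleR_left)
      have "conv k f x - f x = (\<integral>z. k z *\<^sub>R f (x - z) \<partial>lborel) - (\<integral>z. k (z::'a) *\<^sub>R f x \<partial>lborel)"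
        using integral_scaleR_left[OF kernel_integrable(2)[OF k f], of "f x"]
        by (subst conv_commute) (simp_all add: ki')
      also have "\<dots> = (\<integral>z. k z *\<^sub>R (f (x - z) - f x) \<partial>lborel)"
        using integral_diff[OF i1 i2] by (simp add: scaleR_diff_right)
      finally have "ennreal (norm (conv k f x - f x)) \<le> (\<integral>\<^sup>+z. ennreal (norm (k z *\<^sub>R (f (x - z) - f x))) \<partial>lborel)"
        using integral_norm_bound_ennreal[OF integrable_diff[OF i1 i2]] by (simp add: scaleR_diff_right)
      then show ?thesis by (simp add: ennreal_mult' abs_of_nonneg[OF k0] k0)
    qed
    have "(\<integral>\<^sup>+x. ennreal (norm (conv k f x - f x)) \<partial>lborel)
       \<le> (\<integral>\<^sup>+x. (\<integral>\<^sup>+z. ennreal (k z) * ennreal (norm (f (x - z) - f x)) \<partial>lborel) \<partial>lborel)"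
      by (rule nn_integral_mono) (rule 1)
    also have "\<dots> = (\<integral>\<^sup>+z. (\<integral>\<^sup>+x. ennreal (k z) * ennreal (norm (f (x - z) - f x)) \<partial>lborel) \<partial>lborel)"
      by (rule lborel_pair.Fubini') measurable
    also have "\<dots> \<le> (\<integral>\<^sup>+z. ennreal (k (z::'a)) * ennreal e \<partial>lborel)"
    proof (rule nn_integral_mono)
      fix z :: 'a
      have "(\<integral>\<^sup>+x. ennreal (norm (f (x - z) - f x)) \<partial>lborel) \<le> ennreal e" if "norm z < d"
      proof -
        have "integrable lborel (\<lambda>x. norm (f (x + (- z)) - f x))"
          by (intro integrable_norm integrable_diff integrable_shift f)
        then have "(\<integral>\<^sup>+x. ennreal (norm (f (x - z) - f x)) \<partial>lborel) = ennreal (\<integral>x. norm (f (x - z) - f x) \<partial>lborel)"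
          by (intro nn_integral_eq_integral) auto
        also have "\<dots> \<le> ennreal e" using d(2)[of "- z"] that by (intro ennreal_leI) auto
        finally show ?thesis .
      qed
      moreover have "k z = 0" if "\<not> norm z < d" using k that by (simp add: kernel_def)
      ultimately show "(\<integral>\<^sup>+x. ennreal (k z) * ennreal (norm (f (x - z) - f x)) \<partial>lborel) \<le> ennreal (k z) * ennreal e"
        by (cases "norm z < d") (auto simp: nn_integral_cmult intro!: mult_left_mono)
    qed
    also have "\<dots> = ennreal e" by (simp add: nn_integral_multc ki)
    finally show ?thesis .
  qed
  with d(1) show ?thesis by blast
qed

lemma kernel_molk:
  assumes "0 < e" "e \<le> d" shows "kernel d (molk e :: 'a::euclidean_space \<Rightarrow> real)"
  unfolding kernel_def
proof (intro conjI allI impI)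
  obtain B where "\<And>x::'a. \<bar>molk e x\<bar> \<le> B"
    by (rule csupp_bounded[OF molk_csupp[OF assms(1)] smooth_cont[OF molk_smooth[OF assms(1)]]]) blast
  then have "\<forall>z::'a. molk e z \<le> B" by (meson abs_le_D1)
  then show "\<exists>B. \<forall>z::'a. molk e z \<le> B" by blast
qed (use assms in \<open>auto intro: molk_borel molk_nonneg molk_nn_integral molk_0\<close>)

lemma conv_L1:
  fixes f :: "'a::euclidean_space \<Rightarrow> 'b::euclidean_space"
  assumes f: "integrable lborel f" and e: "e > 0"
  shows "\<exists>d>0. \<forall>\<epsilon>. 0 < \<epsilon> \<longrightarrow> \<epsilon> < d \<longrightarrow> (\<integral>\<^sup>+x. ennreal (norm (conv (molk \<epsilon>) f x - f x)) \<partial>lborel) \<le> ennreal e"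
  using kernel_L1[OF f e] kernel_molk[where 'a='a] by (meson less_imp_le)

section \<open>Weak gradients on the whole space\<close>

text \<open>Counterpart of \<open>grad\<close> on an arbitrary Euclidean space;
  \<open>grad_gr\<close> identifies the two on \<open>real^'n\<close>.\<close>

definition gr :: "('a::euclidean_space \<Rightarrow> real) \<Rightarrow> 'a \<Rightarrow> 'a" where
  "gr \<phi> x = (\<Sum>b\<in>Basis. dd \<phi> x b *\<^sub>R b)"

lemma gr_inner: "smooth \<phi> \<Longrightarrow> gr \<phi> x \<bullet> v = dd \<phi> x v"
proof -
  assume s: "smooth \<phi>"
  have l: "linear (dd \<phi> x)" using smooth_has_derivative[OF s] by (rule has_derivative_linear)
  have "dd \<phi> x v = dd \<phi> x (\<Sum>b\<in>Basis. (v \<bullet> b) *\<^sub>R b)" by (simp add: euclidean_representation)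
  also have "\<dots> = (\<Sum>b\<in>Basis. (v \<bullet> b) * dd \<phi> x b)"
    using l by (simp add: linear_sum linear_scale)
  finally show ?thesis by (simp add: gr_def inner_sum_left inner_commute[of v] mult.commute)
qed

lemma gr_mult: "smooth f \<Longrightarrow> smooth g \<Longrightarrow> gr (\<lambda>x. f x * g x) x = f x *\<^sub>R gr g x + g x *\<^sub>R gr f x"
  by (simp add: gr_def dd_mult scaleR_add_left sum.distrib scaleR_sum_right mult.commute)

lemma gr_continuous: "smooth \<phi> \<Longrightarrow> continuous_on A (gr \<phi>)"
  unfolding gr_def[abs_def] by (intro continuous_intros smooth_cont smooth_dd)

lemma gr_borel: "smooth \<phi> \<Longrightarrow> gr \<phi> \<in> borel_measurable borel"
  by (intro borel_measurable_continuous_onI gr_continuous)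

lemma gr_outside:
  assumes "compact K" "\<And>x. x \<notin> K \<Longrightarrow> \<phi> x = 0" "x \<notin> K" shows "gr \<phi> x = 0"
proof -
  have "(\<phi> has_derivative (\<lambda>v. 0)) (at x)"
    by (rule has_derivative_transform_within_open[OF has_derivative_const, of "- K"])
      (use assms in \<open>auto intro: compact_imp_closed\<close>)
  then show ?thesis by (simp add: gr_def dd_eq)
qed

lemma csupp_compact: "compact K \<Longrightarrow> (\<And>x. x \<notin> K \<Longrightarrow> \<phi> x = 0) \<Longrightarrow> csupp \<phi>"
proof -
  assume K: "compact K" "\<And>x. x \<notin> K \<Longrightarrow> \<phi> x = 0"
  obtain r where "\<And>x. x \<in> K \<Longrightarrow> norm x \<le> r" using compact_imp_bounded[OF K(1)] by (auto simp: bounded_iff)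
  then show ?thesis unfolding csupp_def using K(2) by (intro exI[of _ r]) force
qed

lemma csupp_mult: "csupp f \<Longrightarrow> csupp (\<lambda>x. f x * g x)" "csupp f \<Longrightarrow> csupp (\<lambda>x. g x * f x)"
  by (auto simp: csupp_def)

lemma csupp_const_mult: "csupp f \<Longrightarrow> csupp (\<lambda>x. c * f x)"
  by (rule csupp_mult)

lemma csupp_reflect: "csupp f \<Longrightarrow> csupp (\<lambda>x. f (a - x))"
proof -
  assume "csupp f"
  then obtain r where r: "\<And>x. norm x > r \<Longrightarrow> f x = 0" by (auto simp: csupp_def)
  have "f (a - x) = 0" if "norm x > r + norm a" for x
    by (rule r) (use that norm_triangle_ineq3[of x a] in \<open>simp add: norm_minus_commute\<close>)
  then show ?thesis by (auto simp: csupp_def)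
qed

lemma csupp_shift: "csupp f \<Longrightarrow> csupp (\<lambda>x. f (x + h))"
proof -
  assume "csupp f"
  then obtain r where r: "\<And>x. norm x > r \<Longrightarrow> f x = 0" by (auto simp: csupp_def)
  have "f (x + h) = 0" if "norm x > r + norm h" for x
    by (rule r) (use that norm_diff_ineq[of x h] in simp)
  then show ?thesis by (auto simp: csupp_def)
qed

lemma smooth_shift: "smooth f \<Longrightarrow> smooth (\<lambda>x. f (x + h))"
  using smooth_affine[of f 1 h] by simp

lemma dd_shift: "smooth f \<Longrightarrow> dd (\<lambda>x. f (x + h)) x v = dd f (x + h) v"
  using dd_affine[of f 1 h] by simp

lemma smooth_reflect: "smooth f \<Longrightarrow> smooth (\<lambda>x. f (a - x))"
  using smooth_affine[of f "-1" a] by simp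

lemma dd_reflect: "smooth f \<Longrightarrow> dd (\<lambda>x. f (a - x)) x v = - dd f (a - x) v"
  using dd_affine[of f "-1" a] by simp

lemma integrable_mult_csupp:
  fixes f :: "'a::euclidean_space \<Rightarrow> 'b::euclidean_space"
  assumes "continuous_on UNIV \<rho>" "csupp \<rho>" "integrable lborel f"
  shows "integrable lborel (\<lambda>y. \<rho> y *\<^sub>R f y)"
proof -
  obtain B where B: "B > 0" "\<And>x. \<bar>\<rho> x\<bar> \<le> B" by (rule csupp_bounded[OF assms(2,1)]) blast
  have [measurable]: "\<rho> \<in> borel_measurable borel" using assms(1) by (rule borel_measurable_continuous_onI)
  have [measurable]: "f \<in> borel_measurable borel" using borel_measurable_integrable[OF assms(3)] by simp
  show ?thesis
  proof (rule integrable_bound)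
    show "integrable lborel (\<lambda>y. B *\<^sub>R f y)" using assms by auto
    show "AE y in lborel. norm (\<rho> y *\<^sub>R f y) \<le> norm (B *\<^sub>R f y)"
      using B by (auto intro!: mult_right_mono order_trans[OF B(2)])
  qed measurable
qed

text \<open>Translation invariance replaces the divergence theorem: the integral of f(x + t v) -
  f(x) vanishes for every t, and after division by t the remainder tends to zero uniformly on a
  fixed ball.\<close>

lemma integral_dd:
  assumes f: "smooth f" "csupp f" shows "(\<integral>x. dd f x v \<partial>lborel) = 0"
proof -
  obtain r where r: "\<And>x. norm x > r \<Longrightarrow> f x = 0" using f by (auto simp: csupp_def)
  \<comment> \<open>Outside the ball of radius \<open>R\<close>, neither \<open>x\<close> nor
    \<open>x + t *\<^sub>R v\<close> with \<open>t\<close> between 0 and 1 meets the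
    support.\<close>
  define R where "R = max r 0 + norm v"
  let ?m = "measure lborel (cball (0::'a) R)"
  have i: "integrable lborel f" "integrable lborel (\<lambda>x. dd f x v)"
    by (intro smooth_csupp_integrable[of 1] f smooth_dd csupp_dd zero_less_one)+
  have z: "f (x + t *\<^sub>R v) - f x - dd f x (t *\<^sub>R v) = 0" if "norm x > R" "0 \<le> t" "t \<le> 1" for x t
  proof -
    have "norm (t *\<^sub>R v) \<le> norm v" using that by (simp add: mult_left_le_one_le)
    moreover have "norm x - norm (t *\<^sub>R v) \<le> norm (x + t *\<^sub>R v)" by (rule norm_diff_ineq)
    moreover have "norm x > r + norm v" using that by (simp add: R_def)
    ultimately have "norm (x + t *\<^sub>R v) > r" by linarith
    moreover have nx: "norm x > r" using that by (simp add: R_def add_nonneg_nonneg max_def split: if_splits) (smt (verit) norm_ge_zero)+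
    moreover have "dd f x w = 0" for w
      using gr_outside[of "cball 0 r" f x] r nx gr_inner[OF f(1), of x w] by auto
    ultimately show ?thesis using r by simp
  qed
  have "\<bar>\<integral>x. dd f x v \<partial>lborel\<bar> \<le> e" if e: "e > 0" for e
  proof -
    let ?e = "e / (norm v * ?m + 1)"
    have pos: "norm v * ?m + 1 > 0" by (intro add_nonneg_pos mult_nonneg_nonneg) auto
    then have "?e > 0" using e by simp
    from csupp_linearization[OF f this] obtain d where d: "d > 0"
      "\<And>x w. norm w < d \<Longrightarrow> \<bar>f (x + w) - f x - dd f x w\<bar> \<le> ?e * norm w" by blast
    define t where "t = min 1 (d / (2 * (norm v + 1)))"
    have vp: "norm v + 1 > 0" by (intro add_nonneg_pos) auto
    have t: "0 < t" "t \<le> 1" "norm (t *\<^sub>R v) < d"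
    proof -
      show "0 < t" "t \<le> 1" using d vp by (auto simp: t_def)
      have "norm (t *\<^sub>R v) = t * norm v" using \<open>0 < t\<close> by simp
      also have "\<dots> \<le> d / (2 * (norm v + 1)) * norm v" by (intro mult_right_mono) (auto simp: t_def)
      also have "\<dots> = d * (norm v / (2 * (norm v + 1)))" by simp
      also have "\<dots> < d * 1" using d vp by (intro mult_strict_left_mono) (auto simp: divide_less_eq)
      finally show "norm (t *\<^sub>R v) < d" by simp
    qed
    have "dd f x (t *\<^sub>R v) = t * dd f x v" for x
      using linear_scale[OF has_derivative_linear[OF smooth_has_derivative[OF f(1)]]] by simp
    note sc = this
    have "t * (\<integral>x. dd f x v \<partial>lborel) = - (\<integral>x. f (x + t *\<^sub>R v) - f x - dd f x (t *\<^sub>R v) \<partial>lborel)"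
      using i integrable_shift[OF i(1), of "t *\<^sub>R v"] integral_shift[of f "t *\<^sub>R v"] smooth_borel[OF f(1)]
      by (simp add: sc)
    then have "\<bar>t * (\<integral>x. dd f x v \<partial>lborel)\<bar> = norm (\<integral>x. f (x + t *\<^sub>R v) - f x - dd f x (t *\<^sub>R v) \<partial>lborel)"
      by simp
    also have "\<dots> \<le> (\<integral>x. ?e * (t * norm v) * indicat_real (cball (0::'a) R) x \<partial>lborel)"
    proof (rule integral_norm_bound_integral)
      show "integrable lborel (\<lambda>x. f (x + t *\<^sub>R v) - f x - dd f x (t *\<^sub>R v))"
        unfolding sc using i by (intro integrable_diff integrable_shift) auto
      show "integrable lborel (\<lambda>x. ?e * (t * norm v) * indicat_real (cball (0::'a) R) x)"
        using emeasure_lborel_cball_finite[of "0::'a" R] by (intro integrable_mult_right integrable_real_indicator) auto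
      fix x
      show "norm (f (x + t *\<^sub>R v) - f x - dd f x (t *\<^sub>R v)) \<le> ?e * (t * norm v) * indicat_real (cball (0::'a) R) x"
        using d(2)[OF t(3), of x] z[of x t] t by (cases "norm x > R") auto
    qed
    also have "\<dots> = t * (e * ((norm v * ?m) / (norm v * ?m + 1)))" by simp
    also have "\<dots> \<le> t * (e * 1)"
      using t e pos by (intro mult_left_mono) (auto simp: divide_le_eq)
    finally show ?thesis using t by (simp add: abs_mult)
  qed
  then show ?thesis by (metis abs_le_zero_iff dense_ge)
qed

text \<open>Posed on the whole space with global integrability, the notion is stable under
  translations and products with cut-offs, with no domain to keep track of. Testing against a fixed
  vector \<open>v\<close> keeps the identity scalar.\<close>

definition wgrad :: "('a::euclidean_space \<Rightarrow> real) \<Rightarrow> ('a \<Rightarrow> 'a) \<Rightarrow> bool" where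
  "wgrad U F \<longleftrightarrow> integrable lborel U \<and> integrable lborel F \<and>
     (\<forall>\<phi> v. smooth \<phi> \<longrightarrow> csupp \<phi> \<longrightarrow>
        (\<integral>x. U x * dd \<phi> x v \<partial>lborel) = - (\<integral>x. \<phi> x * (F x \<bullet> v) \<partial>lborel))"

lemma wgradD:
  assumes "wgrad U F"
  shows "integrable lborel U" "integrable lborel F" "U \<in> borel_measurable borel" "F \<in> borel_measurable borel"
    "smooth \<phi> \<Longrightarrow> csupp \<phi> \<Longrightarrow> (\<integral>x. U x * dd \<phi> x v \<partial>lborel) = - (\<integral>x. \<phi> x * (F x \<bullet> v) \<partial>lborel)"
  using assms by (auto simp: wgrad_def dest: borel_measurable_integrable)

text \<open>The hypothesis \<open>w\<close> only sees products \<open>\<eta> x * \<phi> x\<close>,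
  so it can be supplied by a gradient that is weak merely near the support of \<eta>. This is how
  data given on a domain enter the whole space.\<close>

lemma wgrad_cutoff:
  assumes \<eta>: "smooth \<eta>" "csupp \<eta>" and U: "integrable lborel U" and F: "integrable lborel F"
    and w: "\<And>\<phi> v. smooth \<phi> \<Longrightarrow> csupp \<phi> \<Longrightarrow>
      (\<integral>x. U x * dd (\<lambda>x. \<eta> x * \<phi> x) x v \<partial>lborel) = - (\<integral>x. \<eta> x * \<phi> x * (F x \<bullet> v) \<partial>lborel)"
  shows "wgrad (\<lambda>x. \<eta> x * U x) (\<lambda>x. \<eta> x *\<^sub>R F x + U x *\<^sub>R gr \<eta> x)"
  unfolding wgrad_def
proof (intro conjI allI impI)
  note i = integrable_mult_csupp[OF smooth_cont[OF \<eta>(1)] \<eta>(2)]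
  show "integrable lborel (\<lambda>x. \<eta> x * U x)" using i[OF U] by simp
  have id: "integrable lborel (\<lambda>x. dd \<phi> x v * U x)" if "smooth \<phi>" "csupp \<phi>" for \<phi> v
    using integrable_mult_csupp[OF smooth_cont[OF smooth_dd[OF that(1)]] csupp_dd[OF that(2)] U] by simp
  have "integrable lborel (\<lambda>x. U x *\<^sub>R gr \<eta> x)"
    unfolding gr_def scaleR_sum_right scaleR_scaleR
    by (intro integrable_sum integrable_scaleR_left)
      (use id[OF \<eta>] in \<open>simp add: mult.commute\<close>)
  then show "integrable lborel (\<lambda>x. \<eta> x *\<^sub>R F x + U x *\<^sub>R gr \<eta> x)"
    by (intro integrable_add i F)
  fix \<phi> :: "'a \<Rightarrow> real" and v assume \<phi>: "smooth \<phi>" "csupp \<phi>"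
  have s: "smooth (\<lambda>x. \<eta> x * \<phi> x)" "csupp (\<lambda>x. \<eta> x * \<phi> x)"
    by (intro smooth_mult csupp_mult(1) \<eta> \<phi>)+
  have i1: "integrable lborel (\<lambda>x. U x * dd (\<lambda>x. \<eta> x * \<phi> x) x v)" using id[OF s] by (simp add: mult.commute)
  have i2: "integrable lborel (\<lambda>x. U x * (dd \<eta> x v * \<phi> x))"
    using integrable_mult_csupp[OF smooth_cont[OF \<phi>(1)] \<phi>(2) id[OF \<eta>]] by (simp add: mult_ac)
  have i3: "integrable lborel (\<lambda>x. \<eta> x * \<phi> x * (F x \<bullet> v))"
    using integrable_inner_left[OF integrable_mult_csupp[OF smooth_cont[OF s(1)] s(2) F], of v] by simp
  have "(\<integral>x. \<eta> x * U x * dd \<phi> x v \<partial>lborel) = (\<integral>x. U x * dd (\<lambda>x. \<eta> x * \<phi> x) x v - U x * (dd \<eta> x v * \<phi> x) \<partial>lborel)"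
    by (rule integral_cong) (auto simp: dd_mult[OF \<eta>(1) \<phi>(1)] algebra_simps)
  also have "\<dots> = - (\<integral>x. \<eta> x * \<phi> x * (F x \<bullet> v) \<partial>lborel) - (\<integral>x. U x * (dd \<eta> x v * \<phi> x) \<partial>lborel)"
    using integral_diff[OF i1 i2] w[OF \<phi>] by simp
  also have "\<dots> = - (\<integral>x. \<eta> x * \<phi> x * (F x \<bullet> v) + U x * (dd \<eta> x v * \<phi> x) \<partial>lborel)"
    using integral_add[OF i3 i2] by simp
  also have "(\<integral>x. \<eta> x * \<phi> x * (F x \<bullet> v) + U x * (dd \<eta> x v * \<phi> x) \<partial>lborel)
     = (\<integral>x. \<phi> x * ((\<eta> x *\<^sub>R F x + U x *\<^sub>R gr \<eta> x) \<bullet> v) \<partial>lborel)"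
    by (rule integral_cong) (auto simp: inner_add_left gr_inner[OF \<eta>(1)] algebra_simps)
  finally show "(\<integral>x. \<eta> x * U x * dd \<phi> x v \<partial>lborel) = - (\<integral>x. \<phi> x * ((\<eta> x *\<^sub>R F x + U x *\<^sub>R gr \<eta> x) \<bullet> v) \<partial>lborel)" .
qed

lemma wgrad_mult:
  assumes \<eta>: "smooth \<eta>" "csupp \<eta>" and w: "wgrad U F"
  shows "wgrad (\<lambda>x. \<eta> x * U x) (\<lambda>x. \<eta> x *\<^sub>R F x + U x *\<^sub>R gr \<eta> x)"
  by (intro wgrad_cutoff \<eta> wgradD[OF w] smooth_mult csupp_mult)

lemma wgrad_smooth:
  assumes \<eta>: "smooth \<eta>" "csupp \<eta>" shows "wgrad \<eta> (gr \<eta>)"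
  unfolding wgrad_def
proof (intro conjI allI impI)
  show "integrable lborel \<eta>" by (rule smooth_csupp_integrable[of 1, OF _ \<eta>]) simp
  have id: "integrable lborel (\<lambda>x. dd \<eta> x v)" for v
    by (rule smooth_csupp_integrable[of 1, OF _ smooth_dd[OF \<eta>(1)] csupp_dd[OF \<eta>(2)]]) simp
  show "integrable lborel (gr \<eta>)" unfolding gr_def[abs_def]
    by (intro integrable_sum integrable_scaleR_left id)
  fix \<phi> :: "'a \<Rightarrow> real" and v assume \<phi>: "smooth \<phi>" "csupp \<phi>"
  have i1: "integrable lborel (\<lambda>x. \<eta> x * dd \<phi> x v)"
    by (rule smooth_csupp_integrable[of 1, OF _ smooth_mult csupp_mult(1)]) (use \<eta> \<phi> smooth_dd in auto)
  have i2: "integrable lborel (\<lambda>x. dd \<eta> x v * \<phi> x)"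
    by (rule smooth_csupp_integrable[of 1, OF _ smooth_mult csupp_mult(2)]) (use \<eta> \<phi> smooth_dd in auto)
  have "0 = (\<integral>x. dd (\<lambda>x. \<eta> x * \<phi> x) x v \<partial>lborel)"
    by (rule integral_dd[symmetric]) (intro smooth_mult csupp_mult(1) \<eta> \<phi>)+
  also have "\<dots> = (\<integral>x. \<eta> x * dd \<phi> x v \<partial>lborel) + (\<integral>x. dd \<eta> x v * \<phi> x \<partial>lborel)"
    unfolding dd_mult[OF \<eta>(1) \<phi>(1)] using i1 i2 by simp
  finally show "(\<integral>x. \<eta> x * dd \<phi> x v \<partial>lborel) = - (\<integral>x. \<phi> x * (gr \<eta> x \<bullet> v) \<partial>lborel)"
    by (simp add: gr_inner[OF \<eta>(1)] mult.commute)
qed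

lemma wgrad_integrable_aux:
  assumes w: "wgrad U F" and \<phi>: "smooth \<phi>" "csupp \<phi>"
  shows "integrable lborel (\<lambda>x. U x * dd \<phi> x v)" "integrable lborel (\<lambda>x. \<phi> x * (F x \<bullet> v))"
  using integrable_mult_csupp[OF smooth_cont[OF smooth_dd[OF \<phi>(1)]] csupp_dd[OF \<phi>(2)] wgradD(1)[OF w], of v]
    integrable_inner_left[OF integrable_mult_csupp[OF smooth_cont[OF \<phi>(1)] \<phi>(2) wgradD(2)[OF w]], of v]
  by (simp_all add: mult.commute)

lemma wgrad_diff:
  assumes "wgrad U F" "wgrad U' F'" shows "wgrad (\<lambda>x. U x - U' x) (\<lambda>x. F x - F' x)"
  unfolding wgrad_def
proof (intro conjI allI impI)
  fix \<phi> :: "'a \<Rightarrow> real" and v assume \<phi>: "smooth \<phi>" "csupp \<phi>"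
  show "(\<integral>x. (U x - U' x) * dd \<phi> x v \<partial>lborel) = - (\<integral>x. \<phi> x * ((F x - F' x) \<bullet> v) \<partial>lborel)"
    using wgradD(5)[OF assms(1) \<phi>, of v] wgradD(5)[OF assms(2) \<phi>, of v]
      wgrad_integrable_aux[OF assms(1) \<phi>, of v] wgrad_integrable_aux[OF assms(2) \<phi>, of v]
    by (simp add: left_diff_distrib right_diff_distrib inner_diff_left)
qed (use wgradD[OF assms(1)] wgradD[OF assms(2)] in auto)

lemma wgrad_shift:
  assumes w: "wgrad U F" shows "wgrad (\<lambda>x. U (x + h)) (\<lambda>x. F (x + h))"
  unfolding wgrad_def
proof (intro conjI allI impI)
  note [measurable] = wgradD(3,4)[OF w]
  fix \<phi> :: "'a \<Rightarrow> real" and v assume \<phi>: "smooth \<phi>" "csupp \<phi>"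
  let ?p = "\<lambda>x. \<phi> (x + (- h))"
  have p: "smooth ?p" "csupp ?p" by (intro smooth_shift csupp_shift \<phi>)+
  note [measurable] = smooth_borel[OF p(1)] smooth_borel[OF smooth_dd[OF p(1)]]
  have "(\<integral>x. U (x + h) * dd \<phi> x v \<partial>lborel) = (\<integral>x. U (x + h) * dd ?p (x + h) v \<partial>lborel)"
    by (simp only: dd_shift[OF \<phi>(1)] add.assoc right_minus add_0_right)
  also have "\<dots> = (\<integral>x. U x * dd ?p x v \<partial>lborel)" by (rule integral_shift) measurable
  also have "\<dots> = - (\<integral>x. ?p x * (F x \<bullet> v) \<partial>lborel)" by (rule wgradD(5)[OF w p])
  also have "(\<integral>x. ?p x * (F x \<bullet> v) \<partial>lborel) = (\<integral>x. ?p (x + h) * (F (x + h) \<bullet> v) \<partial>lborel)"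
    by (rule integral_shift[symmetric]) measurable
  finally show "(\<integral>x. U (x + h) * dd \<phi> x v \<partial>lborel) = - (\<integral>x. \<phi> x * (F (x + h) \<bullet> v) \<partial>lborel)"
    by simp
qed (intro integrable_shift wgradD[OF w])+

text \<open>The kernel, reflected and centred at \<open>x\<close>, is itself an admissible test
  function, and the definition of the weak gradient moves the derivative from the kernel to
  \<open>U\<close>.\<close>

lemma wgrad_conv:
  assumes w: "wgrad U F" and e: "e > 0"
  shows "smooth (conv (molk e) U)" "gr (conv (molk e) U) x = conv (molk e) F x"
proof -
  note m = molk_smooth[OF e] molk_csupp[OF e]
  show s: "smooth (conv (molk e) U)" by (rule conv_smooth[OF m wgradD(1)[OF w]])
  have "gr (conv (molk e) U) x \<bullet> v = conv (molk e) F x \<bullet> v" for v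
  proof -
    let ?p = "\<lambda>y. molk e (x - y)"
    have p: "smooth ?p" "csupp ?p" by (intro smooth_reflect csupp_reflect m)+
    have "gr (conv (molk e) U) x \<bullet> v = (\<integral>y. dd (molk e) (x - y) v * U y \<partial>lborel)"
      by (simp add: gr_inner[OF s] dd_conv[OF m wgradD(1)[OF w]] conv_def)
    also have "\<dots> = - (\<integral>y. U y * dd ?p y v \<partial>lborel)"
      by (simp add: dd_reflect[OF m(1)] mult.commute)
    also have "\<dots> = (\<integral>y. ?p y * (F y \<bullet> v) \<partial>lborel)" using wgradD(5)[OF w p, of v] by simp
    also have "\<dots> = (\<integral>y. (?p y *\<^sub>R F y) \<bullet> v \<partial>lborel)" by simp
    also have "\<dots> = conv (molk e) F x \<bullet> v" unfolding conv_def
      by (rule integral_inner_left) (intro conv_integrable_aux smooth_cont m wgradD(2)[OF w])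
    finally show ?thesis .
  qed
  then show "gr (conv (molk e) U) x = conv (molk e) F x" by (metis vector_eq_rdot)
qed

section \<open>Cut-off functions\<close>

text \<open>With \<open>d\<close> a distance that can be kept from the complement of
  \<open>D\<close>, the indicator of the \<open>d/2\<close>-neighbourhood of \<open>K\<close> is
  mollified at radius \<open>d/2\<close>: the value 1 persists on \<open>K\<close>, and the support
  stays in the \<open>d\<close>-neighbourhood \<open>K'\<close>.\<close>

lemma cutoff_exists:
  fixes K :: "'a::euclidean_space set"
  assumes "compact K" "open D" "K \<subseteq> D"
  obtains \<zeta> K' where "smooth \<zeta>" "\<And>x. 0 \<le> \<zeta> x" "\<And>x. \<zeta> x \<le> 1" "\<And>x. x \<in> K \<Longrightarrow> \<zeta> x = 1"
    "compact K'" "K' \<subseteq> D" "\<And>x. x \<notin> K' \<Longrightarrow> \<zeta> x = 0"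
proof -
  obtain d where d: "d > 0" "(\<Union>x\<in>K. cball x d) \<subseteq> D"
    by (rule compact_subset_open_imp_cball_epsilon_subset[OF assms]) blast
  have d2: "d/2 > 0" using d by simp
  define K1 where "K1 = {x + y |x y. x \<in> K \<and> y \<in> cball 0 (d/2)}"
  define K' where "K' = {x + y |x y. x \<in> K \<and> y \<in> cball 0 d}"
  have c: "compact K1" "compact K'" unfolding K1_def K'_def by (intro compact_sums assms compact_cball)+
  have K'D: "K' \<subseteq> D" using d(2) by (force simp: K'_def dist_norm)
  have [measurable]: "K1 \<in> sets borel" using c by (simp add: borel_compact)
  have fin: "emeasure lborel K1 < \<infinity>" using c(1) by (rule emeasure_compact_finite)
  let ?f = "indicat_real K1"
  have fi: "integrable lborel ?f" using fin by simp
  note m = molk_smooth[OF d2] molk_csupp[OF d2]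
  note [measurable] = molk_borel[OF d2]
  define \<zeta> where "\<zeta> = conv (molk (d/2)) ?f"
  have eq: "\<zeta> x = (\<integral>z. molk (d/2) z * ?f (x - z) \<partial>lborel)" for x
    unfolding \<zeta>_def by (subst conv_commute) auto
  have i: "integrable lborel (\<lambda>z. molk (d/2) z * ?f (x - z))" for x
    by (rule integrable_bound[OF molk_integrable[OF d2]])
      (auto intro!: AE_I2 simp: indicator_def)
  have "smooth \<zeta>" unfolding \<zeta>_def by (rule conv_smooth[OF m fi])
  moreover have "0 \<le> \<zeta> x" for x
    unfolding eq by (rule integral_nonneg) (simp add: molk_nonneg[OF d2])
  moreover have "\<zeta> x \<le> 1" for x
  proof -
    have "\<zeta> x \<le> (\<integral>z. molk (d/2) (z::'a) \<partial>lborel)"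
      unfolding eq by (rule integral_mono[OF i molk_integrable[OF d2]])
        (auto simp: indicator_def molk_nonneg[OF d2])
    then show ?thesis by (simp add: molk_integral[OF d2])
  qed
  moreover have "\<zeta> x = 1" if "x \<in> K" for x
  proof -
    have "molk (d/2) z * ?f (x - z) = molk (d/2) z" for z
    proof (cases "norm z \<ge> d/2")
      case True then show ?thesis by (simp add: molk_0[OF d2])
    next
      case False
      have "x - z = x + (- z)" "- z \<in> cball 0 (d/2)" using False by auto
      then have "x - z \<in> K1" unfolding K1_def using that by blast
      then show ?thesis by simp
    qed
    then show ?thesis unfolding eq by (simp only: molk_integral[OF d2])
  qed
  moreover have "\<zeta> x = 0" if x: "x \<notin> K'" for x
  proof -
    have "molk (d/2) z * ?f (x - z) = 0" for z
    proof (cases "norm z \<ge> d/2")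
      case True then show ?thesis by (simp add: molk_0[OF d2])
    next
      case False
      have "x - z \<notin> K1"
      proof
        assume "x - z \<in> K1"
        then obtain a b where ab: "x - z = a + b" "a \<in> K" "norm b \<le> d/2" by (auto simp: K1_def)
        have "x = a + (b + z)" using ab(1) by (simp add: algebra_simps)
        moreover have "norm (b + z) \<le> d" using norm_triangle_ineq[of b z] ab False by simp
        ultimately show False using x ab(2) unfolding K'_def by auto
      qed
      then show ?thesis by simp
    qed
    then show ?thesis unfolding eq by (simp only: integral_zero)
  qed
  ultimately show thesis using that c(2) K'D by blast
qed

text \<open>A single cut-off for the unit ball is rescaled, so the constant \<open>B\<close> depends
  on neither centre nor radius.\<close>

lemma ball_cutoffs:
  "\<exists>B>0. \<forall>(x0::'a::euclidean_space) R. R > 0 \<longrightarrow> (\<exists>\<eta>. smooth \<eta> \<and> (\<forall>x. 0 \<le> \<eta> x \<and> \<eta> x \<le> 1) \<and>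
     (\<forall>x\<in>cball x0 R. \<eta> x = 1) \<and> (\<forall>x. x \<notin> cball x0 (2 * R) \<longrightarrow> \<eta> x = 0) \<and> (\<forall>x. norm (gr \<eta> x) \<le> B / R))"
proof -
  obtain \<zeta> K' where z: "smooth \<zeta>" "\<And>x. 0 \<le> \<zeta> x" "\<And>x. \<zeta> x \<le> 1" "\<And>x. x \<in> cball (0::'a) 1 \<Longrightarrow> \<zeta> x = 1"
    "compact K'" "K' \<subseteq> ball 0 2" "\<And>x. x \<notin> K' \<Longrightarrow> \<zeta> x = 0"
    by (rule cutoff_exists[of "cball 0 1" "ball (0::'a) 2"]) auto
  have cz: "csupp \<zeta>" by (rule csupp_compact[OF z(5,7)])
  have "bounded (gr \<zeta> ` K')"
    by (intro compact_imp_bounded compact_continuous_image gr_continuous z)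
  then obtain B where B: "B > 0" "\<And>x. x \<in> K' \<Longrightarrow> norm (gr \<zeta> x) \<le> B" by (auto simp: bounded_pos)
  have B2: "norm (gr \<zeta> x) \<le> B" for x
    using B gr_outside[OF z(5,7)] by (cases "x \<in> K'") auto
  have "\<exists>\<eta>. smooth \<eta> \<and> (\<forall>x. 0 \<le> \<eta> x \<and> \<eta> x \<le> 1) \<and>
     (\<forall>x\<in>cball x0 R. \<eta> x = 1) \<and> (\<forall>x. x \<notin> cball x0 (2 * R) \<longrightarrow> \<eta> x = 0) \<and> (\<forall>x. norm (gr \<eta> x) \<le> B / R)"
    if R: "R > 0" for x0 :: 'a and R
  proof (intro exI conjI allI ballI impI)
    let ?e = "\<lambda>x. \<zeta> ((1/R) *\<^sub>R x + (- (1/R) *\<^sub>R x0))"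
    have n: "norm ((1/R) *\<^sub>R x + (- (1/R) *\<^sub>R x0)) = dist x x0 / R" for x
      using R by (simp add: dist_norm flip: scaleR_diff_right)
    show "smooth ?e" by (rule smooth_affine[OF z(1)])
    show "0 \<le> ?e x" "?e x \<le> 1" for x using z by auto
    show "?e x = 1" if "x \<in> cball x0 R" for x
      by (rule z(4)) (use n[of x] that R in \<open>simp add: dist_commute divide_le_eq\<close>)
    show "?e x = 0" if "x \<notin> cball x0 (2 * R)" for x
    proof (rule z(7))
      have "norm ((1/R) *\<^sub>R x + (- (1/R) *\<^sub>R x0)) \<ge> 2"
        unfolding n using that R by (simp add: dist_commute le_divide_eq)
      then show "(1/R) *\<^sub>R x + (- (1/R) *\<^sub>R x0) \<notin> K'" using z(6) by force
    qed
    show "norm (gr ?e x) \<le> B / R" for x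
    proof -
      have "gr ?e x = (1/R) *\<^sub>R gr \<zeta> ((1/R) *\<^sub>R x + (- (1/R) *\<^sub>R x0))"
        unfolding gr_def dd_affine[OF z(1)] by (simp add: scaleR_sum_right)
      then show ?thesis using B2 R by (simp add: divide_simps)
    qed
  qed
  then show ?thesis using B(1) by blast
qed

section \<open>Growth functions\<close>

abbreviation orlicz :: "(real \<Rightarrow> real) \<Rightarrow> ('a::euclidean_space \<Rightarrow> 'b::euclidean_space) \<Rightarrow> bool" where
  "orlicz P X \<equiv> integrable lborel (\<lambda>x. P (norm (X x)))"

text \<open>
  Monotonicity of \<open>Q t / t\<close> replaces convexity because it passes to \<open>sqrt (P t)\<close> as soon as
  \<open>P t / t\<^sup>2\<close> increases, whereas convexity does not.
\<close>

definition qf :: "real \<Rightarrow> (real \<Rightarrow> real) \<Rightarrow> bool" where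
  "qf c Q \<longleftrightarrow> continuous_on UNIV Q \<and> c \<ge> 1 \<and> Q 0 = 0 \<and> (\<forall>t. 0 \<le> Q t) \<and>
     (\<forall>s t. 0 < s \<longrightarrow> s \<le> t \<longrightarrow> Q s / s \<le> Q t / t) \<and> (\<forall>t\<ge>0. Q (2 * t) \<le> c * Q t)"

context
  fixes c :: real and Q :: "real \<Rightarrow> real" assumes Q: "qf c Q"
begin

lemma qf_borel: "Q \<in> borel_measurable borel"
  using Q by (simp add: qf_def borel_measurable_continuous_onI)

lemma qf_cont: "continuous_on A Q"
  using Q unfolding qf_def by (meson continuous_on_subset subset_UNIV)

lemma qf_nonneg: "0 \<le> Q t" using Q by (simp add: qf_def)

lemma qf_ratio: "0 < s \<Longrightarrow> s \<le> t \<Longrightarrow> Q s / s \<le> Q t / t" using Q by (simp add: qf_def)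

lemma qf_zero: "Q 0 = 0" using Q by (simp add: qf_def)

lemma qf_c: "c \<ge> 1" using Q by (simp add: qf_def)

lemma qf_scale: "0 \<le> \<theta> \<Longrightarrow> \<theta> \<le> 1 \<Longrightarrow> 0 \<le> t \<Longrightarrow> Q (\<theta> * t) \<le> \<theta> * Q t"
proof -
  assume a: "0 \<le> \<theta>" "\<theta> \<le> 1" "0 \<le> t"
  show ?thesis
  proof (cases "\<theta> * t = 0")
    case True then show ?thesis using a qf_nonneg[of t] qf_zero by (auto simp: zero_le_mult_iff)
  next
    case False
    then have p: "0 < \<theta> * t" using a by (simp add: less_le)
    have "Q (\<theta> * t) / (\<theta> * t) \<le> Q t / t"
      using p a by (intro qf_ratio) (auto simp: mult_left_le_one_le)
    then show ?thesis using p a False by (simp add: divide_simps mult_ac split: if_splits)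
  qed
qed

lemma qf_mono: "0 \<le> s \<Longrightarrow> s \<le> t \<Longrightarrow> Q s \<le> Q t"
proof (cases "t = 0")
  case False
  assume a: "0 \<le> s" "s \<le> t"
  then have "t > 0" using False by simp
  then have "Q s \<le> s / t * Q t" using qf_scale[of "s / t" t] a by simp
  also have "\<dots> \<le> 1 * Q t" using a \<open>t > 0\<close> by (intro mult_right_mono qf_nonneg) auto
  finally show ?thesis by simp
qed auto

lemma qf_double: "t \<ge> 0 \<Longrightarrow> Q (2 * t) \<le> c * Q t" using Q by (simp add: qf_def)

lemma qf_add: "0 \<le> s \<Longrightarrow> 0 \<le> t \<Longrightarrow> Q (s + t) \<le> c * (Q s + Q t)"
proof -
  assume a: "0 \<le> s" "0 \<le> t"
  have "Q (s + t) \<le> Q (2 * max s t)" by (rule qf_mono) (use a in auto)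
  also have "\<dots> \<le> c * Q (max s t)" by (rule qf_double) (use a in auto)
  also have "\<dots> \<le> c * (Q s + Q t)" using qf_nonneg[of s] qf_nonneg[of t] qf_c
    by (intro mult_left_mono) (auto simp: max_def)
  finally show ?thesis .
qed

lemma qf_power: "t \<ge> 0 \<Longrightarrow> Q (2 ^ k * t) \<le> c ^ k * Q t"
proof (induction k)
  case (Suc k)
  have "Q (2 ^ Suc k * t) \<le> c * Q (2 ^ k * t)" using qf_double[of "2 ^ k * t"] Suc by (simp add: mult.assoc)
  also have "\<dots> \<le> c * (c ^ k * Q t)" using Suc qf_c by (intro mult_left_mono) auto
  finally show ?case by simp
qed auto

lemma qf_mult_bound: "\<exists>C>0. \<forall>t\<ge>0. Q (M * t) \<le> C * Q t" if "M \<ge> 0"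
proof -
  obtain k where k: "M < 2 ^ k" using real_arch_pow[of 2 M] by auto
  have "Q (M * t) \<le> c ^ k * Q t" if "t \<ge> 0" for t
  proof -
    have "Q (M * t) \<le> Q (2 ^ k * t)" by (rule qf_mono) (use k that \<open>M \<ge> 0\<close> in \<open>auto intro: mult_right_mono\<close>)
    then show ?thesis using qf_power[OF that, of k] by simp
  qed
  moreover have "c ^ k > 0" using qf_c by simp
  ultimately show ?thesis by blast
qed

text \<open>
  Since \<open>Q t / t\<close> increases, \<open>Q\<close> lies above the line of slope \<open>2 Q (T / 2) / T\<close> through the point
  \<open>T / 2\<close> of the axis.
\<close>

lemma qf_jensen:
  fixes w :: "'x \<Rightarrow> ennreal" and f :: "'x \<Rightarrow> real"
  assumes [measurable]: "w \<in> borel_measurable M" "f \<in> borel_measurable M"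
    and w: "(\<integral>\<^sup>+x. w x \<partial>M) \<le> 1" and f: "\<And>x. f x \<ge> 0" and T: "T \<ge> 0"
    "ennreal T \<le> (\<integral>\<^sup>+x. w x * ennreal (f x) \<partial>M)"
  shows "ennreal (Q T) \<le> ennreal c * (\<integral>\<^sup>+x. w x * ennreal (Q (f x)) \<partial>M)"
proof (cases "T = 0")
  case True then show ?thesis by (simp add: qf_zero)
next
  note [measurable] = qf_borel
  case False
  then have T0: "T > 0" using T by simp
  define m where "m = Q (T/2) / (T/2)"
  have m: "m \<ge> 0" using T0 qf_nonneg by (simp add: m_def)
  have pt: "ennreal m * ennreal t \<le> ennreal (Q t) + ennreal (Q (T/2))" if "t \<ge> 0" for t
  proof -
    have "m * t \<le> Q t + Q (T/2)"
    proof (cases "t \<le> T/2")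
      case True
      then have "m * t \<le> m * (T/2)" using m by (intro mult_left_mono) auto
      also have "\<dots> = Q (T/2)" using T0 by (simp add: m_def)
      finally show ?thesis using qf_nonneg[of t] by simp
    next
      case False
      then have "Q (T/2) / (T/2) \<le> Q t / t" using T0 by (intro qf_ratio) auto
      then have "m * t \<le> Q t" using False T0 by (simp add: m_def field_simps)
      then show ?thesis using qf_nonneg[of "T/2"] by simp
    qed
    then show ?thesis using m that qf_nonneg[of t] qf_nonneg[of "T/2"]
      by (simp flip: ennreal_mult ennreal_plus)
  qed
  let ?J = "\<integral>\<^sup>+x. w x * ennreal (Q (f x)) \<partial>M"
  have "ennreal (m * T) = ennreal m * ennreal T" using m T by (simp add: ennreal_mult)
  also have "\<dots> \<le> ennreal m * (\<integral>\<^sup>+x. w x * ennreal (f x) \<partial>M)" by (intro mult_left_mono T) simp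
  also have "\<dots> = (\<integral>\<^sup>+x. w x * (ennreal m * ennreal (f x)) \<partial>M)"
    by (subst nn_integral_cmult[symmetric]) (auto simp: mult_ac)
  also have "\<dots> \<le> (\<integral>\<^sup>+x. w x * ennreal (Q (f x)) + w x * ennreal (Q (T/2)) \<partial>M)"
    by (rule nn_integral_mono) (use pt f in \<open>auto simp flip: distrib_left intro!: mult_left_mono\<close>)
  also have "\<dots> = ?J + (\<integral>\<^sup>+x. w x \<partial>M) * ennreal (Q (T/2))"
    by (simp add: nn_integral_add nn_integral_multc)
  also have "\<dots> \<le> ?J + 1 * ennreal (Q (T/2))" by (intro add_left_mono mult_right_mono w) simp
  finally have le: "ennreal (m * T) \<le> ?J + ennreal (Q (T/2))" by simp
  \<comment> \<open>At \<open>t = T\<close> the line has height \<open>Q (T/2)\<close>. Cancelling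
    one of the two copies leaves the bound for \<open>Q (T/2)\<close>, and doubling gives the one
    for \<open>Q T\<close>.\<close>
  have "m * T = Q (T/2) + Q (T/2)" using T0 by (simp add: m_def)
  then have "ennreal (m * T) = ennreal (Q (T/2)) + ennreal (Q (T/2))"
    using qf_nonneg[of "T/2"] by (simp only: ennreal_plus)
  then have "ennreal (Q (T/2)) + ennreal (Q (T/2)) \<le> ennreal (Q (T/2)) + ?J"
    using le by (simp only: add.commute)
  then have h: "ennreal (Q (T/2)) \<le> ?J"
    by (subst (asm) ennreal_add_left_cancel_le) auto
  have "Q T \<le> c * Q (T/2)" using qf_double[of "T/2"] T0 by simp
  then have "ennreal (Q T) \<le> ennreal (c * Q (T/2))" by (rule ennreal_leI)
  also have "\<dots> = ennreal c * ennreal (Q (T/2))" using qf_c by (intro ennreal_mult') simp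
  also have "\<dots> \<le> ennreal c * ?J" by (intro mult_left_mono h) simp
  finally show ?thesis .
qed

lemma qf_conv:
  fixes F :: "'a::euclidean_space \<Rightarrow> 'b::euclidean_space"
  assumes F: "integrable lborel F" and e: "e > 0" and QF: "orlicz Q F"
  shows "Q (norm (conv (molk e) F x)) \<le> c * conv (molk e) (\<lambda>x. Q (norm (F x))) x"
proof -
  note [measurable] = molk_borel[OF e] qf_borel
  note [measurable] = integrable_borel[OF F(1)]
  have i: "integrable lborel (\<lambda>y. molk e (x - y) *\<^sub>R F y)"
    by (intro conv_integrable_aux smooth_cont molk_smooth molk_csupp e F)
  from integrable_reflect[OF this, of x] have i: "integrable lborel (\<lambda>z. molk e z *\<^sub>R F (x - z))" by simp
  have "ennreal (norm (conv (molk e) F x)) \<le> (\<integral>\<^sup>+z. ennreal (norm (molk e z *\<^sub>R F (x - z))) \<partial>lborel)"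
    using integral_norm_bound_ennreal[OF i] by (subst conv_commute) auto
  then have "ennreal (norm (conv (molk e) F x)) \<le> (\<integral>\<^sup>+z. ennreal (molk e z) * ennreal (norm (F (x - z))) \<partial>lborel)"
    by (simp add: ennreal_mult' abs_of_nonneg[OF molk_nonneg[OF e]] molk_nonneg[OF e])
  then have "ennreal (Q (norm (conv (molk e) F x))) \<le> ennreal c * (\<integral>\<^sup>+z. ennreal (molk e z) * ennreal (Q (norm (F (x - z)))) \<partial>lborel)"
    by (intro qf_jensen) (auto simp: molk_nn_integral[OF e])
  also have "\<dots> = ennreal c * ennreal (conv (molk e) (\<lambda>x. Q (norm (F x))) x)"
    by (subst conv_nn[OF QF _ e]) (auto simp: qf_nonneg)
  also have "\<dots> = ennreal (c * conv (molk e) (\<lambda>x. Q (norm (F x))) x)"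
    using qf_c by (intro ennreal_mult'[symmetric]) simp
  finally show ?thesis
  proof (subst (asm) ennreal_le_iff)
    show "0 \<le> c * conv (molk e) (\<lambda>x. Q (norm (F x))) x"
      unfolding conv_def using qf_c
      by (intro mult_nonneg_nonneg integral_nonneg) (auto simp: qf_nonneg molk_nonneg[OF e])
  qed
qed

end

section \<open>Test functions and difference quotients\<close>

lemma pred_cball [measurable]: "Measurable.pred borel (\<lambda>y. y \<in> cball x r)"
  using borel_closed[OF closed_cball[of x r]] by (simp add: pred_def del: mem_cball)

text \<open>Vanishing off some compact subset is easier to check than a condition on the closure of
  the support; \<open>tests_eq\<close> shows that the class is
  \<open>test_functions\<close>.\<close>

definition tests :: "'a::euclidean_space set \<Rightarrow> ('a \<Rightarrow> real) set" where
  "tests D = {\<phi>. smooth \<phi> \<and> (\<exists>K. compact K \<and> K \<subseteq> D \<and> (\<forall>x. x \<notin> K \<longrightarrow> \<phi> x = 0))}"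

lemma testsI: "smooth \<phi> \<Longrightarrow> compact K \<Longrightarrow> K \<subseteq> D \<Longrightarrow> (\<And>x. x \<notin> K \<Longrightarrow> \<phi> x = 0) \<Longrightarrow> \<phi> \<in> tests D"
  by (auto simp: tests_def)

lemma conv_integrable:
  fixes f :: "'a::euclidean_space \<Rightarrow> 'b::euclidean_space"
  assumes f: "integrable lborel f" and e: "e > 0"
  shows "integrable lborel (conv (molk e) f)"
proof -
  note [measurable] = molk_borel[OF e]
  note [measurable] = integrable_borel[OF f(1)]
  have "ennreal (norm (conv (molk e) f x)) \<le> ennreal (conv (molk e) (\<lambda>x. norm (f x)) x)" for x
  proof -
    have "norm (conv (molk e) f x) \<le> (\<integral>y. norm (molk e (x - y) *\<^sub>R f y) \<partial>lborel)"
      unfolding conv_def by (rule integral_norm_bound)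
    then show ?thesis unfolding conv_def by (intro ennreal_leI) (simp add: abs_of_nonneg[OF molk_nonneg[OF e]])
  qed
  then have "(\<integral>\<^sup>+x. ennreal (norm (conv (molk e) f x)) \<partial>lborel) \<le> SI UNIV (conv (molk e) (\<lambda>x. norm (f x)))"
    unfolding SI_def by (intro nn_integral_mono) simp
  also have "\<dots> \<le> SI UNIV (\<lambda>x. norm (f x))"
    by (rule SI_conv[OF integrable_norm[OF f] _ e]) auto
  also have "\<dots> < \<infinity>" using f by (simp add: SI_def integrable_iff_bounded)
  finally show ?thesis by (simp add: integrable_iff_bounded)
qed

text \<open>A common sequence of radii for two functions, since \<open>test_extension\<close>
  mollifies a gradient \<open>F\<close> and \<open>P (norm (F x))\<close> at the same time.
  Convergence almost everywhere is obtained by passing to subsequences twice.\<close>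

lemma conv_L1_seq:
  fixes f :: "'a::euclidean_space \<Rightarrow> 'b::euclidean_space" and g :: "'a \<Rightarrow> 'c::euclidean_space"
  assumes f: "integrable lborel f" and g: "integrable lborel g" and d: "d > 0"
  obtains \<epsilon> :: "nat \<Rightarrow> real" where "\<And>j. 0 < \<epsilon> j" "\<And>j. \<epsilon> j < d"
    "(\<lambda>j. \<integral>x. norm (conv (molk (\<epsilon> j)) f x - f x) \<partial>lborel) \<longlonglongrightarrow> 0"
    "(\<lambda>j. \<integral>x. norm (conv (molk (\<epsilon> j)) g x - g x) \<partial>lborel) \<longlonglongrightarrow> 0"
    "AE x in lborel. (\<lambda>j. conv (molk (\<epsilon> j)) f x) \<longlonglongrightarrow> f x"
    "AE x in lborel. (\<lambda>j. conv (molk (\<epsilon> j)) g x) \<longlonglongrightarrow> g x"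
proof -
  have ie: "(\<integral>x. norm (conv (molk \<epsilon>) f x - f x) \<partial>lborel) \<le> e"
    if "(\<integral>\<^sup>+x. ennreal (norm (conv (molk \<epsilon>) f x - f x)) \<partial>lborel) \<le> ennreal e" "\<epsilon> > 0" "e > 0" "integrable lborel f"
    for e \<epsilon> and f :: "'a \<Rightarrow> 'd::euclidean_space"
  proof -
    have "integrable lborel (\<lambda>x. norm (conv (molk \<epsilon>) f x - f x))"
      by (rule integrable_norm[OF integrable_diff[OF conv_integrable[OF that(4,2)] that(4)]])
    then show ?thesis using that by (simp add: nn_integral_eq_integral)
  qed
  have "\<exists>\<epsilon>. 0 < \<epsilon> \<and> \<epsilon> < d \<and> (\<integral>x. norm (conv (molk \<epsilon>) f x - f x) \<partial>lborel) \<le> 1 / real (Suc j)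
     \<and> (\<integral>x. norm (conv (molk \<epsilon>) g x - g x) \<partial>lborel) \<le> 1 / real (Suc j)" for j
  proof -
    have e: "1 / real (Suc j) > 0" by simp
    obtain d1 where d1: "d1 > 0" "\<And>\<epsilon>. 0 < \<epsilon> \<Longrightarrow> \<epsilon> < d1 \<Longrightarrow> (\<integral>\<^sup>+x. ennreal (norm (conv (molk \<epsilon>) f x - f x)) \<partial>lborel) \<le> ennreal (1 / real (Suc j))"
      using conv_L1[OF f e] by blast
    obtain d2 where d2: "d2 > 0" "\<And>\<epsilon>. 0 < \<epsilon> \<Longrightarrow> \<epsilon> < d2 \<Longrightarrow> (\<integral>\<^sup>+x. ennreal (norm (conv (molk \<epsilon>) g x - g x)) \<partial>lborel) \<le> ennreal (1 / real (Suc j))"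
      using conv_L1[OF g e] by blast
    define \<epsilon> where "\<epsilon> = min d (min d1 d2) / 2"
    have "0 < min d (min d1 d2)" using d d1(1) d2(1) by simp
    then have "0 < \<epsilon>" "\<epsilon> < d" "\<epsilon> < d1" "\<epsilon> < d2" unfolding \<epsilon>_def by linarith+
    then have "(\<integral>x. norm (conv (molk \<epsilon>) f x - f x) \<partial>lborel) \<le> 1 / real (Suc j)"
      "(\<integral>x. norm (conv (molk \<epsilon>) g x - g x) \<partial>lborel) \<le> 1 / real (Suc j)"
      using ie[OF d1(2) _ e f] ie[OF d2(2) _ e g] by simp_all
    with \<open>0 < \<epsilon>\<close> \<open>\<epsilon> < d\<close> show ?thesis by (intro exI[of _ \<epsilon>] conjI)
  qed
  then have "\<forall>j. \<exists>\<epsilon>. 0 < \<epsilon> \<and> \<epsilon> < d \<and> (\<integral>x. norm (conv (molk \<epsilon>) f x - f x) \<partial>lborel) \<le> 1 / real (Suc j)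
     \<and> (\<integral>x. norm (conv (molk \<epsilon>) g x - g x) \<partial>lborel) \<le> 1 / real (Suc j)" by (rule allI)
  from choice[OF this] obtain \<epsilon> where \<epsilon>: "\<And>j. 0 < \<epsilon> j" "\<And>j. \<epsilon> j < d"
    "\<And>j. (\<integral>x. norm (conv (molk (\<epsilon> j)) f x - f x) \<partial>lborel) \<le> 1 / real (Suc j)"
    "\<And>j. (\<integral>x. norm (conv (molk (\<epsilon> j)) g x - g x) \<partial>lborel) \<le> 1 / real (Suc j)" by auto
  have lim0: "(\<lambda>j. 1 / real (Suc j)) \<longlonglongrightarrow> 0" by (rule LIMSEQ_Suc[OF lim_1_over_n])
  have lf: "(\<lambda>j. \<integral>x. norm (conv (molk (\<epsilon> j)) f x - f x) \<partial>lborel) \<longlonglongrightarrow> 0"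
    by (rule tendsto_sandwich[OF _ _ tendsto_const lim0]) (use \<epsilon> in auto)
  have lg: "(\<lambda>j. \<integral>x. norm (conv (molk (\<epsilon> j)) g x - g x) \<partial>lborel) \<longlonglongrightarrow> 0"
    by (rule tendsto_sandwich[OF _ _ tendsto_const lim0]) (use \<epsilon> in auto)
  obtain r1 where r1: "strict_mono r1" "AE x in lborel. (\<lambda>j. conv (molk (\<epsilon> (r1 j))) f x - f x) \<longlonglongrightarrow> 0"
    using tendsto_L1_AE_subseq[OF integrable_diff[OF conv_integrable[OF f \<epsilon>(1)] f] lf] by blast
  have lg1: "(\<lambda>j. \<integral>x. norm (conv (molk (\<epsilon> (r1 j))) g x - g x) \<partial>lborel) \<longlonglongrightarrow> 0"
    using LIMSEQ_subseq_LIMSEQ[OF lg r1(1)] by (simp add: o_def)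
  obtain r2 where r2: "strict_mono r2" "AE x in lborel. (\<lambda>j. conv (molk (\<epsilon> (r1 (r2 j)))) g x - g x) \<longlonglongrightarrow> 0"
    using tendsto_L1_AE_subseq[OF integrable_diff[OF conv_integrable[OF g \<epsilon>(1)] g] lg1] by blast
  have "AE x in lborel. (\<lambda>j. conv (molk (\<epsilon> (r1 (r2 j)))) g x) \<longlonglongrightarrow> g x"
    using r2(2) by (simp add: LIM_zero_iff)
  moreover have "AE x in lborel. (\<lambda>j. conv (molk (\<epsilon> (r1 (r2 j)))) f x) \<longlonglongrightarrow> f x"
    using r1(2)
  proof eventually_elim
    case (elim x)
    from LIMSEQ_subseq_LIMSEQ[OF elim r2(1)] show ?case by (simp add: o_def LIM_zero_iff)
  qed
  moreover have "(\<lambda>j. \<integral>x. norm (conv (molk (\<epsilon> (r1 (r2 j)))) g x - g x) \<partial>lborel) \<longlonglongrightarrow> 0"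
    using LIMSEQ_subseq_LIMSEQ[OF lg1 r2(1)] by (simp add: o_def)
  moreover have "(\<lambda>j. \<integral>x. norm (conv (molk (\<epsilon> (r1 (r2 j)))) f x - f x) \<partial>lborel) \<longlonglongrightarrow> 0"
    using LIMSEQ_subseq_LIMSEQ[OF LIMSEQ_subseq_LIMSEQ[OF lf r1(1)] r2(1)] by (simp add: o_def)
  ultimately show thesis using that[of "\<lambda>j. \<epsilon> (r1 (r2 j))", OF \<epsilon>(1,2)] by simp
qed

section \<open>Extension of the weak formulation to rough test functions\<close>

lemma conv_support:
  fixes f :: "'a::euclidean_space \<Rightarrow> 'b::euclidean_space"
  assumes "e > 0" "\<And>y. norm (x - y) < e \<Longrightarrow> f y = 0" shows "conv (molk e) f x = 0"
proof -
  have "molk e (x - y) *\<^sub>R f y = 0" for y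
    using molk_0[OF assms(1), of "x - y"] assms(2)[of y] by (cases "norm (x - y) < e") auto
  then show ?thesis by (simp only: conv_def integral_zero)
qed

text \<open>The mollification of \<open>U\<close> is a legitimate test function whose gradient is
  the mollification of \<open>F\<close>. The passage to the limit is a dominated convergence with
  moving majorants: \<open>a x \<bullet> G j x\<close> is controlled by
  \<open>\<bar>k x\<bar> + C * (c * q j x)\<close> only, where the mollifications \<open>q j\<close>
  of \<open>P (norm (F x))\<close> converge in the mean.\<close>

lemma test_extension:
  fixes a :: "'a::euclidean_space \<Rightarrow> 'a"
  assumes P: "qf c P" and [measurable]: "a \<in> borel_measurable borel"
    and sol: "\<And>\<phi>. \<phi> \<in> tests D \<Longrightarrow> (\<integral>x. a x \<bullet> gr \<phi> x \<partial>lborel) = 0"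
    and k: "integrable lborel k" and C: "C \<ge> 0"
    and bound: "AE x in lborel. x \<in> D \<longrightarrow> (\<forall>t\<ge>0. norm (a x) * t \<le> k x + C * P t)"
    and w: "wgrad U F" and K: "compact K" "K \<subseteq> D" "open D" "\<And>x. x \<notin> K \<Longrightarrow> U x = 0" "\<And>x. x \<notin> K \<Longrightarrow> F x = 0"
    and PF: "orlicz P F"
  shows "integrable lborel (\<lambda>x. a x \<bullet> F x)" "(\<integral>x. a x \<bullet> F x \<partial>lborel) = 0"
proof -
  note [measurable] = wgradD(3,4)[OF w] qf_borel[OF P] borel_measurable_integrable[OF k]
  let ?p = "\<lambda>x. P (norm (F x))"
  obtain d where d: "d > 0" "(\<Union>x\<in>K. cball x d) \<subseteq> D"
    by (rule compact_subset_open_imp_cball_epsilon_subset[OF K(1,3,2)]) blast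
  define K' where "K' = {x + y |x y. x \<in> K \<and> y \<in> cball 0 d}"
  have K'1: "compact K'" unfolding K'_def by (intro compact_sums K compact_cball)
  have K'2: "K' \<subseteq> D"
  proof
    fix z assume "z \<in> K'"
    then obtain x y where z: "z = x + y" "x \<in> K" "norm y \<le> d" by (auto simp: K'_def)
    then have "z \<in> cball x d" by (simp add: dist_norm)
    then show "z \<in> D" using d(2) z(2) by blast
  qed
  note K' = K'1 K'2
  obtain e where e: "\<And>j. 0 < e j" "\<And>j::nat. e j < d"
    "(\<lambda>j. \<integral>x. norm (conv (molk (e j)) F x - F x) \<partial>lborel) \<longlonglongrightarrow> 0"
    "(\<lambda>j. \<integral>x. norm (conv (molk (e j)) ?p x - ?p x) \<partial>lborel) \<longlonglongrightarrow> 0"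
    "AE x in lborel. (\<lambda>j. conv (molk (e j)) F x) \<longlonglongrightarrow> F x"
    by (rule conv_L1_seq[OF wgradD(2)[OF w] PF d(1)]) blast
  note [measurable] = molk_borel[OF e(1)]
  define G where "G j = conv (molk (e j)) F" for j
  define q where "q j = conv (molk (e j)) ?p" for j
  have [measurable]: "G j \<in> borel_measurable borel" "q j \<in> borel_measurable borel" for j
    unfolding G_def q_def by measurable
  have qi: "integrable lborel (q j)" for j unfolding q_def by (rule conv_integrable[OF PF e(1)])
  have q0: "q j x \<ge> 0" for j x unfolding q_def conv_def
    by (rule integral_nonneg) (auto simp: qf_nonneg[OF P] molk_nonneg[OF e(1)])
  have Gq: "P (norm (G j x)) \<le> c * q j x" for j x
    unfolding G_def q_def by (rule qf_conv[OF P wgradD(2)[OF w] e(1) PF])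
  have G0: "G j x = 0" if "x \<notin> D" for j x
    unfolding G_def
  proof (rule conv_support[OF e(1)])
    fix y assume "norm (x - y) < e j"
    then have "x \<in> cball y d" using e(2)[of j] by (simp add: dist_norm norm_minus_commute)
    then have "y \<notin> K" using that d by blast
    then show "F y = 0" by (rule K)
  qed
  have G_sol: "(\<integral>x. a x \<bullet> G j x \<partial>lborel) = 0" for j
  proof -
    have "conv (molk (e j)) U \<in> tests D"
    proof (rule testsI[OF wgrad_conv(1)[OF w e(1)] K'])
      fix x assume x: "x \<notin> K'"
      show "conv (molk (e j)) U x = 0"
      proof (rule conv_support[OF e(1)])
        fix y assume y: "norm (x - y) < e j"
        have "y \<notin> K"
        proof
          assume "y \<in> K"
          moreover have "x = y + (x - y)" "x - y \<in> cball 0 d" using y e(2)[of j] by auto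
          ultimately show False using x unfolding K'_def by blast
        qed
        then show "U y = 0" by (rule K)
      qed
    qed
    from sol[OF this] show ?thesis by (simp add: wgrad_conv(2)[OF w e(1)] G_def)
  qed
  have c: "c \<ge> 1" by (rule qf_c[OF P])
  have bd: "AE x in lborel. \<forall>j. \<bar>a x \<bullet> G j x\<bar> \<le> \<bar>k x\<bar> + C * (c * q j x)"
    using bound
  proof eventually_elim
    case (elim x)
    show ?case
    proof
      fix j
      show "\<bar>a x \<bullet> G j x\<bar> \<le> \<bar>k x\<bar> + C * (c * q j x)"
      proof (cases "x \<in> D")
        case True
        have "\<bar>a x \<bullet> G j x\<bar> \<le> norm (a x) * norm (G j x)" by (rule Cauchy_Schwarz_ineq2)
        also have "\<dots> \<le> k x + C * P (norm (G j x))" using elim True by auto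
        also have "\<dots> \<le> \<bar>k x\<bar> + C * (c * q j x)" using Gq[of j x] C by (intro add_mono mult_left_mono) auto
        finally show ?thesis .
      qed (use G0 q0 C c in simp)
    qed
  qed
  have bdF: "AE x in lborel. \<bar>a x \<bullet> F x\<bar> \<le> \<bar>k x\<bar> + C * (c * ?p x)"
    using bound
  proof eventually_elim
    case (elim x)
    show ?case
    proof (cases "x \<in> D")
      case True
      have "\<bar>a x \<bullet> F x\<bar> \<le> norm (a x) * norm (F x)" by (rule Cauchy_Schwarz_ineq2)
      also have "\<dots> \<le> k x + C * P (norm (F x))" using elim True by auto
      also have "\<dots> \<le> \<bar>k x\<bar> + C * (c * ?p x)"
        using C c qf_nonneg[OF P, of "norm (F x)"] mult_right_mono[of 1 c "?p x"] by (intro add_mono mult_left_mono) auto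
      finally show ?thesis .
    next
      case False
      then have "F x = 0" using K by blast
      then show ?thesis using C c qf_nonneg[OF P] by simp
    qed
  qed
  show hi: "integrable lborel (\<lambda>x. a x \<bullet> F x)"
  proof (rule integrable_bound)
    show "integrable lborel (\<lambda>x. \<bar>k x\<bar> + C * (c * ?p x))" using k PF by auto
    show "AE x in lborel. norm (a x \<bullet> F x) \<le> norm (\<bar>k x\<bar> + C * (c * ?p x))"
      using bdF by eventually_elim simp
  qed measurable
  have hji: "integrable lborel (\<lambda>x. a x \<bullet> G j x)" for j
  proof (rule integrable_bound)
    show "integrable lborel (\<lambda>x. \<bar>k x\<bar> + C * (c * q j x))" using k qi by auto
    show "AE x in lborel. norm (a x \<bullet> G j x) \<le> norm (\<bar>k x\<bar> + C * (c * q j x))"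
      using bd by eventually_elim (auto dest!: spec[of _ j])
  qed measurable
  \<comment> \<open>The fixed part of the majorant of
    \<open>a x \<bullet> G j x - a x \<bullet> F x\<close>. What exceeds it is at most
    \<open>C * (c * norm (q j x - ?p x))\<close>, hence vanishes in the mean; the part cut off at
    \<open>H\<close> is left to dominated convergence.\<close>
  define H where "H x = 2 * (\<bar>k x\<bar> + C * (c * ?p x))" for x
  have H: "integrable lborel H" unfolding H_def[abs_def] using k PF by auto
  note [measurable] = borel_measurable_integrable[OF H]
  let ?m = "\<lambda>j x. min \<bar>a x \<bullet> G j x - a x \<bullet> F x\<bar> \<bar>H x\<bar>"
  have mi: "integrable lborel (?m j)" for j
    by (rule integrable_bound[OF H]) (auto intro!: AE_I2)
  have lim: "(\<lambda>j. \<integral>x. ?m j x \<partial>lborel) \<longlonglongrightarrow> integral\<^sup>L (lborel :: 'a measure) (\<lambda>x. 0)"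
  proof (rule integral_dominated_convergence[where w="\<lambda>x. \<bar>H x\<bar>"])
    show "AE x in lborel. (\<lambda>j. ?m j x) \<longlonglongrightarrow> 0"
      using e(5)
    proof eventually_elim
      case (elim x)
      have "(\<lambda>j. a x \<bullet> G j x) \<longlonglongrightarrow> a x \<bullet> F x" unfolding G_def using elim by (intro tendsto_intros)
      then have "(\<lambda>j. \<bar>a x \<bullet> G j x - a x \<bullet> F x\<bar>) \<longlonglongrightarrow> 0" by (intro tendsto_rabs_zero) (simp add: LIM_zero)
      then have "(\<lambda>j. ?m j x) \<longlonglongrightarrow> min 0 \<bar>H x\<bar>" by (intro tendsto_min tendsto_const)
      then show ?case by simp
    qed
  qed (use H in auto)
  have "\<bar>\<integral>x. a x \<bullet> F x \<partial>lborel\<bar> \<le> (\<integral>x. ?m j x \<partial>lborel) + C * (c * (\<integral>x. norm (q j x - ?p x) \<partial>lborel))" for j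
  proof -
    have "\<bar>\<integral>x. a x \<bullet> F x \<partial>lborel\<bar> = norm (\<integral>x. a x \<bullet> G j x - a x \<bullet> F x \<partial>lborel)"
      using hi hji[of j] G_sol[of j] by simp
    also have "\<dots> \<le> (\<integral>x. ?m j x + C * (c * norm (q j x - ?p x)) \<partial>lborel)"
    proof (rule order_trans[OF integral_norm_bound integral_mono_AE])
      show "AE x in lborel. norm (a x \<bullet> G j x - a x \<bullet> F x) \<le> ?m j x + C * (c * norm (q j x - ?p x))"
        using bd bdF
      proof eventually_elim
        case (elim x)
        have "q j x \<le> ?p x + norm (q j x - ?p x)" by simp
        then have "C * (c * q j x) \<le> C * (c * (?p x + norm (q j x - ?p x)))" using C c by (intro mult_left_mono) auto
        moreover have "\<bar>a x \<bullet> G j x\<bar> \<le> \<bar>k x\<bar> + C * (c * q j x)" using elim by blast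
        ultimately have "\<bar>a x \<bullet> G j x - a x \<bullet> F x\<bar> \<le> H x + C * (c * norm (q j x - ?p x))"
          using elim(2) by (simp add: H_def algebra_simps)
        moreover have "0 \<le> C * (c * norm (q j x - ?p x))" using C c by simp
        ultimately show ?case by (auto simp: min_def)
      qed
    qed (use mi[of j] hi hji[of j] qi[of j] PF in auto)
    also have "\<dots> = (\<integral>x. ?m j x \<partial>lborel) + C * (c * (\<integral>x. norm (q j x - ?p x) \<partial>lborel))"
      using mi[of j] qi[of j] PF by simp
    finally show ?thesis .
  qed
  moreover have "(\<lambda>j. (\<integral>x. ?m j x \<partial>lborel) + C * (c * (\<integral>x. norm (q j x - ?p x) \<partial>lborel))) \<longlonglongrightarrow> 0 + C * (c * 0)"
    using lim e(4) unfolding q_def by (intro tendsto_intros) auto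
  ultimately have "\<bar>\<integral>x. a x \<bullet> F x \<partial>lborel\<bar> \<le> 0"
    by (intro LIMSEQ_le_const[where X="\<lambda>j. (\<integral>x. ?m j x \<partial>lborel) + C * (c * (\<integral>x. norm (q j x - ?p x) \<partial>lborel))"]) auto
  then show "(\<integral>x. a x \<bullet> F x \<partial>lborel) = 0" by simp
qed

text \<open>A mollification of \<open>\<zeta> x *\<^sub>R E x\<close> is the integral of
  \<open>E\<close> against a test function, hence zero, and mollifications converge almost
  everywhere. Countably many compact sets exhaust \<open>D\<close>.\<close>

lemma tests_unique:
  fixes E :: "'a::euclidean_space \<Rightarrow> 'a"
  assumes [measurable]: "E \<in> borel_measurable borel" and D: "open D"
    and i: "\<And>K. compact K \<Longrightarrow> K \<subseteq> D \<Longrightarrow> integrable lborel (\<lambda>x. indicat_real K x *\<^sub>R E x)"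
    and z: "\<And>\<phi>. \<phi> \<in> tests D \<Longrightarrow> (\<integral>x. \<phi> x *\<^sub>R E x \<partial>lborel) = 0"
  shows "AE x in lborel. x \<in> D \<longrightarrow> E x = 0"
proof -
  have *: "AE x in lborel. x \<in> K \<longrightarrow> E x = 0" if K: "compact K" "K \<subseteq> D" for K
  proof -
    obtain \<zeta> K' where \<zeta>: "smooth \<zeta>" "\<And>x. 0 \<le> \<zeta> x" "\<And>x. \<zeta> x \<le> 1" "\<And>x. x \<in> K \<Longrightarrow> \<zeta> x = 1"
      "compact K'" "K' \<subseteq> D" "\<And>x. x \<notin> K' \<Longrightarrow> \<zeta> x = 0"
      by (rule cutoff_exists[OF K(1) D K(2)]) (rule that)
    let ?G = "\<lambda>x. \<zeta> x *\<^sub>R E x"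
    have cs: "csupp \<zeta>" by (rule csupp_compact[OF \<zeta>(5,7)])
    have "integrable lborel (\<lambda>x. \<zeta> x *\<^sub>R (indicat_real K' x *\<^sub>R E x))"
      by (intro integrable_mult_csupp smooth_cont \<zeta> cs i)
    also have "(\<lambda>x. \<zeta> x *\<^sub>R (indicat_real K' x *\<^sub>R E x)) = ?G"
      using \<zeta>(7) by (auto simp: fun_eq_iff indicator_def)
    finally have G: "integrable lborel ?G" .
    obtain e where e: "\<And>j. 0 < e j" "AE x in lborel. (\<lambda>j::nat. conv (molk (e j)) ?G x) \<longlonglongrightarrow> ?G x"
      by (rule conv_L1_seq[OF G G zero_less_one]) blast
    have c0: "conv (molk (e j)) ?G x = 0" for j x
    proof -
      have "(\<lambda>y. molk (e j) (x - y) * \<zeta> y) \<in> tests D"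
        by (rule testsI[OF smooth_mult[OF smooth_reflect[OF molk_smooth[OF e(1)]] \<zeta>(1)] \<zeta>(5,6)]) (simp add: \<zeta>)
      from z[OF this] show ?thesis by (simp add: conv_def)
    qed
    have "AE x in lborel. ?G x = 0"
      using e(2) by (rule eventually_mono) (simp add: c0 LIMSEQ_const_iff del: scaleR_eq_0_iff)
    then show ?thesis by (rule eventually_mono) (use \<zeta>(4) in fastforce)
  qed
  obtain C where C: "\<And>n::nat. compact (C n)" "\<And>n. C n \<subseteq> D" "\<Union>(range C) = D"
    by (rule open_Union_compact_subsets[OF D]) blast
  have "AE x in lborel. \<forall>n. x \<in> C n \<longrightarrow> E x = 0"
    unfolding AE_all_countable using *[OF C(1,2)] by blast
  then show ?thesis by (rule eventually_mono) (use C(3) in blast)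
qed

text \<open>The difference quotient is at most the mean of the gradient along the segment from
  \<open>y\<close> to \<open>y + h\<close>; Jensen's inequality on the unit interval and Fubini do
  the rest.\<close>

lemma difference_quotient_smooth:
  fixes f :: "'a::euclidean_space \<Rightarrow> real"
  assumes Q: "qf c Q" and f: "smooth f"
  shows "SI (cball x r) (\<lambda>y. Q (\<bar>f (y + h) - f y\<bar> / norm h)) \<le> ennreal c * SI (cball x (r + norm h)) (\<lambda>y. Q (norm (gr f y)))"
proof (cases "h = 0")
  case True
  have "SI (cball x r) (\<lambda>y. Q (\<bar>f (y + h) - f y\<bar> / norm h)) = 0"
    by (simp add: SI_def True qf_zero[OF Q])
  then show ?thesis by simp
next
  case False
  note [measurable] = qf_borel[OF Q] smooth_borel[OF f] gr_borel[OF f]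
  let ?I = "indicator {0..1} :: real \<Rightarrow> ennreal"
  let ?g = "\<lambda>y t. norm (gr f (y + t *\<^sub>R h))" and ?R = "SI (cball x (r + norm h)) (\<lambda>y. Q (norm (gr f y)))"
  have pt: "ennreal (Q (\<bar>f (y + h) - f y\<bar> / norm h)) \<le> ennreal c * (\<integral>\<^sup>+t. ?I t * ennreal (Q (?g y t)) \<partial>lborel)" for y
  proof (rule qf_jensen[OF Q])
    have d: "((\<lambda>t. f (y + t *\<^sub>R h)) has_vector_derivative (gr f (y + t *\<^sub>R h) \<bullet> h)) (at t within {0..1})" for t
    proof -
      have "((\<lambda>t. f (y + t *\<^sub>R h)) has_derivative (\<lambda>s. dd f (y + t *\<^sub>R h) (s *\<^sub>R h))) (at t within {0..1})"
        by (rule has_derivative_compose[OF _ smooth_has_derivative[OF f]]) (auto intro!: derivative_eq_intros)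
      moreover have "dd f (y + t *\<^sub>R h) (s *\<^sub>R h) = s *\<^sub>R (gr f (y + t *\<^sub>R h) \<bullet> h)" for s
        by (simp add: gr_inner[OF f] linear_scale[OF has_derivative_linear[OF smooth_has_derivative[OF f]]])
      ultimately show ?thesis by (simp add: has_vector_derivative_def)
    qed
    have cont: "continuous_on {0..1} (\<lambda>t. gr f (y + t *\<^sub>R h) \<bullet> h)"
      by (intro continuous_intros continuous_on_compose2[OF gr_continuous[OF f, of UNIV]]) auto
    note ftc = has_bochner_integral_FTC_Icc[of 0 1 "\<lambda>t. f (y + t *\<^sub>R h)", OF _ d cont, simplified]
    have "ennreal \<bar>f (y + h) - f y\<bar> \<le> (\<integral>\<^sup>+t. ennreal (norm (indicator {0..1} t * (gr f (y + t *\<^sub>R h) \<bullet> h))) \<partial>lborel)"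
      using has_bochner_integral_norm_bound[OF ftc] by (simp del: norm_mult)
    also have "\<dots> \<le> (\<integral>\<^sup>+t. ennreal (norm h) * (?I t * ennreal (?g y t)) \<partial>lborel)"
    proof (rule nn_integral_mono)
      fix t :: real
      have "ennreal (norm (gr f (y + t *\<^sub>R h) \<bullet> h)) \<le> ennreal (norm h) * ennreal (?g y t)"
        using Cauchy_Schwarz_ineq2[of "gr f (y + t *\<^sub>R h)" h]
        by (simp add: mult.commute flip: ennreal_mult)
      then show "ennreal (norm (indicator {0..1} t * (gr f (y + t *\<^sub>R h) \<bullet> h))) \<le> ennreal (norm h) * (?I t * ennreal (?g y t))"
        by (auto simp: indicator_def)
    qed
    also have "\<dots> = ennreal (norm h) * (\<integral>\<^sup>+t. ?I t * ennreal (?g y t) \<partial>lborel)"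
      by (simp add: nn_integral_cmult)
    finally have "ennreal (1 / norm h) * ennreal \<bar>f (y + h) - f y\<bar>
        \<le> ennreal (1 / norm h) * (ennreal (norm h) * (\<integral>\<^sup>+t. ?I t * ennreal (?g y t) \<partial>lborel))"
      by (rule mult_left_mono) simp
    moreover have "ennreal (1 / norm h) * ennreal \<bar>f (y + h) - f y\<bar> = ennreal (\<bar>f (y + h) - f y\<bar> / norm h)"
      by (simp flip: ennreal_mult)
    moreover have "ennreal (1 / norm h) * ennreal (norm h) = 1"
      using False by (simp flip: ennreal_mult)
    ultimately show "ennreal (\<bar>f (y + h) - f y\<bar> / norm h) \<le> (\<integral>\<^sup>+t. ?I t * ennreal (?g y t) \<partial>lborel)"
      by (simp add: mult.assoc[symmetric])
  qed auto
  define B where "B = cball x r"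
  have [measurable]: "B \<in> sets borel" by (simp add: B_def)
  have "SI B (\<lambda>y. Q (\<bar>f (y + h) - f y\<bar> / norm h))
     \<le> (\<integral>\<^sup>+y. (\<integral>\<^sup>+t. ennreal c * (?I t * ennreal (Q (?g y t))) * indicator B y \<partial>lborel) \<partial>lborel)"
    unfolding SI_def
    by (rule nn_integral_mono) (use pt in \<open>simp add: nn_integral_cmult nn_integral_multc mult_right_mono\<close>)
  also have "\<dots> = (\<integral>\<^sup>+t. (\<integral>\<^sup>+y. ennreal c * (?I t * ennreal (Q (?g y t))) * indicator B y \<partial>lborel) \<partial>lborel)"
    by (rule lborel_pair.Fubini') measurable
  also have "\<dots> = (\<integral>\<^sup>+t. ennreal c * (?I t * SI B (\<lambda>y. Q (?g y t))) \<partial>lborel)"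
    unfolding SI_def by (simp add: nn_integral_cmult mult.assoc)
  also have "\<dots> \<le> (\<integral>\<^sup>+t. ennreal c * (?I t * ?R) \<partial>lborel)"
  proof (rule nn_integral_mono, rule mult_left_mono)
    fix t :: real
    have "SI B (\<lambda>y. Q (?g y t)) \<le> ?R"
      if "t \<in> {0..1}"
    proof -
      have "SI B (\<lambda>y. Q (?g y t)) \<le> SI (cball x (r + norm (t *\<^sub>R h))) (\<lambda>y. Q (norm (gr f y)))"
        unfolding B_def by (rule SI_cball_shift_le) measurable
      also have "\<dots> \<le> ?R"
        by (intro SI_subset subset_cball add_left_mono) (use that in \<open>simp add: mult_left_le_one_le\<close>)
      finally show ?thesis .
    qed
    then show "?I t * SI B (\<lambda>y. Q (?g y t)) \<le> ?I t * ?R"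
      by (auto simp: indicator_def)
  qed simp
  also have "\<dots> = ennreal c * ?R"
    by (simp add: nn_integral_cmult nn_integral_multc)
  finally show ?thesis unfolding B_def .
qed

text \<open>Approximation by mollifications of radius below \<open>norm h\<close> costs a further
  \<open>norm h\<close> in the radius of the ball and a second factor \<open>c\<close>, from
  \<open>qf_conv\<close>. Fatou's lemma passes to the limit.\<close>

lemma difference_quotient:
  fixes U :: "'a::euclidean_space \<Rightarrow> real"
  assumes Q: "qf c Q" and w: "wgrad U F" and QF: "orlicz Q F"
  shows "SI (cball x r) (\<lambda>y. Q (\<bar>U (y + h) - U y\<bar> / norm h)) \<le> ennreal (c * c) * SI (cball x (r + 2 * norm h)) (\<lambda>y. Q (norm (F y)))"
    (is "?L \<le> ?R")
proof (cases "h = 0")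
  case True
  have "?L = 0"
    by (simp add: SI_def True qf_zero[OF Q])
  then show ?thesis by simp
next
  case False
  note [measurable] = qf_borel[OF Q] wgradD(3,4)[OF w]
  have c: "c \<ge> 1" by (rule qf_c[OF Q])
  obtain e where e: "\<And>j. 0 < e j" "\<And>j::nat. e j < norm h"
    "AE x in lborel. (\<lambda>j. conv (molk (e j)) U x) \<longlonglongrightarrow> U x"
    by (rule conv_L1_seq[OF wgradD(1)[OF w] wgradD(1)[OF w], of "norm h"]) (use False in auto)
  note [measurable] = molk_borel[OF e(1)]
  define u where "u j = conv (molk (e j)) U" for j
  have us: "smooth (u j)" for j unfolding u_def by (rule wgrad_conv(1)[OF w e(1)])
  note [measurable] = smooth_borel[OF us]
  have b: "SI (cball x r) (\<lambda>y. Q (\<bar>u j (y + h) - u j y\<bar> / norm h)) \<le> ?R" for j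
  proof -
    have "SI (cball x r) (\<lambda>y. Q (\<bar>u j (y + h) - u j y\<bar> / norm h))
       \<le> ennreal c * SI (cball x (r + norm h)) (\<lambda>y. Q (norm (gr (u j) y)))"
      by (rule difference_quotient_smooth[OF Q us])
    also have "SI (cball x (r + norm h)) (\<lambda>y. Q (norm (gr (u j) y)))
       \<le> SI (cball x (r + norm h)) (\<lambda>y. c * conv (molk (e j)) (\<lambda>x. Q (norm (F x))) y)"
      by (rule SI_mono) (use qf_conv[OF Q wgradD(2)[OF w] e(1) QF] in \<open>simp add: u_def wgrad_conv(2)[OF w e(1)]\<close>)
    also have "\<dots> = ennreal c * SI (cball x (r + norm h)) (conv (molk (e j)) (\<lambda>x. Q (norm (F x))))"
      using c by (intro SI_cmult) auto
    also have "\<dots> \<le> ennreal c * SI (cball x (r + 2 * norm h)) (\<lambda>y. Q (norm (F y)))"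
    proof (intro mult_left_mono SI_conv[OF QF _ e(1)])
      fix y z :: 'a assume "y \<in> cball x (r + norm h)" "norm z \<le> e j"
      then show "y - z \<in> cball x (r + 2 * norm h)"
        using norm_triangle_ineq[of "x - y" z] e(2)[of j] by (simp add: dist_norm algebra_simps)
    qed (auto simp: qf_nonneg[OF Q])
    finally show ?thesis using c
      by (simp add: ennreal_mult' mult.assoc mult_left_mono)
  qed
  have "?L \<le> (\<integral>\<^sup>+y. liminf (\<lambda>j. ennreal (Q (\<bar>u j (y + h) - u j y\<bar> / norm h)) * indicator (cball x r) y) \<partial>lborel)"
    unfolding SI_def
  proof (rule nn_integral_mono_AE)
    show "AE y in lborel. ennreal (Q (\<bar>U (y + h) - U y\<bar> / norm h)) * indicator (cball x r) y
       \<le> liminf (\<lambda>j. ennreal (Q (\<bar>u j (y + h) - u j y\<bar> / norm h)) * indicator (cball x r) y)"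
      using e(3) AE_shift[OF e(3), of h]
    proof eventually_elim
      case (elim y)
      have "(\<lambda>j. Q (\<bar>u j (y + h) - u j y\<bar> / norm h)) \<longlonglongrightarrow> Q (\<bar>U (y + h) - U y\<bar> / norm h)"
        by (rule continuous_on_tendsto_compose[OF qf_cont[OF Q, of UNIV]])
          (use elim False in \<open>auto simp: u_def intro!: tendsto_intros\<close>)
      then have "(\<lambda>j. ennreal (Q (\<bar>u j (y + h) - u j y\<bar> / norm h)) * indicator (cball x r) y)
        \<longlonglongrightarrow> ennreal (Q (\<bar>U (y + h) - U y\<bar> / norm h)) * indicator (cball x r) y"
        by (cases "y \<in> cball x r") auto
      then show ?case by (simp add: lim_imp_Liminf)
    qed
  qed
  also have "\<dots> \<le> liminf (\<lambda>j. SI (cball x r) (\<lambda>y. Q (\<bar>u j (y + h) - u j y\<bar> / norm h)))"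
    unfolding SI_def by (rule nn_integral_liminf) measurable
  also have "\<dots> \<le> ?R" using Liminf_mono[of _ "\<lambda>_. ?R" sequentially] b
    by (subst (2) Liminf_const[symmetric, of sequentially]) (auto intro!: Liminf_mono always_eventually)
  finally show ?thesis .
qed

section \<open>Averages over balls\<close>

definition vol :: "'a::euclidean_space itself \<Rightarrow> real \<Rightarrow> real" where
  "vol _ r = unit_ball_vol (real DIM('a)) * r ^ DIM('a)"

lemma emeasure_cball_vol:
  "r \<ge> 0 \<Longrightarrow> emeasure lborel (cball (x::'a::euclidean_space) r) = ennreal (vol TYPE('a) r)"
  by (simp add: emeasure_cball vol_def)

lemma unit_ball_vol_dim: "unit_ball_vol (real DIM('a::euclidean_space)) > 0"
  by (rule unit_ball_vol_pos) simp

lemma vol_pos: "r > 0 \<Longrightarrow> vol TYPE('a::euclidean_space) r > 0"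
  using unit_ball_vol_dim[where 'a='a] by (simp add: vol_def)

lemma vol_nonneg: "r \<ge> 0 \<Longrightarrow> vol TYPE('a::euclidean_space) r \<ge> 0"
  using unit_ball_vol_dim[where 'a='a] by (simp add: vol_def)

lemma vol_mult: "vol TYPE('a::euclidean_space) (c * r) = c ^ DIM('a) * vol TYPE('a) r"
  by (simp add: vol_def power_mult_distrib)

lemma vol_strict_mono: "0 \<le> r \<Longrightarrow> r < s \<Longrightarrow> vol TYPE('a::euclidean_space) r < vol TYPE('a) s"
  using unit_ball_vol_dim[where 'a='a] by (simp add: vol_def power_strict_mono)

lemma vol_mono: "0 \<le> r \<Longrightarrow> r \<le> s \<Longrightarrow> vol TYPE('a::euclidean_space) r \<le> vol TYPE('a) s"
  using unit_ball_vol_dim[where 'a='a] by (simp add: vol_def power_mono)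

text \<open>This half of Lebesgue's differentiation theorem starts the stopping argument. Normalised
  indicators of small balls are kernels, so averages over balls converge to \<open>f\<close> in the
  mean, and almost everywhere along a sequence of radii.\<close>

lemma averages_AE:
  fixes f :: "'a::euclidean_space \<Rightarrow> real"
  assumes f: "integrable lborel f" "\<And>x. f x \<ge> 0"
  shows "AE x in lborel. f x > t \<longrightarrow> (\<exists>r>0. SI (cball x r) f \<ge> ennreal (t * vol TYPE('a) r))"
proof -
  note [measurable] = integrable_borel[OF f(1)]
  let ?k = "\<lambda>r (z::'a). indicat_real (cball 0 r) z / vol TYPE('a) r"
  have k: "kernel d (?k r)" if "0 < r" "r < d" for r d
    unfolding kernel_def
  proof (intro conjI allI impI)
    show "0 \<le> ?k r z" for z using vol_pos[OF that(1), where 'a='a] by simp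
    show "\<exists>B. \<forall>z. ?k r z \<le> B"
      using vol_pos[OF that(1), where 'a='a] by (intro exI[of _ "1 / vol TYPE('a) r"]) (auto simp: indicator_def divide_right_mono)
    have "(\<integral>\<^sup>+z. ennreal (?k r z) \<partial>lborel) = (\<integral>\<^sup>+z. ennreal (1 / vol TYPE('a) r) * indicator (cball 0 r) z \<partial>(lborel::'a measure))"
      by (intro nn_integral_cong) (auto simp: indicator_def)
    also have "\<dots> = 1" using vol_pos[OF that(1), where 'a='a] that
      by (simp add: nn_integral_cmult emeasure_cball_vol flip: ennreal_mult)
    finally show "(\<integral>\<^sup>+z. ennreal (?k r z) \<partial>lborel) = 1" .
    show "?k r z = 0" if "norm z \<ge> d" for z using that \<open>r < d\<close> by simp
  qed measurable
  have "\<exists>r>0. (\<integral>\<^sup>+x. ennreal (norm (conv (?k r) f x - f x)) \<partial>lborel) \<le> ennreal (1 / real (Suc j))" for j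
  proof -
    have "1 / real (Suc j) > 0" by simp
    from kernel_L1[OF f(1) this] obtain d where d: "d > 0"
      "\<And>k. kernel d k \<Longrightarrow> (\<integral>\<^sup>+x. ennreal (norm (conv k f x - f x)) \<partial>lborel) \<le> ennreal (1 / real (Suc j))" by blast
    show ?thesis using d(2)[OF k[of "d/2" d]] d(1) by (intro exI[of _ "d/2"]) auto
  qed
  then obtain r where r: "\<And>j. r j > 0" "\<And>j. (\<integral>\<^sup>+x. ennreal (norm (conv (?k (r j)) f x - f x)) \<partial>lborel) \<le> ennreal (1 / real (Suc j))"
    by metis
  define g where "g j = conv (?k (r j)) f" for j
  have [measurable]: "g j \<in> borel_measurable borel" for j unfolding g_def by measurable
  have gi: "integrable lborel (\<lambda>x. g j x - f x)" for j
    using r(2)[of j] by (simp add: integrable_iff_bounded g_def le_less_trans)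
  have lim0: "(\<lambda>j. 1 / real (Suc j)) \<longlonglongrightarrow> 0" by (rule LIMSEQ_Suc[OF lim_1_over_n])
  have "(\<lambda>j. \<integral>x. norm (g j x - f x) \<partial>lborel) \<longlonglongrightarrow> 0"
  proof (rule tendsto_sandwich[OF _ _ tendsto_const lim0])
    have "(\<integral>x. norm (g j x - f x) \<partial>lborel) \<le> 1 / real (Suc j)" for j
      using r(2)[of j] gi[of j] unfolding g_def by (simp add: nn_integral_eq_integral)
    then show "\<forall>\<^sub>F j in sequentially. (\<integral>x. norm (g j x - f x) \<partial>lborel) \<le> 1 / real (Suc j)" by simp
  qed simp
  from tendsto_L1_AE_subseq[OF gi this] obtain s where
    "AE x in lborel. (\<lambda>j. g (s j) x - f x) \<longlonglongrightarrow> 0" by blast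
  then show ?thesis
  proof (rule eventually_mono, intro impI)
    fix x assume l: "(\<lambda>j. g (s j) x - f x) \<longlonglongrightarrow> 0" and fx: "f x > t"
    have "(\<lambda>j. g (s j) x) \<longlonglongrightarrow> f x" using l by (simp add: LIM_zero_iff)
    from order_tendstoD(1)[OF this fx] obtain j where j: "g (s j) x > t" by (auto simp: eventually_sequentially)
    let ?r = "r (s j)"
    note vp = vol_pos[OF r(1)[of "s j"], where 'a='a]
    have i: "integrable lborel (\<lambda>y. indicat_real (cball x ?r) y * f y)"
      using integrable_mult_indicator[OF _ f(1), of "cball x ?r"] by simp
    have "g (s j) x = (\<integral>y. indicat_real (cball x ?r) y * f y / vol TYPE('a) ?r \<partial>lborel)"
      unfolding g_def conv_def by (intro integral_cong) (auto simp: indicator_def dist_norm norm_minus_commute)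
    then have "g (s j) x * vol TYPE('a) ?r = (\<integral>y. indicat_real (cball x ?r) y * f y \<partial>lborel)"
      using vp by (simp add: field_simps)
    moreover have "t * vol TYPE('a) ?r \<le> g (s j) x * vol TYPE('a) ?r"
      using j vp by (intro mult_right_mono) auto
    ultimately have "t * vol TYPE('a) ?r \<le> (\<integral>y. indicat_real (cball x ?r) y * f y \<partial>lborel)" by simp
    also have "ennreal \<dots> = SI (cball x ?r) f"
      unfolding SI_def using i f by (subst nn_integral_eq_integral[symmetric]) (auto intro!: nn_integral_cong simp: indicator_def)
    finally show "\<exists>r>0. SI (cball x r) f \<ge> ennreal (t * vol TYPE('a) r)"
      using r(1) by (auto intro: ennreal_leI)
  qed
qed

section \<open>Calderon-Zygmund stopping radii and Vitali covering\<close>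

definition stopping :: "('a::euclidean_space \<Rightarrow> real) \<Rightarrow> real \<Rightarrow> 'a \<Rightarrow> real \<Rightarrow> bool" where
  "stopping f \<sigma> x r \<longleftrightarrow> 0 < r \<and> SI (cball x r) f \<ge> ennreal (\<sigma> * vol TYPE('a) r) \<and>
     (\<forall>t>r. SI (cball x t) f \<le> ennreal (\<sigma> * vol TYPE('a) t))"

text \<open>The stopping radius is the supremum of the radii with large mean. The total mass bounds
  it by \<rho>, and it is attained because the volume is continuous and the integral over balls
  increases with the radius.\<close>

lemma stopping_exists:
  fixes f :: "'a::euclidean_space \<Rightarrow> real"
  assumes \<sigma>: "\<sigma> > 0" and \<rho>: "\<rho> \<ge> 0" "SI UNIV f \<le> ennreal (\<sigma> * vol TYPE('a) \<rho>)"
    and r0: "r0 > 0" "SI (cball x r0) f \<ge> ennreal (\<sigma> * vol TYPE('a) r0)"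
  shows "\<exists>r\<le>\<rho>. stopping f \<sigma> x r"
proof -
  let ?v = "vol TYPE('a)"
  define S where "S = {r. 0 < r \<and> SI (cball x r) f \<ge> ennreal (\<sigma> * ?v r)}"
  have S: "r0 \<in> S" using r0 by (simp add: S_def)
  have ub: "r \<le> \<rho>" if "r \<in> S" for r
  proof (rule ccontr)
    assume n: "\<not> r \<le> \<rho>"
    have "ennreal (\<sigma> * ?v r) \<le> SI (cball x r) f" using that by (simp add: S_def)
    also have "\<dots> \<le> SI UNIV f" by (rule SI_subset) simp
    also have "\<dots> \<le> ennreal (\<sigma> * ?v \<rho>)" by (rule \<rho>)
    finally have "\<sigma> * ?v r \<le> \<sigma> * ?v \<rho>" using \<sigma> vol_nonneg[OF \<rho>(1), where 'a='a] by (subst (asm) ennreal_le_iff) auto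
    then show False using \<sigma> vol_strict_mono[OF \<rho>(1), of r, where 'a='a] n by simp
  qed
  have bdd: "bdd_above S" using ub by (auto simp: bdd_above_def)
  define R where "R = Sup S"
  have R: "r0 \<le> R" unfolding R_def by (rule cSup_upper[OF S bdd])
  have R\<rho>: "R \<le> \<rho>" unfolding R_def by (rule cSup_least) (use S ub in auto)
  have "SI (cball x R) f \<ge> ennreal (\<sigma> * ?v R)"
  proof -
    have "\<exists>s. s \<in> S \<and> R - 1 / real (Suc j) < s" for j
      using less_cSup_iff[OF _ bdd, of "R - 1 / real (Suc j)"] S unfolding R_def by auto
    then obtain s where s: "\<And>j. s j \<in> S" "\<And>j. R - 1 / real (Suc j) < s j" by metis
    have sR: "s j \<le> R" for j unfolding R_def by (rule cSup_upper[OF s(1) bdd])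
    have "(\<lambda>j. R - 1 / real (Suc j)) \<longlonglongrightarrow> R - 0" by (intro tendsto_intros LIMSEQ_Suc[OF lim_1_over_n])
    then have l: "(\<lambda>j. R - 1 / real (Suc j)) \<longlonglongrightarrow> R" by simp
    have "s \<longlonglongrightarrow> R"
      by (rule tendsto_sandwich[OF _ _ l tendsto_const])
        (use sR in \<open>auto intro!: always_eventually less_imp_le[OF s(2)] simp del: of_nat_Suc\<close>)
    then have "(\<lambda>j. ennreal (\<sigma> * ?v (s j))) \<longlonglongrightarrow> ennreal (\<sigma> * ?v R)"
      unfolding vol_def by (intro tendsto_intros tendsto_ennrealI)
    moreover have "ennreal (\<sigma> * ?v (s j)) \<le> SI (cball x R) f" for j
    proof -
      have "ennreal (\<sigma> * ?v (s j)) \<le> SI (cball x (s j)) f" using s(1)[of j] by (simp add: S_def)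
      also have "\<dots> \<le> SI (cball x R) f" by (intro SI_subset subset_cball sR)
      finally show ?thesis .
    qed
    ultimately show ?thesis by (intro LIMSEQ_le_const2) auto
  qed
  moreover have "SI (cball x t) f \<le> ennreal (\<sigma> * ?v t)" if "t > R" for t
  proof (rule ccontr)
    assume "\<not> ?thesis"
    then have "t \<in> S" using that R r0 by (simp add: S_def)
    then have "t \<le> R" unfolding R_def by (rule cSup_upper[OF _ bdd])
    then show False using that by simp
  qed
  ultimately show ?thesis using R r0 R\<rho> unfolding stopping_def by (intro exI[of _ R]) auto
qed

text \<open>Vitali's lemma selects disjoint balls of radius \<open>m * r i\<close> whose fivefold
  enlargements cover \<open>E\<close> up to a null set; local estimates from the large to the small
  balls then add up. The factor \<open>m\<close> leaves room for estimates that look beyond the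
  stopping ball.\<close>

lemma stopping_covering:
  fixes f k :: "'a::euclidean_space \<Rightarrow> real"
  assumes f: "integrable lborel f" "\<And>x. f x \<ge> 0" and k[measurable]: "k \<in> borel_measurable borel"
    and [measurable]: "E \<in> sets borel" "D' \<in> sets borel"
    and t: "t > 0" and \<rho>: "\<rho> \<ge> 0" "SI UNIV f \<le> ennreal (t * vol TYPE('a) \<rho>)" and m: "m > 0"
    and E: "\<And>x. x \<in> E \<Longrightarrow> f x > t"
    and D': "\<And>x. x \<in> E \<Longrightarrow> cball x (m * \<rho>) \<subseteq> D'"
    and local: "\<And>x r. x \<in> E \<Longrightarrow> r \<le> \<rho> \<Longrightarrow> stopping f t x r \<Longrightarrow>
       SI (E \<inter> cball x (5 * m * r)) f \<le> SI (cball x (m * r)) k"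
  shows "SI E f \<le> SI D' k"
proof -
  note [measurable] = integrable_borel[OF f(1)]
  define G where "G = {x\<in>E. \<exists>r\<le>\<rho>. stopping f t x r}"
  have ae: "AE x in lborel. x \<in> E \<longrightarrow> x \<in> G"
    using averages_AE[OF f, of t]
    by eventually_elim (use stopping_exists[OF t \<rho>] E in \<open>auto simp: G_def\<close>)
  have "\<forall>x. \<exists>r. x \<in> G \<longrightarrow> r \<le> \<rho> \<and> stopping f t x r" by (auto simp: G_def)
  then obtain r where r: "\<And>x. x \<in> G \<Longrightarrow> r x \<le> \<rho>" "\<And>x. x \<in> G \<Longrightarrow> stopping f t x (r x)" by metis
  have r0: "x \<in> G \<Longrightarrow> r x > 0" for x using r(2) by (auto simp: stopping_def)
  have GE: "x \<in> G \<Longrightarrow> x \<in> E" for x by (simp add: G_def)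
  have cov: "G \<subseteq> (\<Union>x\<in>G. cball x (m * r x))"
  proof
    fix x assume "x \<in> G"
    moreover have "x \<in> cball x (m * r x)" using r0[OF \<open>x \<in> G\<close>] m by simp
    ultimately show "x \<in> (\<Union>x\<in>G. cball x (m * r x))" by blast
  qed
  obtain C where C: "countable C" "C \<subseteq> G"
     "pairwise (\<lambda>i j. disjnt (cball i (m * r i)) (cball j (m * r j))) C"
     "G \<subseteq> (\<Union>i\<in>C. cball i (5 * (m * r i)))"
    by (rule Vitali_covering_lemma_cballs[OF cov, of "m * \<rho>"]) (use r r0 m in auto)
  \<comment> \<open>Sums over the countable set of centres are written as integrals over
    \<open>count_space C\<close>, so that they can be exchanged with the integral over
    \<open>x\<close>.\<close>
  have "SI E f \<le> (\<integral>\<^sup>+x. (\<integral>\<^sup>+i. ennreal (f x) * indicator (E \<inter> cball i (5 * m * r i)) x \<partial>count_space C) \<partial>lborel)"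
    unfolding SI_def
  proof (rule nn_integral_mono_AE, rule eventually_mono[OF ae])
    fix x assume x: "x \<in> E \<longrightarrow> x \<in> G"
    show "ennreal (f x) * indicator E x \<le> (\<integral>\<^sup>+i. ennreal (f x) * indicator (E \<inter> cball i (5 * m * r i)) x \<partial>count_space C)"
    proof (cases "x \<in> E")
      case True
      then obtain i where i: "i \<in> C" "x \<in> cball i (5 * (m * r i))" using x C(4) by blast
      have "ennreal (f x) * indicator E x = (\<integral>\<^sup>+j. ennreal (f x) * indicator {i} j \<partial>count_space C)"
        using i True by (simp add: nn_integral_cmult)
      also have "\<dots> \<le> (\<integral>\<^sup>+i. ennreal (f x) * indicator (E \<inter> cball i (5 * m * r i)) x \<partial>count_space C)"
        by (rule nn_integral_mono) (use i True in \<open>auto simp: indicator_def mult.assoc\<close>)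
      finally show ?thesis .
    qed simp
  qed
  also have "\<dots> = (\<integral>\<^sup>+i. SI (E \<inter> cball i (5 * m * r i)) f \<partial>count_space C)"
    unfolding SI_def by (rule nn_integral_count_space_nn_integral[OF C(1)]) measurable
  also have "\<dots> \<le> (\<integral>\<^sup>+i. SI (cball i (m * r i)) k \<partial>count_space C)"
    by (rule nn_integral_mono) (use local C(2) GE r in auto)
  also have "\<dots> = (\<integral>\<^sup>+i. emeasure (density lborel (\<lambda>x. ennreal (k x))) (cball i (m * r i)) \<partial>count_space C)"
    unfolding SI_def by (intro nn_integral_cong) (simp add: emeasure_density)
  \<comment> \<open>Disjointness enters as countable additivity of the measure with density
    \<open>k\<close>.\<close>
  also have "\<dots> = emeasure (density lborel (\<lambda>x. ennreal (k x))) (\<Union>i\<in>C. cball i (m * r i))"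
    by (rule emeasure_UN_countable[symmetric, OF _ C(1)])
      (use C(3) in \<open>auto simp: disjoint_family_on_def pairwise_def disjnt_def\<close>)
  also have "\<dots> \<le> emeasure (density lborel (\<lambda>x. ennreal (k x))) D'"
  proof (rule emeasure_mono)
    show "(\<Union>i\<in>C. cball i (m * r i)) \<subseteq> D'"
    proof (rule UN_least)
      fix i assume i: "i \<in> C"
      have "cball i (m * r i) \<subseteq> cball i (m * \<rho>)" by (intro subset_cball mult_left_mono) (use i C(2) r m in auto)
      also have "\<dots> \<subseteq> D'" using i C(2) GE by (intro D') auto
      finally show "cball i (m * r i) \<subseteq> D'" .
    qed
  qed simp
  also have "\<dots> = SI D' k" unfolding SI_def by (simp add: emeasure_density)
  finally show ?thesis .
qed

lemma ennreal_combo: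
  "0 \<le> a \<Longrightarrow> 0 \<le> b \<Longrightarrow> 0 \<le> c \<Longrightarrow> 0 \<le> d \<Longrightarrow> ennreal a * ennreal b + ennreal c * (ennreal d)\<^sup>2 = ennreal (a * b + c * d\<^sup>2)"
  by (simp add: ennreal_power flip: ennreal_mult ennreal_plus)

lemma SI_real:
  assumes "integrable lborel f" "\<And>x. f x \<ge> 0"
  obtains s where "s \<ge> 0" "SI A f = ennreal s"
proof -
  have "SI A f \<le> SI UNIV f" by (rule SI_subset) simp
  also have "\<dots> < \<infinity>" using assms by (simp add: SI_integrable)
  finally show thesis using that by (cases "SI A f") auto
qed

lemma integrable_sqrt_ball:
  fixes f :: "'a::euclidean_space \<Rightarrow> real"
  assumes f: "integrable lborel f" "\<And>x. f x \<ge> 0"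
  shows "integrable lborel (\<lambda>x. indicat_real (cball x0 R) x * sqrt (f x))"
proof -
  note [measurable] = integrable_borel[OF f(1)]
  have b: "sqrt t \<le> 1 + t" if "t \<ge> 0" for t
    by (rule real_le_lsqrt) (use that in \<open>auto simp: power2_eq_square algebra_simps\<close>)
  have "integrable lborel (indicat_real (cball x0 R))"
    using emeasure_lborel_cball_finite[of x0 R] by (intro integrable_real_indicator) auto
  then have i: "integrable lborel (\<lambda>x. indicat_real (cball x0 R) x + f x)" using f by auto
  show ?thesis
    by (rule integrable_bound[OF i])
      (use b[OF f(2)] f(2) in \<open>auto intro!: AE_I2 simp: indicator_def\<close>)
qed

section \<open>Reverse Hoelder inequalities\<close>

text \<open>
  The first term stems from comparison with averages over much smaller balls, the square root in the
  second from the bound on difference quotients, which holds for \<open>sqrt (P t)\<close> as well.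
\<close>

definition rev_holder :: "'a::euclidean_space set \<Rightarrow> ('a \<Rightarrow> real) \<Rightarrow> bool" where
  "rev_holder D f \<longleftrightarrow> (\<forall>\<epsilon>>0. \<exists>C>0. \<forall>x0 R. R > 0 \<longrightarrow> cball x0 (16 * R) \<subseteq> D \<longrightarrow>
     SI (cball x0 R) f \<le> ennreal \<epsilon> * SI (cball x0 (16 * R)) f
       + ennreal (C / R ^ DIM('a)) * (SI (cball x0 (16 * R)) (\<lambda>x. sqrt (f x)))\<^sup>2)"

text \<open>At a stopping ball the mean of \<open>f\<close> over the 16 times larger ball is at most
  \<sigma>, so the first term of \<open>rev_holder\<close> is absorbed and the mean of
  \<open>sqrt (f x)\<close> is at least a multiple of \<open>sqrt \<sigma>\<close>. Points with
  \<open>f x \<le> c * \<sigma>\<close> supply at most half of that, so the remaining points control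
  the mass of \<open>f\<close>; a Vitali covering adds up the local bounds.\<close>

lemma level_estimate:
  fixes f :: "'a::euclidean_space \<Rightarrow> real"
  assumes f: "integrable lborel f" "\<And>x. f x \<ge> 0" and rh: "rev_holder D f"
  shows "\<exists>C>0. \<exists>c>0. \<forall>x0 R \<sigma>. R > 0 \<longrightarrow> \<sigma> > 0 \<longrightarrow> cball x0 (2 * R) \<subseteq> D \<longrightarrow>
     SI (cball x0 (2 * R)) f \<le> ennreal (\<sigma> * vol TYPE('a) (R / 16)) \<longrightarrow>
     SI (cball x0 R \<inter> {x. f x > \<sigma>}) f
       \<le> SI (cball x0 (2 * R)) (\<lambda>x. C * sqrt \<sigma> * (sqrt (f x) * indicat_real {x. f x > c * \<sigma>} x))"
proof -
  let ?n = "DIM('a)" and ?v = "vol TYPE('a)"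
  define \<omega> where "\<omega> = unit_ball_vol (real ?n)"
  have \<omega>: "\<omega> > 0" unfolding \<omega>_def by (rule unit_ball_vol_dim)
  have v: "?v r = \<omega> * r ^ ?n" for r by (simp add: vol_def \<omega>_def)
  note [measurable] = integrable_borel[OF f(1)]
  \<comment> \<open>With this value the ratio 16^n of the volumes cancels and half of
    \<open>\<sigma> * ?v r\<close> is absorbed.\<close>
  have "1 / (2 * 16 ^ ?n) > (0::real)" by simp
  then obtain C where C: "C > 0" and RH: "\<And>x0 R. R > 0 \<Longrightarrow> cball x0 (16 * R) \<subseteq> D \<Longrightarrow>
     SI (cball x0 R) f \<le> ennreal (1 / (2 * 16 ^ ?n)) * SI (cball x0 (16 * R)) f
       + ennreal (C / R ^ ?n) * (SI (cball x0 (16 * R)) (\<lambda>x. sqrt (f x)))\<^sup>2"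
    using rh unfolding rev_holder_def by blast
  \<comment> \<open>\<open>sqrt \<sigma> * b * r ^ ?n\<close> will be the lower bound for the
    integral of \<open>sqrt (f x)\<close> over the ball of radius \<open>16 * r\<close>.\<close>
  define b where "b = sqrt (\<omega> / (2 * C))"
  have b: "b > 0" using \<omega> C by (simp add: b_def)
  \<comment> \<open>Chosen so that \<open>sqrt (c * \<sigma>) * ?v (16 * r)\<close> is half of that
    lower bound.\<close>
  define c where "c = (b / (2 * 16 ^ ?n * \<omega>))\<^sup>2"
  have c: "c > 0" using b \<omega> by (simp add: c_def)
  have sc: "sqrt c = b / (2 * 16 ^ ?n * \<omega>)" using b \<omega> by (simp add: c_def)
  \<comment> \<open>Chosen so that \<open>C' * sqrt \<sigma>\<close> times the remaining half is
    \<open>\<sigma> * ?v (80 * r)\<close>, the bound for the mass on the fivefold ball.\<close>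
  define C' where "C' = 2 * 80 ^ ?n * \<omega> / b"
  have C': "C' > 0" using b \<omega> by (simp add: C'_def)
  have "SI (cball x0 R \<inter> {x. f x > \<sigma>}) f
       \<le> SI (cball x0 (2 * R)) (\<lambda>x. C' * sqrt \<sigma> * (sqrt (f x) * indicat_real {x. f x > c * \<sigma>} x))"
    if R: "R > 0" and \<sigma>: "\<sigma> > 0" and D: "cball x0 (2 * R) \<subseteq> D"
      and I: "SI (cball x0 (2 * R)) f \<le> ennreal (\<sigma> * ?v (R / 16))" for x0 R \<sigma>
  proof -
    \<comment> \<open>For the truncated function the hypothesis on the mass confines stopping radii
      to \<open>R / 16\<close>, so the balls of radius \<open>16 * r\<close> stay inside
      \<open>cball x0 (2 * R)\<close>. On those of radius \<open>80 * r\<close>, which may leave it,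
      only \<open>f'\<close> is estimated.\<close>
    define f' where "f' x = indicat_real (cball x0 (2 * R)) x * f x" for x
    have f': "integrable lborel f'" "\<And>x. f' x \<ge> 0"
      using integrable_mult_indicator[OF _ f(1), of "cball x0 (2 * R)"] f(2) by (auto simp: f'_def[abs_def])
    have f'_eq: "SI A f' = SI A f" if "A \<subseteq> cball x0 (2 * R)" for A
      by (rule SI_cong) (use that in \<open>auto simp: f'_def\<close>)
    have f'_UNIV: "SI UNIV f' = SI (cball x0 (2 * R)) f"
      unfolding SI_def by (rule nn_integral_cong) (auto simp: f'_def indicator_def)
    let ?E = "cball x0 R \<inter> {x. f x > \<sigma>}"
    let ?k = "\<lambda>x. C' * sqrt \<sigma> * (sqrt (f x) * indicat_real {x. f x > c * \<sigma>} x)"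
    have incl: "cball x t \<subseteq> cball x0 (2 * R)" if "x \<in> cball x0 R" "t \<le> R" for x t
      using that by (simp add: cball_subset_cball_iff dist_commute)
    have "SI ?E f' \<le> SI (cball x0 (2 * R)) ?k"
    proof (rule stopping_covering[OF f', where t=\<sigma> and \<rho>="R/16" and m=16])
      show "?k \<in> borel_measurable borel" "?E \<in> sets borel" by measurable
      show "SI UNIV f' \<le> ennreal (\<sigma> * ?v (R / 16))" unfolding f'_UNIV by (rule I)
      show "f' x > \<sigma>" if "x \<in> ?E" for x using that R by (auto simp: f'_def indicator_def)
      show "cball x (16 * (R / 16)) \<subseteq> cball x0 (2 * R)" if "x \<in> ?E" for x using incl[of x R] that by simp
      fix x r assume x: "x \<in> ?E" and r: "r \<le> R / 16" and st: "stopping f' \<sigma> x r"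
      have r0: "r > 0" using st by (simp add: stopping_def)
      have sub: "cball x t \<subseteq> cball x0 (2 * R)" if "t \<le> 16 * r" for t
        using incl[of x t] x r that by auto
      let ?g = "\<lambda>x. sqrt (f x)"
      obtain a where a: "a \<ge> 0" "SI (cball x (16 * r)) ?g = ennreal a"
      proof (rule SI_real[OF integrable_sqrt_ball[OF f, of x "16 * r"]])
        show "indicat_real (cball x (16 * r)) y * sqrt (f y) \<ge> 0" for y using f(2) by simp
        fix s assume "s \<ge> 0" "SI (cball x (16 * r)) (\<lambda>y. indicat_real (cball x (16 * r)) y * sqrt (f y)) = ennreal s"
        moreover have "SI (cball x (16 * r)) (\<lambda>y. indicat_real (cball x (16 * r)) y * sqrt (f y)) = SI (cball x (16 * r)) ?g"
          by (rule SI_cong) simp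
        ultimately show thesis using that by simp
      qed
      have "ennreal (\<sigma> * ?v r) \<le> SI (cball x r) f"
        using st sub[of r] r0 f'_eq[of "cball x r"] by (simp add: stopping_def)
      also have "\<dots> \<le> ennreal (1 / (2 * 16 ^ ?n)) * SI (cball x (16 * r)) f + ennreal (C / r ^ ?n) * (ennreal a)\<^sup>2"
        unfolding a(2)[symmetric] by (rule RH[OF r0]) (use sub[of "16 * r"] D in auto)
      also have "SI (cball x (16 * r)) f \<le> ennreal (\<sigma> * ?v (16 * r))"
        using st sub[of "16 * r"] r0 f'_eq[of "cball x (16 * r)"]
        by (auto simp: stopping_def dest!: spec[of _ "16 * r"])
      finally have "ennreal (\<sigma> * ?v r) \<le> ennreal (1 / (2 * 16 ^ ?n)) * ennreal (\<sigma> * ?v (16 * r)) + ennreal (C / r ^ ?n) * (ennreal a)\<^sup>2"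
        by (simp add: mult_left_mono add_right_mono)
      also have "\<dots> = ennreal (1 / (2 * 16 ^ ?n) * (\<sigma> * ?v (16 * r)) + C / r ^ ?n * a\<^sup>2)"
        using \<sigma> C r0 a(1) vol_nonneg[of "16 * r", where 'a='a] by (intro ennreal_combo) auto
      finally have "\<sigma> * ?v r \<le> 1 / (2 * 16 ^ ?n) * (\<sigma> * ?v (16 * r)) + C / r ^ ?n * a\<^sup>2"
        using \<sigma> C r0 vol_nonneg[of "16 * r", where 'a='a] by (subst (asm) ennreal_le_iff) auto
      moreover have "1 / (2 * 16 ^ ?n) * (\<sigma> * ?v (16 * r)) = \<sigma> * ?v r / 2" by (simp add: vol_mult)
      ultimately have "\<sigma> * ?v r / 2 \<le> C / r ^ ?n * a\<^sup>2" by linarith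
      then have "\<sigma> * \<omega> / (2 * C) * (r ^ ?n)\<^sup>2 \<le> a\<^sup>2"
        using C r0 by (simp add: v field_simps power2_eq_square)
      also have "\<sigma> * \<omega> / (2 * C) * (r ^ ?n)\<^sup>2 = (sqrt \<sigma> * b * r ^ ?n)\<^sup>2"
        using \<sigma> \<omega> C by (simp add: b_def power_mult_distrib)
      finally have ab: "sqrt \<sigma> * b * r ^ ?n \<le> a"
        using a(1) by (rule power2_le_imp_le)
      let ?h = "\<lambda>x. sqrt (f x) * indicat_real {x. f x > c * \<sigma>} x"
      have "ennreal a \<le> SI (cball x (16 * r)) (\<lambda>y. ?h y + sqrt (c * \<sigma>))"
        unfolding a(2)[symmetric]
        by (rule SI_mono) (use c \<sigma> in \<open>auto simp: indicator_def intro!: real_sqrt_le_mono\<close>)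
      also have "\<dots> = SI (cball x (16 * r)) ?h + SI (cball x (16 * r)) (\<lambda>y. sqrt (c * \<sigma>))"
        using c \<sigma> f(2) by (intro SI_add) auto
      also have "SI (cball x (16 * r)) (\<lambda>y. sqrt (c * \<sigma>)) = ennreal (sqrt (c * \<sigma>) * ?v (16 * r))"
        using r0 c \<sigma> by (simp add: SI_const emeasure_cball_vol ennreal_mult')
      also have "sqrt (c * \<sigma>) * ?v (16 * r) = sqrt \<sigma> * b * r ^ ?n / 2"
        using \<omega> by (simp add: real_sqrt_mult sc v power_mult_distrib)
      finally have 1: "ennreal a \<le> SI (cball x (16 * r)) ?h + ennreal (sqrt \<sigma> * b * r ^ ?n / 2)" .
      have "ennreal (sqrt \<sigma> * b * r ^ ?n / 2) + ennreal (sqrt \<sigma> * b * r ^ ?n / 2) = ennreal (sqrt \<sigma> * b * r ^ ?n)"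
        using \<sigma> b r0 by (simp flip: ennreal_plus)
      also have "\<dots> \<le> ennreal a" by (rule ennreal_leI[OF ab])
      also note 1
      finally have h: "ennreal (sqrt \<sigma> * b * r ^ ?n / 2) \<le> SI (cball x (16 * r)) ?h"
        by (simp only: add.commute[of "SI _ _"] ennreal_add_left_cancel_le) simp
      have "SI (?E \<inter> cball x (5 * 16 * r)) f' \<le> SI (cball x (80 * r)) f'" by (rule SI_subset) auto
      also have "\<dots> \<le> ennreal (\<sigma> * ?v (80 * r))" using st r0 by (simp add: stopping_def)
      also have "\<sigma> * ?v (80 * r) = C' * sqrt \<sigma> * (sqrt \<sigma> * b * r ^ ?n / 2)"
        using b \<sigma> by (simp add: C'_def v power_mult_distrib)
      also have "ennreal \<dots> = ennreal (C' * sqrt \<sigma>) * ennreal (sqrt \<sigma> * b * r ^ ?n / 2)"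
        using C' \<sigma> by (intro ennreal_mult') simp
      also have "\<dots> \<le> ennreal (C' * sqrt \<sigma>) * SI (cball x (16 * r)) ?h" by (intro mult_left_mono h) simp
      also have "\<dots> = SI (cball x (16 * r)) ?k" using C' \<sigma> by (intro SI_cmult[symmetric]) auto
      finally show "SI (?E \<inter> cball x (5 * 16 * r)) f' \<le> SI (cball x (16 * r)) ?k" .
    qed (use R \<sigma> in auto)
    also have "SI ?E f' = SI ?E f" by (rule f'_eq) (use R in auto)
    finally show ?thesis .
  qed
  then show ?thesis using C' c by blast
qed

text \<open>The terms form a geometric progression that stops below \<open>b\<close>. The bound
  \<open>2 ^ J * a\<close> is carried along in the induction because a new term is compared with
  it.\<close>

lemma dyadic_sum_bound:
  assumes "a > (0::real)" "b \<ge> 0"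
  shows "(\<Sum>j<J. 2 ^ j * a * (if 2 ^ j * a < b then 1 else 0)) \<le> 2 * b"
proof -
  have "(\<Sum>j<J. 2 ^ j * a * (if 2 ^ j * a < b then 1 else 0)) \<le> 2 * b
     \<and> (\<Sum>j<J. 2 ^ j * a * (if 2 ^ j * a < b then 1 else 0)) \<le> 2 ^ J * a"
    by (induction J) (use assms in \<open>auto simp: algebra_simps\<close>)
  then show ?thesis by blast
qed

text \<open>\<open>level_estimate\<close> at the levels \<open>4 ^ j * s\<close> bounds the mass
  above the top level by each of \<open>J\<close> terms whose sum is at most \<open>C2 * I\<close>,
  the thresholds being geometric. So that mass is at most the fraction \<open>C2 / J\<close> of the
  total, and below the top level \<open>f\<close> is bounded, hence contributes little on sets of
  small measure.\<close>

lemma A_infinity: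
  fixes f :: "'a::euclidean_space \<Rightarrow> real"
  assumes f: "integrable lborel f" "\<And>x. f x \<ge> 0" and rh: "rev_holder D f" and \<epsilon>: "\<epsilon> > 0"
  shows "\<exists>\<tau>>0. \<forall>x0 R S. R > 0 \<longrightarrow> cball x0 (2 * R) \<subseteq> D \<longrightarrow> S \<in> sets borel \<longrightarrow> S \<subseteq> cball x0 R \<longrightarrow>
     emeasure lborel S \<le> ennreal (\<tau> * vol TYPE('a) R) \<longrightarrow> SI S f \<le> ennreal \<epsilon> * SI (cball x0 (2 * R)) f"
proof -
  let ?n = "DIM('a)" and ?v = "vol TYPE('a)"
  note [measurable] = integrable_borel[OF f(1)]
  obtain C c where C: "C > 0" "c > 0" and lev: "\<And>x0 R t. R > 0 \<Longrightarrow> t > 0 \<Longrightarrow> cball x0 (2 * R) \<subseteq> D \<Longrightarrow>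
     SI (cball x0 (2 * R)) f \<le> ennreal (t * ?v (R / 16)) \<Longrightarrow>
     SI (cball x0 R \<inter> {x. f x > t}) f
       \<le> SI (cball x0 (2 * R)) (\<lambda>x. C * sqrt t * (sqrt (f x) * indicat_real {x. f x > c * t} x))"
    using level_estimate[OF f rh] by blast
  define C2 where "C2 = 2 * C / sqrt c"
  have C2: "C2 > 0" using C by (simp add: C2_def)
  \<comment> \<open>Makes the fraction \<open>C2 / J\<close> at most \<open>\<epsilon> / 2\<close>;
    the choice of \<tau> gives the other half to the bounded part.\<close>
  obtain J :: nat where J: "J > 2 * C2 / \<epsilon>" using reals_Archimedean2 by blast
  have J0: "real J > 0" using J C2 \<epsilon> by (smt (verit) divide_pos_pos)
  define \<tau> where "\<tau> = \<epsilon> / (2 * 4 ^ J * 16 ^ ?n)"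
  have \<tau>: "\<tau> > 0" using \<epsilon> by (simp add: \<tau>_def)
  have "SI S f \<le> ennreal \<epsilon> * SI (cball x0 (2 * R)) f"
    if R: "R > 0" and D: "cball x0 (2 * R) \<subseteq> D" and S[measurable]: "S \<in> sets borel" and SR: "S \<subseteq> cball x0 R"
      and mS: "emeasure lborel S \<le> ennreal (\<tau> * ?v R)" for x0 R S
  proof -
    have sub: "cball x0 R \<subseteq> cball x0 (2 * R)" using R by (intro subset_cball) auto
    obtain I where I: "I \<ge> 0" "SI (cball x0 (2 * R)) f = ennreal I" by (rule SI_real[OF f])
    show ?thesis
    proof (cases "I = 0")
      case True
      have "SI S f \<le> SI (cball x0 (2 * R)) f" by (rule SI_subset) (use SR sub in auto)
      then show ?thesis using I True by simp
    next
      case False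
      \<comment> \<open>The lowest level at which the total mass meets the hypothesis of
        \<open>level_estimate\<close>.\<close>
      define s where "s = I / ?v (R / 16)"
      have vp: "?v (R / 16) > 0" using R by (intro vol_pos) auto
      have s: "s > 0" using I False vp by (simp add: s_def less_le)
      let ?A = "\<lambda>j. cball x0 R \<inter> {x. f x > 4 ^ j * s}"
      let ?k = "\<lambda>j x. C * sqrt (4 ^ j * s) * (sqrt (f x) * indicat_real {x. f x > c * (4 ^ j * s)} x)"
      have Aj: "SI (?A J) f \<le> SI (cball x0 (2 * R)) (?k j)" if "j < J" for j
      proof -
        have "4 ^ j * s \<le> 4 ^ J * s" using s that by (intro mult_right_mono power_increasing) auto
        then have "SI (?A J) f \<le> SI (?A j) f" by (intro SI_subset) auto
        also have "\<dots> \<le> SI (cball x0 (2 * R)) (?k j)"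
        proof (rule lev[OF R _ D])
          have "I = s * ?v (R / 16)" using vp by (simp add: s_def)
          also have "\<dots> \<le> 4 ^ j * s * ?v (R / 16)" using s vp by (intro mult_right_mono) auto
          finally show "SI (cball x0 (2 * R)) f \<le> ennreal (4 ^ j * s * ?v (R / 16))"
            unfolding I(2) by (rule ennreal_leI)
        qed (use s in auto)
        finally show ?thesis .
      qed
      have knn: "?k j x \<ge> 0" for j x using C s f(2)[of x] by auto
      have ks: "(\<Sum>j<K. SI (cball x0 (2 * R)) (?k j)) = SI (cball x0 (2 * R)) (\<lambda>x. \<Sum>j<K. ?k j x)" for K
      proof (induction K)
        case (Suc K)
        have "SI (cball x0 (2 * R)) (\<lambda>x. (\<Sum>j<K. ?k j x) + ?k K x) = SI (cball x0 (2 * R)) (\<lambda>x. \<Sum>j<K. ?k j x) + SI (cball x0 (2 * R)) (?k K)"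
          by (rule SI_add) (use knn in \<open>auto intro!: sum_nonneg\<close>)
        then show ?case using Suc by simp
      qed (simp add: SI_def)
      have pt: "(\<Sum>j<J. ?k j x) \<le> C2 * f x" for x
      proof -
        have e: "?k j x = C * sqrt (f x) * (2 ^ j * sqrt s * (if 2 ^ j * sqrt s < sqrt (f x / c) then 1 else 0))" for j
        proof -
          have "sqrt (4 ^ j * s) = 2 ^ j * sqrt s"
            using real_sqrt_power[of 4 j] by (simp add: real_sqrt_mult)
          moreover have "f x > c * (4 ^ j * s) \<longleftrightarrow> sqrt (4 ^ j * s) < sqrt (f x / c)"
            using C by (simp add: field_simps)
          ultimately show ?thesis by (auto simp: indicator_def)
        qed
        have "(\<Sum>j<J. ?k j x) = C * sqrt (f x) * (\<Sum>j<J. 2 ^ j * sqrt s * (if 2 ^ j * sqrt s < sqrt (f x / c) then 1 else 0))"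
          unfolding e by (simp add: sum_distrib_left)
        also have "\<dots> \<le> C * sqrt (f x) * (2 * sqrt (f x / c))"
          by (intro mult_left_mono dyadic_sum_bound) (use C s f(2)[of x] in auto)
        also have "\<dots> = C2 * (sqrt (f x) * sqrt (f x))" by (simp add: C2_def real_sqrt_divide)
        also have "\<dots> = C2 * f x" using f(2)[of x] by simp
        finally show ?thesis .
      qed
      obtain a where a: "a \<ge> 0" "SI (?A J) f = ennreal a" by (rule SI_real[OF f])
      have "(\<Sum>j<J. SI (?A J) f) \<le> (\<Sum>j<J. SI (cball x0 (2 * R)) (?k j))"
        by (rule sum_mono) (use Aj in auto)
      also have "\<dots> \<le> SI (cball x0 (2 * R)) (\<lambda>x. C2 * f x)" unfolding ks by (rule SI_mono) (use pt in auto)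
      also have "\<dots> = ennreal (C2 * I)" using C2 I by (subst SI_cmult) (auto simp: ennreal_mult)
      finally have "ennreal (real J * a) \<le> ennreal (C2 * I)"
        using a(1) by (simp add: a(2) ennreal_mult ennreal_of_nat_eq_real_of_nat)
      then have "real J * a \<le> C2 * I" using C2 I by (subst (asm) ennreal_le_iff) auto
      then have aJ: "a \<le> C2 / real J * I" using J0 by (simp add: field_simps)
      have "SI S f \<le> SI (S \<union> ?A J) (\<lambda>x. 4 ^ J * s * indicat_real S x + f x * indicat_real (?A J) x)"
        by (rule SI_mono) (use SR s f(2) in \<open>auto simp: indicator_def\<close>)
      also have "\<dots> \<le> SI (S \<union> ?A J) (\<lambda>x. 4 ^ J * s * indicat_real S x) + SI (S \<union> ?A J) (\<lambda>x. f x * indicat_real (?A J) x)"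
        by (rule SI_add_le) measurable
      also have "SI (S \<union> ?A J) (\<lambda>x. 4 ^ J * s * indicat_real S x) = SI S (\<lambda>x. 4 ^ J * s)"
        unfolding SI_def by (rule nn_integral_cong) (auto simp: indicator_def)
      also have "SI (S \<union> ?A J) (\<lambda>x. f x * indicat_real (?A J) x) = SI (?A J) f"
        unfolding SI_def by (rule nn_integral_cong) (auto simp: indicator_def)
      also have "SI S (\<lambda>x. 4 ^ J * s) \<le> ennreal (4 ^ J * s) * ennreal (\<tau> * ?v R)"
        unfolding SI_const[OF S] by (rule mult_left_mono[OF mS]) simp
      also have "\<dots> = ennreal (4 ^ J * s * (\<tau> * ?v R))" using s by (intro ennreal_mult'[symmetric]) simp
      also have "4 ^ J * s * (\<tau> * ?v R) = \<epsilon> / 2 * I"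
      proof -
        have "?v R = 16 ^ ?n * ?v (R / 16)" using vol_mult[of 16 "R / 16", where 'a='a] by simp
        then show ?thesis using vp by (simp add: s_def \<tau>_def)
      qed
      also have "ennreal (\<epsilon> / 2 * I) + SI (?A J) f = ennreal (\<epsilon> / 2 * I + a)"
        using a \<epsilon> I by (simp add: ennreal_plus)
      also have "\<dots> \<le> ennreal (\<epsilon> * I)"
      proof (rule ennreal_leI)
        have "C2 / real J * I \<le> \<epsilon> / 2 * I"
          using J J0 C2 \<epsilon> I by (intro mult_right_mono) (simp_all add: field_simps)
        then have "a \<le> \<epsilon> / 2 * I" using aJ by linarith
        then show "\<epsilon> / 2 * I + a \<le> \<epsilon> * I" by (simp add: field_simps)
      qed
      also have "\<dots> = ennreal \<epsilon> * SI (cball x0 (2 * R)) f" using \<epsilon> by (simp add: I ennreal_mult')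
      finally show ?thesis by (simp add: add_right_mono)
    qed
  qed
  then show ?thesis using \<tau> by blast
qed

section \<open>Jensen's inequality for mean values\<close>

definition avg :: "'a::euclidean_space set \<Rightarrow> ('a \<Rightarrow> 'b::euclidean_space) \<Rightarrow> 'b" where
  "avg B G = (1 / measure lborel B) *\<^sub>R (\<integral>z. indicat_real B z *\<^sub>R G z \<partial>lborel)"

lemma avg_jensen:
  fixes G :: "'a::euclidean_space \<Rightarrow> 'b::euclidean_space"
  assumes Q: "qf c Q" and L: "L > 0" and [measurable]: "G \<in> borel_measurable borel" "B \<in> sets borel"
    and B: "emeasure lborel B < \<infinity>" "measure lborel B > 0"
    and i: "integrable lborel (\<lambda>z. indicat_real B z *\<^sub>R G z)"
  shows "ennreal (Q (norm (v - avg B G) / L)) \<le> ennreal (c / measure lborel B) * SI B (\<lambda>z. Q (norm (v - G z) / L))"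
proof -
  note [measurable] = qf_borel[OF Q]
  let ?m = "measure lborel B"
  let ?w = "\<lambda>z. ennreal (1 / ?m) * indicator B z"
  have c: "c \<ge> 1" by (rule qf_c[OF Q])
  have eB: "emeasure lborel B = ennreal ?m" using B by (simp add: emeasure_eq_ennreal_measure)
  have iB: "integrable lborel (\<lambda>z. indicat_real B z *\<^sub>R v)"
    using B by (intro integrable_scaleR_left integrable_real_indicator) auto
  have "v - avg B G = (1 / ?m) *\<^sub>R (\<integral>z. indicat_real B z *\<^sub>R v - indicat_real B z *\<^sub>R G z \<partial>lborel)"
    using i iB B by (simp add: avg_def scaleR_diff_right)
  also have "\<dots> = (1 / ?m) *\<^sub>R (\<integral>z. indicat_real B z *\<^sub>R (v - G z) \<partial>lborel)"
    by (simp add: scaleR_diff_right)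
  finally have e: "norm (v - avg B G) / L = (1 / (?m * L)) * norm (\<integral>z. indicat_real B z *\<^sub>R (v - G z) \<partial>lborel)"
    using B L by simp
  have i2: "integrable lborel (\<lambda>z. indicat_real B z *\<^sub>R (v - G z))"
    using integrable_diff[OF iB i] by (simp add: scaleR_diff_right)
  have "ennreal (norm (v - avg B G) / L) = ennreal (1 / (?m * L)) * ennreal (norm (\<integral>z. indicat_real B z *\<^sub>R (v - G z) \<partial>lborel))"
    unfolding e using B L by (intro ennreal_mult') simp
  also have "\<dots> \<le> ennreal (1 / (?m * L)) * (\<integral>\<^sup>+z. ennreal (norm (indicat_real B z *\<^sub>R (v - G z))) \<partial>lborel)"
    by (intro mult_left_mono integral_norm_bound_ennreal i2) simp
  also have "\<dots> = (\<integral>\<^sup>+z. ennreal (1 / (?m * L)) * ennreal (norm (indicat_real B z *\<^sub>R (v - G z))) \<partial>lborel)"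
    by (rule nn_integral_cmult[symmetric]) measurable
  also have "\<dots> = (\<integral>\<^sup>+z. ?w z * ennreal (norm (v - G z) / L) \<partial>lborel)"
    using B L by (intro nn_integral_cong) (auto simp: indicator_def simp flip: ennreal_mult)
  finally have T: "ennreal (norm (v - avg B G) / L) \<le> (\<integral>\<^sup>+z. ?w z * ennreal (norm (v - G z) / L) \<partial>lborel)" .
  have "ennreal (Q (norm (v - avg B G) / L)) \<le> ennreal c * (\<integral>\<^sup>+z. ?w z * ennreal (Q (norm (v - G z) / L)) \<partial>lborel)"
  proof (rule qf_jensen[OF Q _ _ _ _ _ T])
    show "(\<integral>\<^sup>+z. ?w z \<partial>lborel) \<le> 1" using B by (simp add: nn_integral_cmult eB flip: ennreal_mult)
  qed (use L in auto)
  also have "(\<integral>\<^sup>+z. ?w z * ennreal (Q (norm (v - G z) / L)) \<partial>lborel) = ennreal (1 / ?m) * SI B (\<lambda>z. Q (norm (v - G z) / L))"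
    unfolding SI_def by (subst nn_integral_cmult[symmetric]) (auto simp: mult_ac)
  also have "ennreal c * (ennreal (1 / ?m) * SI B (\<lambda>z. Q (norm (v - G z) / L))) = ennreal (c / ?m) * SI B (\<lambda>z. Q (norm (v - G z) / L))"
    using c by (simp add: mult.assoc[symmetric] flip: ennreal_mult)
  finally show ?thesis .
qed

text \<open>Jensen's inequality in both variables produces a double integral over \<open>A\<close>
  and \<open>B\<close>, which is regrouped by the displacement \<open>h = z - s\<close>. Each
  displacement contributes at most \<open>X\<close>, and all of them lie in a ball of radius
  \<open>r\<close>.\<close>

lemma avg_diff_jensen:
  fixes G :: "'a::euclidean_space \<Rightarrow> 'b::euclidean_space"
  assumes Q: "qf c Q" and L: "L > 0" and [measurable]: "G \<in> borel_measurable borel" "A \<in> sets borel" "B \<in> sets borel"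
    and A: "emeasure lborel A < \<infinity>" "measure lborel A > 0" "integrable lborel (\<lambda>z. indicat_real A z *\<^sub>R G z)"
    and B: "emeasure lborel B < \<infinity>" "measure lborel B > 0" "integrable lborel (\<lambda>z. indicat_real B z *\<^sub>R G z)"
    and X: "\<And>h. norm h \<le> r \<Longrightarrow> SI {s \<in> A. s + h \<in> B} (\<lambda>s. Q (norm (G (s + h) - G s) / L)) \<le> X"
    and AB: "\<And>s z. s \<in> A \<Longrightarrow> z \<in> B \<Longrightarrow> norm (z - s) \<le> r" and r: "r \<ge> 0"
  shows "ennreal (Q (norm (avg A G - avg B G) / L))
     \<le> ennreal (c * c * vol TYPE('a) r / (measure lborel A * measure lborel B)) * X"
proof -
  note [measurable] = qf_borel[OF Q]
  let ?q = "\<lambda>s z. Q (norm (G s - G z) / L)"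
  have c: "c \<ge> 1" by (rule qf_c[OF Q])
  have "ennreal (Q (norm (avg A G - avg B G) / L)) = ennreal (Q (norm (avg B G - avg A G) / L))"
    by (simp add: norm_minus_commute)
  also have "\<dots> \<le> ennreal (c / measure lborel A) * SI A (\<lambda>s. Q (norm (avg B G - G s) / L))"
    by (rule avg_jensen[OF Q L _ _ A]) measurable
  also have "SI A (\<lambda>s. Q (norm (avg B G - G s) / L)) \<le> (\<integral>\<^sup>+s. ennreal (c / measure lborel B) * (SI B (?q s) * indicator A s) \<partial>lborel)"
    unfolding SI_def[of A]
  proof (rule nn_integral_mono)
    fix s
    have "ennreal (Q (norm (avg B G - G s) / L)) \<le> ennreal (c / measure lborel B) * SI B (?q s)"
      using avg_jensen[OF Q L _ _ B, of "G s"] by (simp add: norm_minus_commute)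
    then show "ennreal (Q (norm (avg B G - G s) / L)) * indicator A s \<le> ennreal (c / measure lborel B) * (SI B (?q s) * indicator A s)"
      by (auto simp: indicator_def)
  qed
  also have "\<dots> = ennreal (c / measure lborel B) * (\<integral>\<^sup>+s. SI B (?q s) * indicator A s \<partial>lborel)"
    unfolding SI_def by (rule nn_integral_cmult) measurable
  also have "(\<integral>\<^sup>+s. SI B (?q s) * indicator A s \<partial>lborel) \<le> ennreal (vol TYPE('a) r) * X"
  proof -
    have "(\<integral>\<^sup>+s. SI B (?q s) * indicator A s \<partial>lborel)
       = (\<integral>\<^sup>+s. (\<integral>\<^sup>+h. ennreal (?q s (h + s)) * indicator B (h + s) * indicator A s \<partial>lborel) \<partial>lborel)"
    proof (rule nn_integral_cong)
      fix s :: 'a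
      have "SI B (?q s) = (\<integral>\<^sup>+h. ennreal (?q s (h + s)) * indicator B (h + s) \<partial>lborel)"
        unfolding SI_def by (rule nn_integral_shift[symmetric]) measurable
      then show "SI B (?q s) * indicator A s = (\<integral>\<^sup>+h. ennreal (?q s (h + s)) * indicator B (h + s) * indicator A s \<partial>lborel)"
        by (simp add: nn_integral_multc)
    qed
    also have "\<dots> = (\<integral>\<^sup>+h. (\<integral>\<^sup>+s. ennreal (?q s (h + s)) * indicator B (h + s) * indicator A s \<partial>lborel) \<partial>lborel)"
      by (rule lborel_pair.Fubini') measurable
    also have "\<dots> \<le> (\<integral>\<^sup>+h. X * indicator (cball (0::'a) r) h \<partial>lborel)"
    proof (rule nn_integral_mono)
      fix h :: 'a
      have e: "(\<integral>\<^sup>+s. ennreal (?q s (h + s)) * indicator B (h + s) * indicator A s \<partial>lborel)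
        = SI {s \<in> A. s + h \<in> B} (\<lambda>s. Q (norm (G (s + h) - G s) / L))"
        unfolding SI_def by (rule nn_integral_cong) (auto simp: indicator_def norm_minus_commute add.commute)
      show "(\<integral>\<^sup>+s. ennreal (?q s (h + s)) * indicator B (h + s) * indicator A s \<partial>lborel) \<le> X * indicator (cball (0::'a) r) h"
      proof (cases "norm h \<le> r")
        case True then show ?thesis unfolding e using X by simp
      next
        case False
        then have "{s \<in> A. s + h \<in> B} = {}" using AB[of _ "_ + h"] by fastforce
        then show ?thesis unfolding e by (simp add: SI_def)
      qed
    qed
    also have "\<dots> = ennreal (vol TYPE('a) r) * X" using r by (simp add: nn_integral_cmult emeasure_cball_vol mult.commute)
    finally show ?thesis .
  qed
  finally have "ennreal (Q (norm (avg A G - avg B G) / L)) \<le>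
    ennreal (c / measure lborel A) * (ennreal (c / measure lborel B) * (ennreal (vol TYPE('a) r) * X))"
    by (simp add: mult_left_mono)
  also have "\<dots> = ennreal (c * c * vol TYPE('a) r / (measure lborel A * measure lborel B)) * X"
    using c A B vol_nonneg[OF r, where 'a='a] by (simp add: mult.assoc[symmetric] flip: ennreal_mult)
  finally show ?thesis .
qed

text \<open>The same regrouping by displacements as in \<open>avg_diff_jensen\<close>; here the ball
  moves with its centre, so the displacements range over \<open>cball 0 r\<close>, whose volume
  cancels.\<close>

lemma avg_ball_approx:
  fixes G :: "'a::euclidean_space \<Rightarrow> 'b::euclidean_space"
  assumes Q: "qf c Q" and L: "L > 0" and [measurable]: "G \<in> borel_measurable borel" "A \<in> sets borel"
    and r: "r > 0" and i: "\<And>y. y \<in> A \<Longrightarrow> integrable lborel (\<lambda>z. indicat_real (cball y r) z *\<^sub>R G z)"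
    and X: "\<And>h. norm h \<le> r \<Longrightarrow> SI A (\<lambda>s. Q (norm (G (s + h) - G s) / L)) \<le> X"
  shows "SI A (\<lambda>y. Q (norm (G y - avg (cball y r) G) / L)) \<le> ennreal c * X"
proof -
  note [measurable] = qf_borel[OF Q]
  let ?v = "vol TYPE('a) r"
  have v: "?v > 0" by (rule vol_pos[OF r])
  have m: "measure lborel (cball y r) = ?v" for y :: 'a using r by (simp add: measure_def emeasure_cball_vol vol_nonneg)
  have c: "c \<ge> 1" by (rule qf_c[OF Q])
  let ?q = "\<lambda>y z. Q (norm (G y - G z) / L)"
  have "SI A (\<lambda>y. Q (norm (G y - avg (cball y r) G) / L))
     \<le> (\<integral>\<^sup>+y. (\<integral>\<^sup>+h. ennreal (c / ?v) * (ennreal (?q y (h + y)) * indicator (cball 0 r) h * indicator A y) \<partial>lborel) \<partial>lborel)"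
    unfolding SI_def[of A]
  proof (rule nn_integral_mono)
    fix y :: 'a
    show "ennreal (Q (norm (G y - avg (cball y r) G) / L)) * indicator A y
       \<le> (\<integral>\<^sup>+h. ennreal (c / ?v) * (ennreal (?q y (h + y)) * indicator (cball 0 r) h * indicator A y) \<partial>lborel)"
    proof (cases "y \<in> A")
      case True
      have "ennreal (Q (norm (G y - avg (cball y r) G) / L)) \<le> ennreal (c / ?v) * SI (cball y r) (?q y)"
        using avg_jensen[OF Q L _ _ _ _ i[OF True], of "G y"] v emeasure_lborel_cball_finite[of y r] by (simp add: m)
      also have "SI (cball y r) (?q y) = (\<integral>\<^sup>+h. ennreal (?q y (h + y)) * indicator (cball y r) (h + y) \<partial>lborel)"
        unfolding SI_def by (rule nn_integral_shift[symmetric]) measurable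
      also have "\<dots> = (\<integral>\<^sup>+h. ennreal (?q y (h + y)) * indicator (cball 0 r) h \<partial>lborel)"
        by (rule nn_integral_cong) (auto simp: indicator_def dist_norm)
      also have "ennreal (c / ?v) * \<dots> = (\<integral>\<^sup>+h. ennreal (c / ?v) * (ennreal (?q y (h + y)) * indicator (cball 0 r) h) \<partial>lborel)"
        by (rule nn_integral_cmult[symmetric]) measurable
      finally show ?thesis using True by simp
    qed simp
  qed
  also have "\<dots> = (\<integral>\<^sup>+h. (\<integral>\<^sup>+y. ennreal (c / ?v) * (ennreal (?q y (h + y)) * indicator (cball 0 r) h * indicator A y) \<partial>lborel) \<partial>lborel)"
    by (rule lborel_pair.Fubini') measurable
  also have "\<dots> \<le> (\<integral>\<^sup>+h. ennreal (c / ?v) * (X * indicator (cball (0::'a) r) h) \<partial>lborel)"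
  proof (rule nn_integral_mono)
    fix h :: 'a
    have "(\<integral>\<^sup>+y. ennreal (c / ?v) * (ennreal (?q y (h + y)) * indicator (cball 0 r) h * indicator A y) \<partial>lborel)
       = ennreal (c / ?v) * (SI A (\<lambda>s. Q (norm (G (s + h) - G s) / L)) * indicator (cball 0 r) h)"
      unfolding SI_def
      by (subst nn_integral_multc[symmetric], measurable, subst nn_integral_cmult[symmetric], measurable)
        (auto intro!: nn_integral_cong simp: mult_ac norm_minus_commute add.commute)
    also have "\<dots> \<le> ennreal (c / ?v) * (X * indicator (cball (0::'a) r) h)"
      by (rule mult_left_mono) (use X[of h] in \<open>auto simp: indicator_def\<close>)
    finally show "(\<integral>\<^sup>+y. ennreal (c / ?v) * (ennreal (?q y (h + y)) * indicator (cball 0 r) h * indicator A y) \<partial>lborel)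
      \<le> ennreal (c / ?v) * (X * indicator (cball (0::'a) r) h)" .
  qed
  also have "\<dots> = ennreal (c / ?v) * (X * ennreal ?v)"
    using r by (simp add: nn_integral_cmult emeasure_cball_vol)
  also have "\<dots> = (ennreal (c / ?v) * ennreal ?v) * X" by (simp add: mult_ac)
  also have "ennreal (c / ?v) * ennreal ?v = ennreal c" using c v by (simp flip: ennreal_mult)
  finally show ?thesis .
qed

lemma avg_borel:
  fixes G :: "'a::euclidean_space \<Rightarrow> 'b::euclidean_space"
  assumes [measurable]: "G \<in> borel_measurable borel" and r: "r \<ge> 0"
  shows "(\<lambda>y. avg (cball y r) G) \<in> borel_measurable borel"
proof -
  have "avg (cball y r) G = (1 / vol TYPE('a) r) *\<^sub>R (\<integral>z. indicat_real (cball 0 r) (z - y) *\<^sub>R G z \<partial>lborel)" for y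
  proof -
    have "indicat_real (cball y r) z = indicat_real (cball 0 r) (z - y)" for z
      by (auto simp: indicator_def dist_norm norm_minus_commute)
    then show ?thesis using r by (simp add: avg_def measure_def emeasure_cball_vol vol_nonneg)
  qed
  then show ?thesis by (simp only:) measurable
qed

lemma qf_square: "qf 4 (\<lambda>t. t\<^sup>2)"
  unfolding qf_def by (auto intro!: continuous_intros simp: power2_eq_square divide_simps)

section \<open>Higher integrability\<close>

text \<open>
  In the application \<open>V\<close> is \<open>V_P\<close> of the gradient and \<open>f\<close> is comparable to its square. A bound on
  differences of \<open>V\<close> by a small multiple of \<open>f\<close> plus a term quadratic in \<open>h\<close> limits the growth of
  averages of \<open>V\<close> over dyadically shrinking balls, so the superlevel sets of \<open>f\<close> decay.
\<close>

locale small_differences =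
  fixes D :: "'a::euclidean_space set" and f :: "'a \<Rightarrow> real" and V :: "'a \<Rightarrow> 'b::euclidean_space" and C0 C1 :: real
  assumes f: "integrable lborel f" "\<And>x. f x \<ge> 0" and V_borel: "V \<in> borel_measurable borel"
    and V1: "\<And>x. x \<in> D \<Longrightarrow> (norm (V x))\<^sup>2 \<le> f x" and V2: "\<And>x. x \<in> D \<Longrightarrow> f x \<le> 2 * (norm (V x))\<^sup>2 + C0"
    and C0: "C0 \<ge> 0" and C1: "C1 \<ge> 0"
    and VD: "\<And>\<epsilon>. \<epsilon> > 0 \<Longrightarrow> \<exists>R0>0. \<forall>x0 R h. 0 < R \<longrightarrow> R \<le> R0 \<longrightarrow> norm h \<le> R \<longrightarrow> cball x0 (4 * R) \<subseteq> D \<longrightarrow>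
       SI (cball x0 R) (\<lambda>y. (norm (V (y + h) - V y))\<^sup>2) \<le> ennreal (\<epsilon> + C1 * (norm h / R)\<^sup>2) * SI (cball x0 (4 * R)) f"
begin

lemmas f_borel [measurable] = integrable_borel[OF f(1)]

lemmas V_borel' [measurable] = V_borel

lemma V_integrable: "cball y r \<subseteq> D \<Longrightarrow> integrable lborel (\<lambda>z. indicat_real (cball y r) z *\<^sub>R V z)"
  by (rule integrable_bound[OF integrable_sqrt_ball[OF f, of y r]])
    (auto intro!: AE_I2 real_le_rsqrt V1 simp: indicator_def real_sqrt_ge_zero f(2))

text \<open>The means \<open>W k y\<close> of \<open>V\<close> over balls of radius
  \<open>R / 2 ^ k\<close> about \<open>y\<close> change from \<open>k\<close> to
  \<open>Suc k\<close> by at most a multiple of \<open>sqrt \<sigma> * b ^ k\<close>: in the square,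
  short displacements gain 4^(-k) while the normalisation costs 2^(nk). Summation bounds
  \<open>W K y\<close>. Where \<open>f\<close> exceeds the high level, it is then at most 16 times
  the square of \<open>V y - W K y\<close>; this sees displacements up to \<open>R / 2 ^ K\<close>
  only and has integral of order 4^(-K).\<close>

lemma superlevel_ball:
  fixes b :: real and K :: nat
  assumes b: "b > 1" "2 ^ DIM('a) / 4 \<le> b\<^sup>2"
  defines "C3 \<equiv> 64 * (1 + C1) * 20 ^ DIM('a)"
  defines "C5 \<equiv> sqrt (4 * 2 ^ DIM('a)) + sqrt (16 * 32 ^ DIM('a) * (1 + C1)) / (b - 1)"
  shows "\<exists>R0>0. \<forall>x r \<sigma>. 0 < r \<longrightarrow> r \<le> R0 \<longrightarrow> \<sigma> > 0 \<longrightarrow> cball x (40 * r) \<subseteq> D \<longrightarrow> stopping f \<sigma> x r \<longrightarrow>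
     2 * C0 \<le> 16 * C5\<^sup>2 * b ^ (2 * K) * \<sigma> \<longrightarrow>
     SI (cball x (5 * r) \<inter> {y. f y > 16 * C5\<^sup>2 * b ^ (2 * K) * \<sigma>}) f \<le> ennreal (C3 / 4 ^ K * (\<sigma> * vol TYPE('a) r))"
proof -
  let ?n = "DIM('a)" and ?v = "vol TYPE('a)"
  let ?B = "sqrt (16 * 32 ^ ?n * (1 + C1))"
  \<comment> \<open>16 times the bound for \<open>(norm (W K y))\<^sup>2 / \<sigma>\<close>:
    wherever \<open>f y > N * \<sigma>\<close>, the vector \<open>V y\<close> is at least twice as
    long as \<open>W K y\<close>.\<close>
  define N where "N = 16 * C5\<^sup>2 * b ^ (2 * K)"
  \<comment> \<open>The square of the smallest scale \<open>1 / 2 ^ K\<close>: for displacements of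
    order \<open>R / 2 ^ k\<close> with \<open>k \<le> K\<close>, both terms of the coefficient are
    then of order 4^(-k).\<close>
  have "1 / 4 ^ K > (0::real)" by simp
  from VD[OF this] obtain R0 where R0: "R0 > 0" and VD': "\<And>x0 R h. 0 < R \<Longrightarrow> R \<le> R0 \<Longrightarrow> norm h \<le> R \<Longrightarrow> cball x0 (4 * R) \<subseteq> D \<Longrightarrow>
       SI (cball x0 R) (\<lambda>y. (norm (V (y + h) - V y))\<^sup>2) \<le> ennreal (1 / 4 ^ K + C1 * (norm h / R)\<^sup>2) * SI (cball x0 (4 * R)) f"
    by blast
  have "SI (cball x (5 * r) \<inter> {y. f y > N * \<sigma>}) f \<le> ennreal (C3 / 4 ^ K * (\<sigma> * ?v r))"
    if r: "0 < r" "r \<le> R0 / 10" and \<sigma>: "\<sigma> > 0" and D: "cball x (40 * r) \<subseteq> D" and st: "stopping f \<sigma> x r"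
      and N0: "2 * C0 \<le> N * \<sigma>" for x r \<sigma>
  proof -
    define R where "R = 5 * r"
    let ?Y = "(1 + C1) / 4 ^ K * (\<sigma> * ?v (4 * R))"
    have R: "R > 0" using r by (simp add: R_def)
    define \<rho> where "\<rho> k = R / 2 ^ k" for k :: nat
    have \<rho>: "\<rho> k > 0" "\<rho> k \<le> R" "\<rho> (Suc k) \<le> \<rho> k" for k
      using R by (auto simp: \<rho>_def divide_le_eq le_divide_eq mult_le_cancel_left1 field_simps)
    have sub: "cball y t \<subseteq> D" if "y \<in> cball x (2 * R)" "t \<le> 6 * R" for y t
      by (rule subset_trans[OF _ D]) (use that in \<open>simp add: cball_subset_cball_iff R_def dist_commute\<close>)
    have subx: "cball x t \<subseteq> D" if "t \<le> 8 * R" for t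
      by (rule subset_trans[OF _ D]) (use that in \<open>simp add: cball_subset_cball_iff R_def\<close>)
    have If: "SI (cball x t) f \<le> ennreal (\<sigma> * ?v t)" if "t \<ge> R" for t
      using st that r by (auto simp: stopping_def R_def)
    define W where "W k y = avg (cball y (\<rho> k)) V" for k y
    have m: "measure lborel (cball y t) = ?v t" if "t \<ge> 0" for y :: 'a and t
      using that by (simp add: measure_def emeasure_cball_vol vol_nonneg)
    have fin: "emeasure lborel (cball y t) < \<infinity>" for y :: 'a and t by (rule emeasure_lborel_cball_finite)
    have W0: "(norm (W 0 y))\<^sup>2 \<le> 4 * 2 ^ ?n * \<sigma>" if y: "y \<in> cball x R" for y
    proof -
      have \<rho>0: "\<rho> 0 = R" by (simp add: \<rho>_def)
      have vR: "?v R > 0" using R by (rule vol_pos)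
      have y2: "y \<in> cball x (2 * R)" using y R by auto
      have "ennreal ((norm (0 - avg (cball y R) V) / 1)\<^sup>2) \<le> ennreal (4 / measure lborel (cball y R)) * SI (cball y R) (\<lambda>z. (norm (0 - V z) / 1)\<^sup>2)"
        by (rule avg_jensen[OF qf_square]) (use R m[of R y] vR fin sub[OF y2, of R] in \<open>auto intro!: V_integrable\<close>)
      also have "SI (cball y R) (\<lambda>z. (norm (0 - V z) / 1)\<^sup>2) \<le> SI (cball x (2 * R)) f"
      proof (rule SI_mono)
        fix z assume z: "z \<in> cball y R"
        have "z \<in> cball x (2 * R)"
          using subsetD[OF _ z, of "cball x (2 * R)"] y by (simp add: cball_subset_cball_iff dist_commute)
        then show "z \<in> cball x (2 * R) \<and> (norm (0 - V z) / 1)\<^sup>2 \<le> f z"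
          using V1[of z] subx[of "2 * R"] R by auto
      qed
      also have "\<dots> \<le> ennreal (\<sigma> * ?v (2 * R))" by (rule If) (use R in simp)
      also have "ennreal (4 / measure lborel (cball y R)) * ennreal (\<sigma> * ?v (2 * R)) = ennreal (4 * 2 ^ ?n * \<sigma>)"
        using R vR \<sigma> vol_mult[of 2 R, where 'a='a] by (simp add: m vol_nonneg flip: ennreal_mult)
      finally have "ennreal ((norm (W 0 y))\<^sup>2) \<le> ennreal (4 * 2 ^ ?n * \<sigma>)"
        by (simp add: W_def \<rho>0 mult_left_mono)
      then show ?thesis using \<sigma> by (subst (asm) ennreal_le_iff) auto
    qed
    have Wd: "norm (W (Suc k) y - W k y) \<le> ?B * sqrt \<sigma> * b ^ k"
      if y: "y \<in> cball x R" and k: "k < K" for y k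
    proof -
      have y2: "y \<in> cball x (2 * R)" using y R by auto
      let ?X = "(1 + C1) / 4 ^ k * (\<sigma> * ?v (8 * R))"
      have vk: "?v (\<rho> k) > 0" "?v (\<rho> (Suc k)) > 0" using \<rho>(1) by (auto intro: vol_pos)
      have "ennreal ((norm (avg (cball y (\<rho> (Suc k))) V - avg (cball y (\<rho> k)) V) / 1)\<^sup>2)
        \<le> ennreal (4 * 4 * ?v (2 * \<rho> k) / (measure lborel (cball y (\<rho> (Suc k))) * measure lborel (cball y (\<rho> k)))) * ennreal ?X"
      proof (rule avg_diff_jensen[OF qf_square])
        show "integrable lborel (\<lambda>z. indicat_real (cball y (\<rho> k)) z *\<^sub>R V z)"
          "integrable lborel (\<lambda>z. indicat_real (cball y (\<rho> (Suc k))) z *\<^sub>R V z)"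
          using \<rho>(2)[of k] \<rho>(2)[of "Suc k"] R by (auto intro!: V_integrable sub[OF y2])
        show "0 < measure lborel (cball y (\<rho> k))" "0 < measure lborel (cball y (\<rho> (Suc k)))"
          using vk \<rho>(1)[of k] \<rho>(1)[of "Suc k"] by (auto simp: m)
        show "norm (z - s) \<le> 2 * \<rho> k" if "s \<in> cball y (\<rho> (Suc k))" "z \<in> cball y (\<rho> k)" for s z
          using that \<rho>(3)[of k] dist_triangle2[of z s y] by (simp add: dist_norm norm_minus_commute)
        fix h :: 'a assume h: "norm h \<le> 2 * \<rho> k"
        have "SI {s \<in> cball y (\<rho> (Suc k)). s + h \<in> cball y (\<rho> k)} (\<lambda>s. (norm (V (s + h) - V s) / 1)\<^sup>2)
          \<le> SI (cball x (2 * R)) (\<lambda>s. (norm (V (s + h) - V s))\<^sup>2)"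
        proof (rule SI_mono)
          fix s assume "s \<in> {s \<in> cball y (\<rho> (Suc k)). s + h \<in> cball y (\<rho> k)}"
          then have s: "s \<in> cball y (\<rho> (Suc k))" by simp
          have "s \<in> cball x (2 * R)"
            using subsetD[OF _ s, of "cball x (2 * R)"] y \<rho>(2)[of "Suc k"] by (simp add: cball_subset_cball_iff dist_commute)
          then show "s \<in> cball x (2 * R) \<and> (norm (V (s + h) - V s) / 1)\<^sup>2 \<le> (norm (V (s + h) - V s))\<^sup>2" by simp
        qed
        also have "\<dots> \<le> ennreal (1 / 4 ^ K + C1 * (norm h / (2 * R))\<^sup>2) * SI (cball x (4 * (2 * R))) f"
        proof (rule VD')
          have "norm h \<le> 2 * R" using h \<rho>(2)[of k] by simp
          then show "norm h \<le> 2 * R" .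
        qed (use R r subx[of "8 * R"] in \<open>auto simp: R_def\<close>)
        also have "\<dots> \<le> ennreal ((1 + C1) / 4 ^ k) * ennreal (\<sigma> * ?v (8 * R))"
        proof (rule mult_mono)
          have "norm h / (2 * R) \<le> 1 / 2 ^ k" using h R by (simp add: \<rho>_def field_simps)
          then have "(norm h / (2 * R))\<^sup>2 \<le> (1 / 2 ^ k)\<^sup>2" using R by (intro power_mono) auto
          also have "(1 / 2 ^ k)\<^sup>2 = 1 / (4::real) ^ k"
            by (simp add: power_divide power2_eq_square flip: power_mult_distrib)
          finally have "C1 * (norm h / (2 * R))\<^sup>2 \<le> C1 * (1 / 4 ^ k)" using C1 by (intro mult_left_mono)
          moreover have "1 / 4 ^ K \<le> 1 / (4::real) ^ k" using k by (intro divide_left_mono power_increasing) auto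
          ultimately show "ennreal (1 / 4 ^ K + C1 * (norm h / (2 * R))\<^sup>2) \<le> ennreal ((1 + C1) / 4 ^ k)"
            by (intro ennreal_leI) (simp add: add_divide_distrib)
          show "SI (cball x (4 * (2 * R))) f \<le> ennreal (\<sigma> * ?v (8 * R))" using If[of "8 * R"] R by simp
        qed auto
        also have "\<dots> = ennreal ?X" using C1 by (intro ennreal_mult'[symmetric]) simp
        finally show "SI {s \<in> cball y (\<rho> (Suc k)). s + h \<in> cball y (\<rho> k)} (\<lambda>s. (norm (V (s + h) - V s) / 1)\<^sup>2) \<le> ennreal ?X" .
      qed (use fin \<rho>(1)[of k] in auto)
      also have "\<dots> = ennreal (4 * 4 * ?v (2 * \<rho> k) / (?v (\<rho> (Suc k)) * ?v (\<rho> k)) * ?X)"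
        using C1 \<sigma> R \<rho>(1)[of k] \<rho>(1)[of "Suc k"] vk
        by (subst ennreal_mult'') (auto simp: m vol_nonneg intro!: mult_nonneg_nonneg)
      \<comment> \<open>The factor \<open>(2 ^ ?n / 4) ^ k\<close> arises because
        \<open>?v (8 * R)\<close> is (2^n)^k times a fixed multiple of
        \<open>?v (\<rho> k)\<close>.\<close>
      also have "4 * 4 * ?v (2 * \<rho> k) / (?v (\<rho> (Suc k)) * ?v (\<rho> k)) * ?X = 16 * 32 ^ ?n * (1 + C1) * \<sigma> * (2 ^ ?n / 4) ^ k"
      proof -
        have a: "?v (2 * \<rho> k) = 2 ^ ?n * ?v (\<rho> k)" by (rule vol_mult)
        have "?v (\<rho> k) = ?v (2 * \<rho> (Suc k))" by (simp add: \<rho>_def)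
        then have bb: "?v (\<rho> k) = 2 ^ ?n * ?v (\<rho> (Suc k))" by (simp add: vol_mult)
        have "?v R = ?v (2 ^ k * \<rho> k)" by (simp add: \<rho>_def)
        also have "\<dots> = (2 ^ k) ^ ?n * ?v (\<rho> k)" by (rule vol_mult)
        finally have cc: "?v (8 * R) = 8 ^ ?n * ((2 ^ k) ^ ?n * ?v (\<rho> k))" by (simp add: vol_mult)
        have "(32::real) ^ ?n = 2 ^ ?n * 2 ^ ?n * 8 ^ ?n" by (simp flip: power_mult_distrib)
        moreover have "((2::real) ^ k) ^ ?n = (2 ^ ?n) ^ k" by (simp only: power_mult[symmetric] mult.commute)
        ultimately show ?thesis using vk
          unfolding a cc by (subst (3) bb) (simp add: power_divide field_simps)
      qed
      finally have "ennreal ((norm (W (Suc k) y - W k y))\<^sup>2) \<le> ennreal (16 * 32 ^ ?n * (1 + C1) * \<sigma> * (2 ^ ?n / 4) ^ k)"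
        by (simp add: W_def)
      then have "(norm (W (Suc k) y - W k y))\<^sup>2 \<le> 16 * 32 ^ ?n * (1 + C1) * \<sigma> * (2 ^ ?n / 4) ^ k"
        using C1 \<sigma> by (subst (asm) ennreal_le_iff) auto
      also have "\<dots> \<le> 16 * 32 ^ ?n * (1 + C1) * \<sigma> * (b\<^sup>2) ^ k"
        using b C1 \<sigma> by (intro mult_left_mono power_mono) auto
      also have "\<dots> = (?B * sqrt \<sigma> * b ^ k)\<^sup>2"
      proof -
        have "(b\<^sup>2) ^ k = (b ^ k)\<^sup>2" by (simp only: power_mult[symmetric] mult.commute)
        then show ?thesis using C1 \<sigma> by (simp add: power_mult_distrib)
      qed
      finally show ?thesis
      proof (rule power2_le_imp_le)
        show "0 \<le> ?B * sqrt \<sigma> * b ^ k"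
          by (intro mult_nonneg_nonneg zero_le_power) (use C1 \<sigma> b in auto)
      qed
    qed
    have WK: "(norm (W K y))\<^sup>2 \<le> N * \<sigma> / 16" if y: "y \<in> cball x R" for y
    proof -
      \<comment> \<open>Partial sums of the geometric series with ratio \<open>b\<close>, which are
        dominated by their last term since \<open>b > 1\<close>.\<close>
      have "k \<le> K \<Longrightarrow> norm (W k y) \<le> sqrt \<sigma> * (sqrt (4 * 2 ^ ?n) + ?B * ((b ^ k - 1) / (b - 1)))" for k
      proof (induction k)
        case 0
        have "norm (W 0 y) \<le> sqrt (4 * 2 ^ ?n * \<sigma>)" by (rule real_le_rsqrt[OF W0[OF y]])
        then show ?case by (simp add: real_sqrt_mult mult_ac)
      next
        case (Suc k)
        have "norm (W (Suc k) y) \<le> norm (W k y) + norm (W (Suc k) y - W k y)" by (rule norm_triangle_sub)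
        also have "\<dots> \<le> sqrt \<sigma> * (sqrt (4 * 2 ^ ?n) + ?B * ((b ^ k - 1) / (b - 1))) + ?B * sqrt \<sigma> * b ^ k"
          using Suc Wd[OF y, of k] by (intro add_mono) auto
        also have "\<dots> = sqrt \<sigma> * (sqrt (4 * 2 ^ ?n) + ?B * ((b ^ k - 1) / (b - 1) + b ^ k))" by (simp add: algebra_simps)
        also have "(b ^ k - 1) / (b - 1) + b ^ k = (b ^ Suc k - 1) / (b - 1)" using b by (simp add: field_simps)
        finally show ?case .
      qed
      then have "norm (W K y) \<le> sqrt \<sigma> * (sqrt (4 * 2 ^ ?n) + ?B * ((b ^ K - 1) / (b - 1)))" by simp
      also have "\<dots> \<le> sqrt \<sigma> * (sqrt (4 * 2 ^ ?n) * b ^ K + ?B * (b ^ K / (b - 1)))"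
      proof (intro mult_left_mono add_mono)
        show "sqrt (4 * 2 ^ ?n) \<le> sqrt (4 * 2 ^ ?n) * b ^ K" using mult_left_mono[OF one_le_power[of b K], of "sqrt (4 * 2 ^ ?n)"] b by simp
        show "(b ^ K - 1) / (b - 1) \<le> b ^ K / (b - 1)" using b by (intro divide_right_mono) auto
      qed (use C1 \<sigma> in auto)
      also have "\<dots> = sqrt \<sigma> * (C5 * b ^ K)" by (simp add: C5_def algebra_simps)
      finally have "(norm (W K y))\<^sup>2 \<le> (sqrt \<sigma> * (C5 * b ^ K))\<^sup>2" by (intro power_mono) auto
      also have "\<dots> = N * \<sigma> / 16"
      proof -
        have "(b ^ K)\<^sup>2 = b ^ (2 * K)" by (simp only: power_mult[symmetric] mult.commute)
        then show ?thesis using \<sigma> by (simp add: N_def power_mult_distrib)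
      qed
      finally show ?thesis .
    qed
    have "SI (cball x R \<inter> {y. f y > N * \<sigma>}) f \<le> SI (cball x R) (\<lambda>y. 16 * (norm (V y - W K y) / 1)\<^sup>2)"
    proof (rule SI_mono)
      fix y assume y: "y \<in> cball x R \<inter> {y. f y > N * \<sigma>}"
      have yD: "y \<in> D" using y subx[of R] R by auto
      \<comment> \<open>Since \<open>2 * C0 \<le> N * \<sigma>\<close>, the constant
        \<open>C0\<close> is at most half of \<open>f y\<close> and is absorbed.\<close>
      have f4: "f y \<le> 4 * (norm (V y))\<^sup>2" using V2[OF yD] y N0 by simp
      have "(norm (W K y))\<^sup>2 \<le> (norm (V y) / 2)\<^sup>2" using WK[of y] y f4 by (simp add: power_divide)
      then have "norm (W K y) \<le> norm (V y) / 2" by (rule power2_le_imp_le) simp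
      then have "norm (V y) \<le> 2 * norm (V y - W K y)" using norm_triangle_sub[of "V y" "W K y"] by simp
      then have "(norm (V y))\<^sup>2 \<le> (2 * norm (V y - W K y))\<^sup>2" by (intro power_mono) auto
      then show "y \<in> cball x R \<and> f y \<le> 16 * (norm (V y - W K y) / 1)\<^sup>2"
        using y f4 by (simp add: power_mult_distrib)
    qed
    also have "\<dots> = ennreal 16 * SI (cball x R) (\<lambda>y. (norm (V y - W K y) / 1)\<^sup>2)"
    proof (rule SI_cmult)
      show "(\<lambda>y. (norm (V y - W K y) / 1)\<^sup>2) \<in> borel_measurable borel" unfolding W_def
        using avg_borel[OF V_borel less_imp_le[OF \<rho>(1)[of K]]] by measurable
    qed auto
    also have "SI (cball x R) (\<lambda>y. (norm (V y - W K y) / 1)\<^sup>2) \<le> ennreal 4 * ennreal ?Y"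
      unfolding W_def
    proof (rule avg_ball_approx[OF qf_square])
      show "integrable lborel (\<lambda>z. indicat_real (cball y (\<rho> K)) z *\<^sub>R V z)" if "y \<in> cball x R" for y
        using that R \<rho>(2)[of K] by (intro V_integrable sub) auto
      fix h :: 'a assume h: "norm h \<le> \<rho> K"
      have "SI (cball x R) (\<lambda>s. (norm (V (s + h) - V s) / 1)\<^sup>2) \<le> ennreal (1 / 4 ^ K + C1 * (norm h / R)\<^sup>2) * SI (cball x (4 * R)) f"
        using VD'[of R h x] h \<rho>(2)[of K] R r subx[of "4 * R"] by (simp add: R_def)
      also have "\<dots> \<le> ennreal ((1 + C1) / 4 ^ K) * ennreal (\<sigma> * ?v (4 * R))"
      proof (rule mult_mono)
        have "norm h / R \<le> 1 / 2 ^ K" using h R by (simp add: \<rho>_def field_simps)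
        then have "(norm h / R)\<^sup>2 \<le> (1 / 2 ^ K)\<^sup>2" using R by (intro power_mono) auto
        also have "(1 / 2 ^ K)\<^sup>2 = 1 / (4::real) ^ K"
          by (simp add: power_divide power2_eq_square flip: power_mult_distrib)
        finally have "C1 * (norm h / R)\<^sup>2 \<le> C1 * (1 / 4 ^ K)" using C1 by (intro mult_left_mono)
        then show "ennreal (1 / 4 ^ K + C1 * (norm h / R)\<^sup>2) \<le> ennreal ((1 + C1) / 4 ^ K)"
          by (intro ennreal_leI) (simp add: add_divide_distrib)
        show "SI (cball x (4 * R)) f \<le> ennreal (\<sigma> * ?v (4 * R))" using If[of "4 * R"] R by simp
      qed auto
      also have "\<dots> = ennreal ?Y" using C1 by (intro ennreal_mult'[symmetric]) simp
      finally show "SI (cball x R) (\<lambda>s. (norm (V (s + h) - V s) / 1)\<^sup>2) \<le> ennreal ?Y" .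
    qed (use \<rho>(1) in auto)
    also have "ennreal 16 * (ennreal 4 * ennreal ?Y) = ennreal (16 * (4 * ?Y))"
      by (simp only: ennreal_mult'[of 4, OF zero_le_numeral] ennreal_mult'[of 16, OF zero_le_numeral])
    also have "16 * (4 * ?Y) = C3 / 4 ^ K * (\<sigma> * ?v r)"
      using vol_mult[of 20 r, where 'a='a] by (simp add: C3_def R_def)
    finally show ?thesis by (simp add: R_def mult_left_mono)
  qed
  \<comment> \<open>\<open>VD'\<close> is applied with radii up to
    \<open>2 * R = 10 * r\<close>.\<close>
  then show ?thesis using R0 unfolding N_def by (intro exI[of _ "R0 / 10"]) auto
qed

end

lemma power_powr: "x > 0 \<Longrightarrow> (x ^ k) powr p = (x powr p) ^ k" for x p :: real
  by (induction k) (simp_all add: powr_mult)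

context small_differences
begin

text \<open>A Vitali covering makes the local decay global: at a stopping ball, at least half of the
  mass \<open>\<sigma> * ?v r\<close> lies where \<open>f x > \<sigma> / 2\<close>. The margin
  \<rho> between \<open>E\<close> and \<open>D'\<close> is an upper bound for the stopping
  radii.\<close>

lemma superlevel_step:
  fixes b :: real and K :: nat
  assumes b: "b > 1" "2 ^ DIM('a) / 4 \<le> b\<^sup>2"
  defines "C3 \<equiv> 64 * (1 + C1) * 20 ^ DIM('a)"
  defines "C5 \<equiv> sqrt (4 * 2 ^ DIM('a)) + sqrt (16 * 32 ^ DIM('a) * (1 + C1)) / (b - 1)"
  defines "N \<equiv> 16 * C5\<^sup>2 * b ^ (2 * K)"
  shows "\<exists>R0>0. \<forall>\<sigma> \<rho> E D'. \<sigma> > 0 \<longrightarrow> 0 < \<rho> \<longrightarrow> \<rho> \<le> R0 \<longrightarrow> SI UNIV f \<le> ennreal (\<sigma> * vol TYPE('a) \<rho>) \<longrightarrow>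
     2 * C0 \<le> N * \<sigma> \<longrightarrow> E \<in> sets borel \<longrightarrow> D' \<in> sets borel \<longrightarrow>
     (\<forall>x\<in>E. cball x (40 * \<rho>) \<subseteq> D) \<longrightarrow> (\<forall>x\<in>E. cball x \<rho> \<subseteq> D') \<longrightarrow>
     SI (E \<inter> {x. f x > N * \<sigma>}) f \<le> ennreal (2 * C3 / 4 ^ K) * SI (D' \<inter> {x. f x > \<sigma> / 2}) f"
proof -
  let ?v = "vol TYPE('a)"
  obtain R0 where R0: "R0 > 0" and ball: "\<And>x r \<sigma>. 0 < r \<Longrightarrow> r \<le> R0 \<Longrightarrow> \<sigma> > 0 \<Longrightarrow> cball x (40 * r) \<subseteq> D \<Longrightarrow> stopping f \<sigma> x r \<Longrightarrow>
     2 * C0 \<le> N * \<sigma> \<Longrightarrow> SI (cball x (5 * r) \<inter> {y. f y > N * \<sigma>}) f \<le> ennreal (C3 / 4 ^ K * (\<sigma> * ?v r))"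
    using superlevel_ball[OF b, of K] unfolding N_def C3_def C5_def by blast
  have C3: "C3 > 0" using C1 by (simp add: C3_def)
  have N1: "N \<ge> 1"
  proof -
    have "1 \<le> 4 * (2::real) ^ DIM('a)" using one_le_power[of "2::real" "DIM('a)"] by linarith
    then have "1 \<le> sqrt (4 * 2 ^ DIM('a))" by simp
    also have "\<dots> \<le> C5" using b C1 by (simp add: C5_def)
    finally have "1 \<le> C5\<^sup>2" by (rule one_le_power)
    moreover have "1 \<le> b ^ (2 * K)" using b by (intro one_le_power) simp
    ultimately have "1 * 1 \<le> C5\<^sup>2 * b ^ (2 * K)" by (intro mult_mono) auto
    then show ?thesis by (simp add: N_def)
  qed
  have main: "SI (E \<inter> {x. f x > N * \<sigma>}) f \<le> ennreal (2 * C3 / 4 ^ K) * SI (D' \<inter> {x. f x > \<sigma> / 2}) f"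
    if \<sigma>: "\<sigma> > 0" and \<rho>: "0 < \<rho>" "\<rho> \<le> R0" "SI UNIV f \<le> ennreal (\<sigma> * ?v \<rho>)" and CN: "2 * C0 \<le> N * \<sigma>"
      and [measurable]: "E \<in> sets borel" "D' \<in> sets borel"
      and ED: "\<And>x. x \<in> E \<Longrightarrow> cball x (40 * \<rho>) \<subseteq> D" "\<And>x. x \<in> E \<Longrightarrow> cball x \<rho> \<subseteq> D'" for \<sigma> \<rho> E D'
  proof -
    let ?g = "\<lambda>x. f x * indicat_real {x. f x > \<sigma> / 2} x"
    have "SI (E \<inter> {x. f x > N * \<sigma>}) f \<le> SI D' (\<lambda>x. 2 * C3 / 4 ^ K * ?g x)"
    proof (rule stopping_covering[OF f, where t=\<sigma> and \<rho>=\<rho> and m=1])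
      show "f x > \<sigma>" if "x \<in> E \<inter> {x. f x > N * \<sigma>}" for x
        using that mult_right_mono[OF N1, of \<sigma>] \<sigma> by (simp only: Int_iff mem_Collect_eq mult_1_left) linarith
      fix x r assume x: "x \<in> E \<inter> {x. f x > N * \<sigma>}" and r: "r \<le> \<rho>" and st: "stopping f \<sigma> x r"
      have r0: "r > 0" using st by (simp add: stopping_def)
      have "cball x (40 * r) \<subseteq> cball x (40 * \<rho>)" using r by (intro subset_cball) auto
      then have D40: "cball x (40 * r) \<subseteq> D" using ED(1)[of x] x by blast
      have vr: "?v r > 0" by (rule vol_pos[OF r0])
      have "ennreal (\<sigma> / 2 * ?v r) + ennreal (\<sigma> / 2 * ?v r) = ennreal (\<sigma> * ?v r)"
        using \<sigma> vr by (simp flip: ennreal_plus)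
      also have "\<dots> \<le> SI (cball x r) f" using st by (simp add: stopping_def)
      also have "\<dots> \<le> SI (cball x r) (\<lambda>x. ?g x + \<sigma> / 2)"
        by (rule SI_mono) (use \<sigma> in \<open>auto simp: indicator_def\<close>)
      also have "\<dots> = SI (cball x r) ?g + SI (cball x r) (\<lambda>x. \<sigma> / 2)"
        using \<sigma> f(2) by (intro SI_add) auto
      also have "SI (cball x r) (\<lambda>x. \<sigma> / 2) = ennreal (\<sigma> / 2 * ?v r)"
        using \<sigma> r0 by (simp only: SI_const borel_closed closed_cball emeasure_cball_vol less_imp_le) (simp add: ennreal_mult'[symmetric])
      finally have h: "ennreal (\<sigma> / 2 * ?v r) \<le> SI (cball x r) ?g"
        by (simp only: add.commute[of "SI _ _"] ennreal_add_left_cancel_le) simp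
      have "SI (E \<inter> {x. f x > N * \<sigma>} \<inter> cball x (5 * 1 * r)) f \<le> SI (cball x (5 * r) \<inter> {y. f y > N * \<sigma>}) f"
        by (rule SI_subset) auto
      also have "\<dots> \<le> ennreal (C3 / 4 ^ K * (\<sigma> * ?v r))" by (rule ball[OF r0 _ \<sigma> D40 st CN]) (use r \<rho> in simp)
      also have "\<dots> = ennreal (2 * C3 / 4 ^ K * (\<sigma> / 2 * ?v r))" by simp
      also have "\<dots> = ennreal (2 * C3 / 4 ^ K) * ennreal (\<sigma> / 2 * ?v r)" using C3 by (intro ennreal_mult') simp
      also have "\<dots> \<le> ennreal (2 * C3 / 4 ^ K) * SI (cball x r) ?g" by (intro mult_left_mono h) simp
      also have "\<dots> = SI (cball x (1 * r)) (\<lambda>x. 2 * C3 / 4 ^ K * ?g x)"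
        using C3 by (subst SI_cmult) auto
      finally show "SI (E \<inter> {x. f x > N * \<sigma>} \<inter> cball x (5 * 1 * r)) f \<le> SI (cball x (1 * r)) (\<lambda>x. 2 * C3 / 4 ^ K * ?g x)" .
    qed (use \<sigma> \<rho> ED in auto)
    also have "\<dots> = ennreal (2 * C3 / 4 ^ K) * SI D' ?g" using C3 by (intro SI_cmult) auto
    also have "SI D' ?g = SI (D' \<inter> {x. f x > \<sigma> / 2}) f"
      unfolding SI_def by (rule nn_integral_cong) (auto simp: indicator_def)
    finally show ?thesis .
  qed
  show ?thesis by (intro exI[of _ R0] conjI allI impI R0 main) auto
qed

text \<open>\<open>superlevel_step\<close> is iterated along the levels \<open>M ^ j * l\<close> on
  balls shrinking from radius \<open>2 * s\<close> towards \<open>s\<close>. The mass above these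
  levels decays like \<open>\<theta> ^ j\<close>, and the sum over the layers of
  \<open>f x powr (1 + p)\<close> converges because \<open>M powr p * \<theta>\<close> is below
  1.\<close>

lemma higher_integrability:
  fixes \<alpha> :: real
  assumes dim: "DIM('a) \<ge> 2" and \<alpha>: "0 < \<alpha>" "\<alpha> < 1" and s: "s > 0" "cball x1 (3 * s) \<subseteq> D"
  shows "SI (cball x1 s) (\<lambda>x. f x powr (real DIM('a) / (real DIM('a) - 2 * \<alpha>))) < \<infinity>"
proof -
  let ?v = "vol TYPE('a)"
  define n where "n = real DIM('a)"
  have n: "n \<ge> 2" using dim by (simp add: n_def)
  define p where "p = 2 * \<alpha> / (n - 2 * \<alpha>)"
  have nd: "n - 2 * \<alpha> > 0" using n \<alpha> by simp
  have p: "p > 0" using nd \<alpha> by (simp add: p_def)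
  have chi: "real DIM('a) / (real DIM('a) - 2 * \<alpha>) = 1 + p" using nd by (simp add: p_def n_def field_simps)
  \<comment> \<open>\<open>b\<^sup>2\<close> has to be at least \<open>2 powr (n - 2)\<close>, but \<open>(b\<^sup>2) powr p\<close> less than \<open>4\<close>.\<close>
  define b where "b = 2 powr (n / 2 - (1 + \<alpha>) / 2)"
  have b1: "b > 1" unfolding b_def by (rule gr_one_powr) (use n \<alpha> in auto)
  have bb: "b\<^sup>2 = 2 powr (n - (1 + \<alpha>))"
    by (simp add: b_def power2_eq_square flip: powr_add) (simp add: field_simps)
  have b2: "2 ^ DIM('a) / 4 \<le> b\<^sup>2"
  proof -
    have "2 ^ DIM('a) / 4 = 2 powr (n - 2)" by (simp add: n_def powr_diff powr_realpow)
    also have "\<dots> \<le> b\<^sup>2" unfolding bb by (rule powr_mono) (use \<alpha> in auto)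
    finally show ?thesis .
  qed
  define C3 where "C3 = 64 * (1 + C1) * 20 ^ DIM('a)"
  define C5 where "C5 = sqrt (4 * 2 ^ DIM('a)) + sqrt (16 * 32 ^ DIM('a) * (1 + C1)) / (b - 1)"
  have C3: "C3 > 0" using C1 by (simp add: C3_def)
  have C5: "C5 > 0" unfolding C5_def using b1 C1 by (intro add_pos_nonneg) auto
  \<comment> \<open>The factor by which \<open>M powr p * \<theta>\<close> changes when
    \<open>K\<close> grows by one. Being below 1, it beats all constants for large
    \<open>K\<close>.\<close>
  define q where "q = (b\<^sup>2) powr p / 4"
  have q: "0 < q" "q < 1"
  proof -
    show "0 < q" using b1 by (simp add: q_def)
    have "(n - (1 + \<alpha>)) * p < 2"
    proof -
      have "\<alpha> * (1 - \<alpha>) < n * (1 - \<alpha>)" using \<alpha> n by (intro mult_strict_right_mono) auto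
      then have "(n - (1 + \<alpha>)) * (2 * \<alpha>) < 2 * (n - 2 * \<alpha>)" by (simp add: algebra_simps)
      then show ?thesis using nd by (simp add: p_def divide_less_eq)
    qed
    then have "(b\<^sup>2) powr p < 2 powr 2" unfolding bb powr_powr by (intro powr_less_mono) auto
    then show "q < 1" by (simp add: q_def)
  qed
  have "(\<lambda>K. 2 * C3 * (32 * C5\<^sup>2) powr p * q ^ K) \<longlonglongrightarrow> 2 * C3 * (32 * C5\<^sup>2) powr p * 0"
    by (intro tendsto_intros LIMSEQ_realpow_zero) (use q in auto)
  then have ev1: "\<forall>\<^sub>F K in sequentially. 2 * C3 * (32 * C5\<^sup>2) powr p * q ^ K < 1 / 2"
    by (intro order_tendstoD(2)) auto
  have "b\<^sup>2 > 1" using b1 by (simp add: one_less_power)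
  then obtain k0 where k0: "2 ^ DIM('a) / (32 * C5\<^sup>2) < (b\<^sup>2) ^ k0" using real_arch_pow by blast
  have ev2: "\<forall>\<^sub>F K in sequentially. (b\<^sup>2) ^ K \<ge> 2 ^ DIM('a) / (32 * C5\<^sup>2)"
  proof (rule eventually_sequentiallyI[of k0])
    fix K assume "k0 \<le> K"
    then have "(b\<^sup>2) ^ k0 \<le> (b\<^sup>2) ^ K" by (intro power_increasing) (use \<open>b\<^sup>2 > 1\<close> in auto)
    then show "(b\<^sup>2) ^ K \<ge> 2 ^ DIM('a) / (32 * C5\<^sup>2)" using k0 by linarith
  qed
  \<comment> \<open>The second condition gives \<open>M \<ge> 2 ^ DIM('a)\<close>: raising the level
    by the factor \<open>M\<close> then makes up for the loss of volume when the margin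
    \<open>\<rho> / 2 ^ j\<close> is halved.\<close>
  obtain K where K: "2 * C3 * (32 * C5\<^sup>2) powr p * q ^ K < 1 / 2" "(b\<^sup>2) ^ K \<ge> 2 ^ DIM('a) / (32 * C5\<^sup>2)"
    using eventually_conj[OF ev1 ev2] by (auto simp: eventually_sequentially)
  define N where "N = 16 * C5\<^sup>2 * b ^ (2 * K)"
  \<comment> \<open>One step leads from level \<open>\<sigma> / 2\<close> to level
    \<open>N * \<sigma>\<close>, a ratio of \<open>2 * N\<close>.\<close>
  define M where "M = 2 * N"
  define \<theta> where "\<theta> = 2 * C3 / 4 ^ K"
  have bK: "b ^ (2 * K) = (b\<^sup>2) ^ K" by (simp only: power_mult)
  have M2n: "M \<ge> 2 ^ DIM('a)" using K(2) C5 unfolding M_def N_def bK by (simp add: divide_le_eq mult_ac del: power_even_eq)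
  have M1: "M \<ge> 1" using M2n one_le_power[of "2::real" "DIM('a)"] by linarith
  have \<theta>: "\<theta> > 0" using C3 by (simp add: \<theta>_def)
  have ratio: "M powr p * \<theta> < 1 / 2"
  proof -
    have "M powr p = (32 * C5\<^sup>2) powr p * ((b\<^sup>2) powr p) ^ K"
    proof -
      have "M = 32 * C5\<^sup>2 * (b\<^sup>2) ^ K" unfolding M_def N_def bK by simp
      then have "M powr p = (32 * C5\<^sup>2) powr p * ((b\<^sup>2) ^ K) powr p" using C5 by (simp only: powr_mult)
      then show ?thesis using b1 by (simp only: power_powr zero_less_power)
    qed
    then have "M powr p * \<theta> = 2 * C3 * (32 * C5\<^sup>2) powr p * q ^ K"
      by (simp add: \<theta>_def q_def power_divide)
    then show ?thesis using K(1) by simp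
  qed
  from superlevel_step[OF b1 b2, of K, folded C3_def C5_def, folded N_def \<theta>_def]
  obtain R0 where R0: "R0 > 0" and step0: "\<forall>\<sigma> \<rho> E D'. \<sigma> > 0 \<longrightarrow> 0 < \<rho> \<longrightarrow> \<rho> \<le> R0 \<longrightarrow> SI UNIV f \<le> ennreal (\<sigma> * ?v \<rho>) \<longrightarrow>
     2 * C0 \<le> N * \<sigma> \<longrightarrow> E \<in> sets borel \<longrightarrow> D' \<in> sets borel \<longrightarrow>
     (\<forall>x\<in>E. cball x (40 * \<rho>) \<subseteq> D) \<longrightarrow> (\<forall>x\<in>E. cball x \<rho> \<subseteq> D') \<longrightarrow>
     SI (E \<inter> {x. f x > N * \<sigma>}) f \<le> ennreal \<theta> * SI (D' \<inter> {x. f x > \<sigma> / 2}) f"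
    by (elim exE conjE)
  note step = step0[rule_format]
  obtain I where I: "I \<ge> 0" "SI UNIV f = ennreal I" by (rule SI_real[OF f])
  define \<rho> where "\<rho> = min R0 (s / 40)"
  have \<rho>: "\<rho> > 0" "\<rho> \<le> R0" "40 * \<rho> \<le> s" using R0 s by (auto simp: \<rho>_def)
  have v\<rho>: "?v \<rho> > 0" by (rule vol_pos[OF \<rho>(1)])
  \<comment> \<open>The first entry makes the total mass admissible for stopping radii up to \<rho>
    at level \<open>2 * l\<close>; the second dominates \<open>C0\<close> and keeps \<open>l\<close>
    positive.\<close>
  define l where "l = max (I / (2 * ?v \<rho>)) (C0 + 1)"
  have l: "l > 0" "l \<ge> C0" "I \<le> 2 * l * ?v \<rho>"
  proof -
    show "l > 0" "l \<ge> C0" using C0 by (auto simp: l_def)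
    have "I / (2 * ?v \<rho>) \<le> l" by (simp add: l_def)
    then show "I \<le> 2 * l * ?v \<rho>" using v\<rho> by (simp add: field_simps)
  qed
  define A where "A j = cball x1 (s * (1 + 1 / 2 ^ j)) \<inter> {x. f x > M ^ j * l}" for j :: nat
  have A_step: "SI (A (Suc j)) f \<le> ennreal \<theta> * SI (A j) f" for j
  proof -
    let ?\<rho> = "\<rho> / 2 ^ j"
    have \<rho>j: "?\<rho> > 0" "?\<rho> \<le> \<rho>" using \<rho>(1) by (auto simp: divide_le_eq mult_le_cancel_left1)
    have Mj: "M ^ j \<ge> 1" using M1 by (rule one_le_power)
    have "SI (cball x1 (s * (1 + 1 / 2 ^ Suc j)) \<inter> {x. f x > N * (2 * (M ^ j * l))}) f
      \<le> ennreal \<theta> * SI (cball x1 (s * (1 + 1 / 2 ^ j)) \<inter> {x. f x > 2 * (M ^ j * l) / 2}) f"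
    proof (rule step[of _ ?\<rho>])
      show "2 * (M ^ j * l) > 0" using Mj l by simp
      show "?\<rho> \<le> R0" using \<rho>j \<rho> by linarith
      have "2 * l * ?v \<rho> = 2 * l * ((2 ^ DIM('a)) ^ j * ?v ?\<rho>)"
      proof -
        have "?v \<rho> = ?v (2 ^ j * ?\<rho>)" by simp
        also have "\<dots> = (2 ^ j) ^ DIM('a) * ?v ?\<rho>" by (rule vol_mult)
        also have "((2::real) ^ j) ^ DIM('a) = (2 ^ DIM('a)) ^ j" by (simp only: power_mult[symmetric] mult.commute)
        finally show ?thesis by simp
      qed
      also have "\<dots> \<le> 2 * l * (M ^ j * ?v ?\<rho>)"
        using l M2n vol_nonneg[of ?\<rho>, where 'a='a] \<rho>j by (intro mult_left_mono mult_right_mono power_mono) auto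
      finally have "I \<le> 2 * l * (M ^ j * ?v ?\<rho>)" using l(3) by linarith
      then show "SI UNIV f \<le> ennreal (2 * (M ^ j * l) * ?v ?\<rho>)"
        unfolding I(2) by (intro ennreal_leI) (simp add: mult_ac)
      have "C0 \<le> 1 * l" using l by simp
      also have "\<dots> \<le> M ^ Suc j * l" using l M1 by (intro mult_right_mono one_le_power) auto
      also have "\<dots> = N * (2 * (M ^ j * l))" by (simp add: M_def)
      finally have "C0 \<le> N * (2 * (M ^ j * l))" .
      have "2 * C0 \<le> 2 * l" using l by simp
      also have "\<dots> \<le> 2 * (M ^ j * l)" using mult_right_mono[OF Mj, of l] l by simp
      also have "\<dots> \<le> N * (2 * (M ^ j * l))"
      proof -
        have "N \<ge> 1" using M2n power_increasing[of 2 "DIM('a)" "2::real"] dim by (simp add: M_def)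
        then show ?thesis using mult_right_mono[of 1 N "2 * (M ^ j * l)"] Mj l by simp
      qed
      finally show "2 * C0 \<le> N * (2 * (M ^ j * l))" .
      fix x assume x: "x \<in> cball x1 (s * (1 + 1 / 2 ^ Suc j))"
      have j2: "1 / 2 ^ Suc j \<le> (1/2::real)" using one_le_power[of "2::real" j] by (simp add: field_simps)
      have "s * (1 + 1 / 2 ^ Suc j) + 40 * ?\<rho> \<le> s * (1 + 1/2) + s"
        using j2 s \<rho>j \<rho> by (intro add_mono mult_left_mono) auto
      then have "cball x (40 * ?\<rho>) \<subseteq> cball x1 (3 * s)"
        using x s by (simp add: cball_subset_cball_iff dist_commute)
      then show "cball x (40 * ?\<rho>) \<subseteq> D" using s(2) by blast
      have "s * (1 + 1 / 2 ^ Suc j) + ?\<rho> \<le> s * (1 + 1 / 2 ^ j)"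
      proof -
        have "?\<rho> \<le> s / 2 / 2 ^ j" by (rule divide_right_mono) (use \<rho> in auto)
        then show ?thesis by (simp add: algebra_simps)
      qed
      then show "cball x ?\<rho> \<subseteq> cball x1 (s * (1 + 1 / 2 ^ j))"
        using x by (simp add: cball_subset_cball_iff dist_commute)
    qed (use \<rho>j in auto)
    also have "N * (2 * (M ^ j * l)) = M ^ Suc j * l" by (simp add: M_def)
    finally show ?thesis by (simp add: A_def)
  qed
  have A_bound: "SI (A j) f \<le> ennreal (\<theta> ^ j * I)" for j
  proof (induction j)
    case 0
    have "SI (A 0) f \<le> SI UNIV f" by (rule SI_subset) simp
    then show ?case by (simp add: I)
  next
    case (Suc j)
    have "SI (A (Suc j)) f \<le> ennreal \<theta> * ennreal (\<theta> ^ j * I)"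
      by (rule order_trans[OF A_step mult_left_mono[OF Suc]]) simp
    also have "\<dots> = ennreal (\<theta> ^ Suc j * I)" using \<theta> by (simp add: mult.assoc ennreal_mult'[symmetric])
    finally show ?case .
  qed
  \<comment> \<open>On the layer between \<open>M ^ j * l\<close> and \<open>M ^ Suc j * l\<close>,
    the power \<open>f x powr p\<close> is at most its value at the upper end.\<close>
  let ?h = "\<lambda>j x. (M ^ Suc j * l) powr p * (f x * indicat_real (A j) x)"
  have [measurable]: "A j \<in> sets borel" for j unfolding A_def by measurable
  have pt: "ennreal (f x powr (1 + p)) * indicator (cball x1 s) x
      \<le> ennreal (l powr p * f x) + (\<Sum>j. ennreal (?h j x))" for x
  proof (cases "x \<in> cball x1 s \<and> f x > l")
    case False
    show ?thesis
    proof (cases "x \<in> cball x1 s")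
      case True
      then have "f x \<le> l" using False by simp
      then have "f x powr (1 + p) \<le> l powr p * f x"
        using f(2)[of x] p by (cases "f x = 0") (auto simp: powr_add mult.commute intro!: mult_right_mono powr_mono2)
      then show ?thesis using True by (simp add: ennreal_leI add_increasing2)
    qed simp
  next
    case True
    have "\<exists>k. f x \<le> M ^ k * l"
    proof -
      have "2 \<le> M" using M2n power_increasing[of 1 "DIM('a)" "2::real"] dim by simp
      then obtain k where "f x / l < M ^ k" using real_arch_pow[of M "f x / l"] by auto
      then show ?thesis using l by (intro exI[of _ k]) (simp add: field_simps)
    qed
    define k where "k = (LEAST k. f x \<le> M ^ k * l)"
    have k1: "f x \<le> M ^ k * l" unfolding k_def by (rule LeastI_ex) fact
    have "k \<noteq> 0" using k1 True by (cases k) auto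
    then obtain j where j: "k = Suc j" by (cases k) auto
    have k2: "f x > M ^ j * l" using not_less_Least[of j "\<lambda>k. f x \<le> M ^ k * l"] unfolding k_def[symmetric] j by simp
    have xA: "x \<in> A j"
    proof -
      have "s \<le> s * (1 + 1 / 2 ^ j)" using s by (simp add: mult_le_cancel_left1)
      then show ?thesis using True k2 by (auto simp: A_def)
    qed
    have "f x powr (1 + p) = f x powr p * f x" using True l by (simp add: powr_add mult.commute)
    also have "\<dots> \<le> (M ^ Suc j * l) powr p * f x"
      using k1 True l p unfolding j by (intro mult_right_mono powr_mono2) auto
    also have "\<dots> = ?h j x" using xA by simp
    finally have "ennreal (f x powr (1 + p)) \<le> ennreal (?h j x)" by (rule ennreal_leI)
    also have "\<dots> \<le> (\<Sum>j. ennreal (?h j x))"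
      using sum_le_suminf[of "\<lambda>j. ennreal (?h j x)" "{j}"] by (simp add: summableI)
    finally show ?thesis using True by (simp add: add_increasing)
  qed
  have "SI (cball x1 s) (\<lambda>x. f x powr (1 + p)) \<le> (\<integral>\<^sup>+x. ennreal (l powr p * f x) + (\<Sum>j. ennreal (?h j x)) \<partial>lborel)"
    unfolding SI_def by (rule nn_integral_mono) (rule pt)
  also have "\<dots> = (\<integral>\<^sup>+x. ennreal (l powr p * f x) \<partial>lborel) + (\<Sum>j. \<integral>\<^sup>+x. ennreal (?h j x) \<partial>lborel)"
    by (simp add: nn_integral_add nn_integral_suminf)
  also have "\<dots> < \<infinity>"
  proof -
    have "(\<integral>\<^sup>+x. ennreal (l powr p * f x) \<partial>lborel) < \<infinity>"
      using f by (simp add: ennreal_mult' nn_integral_cmult nn_integral_eq_integral ennreal_mult_less_top)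
    moreover have "(\<Sum>j. \<integral>\<^sup>+x. ennreal (?h j x) \<partial>lborel) < \<infinity>"
    proof -
      let ?c = "(M * l) powr p * I"
      have "(\<integral>\<^sup>+x. ennreal (?h j x) \<partial>lborel) \<le> ennreal (?c * (1 / 2) ^ j)" for j
      proof -
        have "(\<integral>\<^sup>+x. ennreal (?h j x) \<partial>lborel) = ennreal ((M ^ Suc j * l) powr p) * SI (A j) f"
          unfolding SI_def by (subst nn_integral_cmult[symmetric], measurable)
            (auto intro!: nn_integral_cong simp: indicator_def ennreal_mult')
        also have "\<dots> \<le> ennreal ((M ^ Suc j * l) powr p) * ennreal (\<theta> ^ j * I)" by (intro mult_left_mono A_bound) simp
        also have "\<dots> = ennreal ((M ^ Suc j * l) powr p * (\<theta> ^ j * I))" by (rule ennreal_mult'[symmetric]) simp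
        also have "(M ^ Suc j * l) powr p * (\<theta> ^ j * I) = ?c * (M powr p * \<theta>) ^ j"
        proof -
          have "(M ^ Suc j * l) powr p = (M * l) powr p * (M powr p) ^ j"
          proof -
            have "M ^ Suc j * l = M * l * M ^ j" by simp
            then have "(M ^ Suc j * l) powr p = (M * l) powr p * (M ^ j) powr p" using M1 l by (simp only: powr_mult)
            then show ?thesis using M1 by (simp only: power_powr)
          qed
          then show ?thesis by (simp add: power_mult_distrib)
        qed
        also have "ennreal \<dots> \<le> ennreal (?c * (1 / 2) ^ j)"
          using ratio \<theta> I by (intro ennreal_leI mult_left_mono power_mono) auto
        finally show ?thesis .
      qed
      then have "(\<Sum>j. \<integral>\<^sup>+x. ennreal (?h j x) \<partial>lborel) \<le> (\<Sum>j. ennreal (?c * (1 / 2) ^ j))"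
        by (intro suminf_le) (auto intro: summableI)
      also have "\<dots> = ennreal (\<Sum>j. ?c * (1 / 2) ^ j)"
        using I by (intro suminf_ennreal2) (auto intro!: summable_mult summable_geometric)
      finally show ?thesis by (simp add: le_less_trans)
    qed
    ultimately show ?thesis by simp
  qed
  finally show ?thesis unfolding chi .
qed

end

section \<open>Energy estimates\<close>

text \<open>With this form, absorption is done pointwise before integrating, so no possibly infinite
  integrals are subtracted. If the integral of \<open>k\<close> is infinite there is nothing to
  show.\<close>

lemma zero_integral_bound:
  fixes h g k :: "'a::euclidean_space \<Rightarrow> real"
  assumes h: "integrable lborel h" "(\<integral>x. h x \<partial>lborel) = 0"
    and g: "g \<in> borel_measurable borel" "\<And>x. g x \<ge> 0" and k: "k \<in> borel_measurable borel" "\<And>x. k x \<ge> 0"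
    and le: "AE x in lborel. g x \<le> h x + k x"
  shows "SI UNIV g \<le> SI UNIV k"
proof (cases "SI UNIV k < \<infinity>")
  case True
  have ki: "integrable lborel k"
    using True k by (simp add: integrable_iff_bounded SI_def)
  have "SI UNIV g \<le> (\<integral>\<^sup>+x. ennreal (h x + k x) \<partial>lborel)"
    unfolding SI_def by (rule nn_integral_mono_AE, rule eventually_mono[OF le]) (simp add: ennreal_leI)
  also have "\<dots> = ennreal (\<integral>x. h x + k x \<partial>lborel)"
  proof (rule nn_integral_eq_integral)
    show "AE x in lborel. 0 \<le> h x + k x" by (rule eventually_mono[OF le]) (use g(2) in \<open>auto intro: order_trans\<close>)
  qed (use h ki in auto)
  also have "\<dots> = SI UNIV k" using h ki k by (simp add: SI_integrable)
  finally show ?thesis .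
next
  case False
  then have "SI UNIV k = \<infinity>" by (simp add: less_top[symmetric])
  then show ?thesis by simp
qed

section \<open>Young inequalities for growth functions\<close>

context
  fixes c :: real and P :: "real \<Rightarrow> real" assumes P: "qf c P"
begin

lemma orlicz_bound:
  fixes f :: "'a::euclidean_space \<Rightarrow> 'b::euclidean_space" and g :: "'a \<Rightarrow> 'c::euclidean_space"
  assumes [measurable]: "f \<in> borel_measurable borel" and g: "orlicz P g"
    and M: "M \<ge> 0" "\<And>x. norm (f x) \<le> M * norm (g x)"
  shows "orlicz P f"
proof -
  note [measurable] = qf_borel[OF P]
  obtain C where C: "C > 0" "\<And>t. t \<ge> 0 \<Longrightarrow> P (M * t) \<le> C * P t" using qf_mult_bound[OF P M(1)] by blast
  have "P (norm (f x)) \<le> C * P (norm (g x))" for x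
    using qf_mono[OF P norm_ge_zero M(2)[of x]] C(2)[of "norm (g x)"] by simp
  then show ?thesis
    by (intro integrable_bound[OF integrable_mult_right[OF g, of C]])
      (use C qf_nonneg[OF P] in auto)
qed

lemma orlicz_add:
  fixes f g :: "'a::euclidean_space \<Rightarrow> 'b::euclidean_space"
  assumes [measurable]: "f \<in> borel_measurable borel" "g \<in> borel_measurable borel"
    and f: "orlicz P f" and g: "orlicz P g"
  shows "orlicz P (\<lambda>x. f x + g x)"
proof -
  note [measurable] = qf_borel[OF P]
  have "P (norm (f x + g x)) \<le> c * (P (norm (f x)) + P (norm (g x)))" for x
    using qf_mono[OF P norm_ge_zero norm_triangle_ineq[of "f x" "g x"]] qf_add[OF P, of "norm (f x)" "norm (g x)"] by simp
  then show ?thesis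
    by (intro integrable_bound[OF integrable_mult_right[OF integrable_add[OF f g], of c]])
      (use qf_c[OF P] qf_nonneg[OF P] in auto)
qed

lemma orlicz_compact:
  fixes f :: "'a::euclidean_space \<Rightarrow> 'b::euclidean_space"
  assumes [measurable]: "f \<in> borel_measurable borel" and M: "\<And>x. norm (f x) \<le> M" and K: "compact K" "\<And>x. x \<notin> K \<Longrightarrow> f x = 0"
  shows "orlicz P f"
proof -
  note [measurable] = qf_borel[OF P]
  have i: "integrable lborel (\<lambda>x. P M * indicat_real K x)"
    using emeasure_compact_finite[OF K(1)] K(1) by (intro integrable_mult_right integrable_real_indicator) (auto simp: borel_compact)
  have "norm (P (norm (f x))) \<le> norm (P M * indicat_real K x)" for x
    using K(2)[of x] qf_mono[OF P norm_ge_zero M[of x]] qf_nonneg[OF P] qf_zero[OF P] by (cases "x \<in> K") auto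
  then show ?thesis by (intro integrable_bound[OF i]) auto
qed

text \<open>The cases \<open>t \<le> m\<close> and \<open>t > m\<close> take the place of the
  complementary function, and \<open>P m / m\<close> that of the derivative.\<close>

lemma qf_young: "m > 0 \<Longrightarrow> t \<ge> 0 \<Longrightarrow> P m / m * t \<le> P m + P t"
proof (cases "t \<le> m")
  assume "m > 0" "t \<ge> 0"
  case True
  have "P m / m * t \<le> P m / m * m" using True \<open>m > 0\<close> qf_nonneg[OF P] by (intro mult_left_mono) auto
  then show ?thesis using \<open>m > 0\<close> qf_nonneg[OF P, of t] by simp
next
  assume "m > 0" "t \<ge> 0"
  case False
  then have "P m / m * t \<le> P t / t * t" using \<open>m > 0\<close> by (intro mult_right_mono qf_ratio[OF P]) auto
  then show ?thesis using False \<open>m > 0\<close> qf_nonneg[OF P, of m] by simp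
qed

text \<open>Doubling limits the growth of \<open>P\<close> to a power: with
  \<open>c \<le> 2 ^ k\<close>, each doubling of the argument costs at most a factor
  \<open>2 ^ k\<close>. The number \<open>i\<close> counts the doublings that reach
  \<open>1 / z\<close>.\<close>

lemma qf_divide:
  assumes k: "c \<le> 2 ^ k" and z: "0 < z" "z \<le> 1" and t: "t \<ge> 0"
  shows "z ^ k * P (t / z) \<le> c * P t"
proof -
  have c: "c \<ge> 1" by (rule qf_c[OF P])
  have ex: "\<exists>j. 1 / z < 2 ^ j" using real_arch_pow[of 2 "1 / z"] by auto
  define i where "i = (LEAST j. 1 / z < 2 ^ j)"
  have i1: "1 / z < 2 ^ i" unfolding i_def by (rule LeastI_ex[OF ex])
  have "i \<noteq> 0"
  proof
    assume "i = 0"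
    then show False using i1 z by (simp add: divide_less_eq)
  qed
  then obtain j where j: "i = Suc j" by (cases i) auto
  have j1: "2 ^ j \<le> 1 / z" using not_less_Least[of j "\<lambda>j. 1 / z < 2 ^ j"] unfolding i_def[symmetric] j by simp
  have "t / z = 1 / z * t" by simp
  also have "\<dots> \<le> 2 ^ Suc j * t" using i1 t unfolding j by (intro mult_right_mono) auto
  finally have "P (t / z) \<le> P (2 ^ Suc j * t)" using z t by (intro qf_mono[OF P]) auto
  also have "\<dots> \<le> c ^ Suc j * P t" by (rule qf_power[OF P t])
  also have "\<dots> \<le> c * (1 / z) ^ k * P t"
  proof (rule mult_right_mono[OF _ qf_nonneg[OF P]])
    have "c ^ j \<le> (2 ^ k) ^ j" using k c by (intro power_mono) auto
    also have "\<dots> = (2 ^ j) ^ k" by (simp only: power_mult[symmetric] mult.commute)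
    also have "\<dots> \<le> (1 / z) ^ k" using j1 by (intro power_mono) auto
    finally show "c ^ Suc j \<le> c * (1 / z) ^ k" using c by simp
  qed
  finally have "z ^ k * P (t / z) \<le> z ^ k * (c * (1 / z) ^ k * P t)" using z by (intro mult_left_mono) auto
  also have "\<dots> = c * P t" using z by (simp add: power_divide)
  finally show ?thesis .
qed

text \<open>The gradient of a cut-off \<open>z ^ k\<close> leaves only \<open>z ^ (k - 1)\<close>,
  while the term that absorbs it carries \<open>z ^ k\<close>. Either the missing factor comes from
  \<open>M * s \<le> \<theta> * z * m\<close>, or \<open>m\<close> is below
  \<open>M / \<theta> * s / z\<close> and \<open>qf_divide\<close> pays for the division by
  \<open>z\<close>.\<close>

lemma qf_young_cutoff:
  assumes k: "c \<le> 2 ^ k" "k \<ge> 2" and \<theta>: "\<theta> > 0" and M: "M \<ge> 0"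
  shows "\<exists>C>0. \<forall>m s z. m > 0 \<longrightarrow> s \<ge> 0 \<longrightarrow> 0 \<le> z \<longrightarrow> z \<le> 1 \<longrightarrow>
     P m / m * (M * s) * z ^ (k - 1) \<le> \<theta> * z ^ k * P m + C * P s"
proof -
  obtain C where C: "C > 0" "\<And>t. t \<ge> 0 \<Longrightarrow> P (M / \<theta> * t) \<le> C * P t"
    using qf_mult_bound[OF P, of "M / \<theta>"] M \<theta> by auto
  have c: "c \<ge> 1" by (rule qf_c[OF P])
  have "P m / m * (M * s) * z ^ (k - 1) \<le> \<theta> * z ^ k * P m + \<theta> * (c * C) * P s"
    if m: "m > 0" and s: "s \<ge> 0" and z: "0 \<le> z" "z \<le> 1" for m s z
  proof (cases "z = 0")
    case True
    then show ?thesis using k C c \<theta> qf_nonneg[OF P, of s] by (simp add: power_0_left)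
  next
    case False
    then have z0: "z > 0" using z by simp
    have zk: "z * z ^ (k - 1) = z ^ k" using k by (cases k) auto
    show ?thesis
    proof (cases "M * s \<le> \<theta> * z * m")
      case True
      have "P m / m * (M * s) * z ^ (k - 1) \<le> P m / m * (\<theta> * z * m) * z ^ (k - 1)"
        using True m qf_nonneg[OF P, of m] z by (intro mult_right_mono mult_left_mono) auto
      also have "\<dots> = \<theta> * (z * z ^ (k - 1)) * P m" using m by simp
      also have "\<dots> = \<theta> * z ^ k * P m" by (simp only: zk)
      also have "\<dots> \<le> \<theta> * z ^ k * P m + \<theta> * (c * C) * P s" using \<theta> c C qf_nonneg[OF P, of s] by simp
      finally show ?thesis .
    next
      case False
      define t where "t = M / \<theta> * s / z"
      have tm: "m < t" using False \<theta> z0 by (simp add: t_def field_simps)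
      have "P m / m * (M * s) * z ^ (k - 1) \<le> P t / t * (M * s) * z ^ (k - 1)"
        using m tm M s z by (intro mult_right_mono qf_ratio[OF P]) auto
      also have "\<dots> = \<theta> * ((z * z ^ (k - 1)) * P t)"
      proof -
        have "M * s = t * \<theta> * z" using \<theta> z0 by (simp add: t_def)
        then show ?thesis using tm m by simp
      qed
      also have "\<dots> = \<theta> * (z ^ k * P (M / \<theta> * s / z))" by (simp only: zk t_def)
      also have "\<dots> \<le> \<theta> * (c * P (M / \<theta> * s))"
        using \<theta> M s z z0 k by (intro mult_left_mono qf_divide) auto
      also have "\<dots> \<le> \<theta> * (c * (C * P s))" using C(2)[OF s] c \<theta> by (intro mult_left_mono) auto
      also have "\<dots> \<le> \<theta> * z ^ k * P m + \<theta> * (c * C) * P s" using \<theta> z qf_nonneg[OF P, of m] by (simp add: mult.assoc)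
      finally show ?thesis .
    qed
  qed
  then show ?thesis using \<theta> c C by (intro exI[of _ "\<theta> * (c * C)"]) auto
qed

end

abbreviation bracket :: "real \<Rightarrow> 'a::real_normed_vector \<Rightarrow> real" where
  "bracket \<mu> \<xi> \<equiv> sqrt (\<mu>\<^sup>2 + (norm \<xi>)\<^sup>2)"

text \<open>
  Here \<open>U\<close> and \<open>F\<close> are a cut-off solution and its gradient, globally integrable and unchanged on
  \<open>D\<close>; the field \<open>a\<close> stands for \<open>A x (F x)\<close>.
\<close>

locale energy =
  fixes c :: real and P :: "real \<Rightarrow> real" and \<mu> :: real and D :: "'a::euclidean_space set"
    and U :: "'a \<Rightarrow> real" and F a :: "'a \<Rightarrow> 'a" and \<kappa> c0 K0 :: real
  assumes P: "qf c P" and P_sq: "\<And>s t. 0 < s \<Longrightarrow> s \<le> t \<Longrightarrow> P s / s\<^sup>2 \<le> P t / t\<^sup>2" and P1: "P 1 = 1"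
    and \<mu>: "\<mu> > 0" and P\<mu>: "P \<mu> > 0" and D: "open D"
    and w: "wgrad U F" and PU: "orlicz P U" and PF: "orlicz P F"
    and wD: "integrable lborel (\<lambda>x. indicat_real D x * P (bracket \<mu> (F x)))"
    and a: "a \<in> borel_measurable borel" and a0: "\<And>x. x \<notin> D \<Longrightarrow> a x = 0"
    and \<kappa>: "\<kappa> \<ge> 0" and aP: "AE x in lborel. x \<in> D \<longrightarrow> norm (a x) \<le> \<kappa> * (P (bracket \<mu> (F x)) / bracket \<mu> (F x))"
    and c0: "c0 > 0" and K0: "K0 \<ge> 0"
    and coercive: "AE x in lborel. x \<in> D \<longrightarrow> a x \<bullet> F x \<ge> c0 * P (bracket \<mu> (F x)) - K0"
    and sol: "\<And>\<phi>. \<phi> \<in> tests D \<Longrightarrow> (\<integral>x. a x \<bullet> gr \<phi> x \<partial>lborel) = 0"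
begin

definition m :: "'a \<Rightarrow> real" where "m x = bracket \<mu> (F x)"

definition f :: "'a \<Rightarrow> real" where "f x = indicat_real D x * P (m x)"

lemma meas [measurable]: "U \<in> borel_measurable borel" "F \<in> borel_measurable borel" "P \<in> borel_measurable borel"
  "a \<in> borel_measurable borel" "D \<in> sets borel" "m \<in> borel_measurable borel" "f \<in> borel_measurable borel"
proof -
  show [measurable]: "U \<in> borel_measurable borel" "F \<in> borel_measurable borel" "P \<in> borel_measurable borel"
    "a \<in> borel_measurable borel" "D \<in> sets borel"
    using wgradD[OF w] qf_borel[OF P] a D by auto
  show [measurable]: "m \<in> borel_measurable borel" unfolding m_def[abs_def] by measurable
  show "f \<in> borel_measurable borel" unfolding f_def[abs_def] by measurable
qed

lemma m_pos: "m x > 0" using \<mu> by (simp add: m_def add_pos_nonneg)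

lemma m_ge: "norm (F x) \<le> m x" "\<mu> \<le> m x"
  using \<mu> by (auto simp: m_def intro!: real_le_rsqrt)

lemma f_int: "integrable lborel f" using wD by (simp add: f_def[abs_def] m_def)

lemma f_nonneg: "f x \<ge> 0" by (simp add: f_def qf_nonneg[OF P])

lemma f_D: "x \<in> D \<Longrightarrow> f x = P (m x)" by (simp add: f_def)

lemma PF_le: "P (norm (F x)) \<le> P (m x)" by (intro qf_mono[OF P] norm_ge_zero m_ge)

lemma PF_f: "x \<in> D \<Longrightarrow> P (norm (F x)) \<le> f x" by (simp add: f_D PF_le)

lemma young: "AE x in lborel. x \<in> D \<longrightarrow> (\<forall>t\<ge>0. norm (a x) * t \<le> \<kappa> * f x + \<kappa> * P t)"
  using aP
proof eventually_elim
  case (elim x)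
  show ?case
  proof (intro impI allI)
    fix t :: real assume x: "x \<in> D" and t: "t \<ge> 0"
    have "norm (a x) * t \<le> \<kappa> * (P (m x) / m x) * t" using elim x t by (intro mult_right_mono) (auto simp: m_def)
    also have "\<dots> \<le> \<kappa> * (P (m x) + P t)" using mult_left_mono[OF qf_young[OF P m_pos[of x] t] \<kappa>] by (simp add: mult.assoc)
    finally show "norm (a x) * t \<le> \<kappa> * f x + \<kappa> * P t" using x by (simp add: f_D algebra_simps)
  qed
qed

lemma test:
  assumes "wgrad \<psi> \<Psi>" "compact K" "K \<subseteq> D" "\<And>x. x \<notin> K \<Longrightarrow> \<psi> x = 0" "\<And>x. x \<notin> K \<Longrightarrow> \<Psi> x = 0"
    "orlicz P \<Psi>"
  shows "integrable lborel (\<lambda>x. a x \<bullet> \<Psi> x)" "(\<integral>x. a x \<bullet> \<Psi> x \<partial>lborel) = 0"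
  using test_extension[OF P a sol _ \<kappa> young assms(1-3) D assms(4-6)] f_int by auto

text \<open>The equation is tested with \<open>U - d\<close> times the \<open>k\<close>-th power of
  a cut-off, \<open>k\<close> being large enough for the growth of \<open>P\<close> that the cut-off
  term can be absorbed. The summand 1 on the right carries the constant \<open>K0\<close> of the
  coercivity.\<close>

lemma caccioppoli:
  "\<exists>C>0. \<forall>x0 R d. R > 0 \<longrightarrow> cball x0 (2 * R) \<subseteq> D \<longrightarrow>
     SI (cball x0 R) f \<le> ennreal C * SI (cball x0 (2 * R)) (\<lambda>x. P (\<bar>U x - d\<bar> / R) + 1)"
proof -
  obtain B where B: "B > 0" and cut: "\<And>(x0::'a) R. R > 0 \<Longrightarrow> \<exists>\<eta>. smooth \<eta> \<and> (\<forall>x. 0 \<le> \<eta> x \<and> \<eta> x \<le> 1) \<and>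
     (\<forall>x\<in>cball x0 R. \<eta> x = 1) \<and> (\<forall>x. x \<notin> cball x0 (2 * R) \<longrightarrow> \<eta> x = 0) \<and> (\<forall>x. norm (gr \<eta> x) \<le> B / R)"
    using ball_cutoffs[where 'a='a] by blast
  obtain k0 where k0: "c < 2 ^ k0" using real_arch_pow[of 2 c] by auto
  define k where "k = k0 + 2"
  have "(2::real) ^ k0 \<le> 2 ^ k" by (rule power_increasing) (auto simp: k_def)
  then have k: "c \<le> 2 ^ k" "k \<ge> 2" using k0 by (linarith, simp add: k_def)
  define M where "M = \<kappa> * (real k * B)"
  have M: "M \<ge> 0" using \<kappa> B by (simp add: M_def)
  obtain C where C: "C > 0" and yc: "\<And>m s z. m > 0 \<Longrightarrow> s \<ge> 0 \<Longrightarrow> 0 \<le> z \<Longrightarrow> z \<le> 1 \<Longrightarrow>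
     P m / m * (M * s) * z ^ (k - 1) \<le> c0 / 2 * z ^ k * P m + C * P s"
    using qf_young_cutoff[OF P k half_gt_zero[OF c0] M] by blast
  have main: "SI (cball x0 R) f \<le> ennreal (2 * (C + K0) / c0) * SI (cball x0 (2 * R)) (\<lambda>x. P (\<bar>U x - d\<bar> / R) + 1)"
    if R: "R > 0" and RD: "cball x0 (2 * R) \<subseteq> D" for x0 R d
  proof -
    let ?B = "cball x0 (2 * R)"
    obtain \<zeta> where \<zeta>: "smooth \<zeta>" "\<And>x. 0 \<le> \<zeta> x" "\<And>x. \<zeta> x \<le> 1" "\<And>x. x \<in> cball x0 R \<Longrightarrow> \<zeta> x = 1"
      "\<And>x. x \<notin> ?B \<Longrightarrow> \<zeta> x = 0" "\<And>x. norm (gr \<zeta> x) \<le> B / R" using cut[OF R, of x0] by blast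
    define \<eta> where "\<eta> x = \<zeta> x ^ k" for x
    have \<eta>s: "smooth \<eta>" unfolding \<eta>_def[abs_def] by (rule smooth_power[OF \<zeta>(1)])
    have \<eta>0: "\<eta> x = 0" if "x \<notin> ?B" for x using \<zeta>(5)[OF that] k by (simp add: \<eta>_def)
    have \<eta>c: "csupp \<eta>" by (rule csupp_compact[OF compact_cball \<eta>0])
    have \<eta>1: "0 \<le> \<eta> x" "\<eta> x \<le> 1" for x using \<zeta>(2,3)[of x] by (auto simp: \<eta>_def power_le_one)
    have gr\<eta>: "gr \<eta> x = (real k * \<zeta> x ^ (k - 1)) *\<^sub>R gr \<zeta> x" for x
    proof -
      have "((\<lambda>x. \<zeta> x ^ k) has_derivative (\<lambda>v. real k * \<zeta> x ^ (k - 1) * dd \<zeta> x v)) (at x)"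
        by (rule derivative_eq_intros smooth_has_derivative[OF \<zeta>(1)] refl)+ (auto simp: mult_ac)
      from dd_eq[OF this] show ?thesis
        unfolding \<eta>_def[abs_def] gr_def by (simp add: scaleR_sum_right)
    qed
    have gr\<eta>b: "norm (gr \<eta> x) \<le> real k * \<zeta> x ^ (k - 1) * (B / R)" for x
      using mult_left_mono[OF \<zeta>(6)[of x], of "real k * \<zeta> x ^ (k - 1)"] \<zeta>(2)[of x] by (simp add: gr\<eta> abs_mult)
    have gr\<eta>0: "gr \<eta> x = 0" if "x \<notin> ?B" for x by (rule gr_outside[OF compact_cball \<eta>0 that])
    note [measurable] = smooth_borel[OF \<eta>s] gr_borel[OF \<eta>s] smooth_borel[OF \<zeta>(1)]
    have d\<eta>: "smooth (\<lambda>x. d * \<eta> x)" "csupp (\<lambda>x. d * \<eta> x)"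
      by (intro smooth_mult smooth_const \<eta>s csupp_const_mult \<eta>c)+
    \<comment> \<open>A nonzero constant \<open>d\<close> is not integrable on the whole space, so
      \<eta> times \<open>U - d\<close> is formed as the difference of \<open>\<eta> x * U x\<close>
      and the compactly supported \<open>d * \<eta> x\<close>.\<close>
    define \<Psi> where "\<Psi> x = \<eta> x *\<^sub>R F x + U x *\<^sub>R gr \<eta> x - gr (\<lambda>x. d * \<eta> x) x" for x
    have wg: "wgrad (\<lambda>x. \<eta> x * U x - d * \<eta> x) \<Psi>"
      unfolding \<Psi>_def[abs_def] by (rule wgrad_diff[OF wgrad_mult[OF \<eta>s \<eta>c w] wgrad_smooth[OF d\<eta>]])
    have dgr: "gr (\<lambda>x. d * \<eta> x) x = d *\<^sub>R gr \<eta> x" for x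
      using gr_mult[OF smooth_const \<eta>s, of d x] by (simp add: gr_def dd_eq[OF has_derivative_const])
    have \<Psi>: "\<Psi> x = \<eta> x *\<^sub>R F x + (U x - d) *\<^sub>R gr \<eta> x" for x
      by (simp add: \<Psi>_def dgr algebra_simps)
    have grM: "norm (gr \<eta> x) \<le> real k * B / R" for x
    proof -
      have "real k * \<zeta> x ^ (k - 1) * (B / R) \<le> real k * 1 * (B / R)"
        using B R \<zeta>(2,3)[of x] by (intro mult_right_mono mult_left_mono power_le_one) auto
      then show ?thesis using gr\<eta>b[of x] by simp
    qed
    have PI: "orlicz P \<Psi>"
      unfolding \<Psi>_def diff_conv_add_uminus dgr
    proof (intro orlicz_add[OF P])
      show "orlicz P (\<lambda>x. \<eta> x *\<^sub>R F x)"
        by (rule orlicz_bound[OF P _ PF, of _ 1]) (use \<eta>1 in \<open>auto intro!: mult_left_le_one_le\<close>)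
      show "orlicz P (\<lambda>x. U x *\<^sub>R gr \<eta> x)"
      proof (rule orlicz_bound[OF P _ PU])
        show "norm (U x *\<^sub>R gr \<eta> x) \<le> (real k * B / R) * norm (U x)" for x
          using mult_left_mono[OF grM[of x], of "\<bar>U x\<bar>"] by (simp add: mult.commute)
      qed (use B R in auto)
      show "orlicz P (\<lambda>x. - (d *\<^sub>R gr \<eta> x))"
      proof (rule orlicz_compact[OF P _ _ compact_cball[of x0 "2 * R"]])
        show "norm (- (d *\<^sub>R gr \<eta> x)) \<le> \<bar>d\<bar> * (real k * B / R)" for x
          using mult_left_mono[OF grM[of x], of "\<bar>d\<bar>"] by simp
      qed (use gr\<eta>0 in auto)
    qed measurable
    have T: "integrable lborel (\<lambda>x. a x \<bullet> \<Psi> x)" "(\<integral>x. a x \<bullet> \<Psi> x \<partial>lborel) = 0"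
      by (rule test[OF wg compact_cball RD _ _ PI]; simp add: \<eta>0 gr\<eta>0 \<Psi> del: mem_cball)+
    let ?s = "\<lambda>x. \<bar>U x - d\<bar> / R"
    have "SI UNIV (\<lambda>x. indicat_real ?B x * (c0 / 2 * (\<eta> x * P (m x))))
        \<le> SI UNIV (\<lambda>x. indicat_real ?B x * ((C + K0) * (P (?s x) + 1)))"
    proof (rule zero_integral_bound[OF T])
      show "AE x in lborel. indicat_real ?B x * (c0 / 2 * (\<eta> x * P (m x)))
          \<le> a x \<bullet> \<Psi> x + indicat_real ?B x * ((C + K0) * (P (?s x) + 1))"
        using aP coercive
      proof eventually_elim
        case (elim x)
        show ?case
        proof (cases "x \<in> ?B")
          case False then show ?thesis by (simp add: \<Psi> \<eta>0 gr\<eta>0 del: mem_cball)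
        next
          case True
          then have xD: "x \<in> D" using RD by blast
          have 1: "\<eta> x * (a x \<bullet> F x) \<ge> \<eta> x * (c0 * P (m x) - K0)"
            using elim(2) xD \<eta>1[of x] by (intro mult_left_mono) (auto simp: m_def)
          have K: "\<eta> x * K0 \<le> K0" using \<eta>1[of x] K0 by (simp add: mult_left_le_one_le)
          have s0: "?s x \<ge> 0" using R by simp
          have "\<bar>(U x - d) * (a x \<bullet> gr \<eta> x)\<bar> \<le> \<bar>U x - d\<bar> * (norm (a x) * norm (gr \<eta> x))"
            unfolding abs_mult by (intro mult_left_mono Cauchy_Schwarz_ineq2) simp
          also have "\<dots> \<le> \<bar>U x - d\<bar> * (\<kappa> * (P (m x) / m x) * (real k * \<zeta> x ^ (k - 1) * (B / R)))"
            using elim(1) xD gr\<eta>b[of x] \<kappa> m_pos[of x] qf_nonneg[OF P, of "m x"]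
            by (intro mult_left_mono mult_mono) (auto simp: m_def)
          also have "\<dots> = P (m x) / m x * (M * ?s x) * \<zeta> x ^ (k - 1)" by (simp add: M_def)
          also have "\<dots> \<le> c0 / 2 * \<zeta> x ^ k * P (m x) + C * P (?s x)"
            using \<zeta>(2,3)[of x] by (intro yc m_pos s0)
          finally have 2: "\<bar>(U x - d) * (a x \<bullet> gr \<eta> x)\<bar> \<le> c0 / 2 * (\<eta> x * P (m x)) + C * P (?s x)" by (simp add: \<eta>_def)
          have "a x \<bullet> \<Psi> x = \<eta> x * (a x \<bullet> F x) + (U x - d) * (a x \<bullet> gr \<eta> x)" by (simp add: \<Psi> inner_add_right)
          moreover have "\<eta> x * (c0 * P (m x) - K0) = c0 * (\<eta> x * P (m x)) - \<eta> x * K0" by (simp add: algebra_simps)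
          ultimately have "c0 / 2 * (\<eta> x * P (m x)) \<le> a x \<bullet> \<Psi> x + (C * P (?s x) + K0)"
            using 1 2 K by linarith
          moreover have "C * P (?s x) + K0 \<le> (C + K0) * (P (?s x) + 1)"
            using C K0 qf_nonneg[OF P, of "?s x"] by (simp add: algebra_simps)
          ultimately show ?thesis using True by (simp del: mem_cball)
        qed
      qed
    qed (use \<eta>1 qf_nonneg[OF P] c0 C K0 in auto)
    also have "SI UNIV (\<lambda>x. indicat_real ?B x * ((C + K0) * (P (?s x) + 1))) = SI ?B (\<lambda>x. (C + K0) * (P (?s x) + 1))"
      unfolding SI_def by (rule nn_integral_cong) (auto simp: indicator_def)
    finally have 1: "SI UNIV (\<lambda>x. indicat_real ?B x * (c0 / 2 * (\<eta> x * P (m x)))) \<le> SI ?B (\<lambda>x. (C + K0) * (P (?s x) + 1))" .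
    have "SI (cball x0 R) f = SI (cball x0 R) (\<lambda>x. 2 / c0 * (c0 / 2 * f x))" using c0 by simp
    also have "\<dots> = ennreal (2 / c0) * SI (cball x0 R) (\<lambda>x. c0 / 2 * f x)" using c0 by (intro SI_cmult) auto
    also have "SI (cball x0 R) (\<lambda>x. c0 / 2 * f x) \<le> SI UNIV (\<lambda>x. indicat_real ?B x * (c0 / 2 * (\<eta> x * P (m x))))"
    proof (rule SI_mono)
      fix x assume x: "x \<in> cball x0 R"
      then have "x \<in> ?B" using R by auto
      moreover have "\<eta> x = 1" using \<zeta>(4)[OF x] by (simp add: \<eta>_def)
      ultimately show "x \<in> UNIV \<and> c0 / 2 * f x \<le> indicat_real ?B x * (c0 / 2 * (\<eta> x * P (m x)))"
        using RD by (simp add: f_D subset_iff)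
    qed
    also note 1
    also have "SI ?B (\<lambda>x. (C + K0) * (P (?s x) + 1)) = ennreal (C + K0) * SI ?B (\<lambda>x. P (?s x) + 1)"
      using C K0 by (intro SI_cmult) auto
    also have "ennreal (2 / c0) * (ennreal (C + K0) * SI ?B (\<lambda>x. P (?s x) + 1)) = ennreal (2 * (C + K0) / c0) * SI ?B (\<lambda>x. P (?s x) + 1)"
    proof -
      have "ennreal (2 / c0) * ennreal (C + K0) = ennreal (2 / c0 * (C + K0))" using c0 C K0 by (intro ennreal_mult[symmetric]) auto
      then show ?thesis by (simp only: mult.assoc[symmetric] times_divide_eq_left)
    qed
    finally show ?thesis by (simp add: mult_left_mono)
  qed
  have "2 * (C + K0) / c0 > 0" using C K0 c0 by (simp add: add_pos_nonneg)
  then show ?thesis using main by blast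
qed

section \<open>Reverse Hoelder inequality for the energy\<close>

lemma P_scale_sq: "0 \<le> \<theta> \<Longrightarrow> \<theta> \<le> 1 \<Longrightarrow> 0 \<le> t \<Longrightarrow> P (\<theta> * t) \<le> \<theta>\<^sup>2 * P t"
proof -
  assume a: "0 \<le> \<theta>" "\<theta> \<le> 1" "0 \<le> t"
  show ?thesis
  proof (cases "\<theta> * t = 0")
    case True then show ?thesis using qf_nonneg[OF P] qf_zero[OF P] by auto
  next
    case False
    then have p: "0 < \<theta> * t" using a by (simp add: less_le)
    have "P (\<theta> * t) / (\<theta> * t)\<^sup>2 \<le> P t / t\<^sup>2" by (rule P_sq[OF p]) (use a in \<open>simp add: mult_left_le_one_le\<close>)
    then show ?thesis using p a False by (simp add: divide_simps power_mult_distrib mult_ac split: if_splits)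
  qed
qed

text \<open>Monotonicity of \<open>P t / t\<^sup>2\<close> becomes the ratio condition for
  \<open>sqrt (P t)\<close> after taking roots, so all estimates for growth functions apply to the
  root as well.\<close>

lemma qf_sqrt: "qf (sqrt c) (\<lambda>t. sqrt (P t))"
  unfolding qf_def
proof (intro conjI allI impI)
  show "continuous_on UNIV (\<lambda>t. sqrt (P t))" by (intro continuous_on_real_sqrt qf_cont[OF P])
  show "sqrt c \<ge> 1" "sqrt (P 0) = 0" "0 \<le> sqrt (P t)" for t
    using qf_c[OF P] qf_zero[OF P] qf_nonneg[OF P] by auto
  show "sqrt (P s) / s \<le> sqrt (P t) / t" if "0 < s" "s \<le> t" for s t
  proof -
    have "sqrt (P s / s\<^sup>2) \<le> sqrt (P t / t\<^sup>2)" using P_sq[OF that] by simp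
    then show ?thesis using that by (simp add: real_sqrt_divide)
  qed
  show "sqrt (P (2 * t)) \<le> sqrt c * sqrt (P t)" if "t \<ge> 0" for t
    using qf_double[OF P that] by (simp add: real_sqrt_mult[symmetric])
qed

text \<open>The value \<open>P 1 = 1\<close> calibrates the comparison: up to 1 the root is at most
  \<open>t\<close>, beyond 1 at most \<open>P t\<close>.\<close>

lemma sqrt_P_int: "integrable lborel (\<lambda>x. sqrt (P (norm (F x))))"
proof (rule integrable_bound)
  show "integrable lborel (\<lambda>x. norm (F x) + P (norm (F x)))" using wgradD(2)[OF w] PF by auto
  have "sqrt (P t) \<le> t + P t" if t: "t \<ge> 0" for t
  proof (cases "t \<le> 1")
    case True
    have "sqrt (P (t * 1)) \<le> t * sqrt (P 1)" by (rule qf_scale[OF qf_sqrt]) (use t True in auto)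
    then show ?thesis using P1 qf_nonneg[OF P, of t] by simp
  next
    case False
    have "1 \<le> P t" using qf_mono[OF P, of 1 t] P1 False by simp
    then have "sqrt (P t) \<le> P t" by (intro real_le_lsqrt) (auto simp: power2_eq_square mult_le_cancel_left1)
    then show ?thesis using t by simp
  qed
  then show "AE x in lborel. norm (sqrt (P (norm (F x)))) \<le> norm (norm (F x) + P (norm (F x)))"
    using qf_nonneg[OF P] by (intro AE_I2) simp
qed measurable

lemma SI_PF: "A \<subseteq> D \<Longrightarrow> SI A (\<lambda>x. P (norm (F x))) \<le> SI A f"
  by (rule SI_mono) (use PF_f in auto)

lemma SI_sqrt_PF: "A \<subseteq> D \<Longrightarrow> SI A (\<lambda>x. sqrt (P (norm (F x)))) \<le> SI A (\<lambda>x. sqrt (f x))"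
  by (rule SI_mono) (use PF_f in auto)

lemma increment_scale:
  fixes h :: 'a
  shows "R > 0 \<Longrightarrow> \<bar>U (s + h) - U s\<bar> / R = norm h / R * (\<bar>U (s + h) - U s\<bar> / norm h)"
  by (cases "h = 0") auto

text \<open>In the Caccioppoli inequality \<open>d\<close> is the mean of \<open>U\<close>, and
  \<open>U - d\<close> is split at the means \<open>A\<close> over balls of the much smaller radius
  \<open>\<delta> * R\<close>. The distance from \<open>U\<close> to \<open>A\<close> sees short
  displacements only and gains \<open>\<delta>\<^sup>2\<close>; the distance from \<open>A\<close>
  to \<open>d\<close> is a difference of two means, bounded pointwise through the integral of
  \<open>sqrt (f x)\<close>.\<close>

lemma rev_holder_f: "rev_holder D f"
  unfolding rev_holder_def
proof (intro allI impI)
  fix \<epsilon> :: real assume \<epsilon>: "\<epsilon> > 0"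
  let ?n = "DIM('a)" and ?v = "vol TYPE('a)"
  define \<omega> where "\<omega> = unit_ball_vol (real ?n)"
  have \<omega>: "\<omega> > 0" unfolding \<omega>_def by (rule unit_ball_vol_dim)
  have v: "?v r = \<omega> * r ^ ?n" for r by (simp add: vol_def \<omega>_def)
  have c: "c \<ge> 1" by (rule qf_c[OF P])
  obtain C where C: "C > 0" and cac: "\<And>x0 R d. R > 0 \<Longrightarrow> cball x0 (2 * R) \<subseteq> D \<Longrightarrow>
     SI (cball x0 R) f \<le> ennreal C * SI (cball x0 (2 * R)) (\<lambda>x. P (\<bar>U x - d\<bar> / R) + 1)"
    using caccioppoli by blast
  \<comment> \<open>Makes the total coefficient \<open>C * c ^ 4 * \<delta>\<^sup>2\<close> of the
    first term at most \<epsilon>; the bound by 1 is for \<open>P_scale_sq\<close>.\<close>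
  define \<delta> where "\<delta> = min 1 (sqrt (\<epsilon> / (C * c ^ 4)))"
  have \<delta>: "\<delta> > 0" "\<delta> \<le> 1" using \<epsilon> C c by (auto simp: \<delta>_def)
  have \<delta>\<epsilon>: "C * c ^ 4 * \<delta>\<^sup>2 \<le> \<epsilon>"
  proof -
    have "\<delta>\<^sup>2 \<le> (sqrt (\<epsilon> / (C * c ^ 4)))\<^sup>2" using \<delta> by (intro power_mono) (auto simp: \<delta>_def)
    also have "\<dots> = \<epsilon> / (C * c ^ 4)" using \<epsilon> C c by simp
    finally show ?thesis using C c by (simp add: field_simps)
  qed
  \<comment> \<open>Points of the two balls compared in \<open>t2\<close> are at most
    \<open>5 * R\<close> apart. With these displacements \<open>difference_quotient\<close> reaches
    out to radius \<open>3 * R + 10 * R\<close>, within \<open>16 * R\<close>.\<close>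
  obtain C5 where C5: "C5 > 0" and c5: "\<And>t. t \<ge> 0 \<Longrightarrow> sqrt (P (5 * t)) \<le> C5 * sqrt (P t)"
    using qf_mult_bound[OF qf_sqrt, of 5] by auto
  define K where "K = c * c * C5 * 5 ^ ?n / (\<delta> ^ ?n * 2 ^ ?n * \<omega>)"
  have K: "K > 0" using c C5 \<delta> \<omega> by (simp add: K_def)
  define C' where "C' = C * c * (\<omega> * 2 ^ ?n * K\<^sup>2) + C / (P \<mu> * \<omega> * 16 ^ ?n)"
  have C': "C' > 0" unfolding C'_def using C c \<omega> K P\<mu> by (intro add_pos_pos) auto
  have main: "SI (cball x0 R) f \<le> ennreal \<epsilon> * SI (cball x0 (16 * R)) f
       + ennreal (C' / R ^ ?n) * (SI (cball x0 (16 * R)) (\<lambda>x. sqrt (f x)))\<^sup>2"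
    if R: "R > 0" and RD: "cball x0 (16 * R) \<subseteq> D" for x0 R
  proof -
    let ?B2 = "cball x0 (2 * R)"
    let ?q = "\<lambda>h s. \<bar>U (s + h) - U s\<bar> / norm h" and ?w = "1 / (P \<mu> * \<omega> * 16 ^ ?n * R ^ ?n)"
    define S where "S = SI (cball x0 (16 * R)) (\<lambda>x. sqrt (f x))"
    let ?K2 = "ennreal ((K / R ^ ?n)\<^sup>2) * S\<^sup>2"
    define Sf where "Sf = SI (cball x0 (16 * R)) f"
    have sub: "cball x0 t \<subseteq> D" if "t \<le> 16 * R" for t
      by (rule subset_trans[OF subset_cball[OF that] RD])
    define \<rho> where "\<rho> = \<delta> * R"
    have \<rho>: "\<rho> > 0" "\<rho> \<le> R" using R \<delta> by (auto simp: \<rho>_def mult_left_le_one_le)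
    have mb: "measure lborel (cball y t) = ?v t" if "t \<ge> 0" for y :: 'a and t
      using that by (simp add: measure_def emeasure_cball_vol vol_nonneg)
    have fin: "emeasure lborel (cball y t) < \<infinity>" for y :: 'a and t by (rule emeasure_lborel_cball_finite)
    have Ui: "integrable lborel (\<lambda>z. indicat_real (cball y t) z *\<^sub>R U z)" for y t
      using wgradD(1)[OF w] by (intro integrable_mult_indicator) auto
    define d where "d = avg ?B2 U"
    define A where "A y = avg (cball y \<rho>) U" for y
    have [measurable]: "A \<in> borel_measurable borel" unfolding A_def using \<rho> by (intro avg_borel) auto
    have t1: "SI ?B2 (\<lambda>y. P (\<bar>U y - A y\<bar> / R)) \<le> ennreal c * (ennreal (\<delta>\<^sup>2 * (c * c)) * Sf)"
    proof -
      have "SI ?B2 (\<lambda>y. P (norm (U y - avg (cball y \<rho>) U) / R)) \<le> ennreal c * (ennreal (\<delta>\<^sup>2 * (c * c)) * Sf)"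
      proof (rule avg_ball_approx[OF P R _ _ \<rho>(1) Ui])
        fix h :: 'a assume h: "norm h \<le> \<rho>"
        have "SI ?B2 (\<lambda>s. P (norm (U (s + h) - U s) / R)) \<le> SI ?B2 (\<lambda>s. \<delta>\<^sup>2 * P (?q h s))"
        proof (rule SI_mono, intro conjI)
          fix s
          have hR: "norm h / R \<le> \<delta>" using h R by (simp add: \<rho>_def divide_le_eq)
          have "P (norm (U (s + h) - U s) / R) = P (norm h / R * (?q h s))"
            using increment_scale[OF R, of s h] by simp
          also have "\<dots> \<le> (norm h / R)\<^sup>2 * P (?q h s)"
            using order_trans[OF hR \<delta>(2)] R by (intro P_scale_sq) auto
          also have "\<dots> \<le> \<delta>\<^sup>2 * P (?q h s)"
            using hR R by (intro mult_right_mono power_mono qf_nonneg[OF P]) auto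
          finally show "P (norm (U (s + h) - U s) / R) \<le> \<delta>\<^sup>2 * P (?q h s)" .
        qed
        also have "\<dots> = ennreal (\<delta>\<^sup>2) * SI ?B2 (\<lambda>s. P (?q h s))"
          by (rule SI_cmult) auto
        also have "SI ?B2 (\<lambda>s. P (?q h s)) \<le> ennreal (c * c) * SI (cball x0 (2 * R + 2 * norm h)) (\<lambda>y. P (norm (F y)))"
          by (rule difference_quotient[OF P w PF])
        also have "SI (cball x0 (2 * R + 2 * norm h)) (\<lambda>y. P (norm (F y))) \<le> Sf"
          unfolding Sf_def
          by (rule order_trans[OF SI_PF SI_subset]) (use h \<rho> R in \<open>auto intro!: sub subset_cball\<close>)
        also have "ennreal (\<delta>\<^sup>2) * (ennreal (c * c) * Sf) = ennreal (\<delta>\<^sup>2 * (c * c)) * Sf"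
          using c by (simp add: mult.assoc[symmetric] flip: ennreal_mult)
        finally show "SI ?B2 (\<lambda>s. P (norm (U (s + h) - U s) / R)) \<le> ennreal (\<delta>\<^sup>2 * (c * c)) * Sf"
          by (simp add: mult_left_mono)
      qed auto
      then show ?thesis by (simp add: A_def)
    qed
    have t2: "ennreal (P (\<bar>A y - d\<bar> / R)) \<le> ?K2" if y: "y \<in> ?B2" for y
    proof -
      have "ennreal (sqrt (P (norm (avg (cball y \<rho>) U - avg ?B2 U) / R)))
         \<le> ennreal (sqrt c * sqrt c * ?v (5 * R) / (measure lborel (cball y \<rho>) * measure lborel ?B2)) * (ennreal (C5 * c) * S)"
      proof (rule avg_diff_jensen[OF qf_sqrt R])
        show "norm (z - s) \<le> 5 * R" if "s \<in> cball y \<rho>" "z \<in> ?B2" for s z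
        proof -
          have "norm (z - s) \<le> dist z x0 + dist x0 y + dist y s"
            using dist_triangle[of z s x0] dist_triangle[of x0 s y] by (simp add: dist_norm)
          then show ?thesis using that y \<rho> by (simp add: dist_commute)
        qed
        show "0 < measure lborel (cball y \<rho>)" "0 < measure lborel ?B2" using \<rho> R by (auto simp: mb intro!: vol_pos)
        fix h :: 'a assume h: "norm h \<le> 5 * R"
        have "SI {s \<in> cball y \<rho>. s + h \<in> ?B2} (\<lambda>s. sqrt (P (norm (U (s + h) - U s) / R)))
          \<le> SI (cball x0 (3 * R)) (\<lambda>s. C5 * sqrt (P (?q h s)))"
        proof (rule SI_mono, intro conjI)
          fix s assume "s \<in> {s \<in> cball y \<rho>. s + h \<in> ?B2}"
          then have s: "s \<in> cball y \<rho>" by simp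
          have "cball y \<rho> \<subseteq> cball x0 (3 * R)" using y \<rho> by (simp add: cball_subset_cball_iff dist_commute)
          then show "s \<in> cball x0 (3 * R)" using s by blast
          have hR: "norm h / R \<le> 5" using h R by (simp add: divide_le_eq)
          have "norm (U (s + h) - U s) / R = norm h / R * (?q h s)"
            using increment_scale[OF R, of s h] by simp
          also have "\<dots> \<le> 5 * (?q h s)" by (intro mult_right_mono hR) auto
          finally have "sqrt (P (norm (U (s + h) - U s) / R)) \<le> sqrt (P (5 * (?q h s)))"
            using R by (intro qf_mono[OF qf_sqrt]) auto
          also have "\<dots> \<le> C5 * sqrt (P (?q h s))" by (rule c5) simp
          finally show "sqrt (P (norm (U (s + h) - U s) / R)) \<le> C5 * sqrt (P (?q h s))" .
        qed
        also have "\<dots> = ennreal C5 * SI (cball x0 (3 * R)) (\<lambda>s. sqrt (P (?q h s)))"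
          by (rule SI_cmult) (use C5 in auto)
        also have "SI (cball x0 (3 * R)) (\<lambda>s. sqrt (P (?q h s)))
           \<le> ennreal (sqrt c * sqrt c) * SI (cball x0 (3 * R + 2 * norm h)) (\<lambda>y. sqrt (P (norm (F y))))"
          by (rule difference_quotient[OF qf_sqrt w sqrt_P_int])
        also have "SI (cball x0 (3 * R + 2 * norm h)) (\<lambda>y. sqrt (P (norm (F y)))) \<le> S"
          unfolding S_def
          by (rule order_trans[OF SI_sqrt_PF SI_subset]) (use h R in \<open>auto intro!: sub subset_cball\<close>)
        also have "ennreal C5 * (ennreal (sqrt c * sqrt c) * S) = ennreal (C5 * c) * S"
          using c C5 by (simp add: mult.assoc[symmetric] flip: ennreal_mult)
        finally show "SI {s \<in> cball y \<rho>. s + h \<in> ?B2} (\<lambda>s. sqrt (P (norm (U (s + h) - U s) / R))) \<le> ennreal (C5 * c) * S"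
          by (simp add: mult_left_mono)
      qed (use fin R Ui in auto)
      also have "\<dots> = ennreal (K / R ^ ?n) * S"
      proof -
        have "sqrt c * sqrt c * ?v (5 * R) / (measure lborel (cball y \<rho>) * measure lborel ?B2) * (C5 * c) = K / R ^ ?n"
          using c \<rho> R \<omega> \<delta> by (simp add: mb v K_def \<rho>_def power_mult_distrib field_simps)
        moreover have "ennreal (sqrt c * sqrt c * ?v (5 * R) / (measure lborel (cball y \<rho>) * measure lborel ?B2)) * ennreal (C5 * c)
          = ennreal (sqrt c * sqrt c * ?v (5 * R) / (measure lborel (cball y \<rho>) * measure lborel ?B2) * (C5 * c))"
          using c C5 by (intro ennreal_mult''[symmetric]) simp
        ultimately show ?thesis by (simp only: mult.assoc[symmetric])
      qed
      finally have "ennreal (sqrt (P (\<bar>A y - d\<bar> / R))) \<le> ennreal (K / R ^ ?n) * S" by (simp add: A_def d_def)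
      then have "(ennreal (sqrt (P (\<bar>A y - d\<bar> / R))))\<^sup>2 \<le> (ennreal (K / R ^ ?n) * S)\<^sup>2" by (rule power_mono) simp
      then show ?thesis using K R qf_nonneg[OF P] by (simp add: power_mult_distrib ennreal_power)
    qed
    \<comment> \<open>This deals with the summand 1 of the Caccioppoli inequality: since
      \<open>f\<close> is at least \<open>P \<mu>\<close> on \<open>D\<close>, the volume of the
      ball is itself controlled by \<open>S\<^sup>2\<close>.\<close>
    have S2: "ennreal (?v (2 * R)) \<le> ennreal ?w * S\<^sup>2"
    proof -
      have "ennreal (sqrt (P \<mu>) * ?v (16 * R)) = SI (cball x0 (16 * R)) (\<lambda>x. sqrt (P \<mu>))"
        using R qf_nonneg[OF P] by (simp add: SI_const emeasure_cball_vol ennreal_mult')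
      also have "\<dots> \<le> S"
        unfolding S_def by (rule SI_mono) (use RD \<mu> m_ge in \<open>auto simp: f_D subset_iff intro!: qf_mono[OF P]\<close>)
      finally have "(ennreal (sqrt (P \<mu>) * ?v (16 * R)))\<^sup>2 \<le> S\<^sup>2" by (rule power_mono) simp
      then have s: "ennreal (P \<mu> * (?v (16 * R))\<^sup>2) \<le> S\<^sup>2"
        using R P\<mu> vol_nonneg[of "16 * R", where 'a='a] by (simp add: ennreal_power power_mult_distrib)
      have "?v (2 * R) \<le> ?v (16 * R)" using R by (intro vol_mono) auto
      also have "\<dots> = ?w * (P \<mu> * (?v (16 * R))\<^sup>2)"
        using P\<mu> \<omega> R by (simp add: v power2_eq_square power_mult_distrib)
      finally have "ennreal (?v (2 * R)) \<le> ennreal (?w * (P \<mu> * (?v (16 * R))\<^sup>2))"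
        by (rule ennreal_leI)
      also have "\<dots> = ennreal ?w * ennreal (P \<mu> * (?v (16 * R))\<^sup>2)"
        using P\<mu> \<omega> R by (intro ennreal_mult') simp
      also have "\<dots> \<le> ennreal ?w * S\<^sup>2" by (rule mult_left_mono[OF s]) simp
      finally show ?thesis .
    qed
    have "SI (cball x0 R) f \<le> ennreal C * SI ?B2 (\<lambda>x. P (\<bar>U x - d\<bar> / R) + 1)"
      by (rule cac[OF R]) (use R in \<open>auto intro!: sub\<close>)
    also have "SI ?B2 (\<lambda>x. P (\<bar>U x - d\<bar> / R) + 1)
      \<le> SI ?B2 (\<lambda>x. c * P (\<bar>U x - A x\<bar> / R) + (c * P (\<bar>A x - d\<bar> / R) + 1))"
    proof (rule SI_mono, intro conjI)
      fix x
      have "P (\<bar>U x - d\<bar> / R) \<le> P (\<bar>U x - A x\<bar> / R + \<bar>A x - d\<bar> / R)"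
        using R by (intro qf_mono[OF P]) (auto simp: add_divide_distrib[symmetric] intro!: divide_right_mono)
      also have "\<dots> \<le> c * (P (\<bar>U x - A x\<bar> / R) + P (\<bar>A x - d\<bar> / R))" using R by (intro qf_add[OF P]) auto
      finally show "P (\<bar>U x - d\<bar> / R) + 1 \<le> c * P (\<bar>U x - A x\<bar> / R) + (c * P (\<bar>A x - d\<bar> / R) + 1)"
        by (simp add: algebra_simps)
    qed
    also have "\<dots> = ennreal c * SI ?B2 (\<lambda>x. P (\<bar>U x - A x\<bar> / R)) + (ennreal c * SI ?B2 (\<lambda>x. P (\<bar>A x - d\<bar> / R)) + ennreal (?v (2 * R)))"
      using c qf_nonneg[OF P] R
      by (simp add: SI_add SI_cmult SI_const emeasure_cball_vol)
    also have "\<dots> \<le> ennreal c * (ennreal c * (ennreal (\<delta>\<^sup>2 * (c * c)) * Sf))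
       + (ennreal c * (ennreal (?v (2 * R)) * ?K2) + ennreal ?w * S\<^sup>2)"
    proof (intro add_mono mult_left_mono t1 S2)
      have "SI ?B2 (\<lambda>x. P (\<bar>A x - d\<bar> / R)) \<le> (\<integral>\<^sup>+x. ?K2 * indicator ?B2 x \<partial>lborel)"
        unfolding SI_def by (rule nn_integral_mono) (use t2 in \<open>auto simp: indicator_def\<close>)
      also have "\<dots> = ennreal (?v (2 * R)) * ?K2"
        using R by (subst nn_integral_cmult_indicator) (auto simp: emeasure_cball_vol mult.commute)
      finally show "SI ?B2 (\<lambda>x. P (\<bar>A x - d\<bar> / R)) \<le> ennreal (?v (2 * R)) * ?K2" .
    qed auto
    finally have "SI (cball x0 R) f \<le> ennreal C * (ennreal c * (ennreal c * (ennreal (\<delta>\<^sup>2 * (c * c)) * Sf))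
       + (ennreal c * (ennreal (?v (2 * R)) * ?K2) + ennreal ?w * S\<^sup>2))"
      by (simp add: mult_left_mono)
    also have "\<dots> = ennreal C * (ennreal c * (ennreal c * ennreal (\<delta>\<^sup>2 * (c * c)))) * Sf
       + (ennreal C * (ennreal c * (ennreal (?v (2 * R)) * ennreal ((K / R ^ ?n)\<^sup>2))) + ennreal C * ennreal ?w) * S\<^sup>2"
      by (simp add: distrib_left distrib_right mult.assoc)
    also have "ennreal C * (ennreal c * (ennreal c * ennreal (\<delta>\<^sup>2 * (c * c)))) = ennreal (C * c ^ 4 * \<delta>\<^sup>2)"
      using C c by (simp add: power4_eq_xxxx mult_ac flip: ennreal_mult)
    also have "ennreal C * (ennreal c * (ennreal (?v (2 * R)) * ennreal ((K / R ^ ?n)\<^sup>2))) + ennreal C * ennreal ?w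
       = ennreal (C' / R ^ ?n)"
    proof -
      have v0: "?v (2 * R) \<ge> 0" using R by (intro vol_nonneg) simp
      have "ennreal C * (ennreal c * (ennreal (?v (2 * R)) * ennreal ((K / R ^ ?n)\<^sup>2))) + ennreal C * ennreal ?w
        = ennreal (C * (c * (?v (2 * R) * (K / R ^ ?n)\<^sup>2)) + C * ?w)"
        using C c v0 P\<mu> \<omega> R by (simp only: ennreal_mult[symmetric] ennreal_plus[symmetric] mult_nonneg_nonneg zero_le_power2 less_imp_le order_trans[OF zero_le_one] zero_le_divide_1_iff zero_le_power zero_le_numeral)
      also have "C * (c * (?v (2 * R) * (K / R ^ ?n)\<^sup>2)) + C * ?w = C' / R ^ ?n"
        using R by (simp add: C'_def v power_divide power_mult_distrib add_divide_distrib power2_eq_square)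
      finally show ?thesis .
    qed
    also have "ennreal (C * c ^ 4 * \<delta>\<^sup>2) * Sf + ennreal (C' / R ^ ?n) * S\<^sup>2 \<le> ennreal \<epsilon> * Sf + ennreal (C' / R ^ ?n) * S\<^sup>2"
      by (intro add_right_mono mult_right_mono ennreal_leI \<delta>\<epsilon>) simp
    finally show ?thesis unfolding S_def Sf_def .
  qed
  show "\<exists>C>0. \<forall>x0 R. R > 0 \<longrightarrow> cball x0 (16 * R) \<subseteq> D \<longrightarrow>
     SI (cball x0 R) f \<le> ennreal \<epsilon> * SI (cball x0 (16 * R)) f
       + ennreal (C / R ^ ?n) * (SI (cball x0 (16 * R)) (\<lambda>x. sqrt (f x)))\<^sup>2"
    using C' main by (intro exI[of _ C'] conjI allI impI) auto
qed

section \<open>Differences of the gradient\<close>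

definition Mh :: "'a \<Rightarrow> 'a \<Rightarrow> real" where "Mh h x = sqrt (\<mu>\<^sup>2 + (norm (F x))\<^sup>2 + (norm (F (x + h)))\<^sup>2)"

text \<open>The weight of the monotonicity and growth conditions at the pair of gradients
  \<open>F x\<close> and \<open>F (x + h)\<close>.\<close>

definition q :: "'a \<Rightarrow> 'a \<Rightarrow> real" where "q h x = P (Mh h x) / (Mh h x)\<^sup>2"

lemma Mh_pos: "Mh h x > 0" using \<mu> by (simp add: Mh_def add_pos_nonneg)

lemma q_nonneg: "q h x \<ge> 0" by (simp add: q_def qf_nonneg[OF P])

lemma q_borel [measurable]: "q h \<in> borel_measurable borel"
  unfolding q_def[abs_def] Mh_def[abs_def] by measurable

lemma Mh_le: "Mh h x \<le> m x + m (x + h)"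
  unfolding Mh_def
proof (rule real_le_lsqrt)
  have "\<mu>\<^sup>2 + (norm (F x))\<^sup>2 + (norm (F (x + h)))\<^sup>2 \<le> (m x)\<^sup>2 + (m (x + h))\<^sup>2"
    by (simp add: m_def)
  also have "\<dots> \<le> (m x + m (x + h))\<^sup>2" using m_pos[of x] m_pos[of "x + h"] by (simp add: power2_sum)
  finally show "\<mu>\<^sup>2 + (norm (F x))\<^sup>2 + (norm (F (x + h)))\<^sup>2 \<le> (m x + m (x + h))\<^sup>2" .
qed (use m_pos[of x] m_pos[of "x + h"] in auto)

text \<open>For \<open>t \<le> Mh h x\<close> the left side is at most \<open>P (Mh h x)\<close>;
  beyond, \<open>P_sq\<close> lets \<open>t\<close> take the place of \<open>Mh h x\<close>. In the
  application \<open>t\<close> is a difference quotient of \<open>U\<close>, whose size is unrelated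
  to the gradients at the two points.\<close>

lemma q_square_le:
  assumes "t \<ge> 0" shows "q h x * t\<^sup>2 \<le> c * (P (m x) + P (m (x + h))) + P t"
proof -
  have c: "c \<ge> 1" by (rule qf_c[OF P])
  have PM: "P (Mh h x) \<le> c * (P (m x) + P (m (x + h)))"
    using qf_mono[OF P less_imp_le[OF Mh_pos] Mh_le] qf_add[OF P less_imp_le[OF m_pos] less_imp_le[OF m_pos]] by (rule order_trans)
  show ?thesis
  proof (cases "t \<le> Mh h x")
    case True
    have "q h x * t\<^sup>2 \<le> q h x * (Mh h x)\<^sup>2" using True assms by (intro mult_left_mono power_mono q_nonneg)
    also have "\<dots> = P (Mh h x)" using Mh_pos[of h x] by (simp add: q_def)
    finally show ?thesis using PM qf_nonneg[OF P, of t] by simp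
  next
    case False
    then have "q h x \<le> P t / t\<^sup>2" unfolding q_def by (intro P_sq Mh_pos) simp
    then have "q h x * t\<^sup>2 \<le> P t / t\<^sup>2 * t\<^sup>2" by (rule mult_right_mono) simp
    also have "\<dots> = P t" using False Mh_pos[of h x] by simp
    finally show ?thesis using c qf_nonneg[OF P, of "m x"] qf_nonneg[OF P, of "m (x + h)"] by (simp add: add_increasing)
  qed
qed

lemma a_int:
  assumes [measurable]: "\<Phi> \<in> borel_measurable borel" and PI: "orlicz P \<Phi>"
  shows "integrable lborel (\<lambda>x. a x \<bullet> \<Phi> x)"
proof (rule integrable_bound)
  show "integrable lborel (\<lambda>x. \<kappa> * f x + \<kappa> * P (norm (\<Phi> x)))" using f_int PI by auto
  show "AE x in lborel. norm (a x \<bullet> \<Phi> x) \<le> norm (\<kappa> * f x + \<kappa> * P (norm (\<Phi> x)))"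
    using young
  proof eventually_elim
    case (elim x)
    show ?case
    proof (cases "x \<in> D")
      case True
      have "norm (a x \<bullet> \<Phi> x) \<le> norm (a x) * norm (\<Phi> x)" unfolding real_norm_def by (rule Cauchy_Schwarz_ineq2)
      also have "\<dots> \<le> \<kappa> * f x + \<kappa> * P (norm (\<Phi> x))" using elim True by simp
      finally show ?thesis by simp
    qed (simp add: a0)
  qed
qed measurable

text \<open>Two weighted Young inequalities spend \<open>\<upsilon> / 4 * X\<^sup>2\<close> each. In
  \<open>difference_estimate\<close>, \<open>X\<close> is the weighted difference of gradients,
  \<open>Y\<close> comes from the oscillation of the field and \<open>Z\<close> from the gradient of
  the cut-off.\<close>

lemma quadratic_absorb:
  fixes X Y Z L \<upsilon> :: real
  assumes "\<upsilon> > 0"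
  shows "\<upsilon> / 2 * X\<^sup>2 \<le> (\<upsilon> * X\<^sup>2 - X * Y - 2 * Z * (L * X + Y)) + (1 / \<upsilon> + 1 + 4 * L\<^sup>2 / \<upsilon>) * (Y\<^sup>2 + Z\<^sup>2)"
proof -
  have 1: "X * Y \<le> \<upsilon> / 4 * X\<^sup>2 + 1 / \<upsilon> * Y\<^sup>2"
  proof -
    have "0 \<le> (\<upsilon> / 2 * X - Y)\<^sup>2 / \<upsilon>" using assms by simp
    also have "\<dots> = \<upsilon> / 4 * X\<^sup>2 + 1 / \<upsilon> * Y\<^sup>2 - X * Y"
      using assms by (simp add: power2_eq_square field_simps)
    finally show ?thesis by simp
  qed
  have 2: "2 * Z * (L * X) \<le> \<upsilon> / 4 * X\<^sup>2 + 4 * L\<^sup>2 / \<upsilon> * Z\<^sup>2"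
  proof -
    have "0 \<le> (\<upsilon> / 2 * X - 2 * L * Z)\<^sup>2 / \<upsilon>" using assms by simp
    also have "\<dots> = \<upsilon> / 4 * X\<^sup>2 + 4 * L\<^sup>2 / \<upsilon> * Z\<^sup>2 - 2 * Z * (L * X)"
      using assms by (simp add: power2_eq_square field_simps)
    finally show ?thesis by simp
  qed
  have 3: "2 * Z * Y \<le> Z\<^sup>2 + Y\<^sup>2" using zero_le_power2[of "Z - Y"] by (simp add: power2_eq_square algebra_simps)
  have "(A + 1 + B) * (Y\<^sup>2 + Z\<^sup>2) = A * Y\<^sup>2 + B * Z\<^sup>2 + (Z\<^sup>2 + Y\<^sup>2) + (A * Z\<^sup>2 + B * Y\<^sup>2)" for A B :: real
    by (simp add: algebra_simps)
  moreover have "0 \<le> 1 / \<upsilon> * Z\<^sup>2 + 4 * L\<^sup>2 / \<upsilon> * Y\<^sup>2" using assms by simp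
  ultimately have "(1 / \<upsilon> + 1 + 4 * L\<^sup>2 / \<upsilon>) * (Y\<^sup>2 + Z\<^sup>2) \<ge> 1 / \<upsilon> * Y\<^sup>2 + 4 * L\<^sup>2 / \<upsilon> * Z\<^sup>2 + (Z\<^sup>2 + Y\<^sup>2)"
    by simp
  moreover have "2 * Z * (L * X + Y) = 2 * Z * (L * X) + 2 * Z * Y" by (simp add: algebra_simps)
  ultimately show ?thesis using 1 2 3 by linarith
qed

text \<open>
  This is what monotonicity and growth of \<open>A\<close> leave of the differences of \<open>a\<close>; the function \<open>G\<close>
  collects the oscillation of \<open>A\<close> in its first argument.
\<close>

definition structure_at :: "real \<Rightarrow> real \<Rightarrow> ('a \<Rightarrow> real) \<Rightarrow> 'a \<Rightarrow> 'a \<Rightarrow> bool" where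
  "structure_at \<upsilon> L G h x \<longleftrightarrow> (x \<in> D \<longrightarrow> x + h \<in> D \<longrightarrow>
     (a (x + h) - a x) \<bullet> (F (x + h) - F x) \<ge> \<upsilon> * q h x * (norm (F (x + h) - F x))\<^sup>2
       - G x * sqrt (f x) * sqrt (q h x) * norm (F (x + h) - F x) \<and>
     norm (a (x + h) - a x) \<le> L * q h x * norm (F (x + h) - F x) + G x * sqrt (f x) * sqrt (q h x))"

text \<open>The test function is a backward difference of \<eta> squared times the forward
  difference of \<open>U\<close>. This discrete integration by parts leaves a vanishing integral of
  \<open>a (x + h) - a x\<close> against \<open>\<Phi> x\<close>; expanding \<Phi> yields the three
  quantities that \<open>quadratic_absorb\<close> balances.\<close>

lemma difference_estimate:
  fixes \<upsilon> L :: real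
  assumes \<upsilon>: "\<upsilon> > 0" and L: "L \<ge> 0"
  shows "\<exists>C>0. \<forall>x0 R h G. R > 0 \<longrightarrow> cball x0 (4 * R) \<subseteq> D \<longrightarrow> norm h \<le> R \<longrightarrow>
     G \<in> borel_measurable borel \<longrightarrow> (\<forall>x. 0 \<le> G x) \<longrightarrow>
     (AE x in lborel. structure_at \<upsilon> L G h x) \<longrightarrow>
     SI (cball x0 R) (\<lambda>x. q h x * (norm (F (x + h) - F x))\<^sup>2)
       \<le> ennreal C * (SI (cball x0 (2 * R)) (\<lambda>x. (G x)\<^sup>2 * f x) + ennreal ((norm h / R)\<^sup>2) * SI (cball x0 (4 * R)) f)"
proof -
  obtain B where B: "B > 0" and cut: "\<And>(x0::'a) R. R > 0 \<Longrightarrow> \<exists>\<eta>. smooth \<eta> \<and> (\<forall>x. 0 \<le> \<eta> x \<and> \<eta> x \<le> 1) \<and>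
     (\<forall>x\<in>cball x0 R. \<eta> x = 1) \<and> (\<forall>x. x \<notin> cball x0 (2 * R) \<longrightarrow> \<eta> x = 0) \<and> (\<forall>x. norm (gr \<eta> x) \<le> B / R)"
    using ball_cutoffs[where 'a='a] by blast
  have c: "c \<ge> 1" by (rule qf_c[OF P])
  define E where "E = 1 / \<upsilon> + 1 + 4 * L\<^sup>2 / \<upsilon>"
  have E: "E \<ge> 1" using \<upsilon> by (simp add: E_def)
  define C where "C = 2 / \<upsilon> * E * (1 + B\<^sup>2 * (2 * c + c * c))"
  have C: "C > 0" unfolding C_def using \<upsilon> E c B by (intro mult_pos_pos add_pos_nonneg) auto
  have main: "SI (cball x0 R) (\<lambda>x. q h x * (norm (F (x + h) - F x))\<^sup>2)
       \<le> ennreal C * (SI (cball x0 (2 * R)) (\<lambda>x. (G x)\<^sup>2 * f x) + ennreal ((norm h / R)\<^sup>2) * SI (cball x0 (4 * R)) f)"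
    if R: "R > 0" and RD: "cball x0 (4 * R) \<subseteq> D" and h: "norm h \<le> R" and G[measurable]: "G \<in> borel_measurable borel"
      and G0: "\<And>x. 0 \<le> G x"
      and str: "AE x in lborel. structure_at \<upsilon> L G h x" for x0 R h G
  proof -
    let ?B2 = "cball x0 (2 * R)"
    obtain \<eta> where \<eta>: "smooth \<eta>" "\<And>x. 0 \<le> \<eta> x" "\<And>x. \<eta> x \<le> 1" "\<And>x. x \<in> cball x0 R \<Longrightarrow> \<eta> x = 1"
      "\<And>x. x \<notin> ?B2 \<Longrightarrow> \<eta> x = 0" "\<And>x. norm (gr \<eta> x) \<le> B / R" using cut[OF R, of x0] by blast
    define \<eta>2 where "\<eta>2 x = \<eta> x * \<eta> x" for x
    have \<eta>2s: "smooth \<eta>2" unfolding \<eta>2_def[abs_def] by (rule smooth_mult[OF \<eta>(1) \<eta>(1)])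
    have \<eta>20: "\<eta>2 x = 0" if "x \<notin> ?B2" for x using \<eta>(5)[OF that] by (simp add: \<eta>2_def)
    have \<eta>2c: "csupp \<eta>2" by (rule csupp_compact[OF compact_cball \<eta>20])
    have \<eta>2b: "0 \<le> \<eta>2 x" "\<eta>2 x \<le> 1" for x using \<eta>(2,3)[of x] by (auto simp: \<eta>2_def mult_le_one)
    have gr2: "gr \<eta>2 x = (2 * \<eta> x) *\<^sub>R gr \<eta> x" for x
      unfolding \<eta>2_def[abs_def] gr_mult[OF \<eta>(1) \<eta>(1)] by (simp add: scaleR_left_distrib[symmetric])
    note [measurable] = smooth_borel[OF \<eta>2s] gr_borel[OF \<eta>2s] smooth_borel[OF \<eta>(1)] gr_borel[OF \<eta>(1)]
    define dU where "dU x = U (x + h) - U x" for x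
    define dF where "dF x = F (x + h) - F x" for x
    have [measurable]: "dU \<in> borel_measurable borel" "dF \<in> borel_measurable borel"
      unfolding dU_def[abs_def] dF_def[abs_def] by measurable
    have wd: "wgrad dU dF" unfolding dU_def[abs_def] dF_def[abs_def] by (rule wgrad_diff[OF wgrad_shift[OF w] w])
    define \<Phi> where "\<Phi> x = \<eta>2 x *\<^sub>R dF x + dU x *\<^sub>R gr \<eta>2 x" for x
    have [measurable]: "\<Phi> \<in> borel_measurable borel" unfolding \<Phi>_def[abs_def] by measurable
    have wp: "wgrad (\<lambda>x. \<eta>2 x * dU x) \<Phi>" unfolding \<Phi>_def[abs_def] by (rule wgrad_mult[OF \<eta>2s \<eta>2c wd])
    have \<Phi>0: "\<Phi> x = 0" if "x \<notin> ?B2" for x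
      using \<eta>20[OF that] \<eta>(5)[OF that] by (simp add: \<Phi>_def gr2)
    have PdF: "orlicz P dF"
      unfolding dF_def diff_conv_add_uminus
      by (rule orlicz_add[OF P]) (use integrable_shift[OF PF, of h] PF in auto)
    have PdU: "orlicz P dU"
      unfolding dU_def diff_conv_add_uminus
      by (rule orlicz_add[OF P]) (use integrable_shift[OF PU, of h] PU in auto)
    have gr2b: "norm (gr \<eta>2 x) \<le> 2 * (B / R)" for x
      using mult_mono[of "\<eta> x" 1 "norm (gr \<eta> x)" "B / R"] \<eta>(2,3)[of x] \<eta>(6)[of x] B R by (simp add: gr2)
    have P\<Phi>: "orlicz P \<Phi>"
      unfolding \<Phi>_def
    proof (rule orlicz_add[OF P])
      show "orlicz P (\<lambda>x. \<eta>2 x *\<^sub>R dF x)"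
        by (rule orlicz_bound[OF P _ PdF, of _ 1]) (use \<eta>2b in \<open>auto intro!: mult_left_le_one_le\<close>)
      show "orlicz P (\<lambda>x. dU x *\<^sub>R gr \<eta>2 x)"
      proof (rule orlicz_bound[OF P _ PdU])
        show "norm (dU x *\<^sub>R gr \<eta>2 x) \<le> (2 * (B / R)) * norm (dU x)" for x
          using mult_left_mono[OF gr2b[of x], of "\<bar>dU x\<bar>"] by (simp add: mult.commute)
      qed (use B R in auto)
    qed measurable
    have P\<Phi>': "orlicz P (\<lambda>x. \<Phi> (x + (- h)))" by (rule integrable_shift[OF P\<Phi>])
    \<comment> \<open>The translated test function lives on a ball of radius
      \<open>2 * R + norm h\<close>.\<close>
    have sub3: "cball x0 (3 * R) \<subseteq> D" by (rule subset_trans[OF subset_cball RD]) (use R in simp)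
    have out: "x \<notin> ?B2" "x + (- h) \<notin> ?B2" if "x \<notin> cball x0 (3 * R)" for x
    proof -
      show "x \<notin> ?B2" using that R by auto
      show "x + (- h) \<notin> ?B2"
      proof
        assume "x + (- h) \<in> ?B2"
        then have "dist x0 x \<le> 2 * R + norm h"
          using dist_triangle[of x0 x "x + (- h)"] by (simp add: dist_norm)
        then show False using that h by simp
      qed
    qed
    have T: "integrable lborel (\<lambda>x. a x \<bullet> (\<Phi> (x + (- h)) - \<Phi> x))" "(\<integral>x. a x \<bullet> (\<Phi> (x + (- h)) - \<Phi> x) \<partial>lborel) = 0"
    proof -
      have w3: "wgrad (\<lambda>x. \<eta>2 (x + (- h)) * dU (x + (- h)) - \<eta>2 x * dU x) (\<lambda>x. \<Phi> (x + (- h)) - \<Phi> x)"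
        by (rule wgrad_diff[OF wgrad_shift[OF wp] wp])
      have PI3: "orlicz P (\<lambda>x. \<Phi> (x + (- h)) - \<Phi> x)"
        unfolding diff_conv_add_uminus[of "\<Phi> _"]
        by (rule orlicz_add[OF P]) (use P\<Phi> P\<Phi>' in auto)
      show "integrable lborel (\<lambda>x. a x \<bullet> (\<Phi> (x + (- h)) - \<Phi> x))" "(\<integral>x. a x \<bullet> (\<Phi> (x + (- h)) - \<Phi> x) \<partial>lborel) = 0"
        by (rule test[OF w3 compact_cball sub3 _ _ PI3]; use out \<eta>20 \<Phi>0 in \<open>simp del: mem_cball\<close>)+
    qed
    have i1: "integrable lborel (\<lambda>x. a x \<bullet> \<Phi> x)" by (rule a_int[OF _ P\<Phi>]) measurable
    have i2: "integrable lborel (\<lambda>x. a x \<bullet> \<Phi> (x + (- h)))" by (rule a_int[OF _ P\<Phi>']) measurable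
    have i3: "integrable lborel (\<lambda>x. a (x + h) \<bullet> \<Phi> x)"
      using integrable_shift[OF i2, of h] by simp
    \<comment> \<open>Substituting \<open>x + h\<close> for \<open>x\<close> in the translated
      summand moves the translation from \<Phi> to \<open>a\<close>.\<close>
    have H: "integrable lborel (\<lambda>x. (a (x + h) - a x) \<bullet> \<Phi> x)" "(\<integral>x. (a (x + h) - a x) \<bullet> \<Phi> x \<partial>lborel) = 0"
    proof -
      show "integrable lborel (\<lambda>x. (a (x + h) - a x) \<bullet> \<Phi> x)" unfolding inner_diff_left by (intro integrable_diff i1 i3)
      have "(\<integral>x. a (x + h) \<bullet> \<Phi> x \<partial>lborel) = (\<integral>x. a x \<bullet> \<Phi> (x + (- h)) \<partial>lborel)"
        using integral_shift[of "\<lambda>x. a x \<bullet> \<Phi> (x + (- h))" h] by simp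
      then show "(\<integral>x. (a (x + h) - a x) \<bullet> \<Phi> x \<partial>lborel) = 0"
        using T(2) i1 i2 i3 by (simp add: inner_diff_left inner_diff_right)
    qed
    let ?t = "\<lambda>x. \<bar>dU x\<bar> / norm h"
    let ?Q = "\<lambda>x. q h x * (norm (dF x))\<^sup>2" and ?H = "(norm h / R)\<^sup>2"
    let ?W = "\<lambda>x. c * (f x + f (x + h)) + P (?t x)"
    let ?k = "\<lambda>x. E * ((G x)\<^sup>2 * f x) + E * B\<^sup>2 * ?H * ?W x"
    have "SI UNIV (\<lambda>x. indicat_real ?B2 x * (\<upsilon> / 2 * (\<eta>2 x * ?Q x)))
        \<le> SI UNIV (\<lambda>x. indicat_real ?B2 x * ?k x)"
    proof (rule zero_integral_bound[OF H])
      show "AE x in lborel. indicat_real ?B2 x * (\<upsilon> / 2 * (\<eta>2 x * ?Q x))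
          \<le> (a (x + h) - a x) \<bullet> \<Phi> x + indicat_real ?B2 x * ?k x"
        using str unfolding structure_at_def
      proof eventually_elim
        case (elim x)
        show ?case
        proof (cases "x \<in> ?B2")
          case False then show ?thesis by (simp add: \<Phi>0 del: mem_cball)
        next
          case True
          have xh: "x + h \<in> cball x0 (3 * R)"
            using True h dist_triangle[of x0 "x + h" x] by (simp add: dist_norm)
          have xD: "x \<in> D" "x + h \<in> D" using sub3 xh True R by auto
          define X where "X = \<eta> x * (sqrt (q h x) * norm (dF x))"
          define Y where "Y = \<eta> x * (G x * sqrt (f x))"
          define Z where "Z = sqrt (q h x) * (\<bar>dU x\<bar> * norm (gr \<eta> x))"
          have q2: "q h x = (sqrt (q h x))\<^sup>2" using q_nonneg[of h x] by simp
          have "(a (x + h) - a x) \<bullet> \<Phi> x = \<eta>2 x * ((a (x + h) - a x) \<bullet> dF x) + 2 * \<eta> x * dU x * ((a (x + h) - a x) \<bullet> gr \<eta> x)"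
            by (simp add: \<Phi>_def gr2 inner_add_right)
          moreover have "\<eta>2 x * ((a (x + h) - a x) \<bullet> dF x) \<ge> \<upsilon> * X\<^sup>2 - X * Y"
          proof -
            have "\<upsilon> * X\<^sup>2 - X * Y = \<eta>2 x * (\<upsilon> * q h x * (norm (dF x))\<^sup>2 - G x * sqrt (f x) * sqrt (q h x) * norm (dF x))"
              using q_nonneg[of h x] by (simp add: X_def Y_def \<eta>2_def power_mult_distrib algebra_simps power2_eq_square)
            also have "\<dots> \<le> \<eta>2 x * ((a (x + h) - a x) \<bullet> dF x)"
              using elim xD \<eta>2b by (intro mult_left_mono) (auto simp: dF_def)
            finally show ?thesis .
          qed
          moreover have "2 * \<eta> x * dU x * ((a (x + h) - a x) \<bullet> gr \<eta> x) \<ge> - (2 * Z * (L * X + Y))"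
          proof -
            have "\<bar>dU x * ((a (x + h) - a x) \<bullet> gr \<eta> x)\<bar> \<le> \<bar>dU x\<bar> * (norm (a (x + h) - a x) * norm (gr \<eta> x))"
              unfolding abs_mult by (intro mult_left_mono Cauchy_Schwarz_ineq2) simp
            also have "\<dots> \<le> \<bar>dU x\<bar> * ((L * q h x * norm (dF x) + G x * sqrt (f x) * sqrt (q h x)) * norm (gr \<eta> x))"
              using elim xD by (intro mult_left_mono mult_right_mono) (auto simp: dF_def)
            finally have "\<eta> x * \<bar>dU x * ((a (x + h) - a x) \<bullet> gr \<eta> x)\<bar>
               \<le> \<eta> x * (\<bar>dU x\<bar> * ((L * q h x * norm (dF x) + G x * sqrt (f x) * sqrt (q h x)) * norm (gr \<eta> x)))"
              by (rule mult_left_mono[OF _ \<eta>(2)])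
            also have "\<dots> = Z * (L * X + Y)"
              by (subst (1) q2) (simp add: X_def Y_def Z_def algebra_simps power2_eq_square)
            finally have "\<bar>\<eta> x * (dU x * ((a (x + h) - a x) \<bullet> gr \<eta> x))\<bar> \<le> Z * (L * X + Y)"
              using \<eta>(2)[of x] by (simp add: abs_mult)
            then show ?thesis by (simp add: mult.assoc)
          qed
          ultimately have xx: "\<upsilon> / 2 * X\<^sup>2 \<le> (a (x + h) - a x) \<bullet> \<Phi> x + E * (Y\<^sup>2 + Z\<^sup>2)"
            using quadratic_absorb[OF \<upsilon>, of X Y Z L] unfolding E_def by linarith
          have x2: "X\<^sup>2 = \<eta>2 x * ?Q x"
            using q_nonneg[of h x] by (simp add: X_def \<eta>2_def power_mult_distrib power2_eq_square)
          have y2: "Y\<^sup>2 \<le> (G x)\<^sup>2 * f x"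
          proof -
            have "Y\<^sup>2 = \<eta>2 x * ((G x)\<^sup>2 * f x)" using f_nonneg[of x] by (simp add: Y_def \<eta>2_def power_mult_distrib power2_eq_square)
            also have "\<dots> \<le> 1 * ((G x)\<^sup>2 * f x)" using \<eta>2b f_nonneg[of x] by (intro mult_right_mono) auto
            finally show ?thesis by simp
          qed
          \<comment> \<open>The difference of \<open>U\<close> is written as \<open>norm h\<close>
            times the difference quotient \<open>t\<close>; the factor \<open>norm h\<close>
            together with \<open>B / R\<close> yields \<open>?H\<close>, and
            \<open>q_square_le\<close> handles the quotient.\<close>
          have z2: "Z\<^sup>2 \<le> B\<^sup>2 * ?H * ?W x"
          proof -
            define t where "t = ?t x"
            have t0: "t \<ge> 0" by (simp add: t_def)
            have dUt: "\<bar>dU x\<bar> = norm h * t" by (cases "h = 0") (auto simp: dU_def t_def)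
            have "Z\<^sup>2 = (q h x * t\<^sup>2) * ((norm h)\<^sup>2 * (norm (gr \<eta> x))\<^sup>2)"
              unfolding Z_def dUt using q_nonneg[of h x] by (simp add: power_mult_distrib)
            also have "\<dots> \<le> ?W x * ((norm h)\<^sup>2 * (B / R)\<^sup>2)"
            proof (rule mult_mono)
              show "q h x * t\<^sup>2 \<le> ?W x" using q_square_le[OF t0, of h x] xD by (simp add: f_D t_def)
              show "(norm h)\<^sup>2 * (norm (gr \<eta> x))\<^sup>2 \<le> (norm h)\<^sup>2 * (B / R)\<^sup>2"
                by (intro mult_left_mono power_mono \<eta>(6)) auto
              show "0 \<le> ?W x" using c f_nonneg qf_nonneg[OF P] by (intro add_nonneg_nonneg mult_nonneg_nonneg) auto
            qed simp
            also have "\<dots> = B\<^sup>2 * ?H * ?W x" by (simp add: power_divide)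
            finally show ?thesis .
          qed
          have "\<upsilon> / 2 * (\<eta>2 x * ?Q x)
             \<le> (a (x + h) - a x) \<bullet> \<Phi> x + E * ((G x)\<^sup>2 * f x + B\<^sup>2 * ?H * ?W x)"
            using mult_left_mono[OF add_mono[OF y2 z2], of E] E xx unfolding x2 by linarith
          then show ?thesis using True by (simp add: algebra_simps del: mem_cball)
        qed
      qed
      show "0 \<le> indicat_real ?B2 x * (\<upsilon> / 2 * (\<eta>2 x * ?Q x))" for x
        using \<upsilon> \<eta>2b q_nonneg by (intro mult_nonneg_nonneg) auto
      show "0 \<le> indicat_real ?B2 x * ?k x" for x
        using E c f_nonneg qf_nonneg[OF P] by (intro mult_nonneg_nonneg add_nonneg_nonneg) auto
    qed measurable
    also have "SI UNIV (\<lambda>x. indicat_real ?B2 x * ?k x) = SI ?B2 ?k"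
      unfolding SI_def by (rule nn_integral_cong) (auto simp: indicator_def)
    finally have 1: "SI UNIV (\<lambda>x. indicat_real ?B2 x * (\<upsilon> / 2 * (\<eta>2 x * ?Q x))) \<le> SI ?B2 ?k" .
    define S4 where "S4 = SI (cball x0 (4 * R)) f"
    have W: "SI ?B2 ?W \<le> ennreal (2 * c + c * c) * S4"
    proof -
      have "SI ?B2 ?W = ennreal c * (SI ?B2 f + SI ?B2 (\<lambda>x. f (x + h))) + SI ?B2 (\<lambda>x. P (?t x))"
        using c f_nonneg qf_nonneg[OF P] by (simp add: SI_add SI_cmult)
      also have "\<dots> \<le> ennreal c * (S4 + S4) + ennreal (c * c) * S4"
      proof (intro add_mono mult_left_mono)
        show "SI ?B2 f \<le> S4" unfolding S4_def by (intro SI_subset subset_cball) (use R in simp)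
        show "SI ?B2 (\<lambda>x. f (x + h)) \<le> S4" unfolding S4_def
          by (rule order_trans[OF SI_cball_shift_le SI_subset]) (use R h in \<open>auto intro!: subset_cball\<close>)
        have "SI ?B2 (\<lambda>x. P (?t x)) \<le> ennreal (c * c) * SI (cball x0 (2 * R + 2 * norm h)) (\<lambda>y. P (norm (F y)))"
          unfolding dU_def by (rule difference_quotient[OF P w PF])
        also have "\<dots> \<le> ennreal (c * c) * SI (cball x0 (4 * R)) (\<lambda>y. P (norm (F y)))"
          by (intro mult_left_mono SI_subset subset_cball) (use h in auto)
        also have "\<dots> \<le> ennreal (c * c) * S4" unfolding S4_def by (intro mult_left_mono SI_PF RD) simp
        finally show "SI ?B2 (\<lambda>x. P (?t x)) \<le> ennreal (c * c) * S4" .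
      qed auto
      also have "\<dots> = (ennreal c + ennreal c + ennreal (c * c)) * S4" by (simp add: distrib_left distrib_right)
      also have "ennreal c + ennreal c + ennreal (c * c) = ennreal (2 * c + c * c)" using c by (simp flip: ennreal_plus)
      finally show ?thesis .
    qed
    define SG where "SG = SI ?B2 (\<lambda>x. (G x)\<^sup>2 * f x)"
    have "SI ?B2 ?k = ennreal E * SG + ennreal (E * B\<^sup>2 * ?H) * SI ?B2 ?W"
      unfolding SG_def using E c f_nonneg qf_nonneg[OF P] B
      by (subst SI_add) (auto simp: SI_cmult intro!: mult_nonneg_nonneg add_nonneg_nonneg)
    also have "\<dots> \<le> ennreal E * SG + ennreal (E * B\<^sup>2 * ?H) * (ennreal (2 * c + c * c) * S4)"
      by (intro add_left_mono mult_left_mono W) simp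
    also have "\<dots> \<le> ennreal (E * (1 + B\<^sup>2 * (2 * c + c * c))) * (SG + ennreal (?H) * S4)"
    proof -
      have "ennreal (E * B\<^sup>2 * ?H) * (ennreal (2 * c + c * c) * S4) = ennreal (E * (B\<^sup>2 * (2 * c + c * c))) * (ennreal (?H) * S4)"
      proof -
        have "ennreal (E * B\<^sup>2 * ?H) * ennreal (2 * c + c * c) = ennreal (E * B\<^sup>2 * ?H * (2 * c + c * c))"
          using E by (intro ennreal_mult'[symmetric]) simp
        also have "E * B\<^sup>2 * ?H * (2 * c + c * c) = E * (B\<^sup>2 * (2 * c + c * c)) * ?H" by (simp only: mult_ac)
        also have "ennreal \<dots> = ennreal (E * (B\<^sup>2 * (2 * c + c * c))) * ennreal (?H)"
          using E c by (intro ennreal_mult') simp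
        finally show ?thesis by (simp only: mult.assoc[symmetric])
      qed
      also have "\<dots> \<le> ennreal (E * (1 + B\<^sup>2 * (2 * c + c * c))) * (ennreal (?H) * S4)"
        using E by (intro mult_right_mono ennreal_leI mult_left_mono) auto
      finally have 2: "ennreal (E * B\<^sup>2 * ?H) * (ennreal (2 * c + c * c) * S4)
         \<le> ennreal (E * (1 + B\<^sup>2 * (2 * c + c * c))) * (ennreal (?H) * S4)" .
      have "E * 1 \<le> E * (1 + B\<^sup>2 * (2 * c + c * c))" using E c by (intro mult_left_mono) auto
      then have "ennreal E * SG \<le> ennreal (E * (1 + B\<^sup>2 * (2 * c + c * c))) * SG"
        by (intro mult_right_mono ennreal_leI) auto
      from add_mono[OF this 2] show ?thesis by (simp only: distrib_left[of "ennreal _"])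
    qed
    finally have 3: "SI ?B2 ?k \<le> ennreal (E * (1 + B\<^sup>2 * (2 * c + c * c))) * (SG + ennreal (?H) * S4)" .
    have "SI (cball x0 R) (\<lambda>x. q h x * (norm (F (x + h) - F x))\<^sup>2) = SI (cball x0 R) (\<lambda>x. 2 / \<upsilon> * (\<upsilon> / 2 * ?Q x))"
      using \<upsilon> by (simp add: dF_def)
    also have "\<dots> = ennreal (2 / \<upsilon>) * SI (cball x0 R) (\<lambda>x. \<upsilon> / 2 * ?Q x)"
      using \<upsilon> by (intro SI_cmult) auto
    also have "SI (cball x0 R) (\<lambda>x. \<upsilon> / 2 * ?Q x) \<le> SI UNIV (\<lambda>x. indicat_real ?B2 x * (\<upsilon> / 2 * (\<eta>2 x * ?Q x)))"
    proof (rule SI_mono)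
      fix x assume x: "x \<in> cball x0 R"
      then have "x \<in> ?B2" using R by auto
      moreover have "\<eta>2 x = 1" using \<eta>(4)[OF x] by (simp add: \<eta>2_def)
      ultimately show "x \<in> UNIV \<and> \<upsilon> / 2 * ?Q x \<le> indicat_real ?B2 x * (\<upsilon> / 2 * (\<eta>2 x * ?Q x))" by simp
    qed
    also note 1
    also note 3
    also have "ennreal (2 / \<upsilon>) * (ennreal (E * (1 + B\<^sup>2 * (2 * c + c * c))) * (SG + ennreal (?H) * S4)) = ennreal C * (SG + ennreal (?H) * S4)"
    proof -
      have "ennreal (2 / \<upsilon>) * ennreal (E * (1 + B\<^sup>2 * (2 * c + c * c))) = ennreal C"
        unfolding C_def using \<upsilon> by (subst ennreal_mult'[symmetric]) (auto simp: mult.assoc)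
      then show ?thesis by (simp only: mult.assoc[symmetric])
    qed
    finally show ?thesis by (simp add: SG_def S4_def mult_left_mono)
  qed
  show ?thesis using C main by (intro exI[of _ C] conjI allI impI) blast+
qed

end

text \<open>Absolute continuity of the integral, made uniform in the centre by splitting \<gamma>
  into a part bounded by \<open>N\<close> and a remainder of small total mass.\<close>

lemma small_balls:
  fixes \<gamma> :: "'a::euclidean_space \<Rightarrow> real"
  assumes \<gamma>: "integrable lborel \<gamma>" "\<And>x. \<gamma> x \<ge> 0" and \<eta>: "\<eta> > 0"
  shows "\<exists>R0>0. \<forall>x R. 0 < R \<longrightarrow> R \<le> R0 \<longrightarrow> SI (cball x R) \<gamma> \<le> ennreal \<eta>"
proof -
  note [measurable] = integrable_borel[OF \<gamma>(1)]
  have "(\<lambda>N::nat. \<integral>x. max 0 (\<gamma> x - real N) \<partial>lborel) \<longlonglongrightarrow> integral\<^sup>L (lborel :: 'a measure) (\<lambda>x. 0)"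
  proof (rule integral_dominated_convergence[where w=\<gamma>])
    show "AE x in lborel. (\<lambda>N::nat. max 0 (\<gamma> x - real N)) \<longlonglongrightarrow> 0"
    proof (rule AE_I2)
      fix x
      obtain N0 :: nat where "\<gamma> x < real N0" using reals_Archimedean2 by blast
      then have "\<forall>\<^sub>F N in sequentially. max 0 (\<gamma> x - real N) = 0"
        by (intro eventually_sequentiallyI[of N0]) auto
      then show "(\<lambda>N::nat. max 0 (\<gamma> x - real N)) \<longlonglongrightarrow> 0" by (rule tendsto_eventually)
    qed
  qed (use \<gamma> in auto)
  then have "\<forall>\<^sub>F N in sequentially. (\<integral>x. max 0 (\<gamma> x - real N) \<partial>lborel) < \<eta> / 2"
    using \<eta> by (intro order_tendstoD(2)[of _ 0]) auto
  then obtain N where N: "(\<integral>x. max 0 (\<gamma> x - real N) \<partial>lborel) < \<eta> / 2" by (auto simp: eventually_sequentially)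
  have i: "integrable lborel (\<lambda>x. max 0 (\<gamma> x - real N))"
    by (rule integrable_bound[OF \<gamma>(1)]) (use \<gamma>(2) in \<open>auto intro!: AE_I2\<close>)
  have "((\<lambda>R. real N * vol TYPE('a) R) \<longlongrightarrow> real N * vol TYPE('a) 0) (at_right 0)"
    unfolding vol_def by (intro tendsto_intros)
  moreover have "real N * vol TYPE('a) 0 = 0" by (simp add: vol_def)
  ultimately have "\<forall>\<^sub>F R in at_right 0. real N * vol TYPE('a) R < \<eta> / 2"
    using \<eta> by (intro order_tendstoD(2)) auto
  then obtain R1 where R1: "R1 > 0" "\<And>R. 0 < R \<Longrightarrow> R < R1 \<Longrightarrow> real N * vol TYPE('a) R < \<eta> / 2"
    by (auto simp: eventually_at_right_field)
  have "SI (cball x R) \<gamma> \<le> ennreal \<eta>" if R: "0 < R" "R \<le> R1 / 2" for x R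
  proof -
    have "SI (cball x R) \<gamma> \<le> SI (cball x R) (\<lambda>x. real N + max 0 (\<gamma> x - real N))" by (rule SI_mono) auto
    also have "\<dots> = SI (cball x R) (\<lambda>x. real N) + SI (cball x R) (\<lambda>x. max 0 (\<gamma> x - real N))" by (intro SI_add) auto
    also have "\<dots> \<le> ennreal (\<eta> / 2) + ennreal (\<eta> / 2)"
    proof (rule add_mono)
      have "SI (cball x R) (\<lambda>x. real N) = ennreal (real N * vol TYPE('a) R)"
        using R by (simp add: SI_const emeasure_cball_vol ennreal_mult')
      also have "\<dots> \<le> ennreal (\<eta> / 2)" using R1(2)[of R] R R1(1) by (intro ennreal_leI) auto
      finally show "SI (cball x R) (\<lambda>x. real N) \<le> ennreal (\<eta> / 2)" .
      have "SI (cball x R) (\<lambda>x. max 0 (\<gamma> x - real N)) \<le> SI UNIV (\<lambda>x. max 0 (\<gamma> x - real N))" by (rule SI_subset) simp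
      also have "\<dots> = ennreal (\<integral>x. max 0 (\<gamma> x - real N) \<partial>lborel)" by (rule SI_integrable[OF i]) simp
      also have "\<dots> \<le> ennreal (\<eta> / 2)" using N by (intro ennreal_leI) auto
      finally show "SI (cball x R) (\<lambda>x. max 0 (\<gamma> x - real N)) \<le> ennreal (\<eta> / 2)" .
    qed
    also have "\<dots> = ennreal \<eta>" using \<eta> by (simp flip: ennreal_plus)
    finally show ?thesis .
  qed
  then show ?thesis using R1(1) by (intro exI[of _ "R1 / 2"]) auto
qed

text \<open>Hoelder's inequality for the exponents \<open>s / 2\<close> and
  \<open>s / (s - 2)\<close> in pointwise form: whichever of \<open>t\<close> and
  \<open>X powr (s - 2)\<close> is larger determines the term that bounds the product.\<close>

lemma young_powr:
  fixes X t s :: real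
  assumes "X \<ge> 0" "t \<ge> 0" "s > 2"
  shows "X\<^sup>2 * t \<le> X powr s + t powr (s / (s - 2))"
proof (cases "X = 0 \<or> t = 0")
  case False
  then have X: "X > 0" "t > 0" using assms by auto
  show ?thesis
  proof (cases "t \<le> X powr (s - 2)")
    case True
    have "X\<^sup>2 * t \<le> X\<^sup>2 * X powr (s - 2)" using True by (intro mult_left_mono) auto
    also have "X\<^sup>2 * X powr (s - 2) = X powr (2 + (s - 2))" using X by (simp only: powr_add) simp
    finally show ?thesis by (simp add: add_increasing2)
  next
    case False
    have "(X powr (s - 2)) powr (2 / (s - 2)) \<le> t powr (2 / (s - 2))"
      using False assms by (intro powr_mono2) auto
    moreover have "(X powr (s - 2)) powr (2 / (s - 2)) = X\<^sup>2"
    proof -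
      have "(s - 2) * (2 / (s - 2)) = 2" using assms by (simp add: field_simps)
      then show ?thesis using X by (simp only: powr_powr) simp
    qed
    ultimately have "X\<^sup>2 * t \<le> t powr (2 / (s - 2)) * t powr 1" using X by (intro mult_mono) auto
    also have "\<dots> = t powr (2 / (s - 2) + 1)" by (simp only: powr_add)
    also have "2 / (s - 2) + 1 = s / (s - 2)" using assms by (simp add: field_simps)
    finally show ?thesis by (simp add: add_increasing)
  qed
qed auto

text \<open>In the application \<open>V\<close> is \<open>V_P\<close> of the gradient, \<gamma> is
  |g|^(n/alpha) plus an indicator, and \<open>G h\<close> measures the oscillation of the field
  under translation by \<open>h\<close>. The two bounds on \<open>G h\<close> serve different ends:
  \<open>K\<close> where only the measure of a bad set is known, \<open>Gint\<close> for the size of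
  that set and for the rate in \<open>h\<close>.\<close>

locale energy_reg = energy +
  fixes \<upsilon> L \<alpha> Cv C0 Cg K :: real and V :: "'a \<Rightarrow> 'a" and \<gamma> :: "'a \<Rightarrow> real" and G :: "'a \<Rightarrow> 'a \<Rightarrow> real"
  assumes dim: "DIM('a) \<ge> 2" and \<alpha>: "0 < \<alpha>" "\<alpha> < 1" and \<upsilon>: "\<upsilon> > 0" and L: "L \<ge> 0" and Cv: "Cv > 0" and C0: "C0 \<ge> 0" and Cg: "Cg > 0" and K: "K > 0"
    and V_borel: "V \<in> borel_measurable borel"
    and V1: "\<And>x. x \<in> D \<Longrightarrow> (norm (V x))\<^sup>2 \<le> f x" and V2: "\<And>x. x \<in> D \<Longrightarrow> f x \<le> 2 * (norm (V x))\<^sup>2 + C0"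
    and Vq: "\<And>x h. (norm (V (x + h) - V x))\<^sup>2 \<le> Cv * (q h x * (norm (F (x + h) - F x))\<^sup>2)"
    and \<gamma>: "integrable lborel \<gamma>" "\<And>x. \<gamma> x \<ge> 0"
    and G: "\<And>h. G h \<in> borel_measurable borel" "\<And>h x. 0 \<le> G h x" "\<And>h x. G h x \<le> K"
    and Gint: "\<And>h x0 R. h \<noteq> 0 \<Longrightarrow> norm h \<le> R \<Longrightarrow> cball x0 (2 * R) \<subseteq> D \<Longrightarrow>
       SI (cball x0 R) (\<lambda>x. G h x powr (real DIM('a) / \<alpha>)) \<le> ennreal (Cg * norm h ^ DIM('a)) * SI (cball x0 (2 * R)) \<gamma>"
    and str: "\<And>h. h \<noteq> 0 \<Longrightarrow> AE x in lborel. structure_at \<upsilon> L (G h) h x"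
begin

lemmas V_meas [measurable] = V_borel
lemmas G_meas [measurable] = G(1)

lemma V_estimate:
  "\<exists>C>0. \<forall>x0 R h. R > 0 \<longrightarrow> cball x0 (4 * R) \<subseteq> D \<longrightarrow> h \<noteq> 0 \<longrightarrow> norm h \<le> R \<longrightarrow>
     SI (cball x0 R) (\<lambda>x. (norm (V (x + h) - V x))\<^sup>2)
       \<le> ennreal C * (SI (cball x0 (2 * R)) (\<lambda>x. (G h x)\<^sup>2 * f x) + ennreal ((norm h / R)\<^sup>2) * SI (cball x0 (4 * R)) f)"
proof -
  obtain C where C: "C > 0" and de: "\<forall>x0 R h G. R > 0 \<longrightarrow> cball x0 (4 * R) \<subseteq> D \<longrightarrow> norm h \<le> R \<longrightarrow>
     G \<in> borel_measurable borel \<longrightarrow> (\<forall>x. 0 \<le> G x) \<longrightarrow>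
     (AE x in lborel. structure_at \<upsilon> L G h x) \<longrightarrow>
     SI (cball x0 R) (\<lambda>x. q h x * (norm (F (x + h) - F x))\<^sup>2)
       \<le> ennreal C * (SI (cball x0 (2 * R)) (\<lambda>x. (G x)\<^sup>2 * f x) + ennreal ((norm h / R)\<^sup>2) * SI (cball x0 (4 * R)) f)"
    using difference_estimate[OF \<upsilon> L] by (elim exE conjE)
  have main: "SI (cball x0 R) (\<lambda>x. (norm (V (x + h) - V x))\<^sup>2)
       \<le> ennreal (Cv * C) * (SI (cball x0 (2 * R)) (\<lambda>x. (G h x)\<^sup>2 * f x) + ennreal ((norm h / R)\<^sup>2) * SI (cball x0 (4 * R)) f)"
    if "R > 0" "cball x0 (4 * R) \<subseteq> D" "h \<noteq> 0" "norm h \<le> R" for x0 R h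
  proof -
    have "SI (cball x0 R) (\<lambda>x. (norm (V (x + h) - V x))\<^sup>2) \<le> SI (cball x0 R) (\<lambda>x. Cv * (q h x * (norm (F (x + h) - F x))\<^sup>2))"
      by (rule SI_mono) (use Vq in auto)
    also have "\<dots> = ennreal Cv * SI (cball x0 R) (\<lambda>x. q h x * (norm (F (x + h) - F x))\<^sup>2)"
      using Cv by (intro SI_cmult) auto
    also have "\<dots> \<le> ennreal Cv * (ennreal C * (SI (cball x0 (2 * R)) (\<lambda>x. (G h x)\<^sup>2 * f x) + ennreal ((norm h / R)\<^sup>2) * SI (cball x0 (4 * R)) f))"
      by (intro mult_left_mono de[rule_format, OF that(1,2,4) G(1) G(2) str[OF that(3)]]) simp
    also have "\<dots> = ennreal (Cv * C) * (SI (cball x0 (2 * R)) (\<lambda>x. (G h x)\<^sup>2 * f x) + ennreal ((norm h / R)\<^sup>2) * SI (cball x0 (4 * R)) f)"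
      using Cv by (simp only: mult.assoc[symmetric] ennreal_mult'[OF less_imp_le[OF Cv]])
    finally show ?thesis .
  qed
  show ?thesis by (intro exI[of _ "Cv * C"] conjI allI impI main) (use C Cv in auto)
qed

text \<open>Where \<open>G h x \<le> t\<close> the factor is small by the choice of
  \<open>t\<close>. By Chebyshev's inequality, \<open>Gint\<close> and \<open>small_balls\<close>,
  the rest of the ball has small measure, hence by \<open>A_infinity\<close> a small share of the
  mass of \<open>f\<close>, and there the bound \<open>K\<close> is enough. Since
  \<open>norm h \<le> R\<close>, the power of \<open>norm h\<close> in \<open>Gint\<close> is
  controlled by the volume of the ball, which makes the estimate uniform in
  \<open>h\<close>.\<close>

lemma G_small:
  assumes e: "e > 0"
  shows "\<exists>R0>0. \<forall>x0 R h. 0 < R \<longrightarrow> R \<le> R0 \<longrightarrow> h \<noteq> 0 \<longrightarrow> norm h \<le> R \<longrightarrow> cball x0 (4 * R) \<subseteq> D \<longrightarrow>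
     SI (cball x0 (2 * R)) (\<lambda>x. (G h x)\<^sup>2 * f x) \<le> ennreal e * SI (cball x0 (4 * R)) f"
proof -
  let ?n = "DIM('a)" and ?v = "vol TYPE('a)"
  define s where "s = real ?n / \<alpha>"
  define \<omega> where "\<omega> = unit_ball_vol (real ?n)"
  have \<omega>: "\<omega> > 0" unfolding \<omega>_def by (rule unit_ball_vol_dim)
  have v: "?v r = \<omega> * r ^ ?n" for r by (simp add: vol_def \<omega>_def)
  define t where "t = sqrt (e / 2)"
  have t: "t > 0" using e by (simp add: t_def)
  have "e / (2 * K\<^sup>2) > 0" using e K by simp
  from A_infinity[OF f_int f_nonneg rev_holder_f this] obtain \<tau> where \<tau>: "\<tau> > 0"
    and AI: "\<And>x0 R S. R > 0 \<Longrightarrow> cball x0 (2 * R) \<subseteq> D \<Longrightarrow> S \<in> sets borel \<Longrightarrow> S \<subseteq> cball x0 R \<Longrightarrow>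
     emeasure lborel S \<le> ennreal (\<tau> * ?v R) \<Longrightarrow> SI S f \<le> ennreal (e / (2 * K\<^sup>2)) * SI (cball x0 (2 * R)) f"
    by blast
  \<comment> \<open>Solves \<open>Cg * R ^ ?n * \<eta> = t powr s * (\<tau> * ?v (2 * R))\<close>,
    the balance that Chebyshev's inequality requires for \<open>A_infinity\<close>.\<close>
  define \<eta> where "\<eta> = t powr s * \<tau> * \<omega> * 2 ^ ?n / Cg"
  have \<eta>: "\<eta> > 0" using t \<tau> \<omega> Cg by (simp add: \<eta>_def)
  obtain R0 where R0: "R0 > 0" "\<And>x R. 0 < R \<Longrightarrow> R \<le> R0 \<Longrightarrow> SI (cball x R) \<gamma> \<le> ennreal \<eta>"
    using small_balls[OF \<gamma> \<eta>] by blast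
  have main: "SI (cball x0 (2 * R)) (\<lambda>x. (G h x)\<^sup>2 * f x) \<le> ennreal e * SI (cball x0 (4 * R)) f"
    if R: "0 < R" "R \<le> R0 / 4" and h: "h \<noteq> 0" "norm h \<le> R" and RD: "cball x0 (4 * R) \<subseteq> D" for x0 R h
  proof -
    let ?S = "cball x0 (2 * R) \<inter> {x. G h x > t}"
    have mS: "emeasure lborel ?S \<le> ennreal (\<tau> * ?v (2 * R))"
    proof -
      have "ennreal (t powr s) * emeasure lborel ?S = SI ?S (\<lambda>x. t powr s)" by (simp add: SI_const)
      also have "\<dots> \<le> SI (cball x0 (2 * R)) (\<lambda>x. G h x powr s)"
        by (rule SI_mono) (use t dim \<alpha> in \<open>auto intro!: powr_mono2 simp: s_def\<close>)
      also have "\<dots> \<le> ennreal (Cg * norm h ^ ?n) * SI (cball x0 (2 * (2 * R))) \<gamma>"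
        unfolding s_def by (rule Gint) (use h R RD in auto)
      also have "\<dots> \<le> ennreal (Cg * R ^ ?n) * ennreal \<eta>"
        using h R Cg R0(2)[of "4 * R" x0] by (intro mult_mono ennreal_leI mult_left_mono power_mono) auto
      also have "\<dots> = ennreal (Cg * R ^ ?n * \<eta>)" using Cg R by (intro ennreal_mult'[symmetric]) simp
      also have "Cg * R ^ ?n * \<eta> = t powr s * (\<tau> * ?v (2 * R))" using Cg by (simp add: \<eta>_def v power_mult_distrib)
      also have "ennreal \<dots> = ennreal (t powr s) * ennreal (\<tau> * ?v (2 * R))" by (rule ennreal_mult') simp
      finally show ?thesis using t by (subst (asm) ennreal_mult_le_mult_iff) auto
    qed
    have SS: "SI ?S f \<le> ennreal (e / (2 * K\<^sup>2)) * SI (cball x0 (2 * (2 * R))) f"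
      by (rule AI[OF _ _ _ _ mS]) (use R RD in auto)
    have "SI (cball x0 (2 * R)) (\<lambda>x. (G h x)\<^sup>2 * f x) \<le> SI (cball x0 (2 * R)) (\<lambda>x. t\<^sup>2 * f x + K\<^sup>2 * (f x * indicat_real ?S x))"
    proof (rule SI_mono, intro conjI)
      fix x assume x: "x \<in> cball x0 (2 * R)"
      show "(G h x)\<^sup>2 * f x \<le> t\<^sup>2 * f x + K\<^sup>2 * (f x * indicat_real ?S x)"
      proof (cases "G h x > t")
        case True
        have "(G h x)\<^sup>2 * f x \<le> K\<^sup>2 * f x" using G(2,3) f_nonneg by (intro mult_right_mono power_mono) auto
        also have "\<dots> \<le> t\<^sup>2 * f x + K\<^sup>2 * f x" using f_nonneg[of x] by simp
        finally show ?thesis using True x by simp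
      next
        case False
        have "(G h x)\<^sup>2 * f x \<le> t\<^sup>2 * f x" using False G(2) f_nonneg by (intro mult_right_mono power_mono) auto
        then show ?thesis using False by simp
      qed
    qed
    also have "\<dots> = ennreal (t\<^sup>2) * SI (cball x0 (2 * R)) f + ennreal (K\<^sup>2) * SI (cball x0 (2 * R)) (\<lambda>x. f x * indicat_real ?S x)"
      using f_nonneg by (subst SI_add) (auto simp: SI_cmult)
    also have "SI (cball x0 (2 * R)) (\<lambda>x. f x * indicat_real ?S x) = SI ?S f"
      unfolding SI_def by (rule nn_integral_cong) (auto simp: indicator_def)
    also have "ennreal (t\<^sup>2) * SI (cball x0 (2 * R)) f + ennreal (K\<^sup>2) * SI ?S f
      \<le> ennreal (t\<^sup>2) * SI (cball x0 (4 * R)) f + ennreal (K\<^sup>2) * (ennreal (e / (2 * K\<^sup>2)) * SI (cball x0 (4 * R)) f)"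
      using SS R by (intro add_mono mult_left_mono SI_subset subset_cball) auto
    also have "\<dots> = (ennreal (t\<^sup>2) + ennreal (K\<^sup>2) * ennreal (e / (2 * K\<^sup>2))) * SI (cball x0 (4 * R)) f"
      by (simp add: distrib_right mult.assoc)
    also have "ennreal (K\<^sup>2) * ennreal (e / (2 * K\<^sup>2)) = ennreal (e / 2)" using K e by (simp flip: ennreal_mult)
    also have "t\<^sup>2 = e / 2" using e by (simp add: t_def)
    also have "ennreal (e / 2) + ennreal (e / 2) = ennreal e" using e by (simp flip: ennreal_plus)
    finally show ?thesis .
  qed
  show ?thesis by (intro exI[of _ "R0 / 4"] conjI allI impI main) (use R0(1) in auto)
qed

lemma f_higher_integrability:
  assumes "s > 0" "cball x1 (3 * s) \<subseteq> D"
  shows "SI (cball x1 s) (\<lambda>x. f x powr (real DIM('a) / (real DIM('a) - 2 * \<alpha>))) < \<infinity>"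
proof -
  obtain C where C: "C > 0" and ve: "\<And>x0 R h. R > 0 \<Longrightarrow> cball x0 (4 * R) \<subseteq> D \<Longrightarrow> h \<noteq> 0 \<Longrightarrow> norm h \<le> R \<Longrightarrow>
     SI (cball x0 R) (\<lambda>x. (norm (V (x + h) - V x))\<^sup>2)
       \<le> ennreal C * (SI (cball x0 (2 * R)) (\<lambda>x. (G h x)\<^sup>2 * f x) + ennreal ((norm h / R)\<^sup>2) * SI (cball x0 (4 * R)) f)"
    using V_estimate by blast
  interpret small_differences D f V C0 C
  proof
    show "integrable lborel f" by (rule f_int)
    show "f x \<ge> 0" for x by (rule f_nonneg)
    show "0 \<le> C" using C by simp
    fix e :: real assume e: "e > 0"
    then have "e / C > 0" using C by simp
    from G_small[OF this] obtain R0 where R0: "R0 > 0" and gs: "\<And>x0 R h. 0 < R \<Longrightarrow> R \<le> R0 \<Longrightarrow> h \<noteq> 0 \<Longrightarrow> norm h \<le> R \<Longrightarrow> cball x0 (4 * R) \<subseteq> D \<Longrightarrow>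
     SI (cball x0 (2 * R)) (\<lambda>x. (G h x)\<^sup>2 * f x) \<le> ennreal (e / C) * SI (cball x0 (4 * R)) f" by blast
    have main: "SI (cball x0 R) (\<lambda>y. (norm (V (y + h) - V y))\<^sup>2) \<le> ennreal (e + C * (norm h / R)\<^sup>2) * SI (cball x0 (4 * R)) f"
      if R: "0 < R" "R \<le> R0" "norm h \<le> R" "cball x0 (4 * R) \<subseteq> D" for x0 R h
    proof (cases "h = 0")
      case True then show ?thesis by (simp add: SI_def)
    next
      case False
      have "SI (cball x0 R) (\<lambda>y. (norm (V (y + h) - V y))\<^sup>2)
         \<le> ennreal C * (SI (cball x0 (2 * R)) (\<lambda>x. (G h x)\<^sup>2 * f x) + ennreal ((norm h / R)\<^sup>2) * SI (cball x0 (4 * R)) f)"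
        by (rule ve[OF R(1,4) False R(3)])
      also have "\<dots> \<le> ennreal C * (ennreal (e / C) * SI (cball x0 (4 * R)) f + ennreal ((norm h / R)\<^sup>2) * SI (cball x0 (4 * R)) f)"
        by (intro mult_left_mono add_right_mono gs[OF R(1,2) False R(3,4)]) simp
      also have "\<dots> = ennreal C * ennreal (e / C + (norm h / R)\<^sup>2) * SI (cball x0 (4 * R)) f"
        using e C by (simp add: distrib_right[symmetric] mult.assoc)
      also have "ennreal C * ennreal (e / C + (norm h / R)\<^sup>2) = ennreal (C * (e / C + (norm h / R)\<^sup>2))"
        using C by (intro ennreal_mult'[symmetric]) simp
      also have "C * (e / C + (norm h / R)\<^sup>2) = e + C * (norm h / R)\<^sup>2" using C by (simp add: distrib_left)
      finally show ?thesis .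
    qed
    show "\<exists>R0>0. \<forall>x0 R h. 0 < R \<longrightarrow> R \<le> R0 \<longrightarrow> norm h \<le> R \<longrightarrow> cball x0 (4 * R) \<subseteq> D \<longrightarrow>
       SI (cball x0 R) (\<lambda>y. (norm (V (y + h) - V y))\<^sup>2) \<le> ennreal (e + C * (norm h / R)\<^sup>2) * SI (cball x0 (4 * R)) f"
      by (intro exI[of _ R0] conjI allI impI main R0)
  qed (use V_borel V1 V2 C0 in auto)
  show ?thesis by (rule higher_integrability[OF dim \<alpha> assms])
qed

text \<open>Once \<open>f\<close> has the conjugate integrability, the square of \<open>G h\<close>
  can be traded for the full rate \<open>norm h powr (2 * \<alpha>)\<close>; the quadratic term is
  of higher order because \<alpha> < 1.\<close>

lemma local_besov:
  assumes R: "R > 0" and RD: "cball x1 (6 * R) \<subseteq> D"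
  shows "\<exists>C>0. \<forall>h. h \<noteq> 0 \<longrightarrow> norm h \<le> R \<longrightarrow>
     SI (cball x1 R) (\<lambda>x. (norm (V (x + h) - V x))\<^sup>2) \<le> ennreal (C * norm h powr (2 * \<alpha>))"
proof -
  let ?n = "DIM('a)"
  define s where "s = real ?n / \<alpha>"
  have s2: "s > 2" using dim \<alpha> by (simp add: s_def less_divide_eq)
  have s_conj: "s / (s - 2) = real ?n / (real ?n - 2 * \<alpha>)" using \<alpha> dim by (simp add: s_def field_simps)
  have sub: "cball x1 t \<subseteq> D" if "t \<le> 6 * R" for t by (rule subset_trans[OF subset_cball[OF that] RD])
  obtain C where C: "C > 0" and ve: "\<And>x0 R h. R > 0 \<Longrightarrow> cball x0 (4 * R) \<subseteq> D \<Longrightarrow> h \<noteq> 0 \<Longrightarrow> norm h \<le> R \<Longrightarrow>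
     SI (cball x0 R) (\<lambda>x. (norm (V (x + h) - V x))\<^sup>2)
       \<le> ennreal C * (SI (cball x0 (2 * R)) (\<lambda>x. (G h x)\<^sup>2 * f x) + ennreal ((norm h / R)\<^sup>2) * SI (cball x0 (4 * R)) f)"
    using V_estimate by blast
  have "SI (cball x1 (2 * R)) (\<lambda>x. f x powr (s / (s - 2))) < \<infinity>"
    unfolding s_conj by (rule f_higher_integrability) (use R RD in auto)
  then obtain I1 where I1: "I1 \<ge> 0" "SI (cball x1 (2 * R)) (\<lambda>x. f x powr (s / (s - 2))) = ennreal I1"
    by (cases "SI (cball x1 (2 * R)) (\<lambda>x. f x powr (s / (s - 2)))") auto
  obtain I2 where I2: "I2 \<ge> 0" "SI (cball x1 (4 * R)) \<gamma> = ennreal I2" by (rule SI_real[OF \<gamma>])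
  obtain I3 where I3: "I3 \<ge> 0" "SI (cball x1 (4 * R)) f = ennreal I3" by (rule SI_real[OF f_int f_nonneg])
  define C' where "C' = C * (Cg * I2 + I1 + R powr (2 - 2 * \<alpha>) / R\<^sup>2 * I3) + 1"
  have C': "C' > 0" unfolding C'_def using C Cg I1 I2 I3 by (intro add_nonneg_pos mult_nonneg_nonneg add_nonneg_nonneg) auto
  have main: "SI (cball x1 R) (\<lambda>x. (norm (V (x + h) - V x))\<^sup>2) \<le> ennreal (C' * norm h powr (2 * \<alpha>))"
    if h: "h \<noteq> 0" "norm h \<le> R" for h
  proof -
    let ?H = "norm h"
    have H: "?H > 0" using h by simp
    let ?y = "\<lambda>x. 1 / ?H ^ ?n * G h x powr s + f x powr (s / (s - 2))" and ?X = "?H powr (2 * \<alpha>)"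
    have g1: "SI (cball x1 (2 * R)) (\<lambda>x. (G h x)\<^sup>2 * f x) \<le> ennreal (?X * (Cg * I2 + I1))"
    proof -
      have pt: "(G h x)\<^sup>2 * f x \<le> ?X * ?y x" for x
      proof -
        \<comment> \<open>After division by \<open>?H powr \<alpha>\<close>, the power
          \<open>s\<close> of \<open>G h x\<close> carries the factor \<open>1 / ?H ^ ?n\<close>,
          which cancels the power of \<open>norm h\<close> in \<open>Gint\<close>. With this scaling
          Young's inequality gives the rate of Hoelder's.\<close>
        have "(G h x / ?H powr \<alpha>)\<^sup>2 * f x \<le> (G h x / ?H powr \<alpha>) powr s + f x powr (s / (s - 2))"
          by (rule young_powr) (use G(2) f_nonneg s2 in auto)
        also have "(G h x / ?H powr \<alpha>) powr s = 1 / ?H ^ ?n * G h x powr s"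
        proof -
          have "(?H powr \<alpha>) powr s = ?H powr real ?n" using \<alpha> by (simp add: powr_powr s_def)
          also have "\<dots> = ?H ^ ?n" using H by (simp add: powr_realpow)
          finally show ?thesis using G(2)[of h x] by (simp add: powr_divide)
        qed
        finally have "?X * ((G h x / ?H powr \<alpha>)\<^sup>2 * f x) \<le> ?X * ?y x"
          by (rule mult_left_mono) simp
        moreover have "?X = (?H powr \<alpha>)\<^sup>2" by (simp add: power2_eq_square flip: powr_add)
        ultimately show ?thesis using H by (simp add: power_divide)
      qed
      have "SI (cball x1 (2 * R)) (\<lambda>x. (G h x)\<^sup>2 * f x) \<le> SI (cball x1 (2 * R)) (\<lambda>x. ?X * ?y x)"
        by (rule SI_mono) (use pt in auto)
      also have "\<dots> = ennreal (?X) * (ennreal (1 / ?H ^ ?n) * SI (cball x1 (2 * R)) (\<lambda>x. G h x powr s) + ennreal I1)"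
      proof -
        have "SI (cball x1 (2 * R)) (\<lambda>x. ?X * ?y x)
          = ennreal (?X) * SI (cball x1 (2 * R)) (\<lambda>x. ?y x)"
          by (rule SI_cmult) auto
        also have "SI (cball x1 (2 * R)) (\<lambda>x. ?y x)
          = SI (cball x1 (2 * R)) (\<lambda>x. 1 / ?H ^ ?n * G h x powr s) + ennreal I1"
          unfolding I1(2)[symmetric] by (rule SI_add) auto
        also have "SI (cball x1 (2 * R)) (\<lambda>x. 1 / ?H ^ ?n * G h x powr s) = ennreal (1 / ?H ^ ?n) * SI (cball x1 (2 * R)) (\<lambda>x. G h x powr s)"
          by (rule SI_cmult) auto
        finally show ?thesis .
      qed
      also have "\<dots> \<le> ennreal (?X) * (ennreal (1 / ?H ^ ?n) * (ennreal (Cg * ?H ^ ?n) * ennreal I2) + ennreal I1)"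
      proof (intro mult_left_mono add_right_mono)
        have "SI (cball x1 (2 * R)) (\<lambda>x. G h x powr s) \<le> ennreal (Cg * ?H ^ ?n) * SI (cball x1 (2 * (2 * R))) \<gamma>"
          unfolding s_def by (rule Gint) (use h R sub[of "4 * R"] in auto)
        then show "SI (cball x1 (2 * R)) (\<lambda>x. G h x powr s) \<le> ennreal (Cg * ?H ^ ?n) * ennreal I2" by (simp add: I2)
      qed auto
      also have "ennreal (1 / ?H ^ ?n) * (ennreal (Cg * ?H ^ ?n) * ennreal I2) = ennreal (Cg * I2)"
        using Cg H I2(1) by (simp flip: ennreal_mult)
      also have "ennreal (?X) * (ennreal (Cg * I2) + ennreal I1) = ennreal (?X * (Cg * I2 + I1))"
        using Cg I1 I2 by (simp flip: ennreal_mult ennreal_plus)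
      finally show ?thesis .
    qed
    have g2: "(?H / R)\<^sup>2 \<le> ?X * (R powr (2 - 2 * \<alpha>) / R\<^sup>2)"
    proof -
      have "?H\<^sup>2 = ?H powr (2 * \<alpha> + (2 - 2 * \<alpha>))" using H by simp
      also have "\<dots> = ?X * ?H powr (2 - 2 * \<alpha>)" by (rule powr_add)
      also have "\<dots> \<le> ?X * R powr (2 - 2 * \<alpha>)"
        using h \<alpha> by (intro mult_left_mono powr_mono2) auto
      finally show ?thesis using R by (simp add: power_divide divide_right_mono)
    qed
    have "SI (cball x1 R) (\<lambda>x. (norm (V (x + h) - V x))\<^sup>2)
       \<le> ennreal C * (SI (cball x1 (2 * R)) (\<lambda>x. (G h x)\<^sup>2 * f x) + ennreal ((?H / R)\<^sup>2) * SI (cball x1 (4 * R)) f)"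
      by (rule ve[OF R sub h]) (use R in simp)
    also have "\<dots> \<le> ennreal C * (ennreal (?X * (Cg * I2 + I1)) + ennreal (?X * (R powr (2 - 2 * \<alpha>) / R\<^sup>2)) * ennreal I3)"
      unfolding I3(2) by (intro mult_left_mono add_mono g1 mult_right_mono ennreal_leI g2) auto
    also have "\<dots> = ennreal (C * (?X * (Cg * I2 + I1) + ?X * (R powr (2 - 2 * \<alpha>) / R\<^sup>2) * I3))"
    proof -
      have "0 \<le> ?X * (Cg * I2 + I1)" "0 \<le> ?X * (R powr (2 - 2 * \<alpha>) / R\<^sup>2)"
        using Cg I1 I2 by auto
      then show ?thesis using C I3(1)
        by (simp only: ennreal_mult[symmetric] ennreal_plus[symmetric] mult_nonneg_nonneg add_nonneg_nonneg less_imp_le)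
    qed
    also have "\<dots> \<le> ennreal (C' * ?X)"
    proof (rule ennreal_leI)
      have "C' * ?X = C * (?X * (Cg * I2 + I1) + ?X * (R powr (2 - 2 * \<alpha>) / R\<^sup>2) * I3) + ?X"
        by (simp only: C'_def distrib_left distrib_right mult_ac mult_1_left mult_1_right)
      then show "C * (?X * (Cg * I2 + I1) + ?X * (R powr (2 - 2 * \<alpha>) / R\<^sup>2) * I3) \<le> C' * ?X"
        by simp
    qed
    finally show ?thesis .
  qed
  show ?thesis by (intro exI[of _ C'] conjI allI impI C' main)
qed

end

section \<open>From estimates on balls to functions of compact support\<close>

lemma csupp_lipschitz:
  fixes \<phi> :: "'a::euclidean_space \<Rightarrow> real"
  assumes "smooth \<phi>" "csupp \<phi>"
  shows "\<exists>d>0. \<exists>B\<ge>0. \<forall>x h. norm h < d \<longrightarrow> \<bar>\<phi> (x + h) - \<phi> x\<bar> \<le> B * norm h"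
proof -
  obtain d where d: "d > 0" "\<And>x v. norm v < d \<Longrightarrow> \<bar>\<phi> (x + v) - \<phi> x - dd \<phi> x v\<bar> \<le> 1 * norm v"
    using csupp_linearization[OF assms zero_less_one] by blast
  have "\<exists>B. B > 0 \<and> (\<forall>x. \<bar>dd \<phi> x b\<bar> \<le> B)" for b
    by (rule csupp_bounded[OF csupp_dd[OF assms(2)] smooth_cont[OF smooth_dd[OF assms(1)]]]) blast
  then obtain B where B: "\<And>b. B b > 0" "\<And>b x. \<bar>dd \<phi> x b\<bar> \<le> B b" by metis
  have "\<bar>\<phi> (x + h) - \<phi> x\<bar> \<le> (1 + (\<Sum>b\<in>Basis. B b)) * norm h" if h: "norm h < d" for x h
  proof -
    have "norm (gr \<phi> x) \<le> (\<Sum>b\<in>Basis. norm (dd \<phi> x b *\<^sub>R b))" unfolding gr_def by (rule norm_sum)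
    also have "\<dots> \<le> (\<Sum>b\<in>Basis. B b)" by (intro sum_mono) (use B in auto)
    finally have g: "norm (gr \<phi> x) \<le> (\<Sum>b\<in>Basis. B b)" .
    have "\<bar>dd \<phi> x h\<bar> = \<bar>gr \<phi> x \<bullet> h\<bar>" by (simp add: gr_inner[OF assms(1)])
    also have "\<dots> \<le> norm (gr \<phi> x) * norm h" by (rule Cauchy_Schwarz_ineq2)
    also have "\<dots> \<le> (\<Sum>b\<in>Basis. B b) * norm h" by (intro mult_right_mono g) simp
    finally show ?thesis using d(2)[OF h, of x] by (simp add: distrib_right)
  qed
  moreover have "0 \<le> 1 + (\<Sum>b\<in>Basis. B b)" by (intro add_nonneg_nonneg sum_nonneg less_imp_le[OF B(1)]) simp
  ultimately show ?thesis using d(1) by blast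
qed

lemma SI_finite_cover:
  assumes "finite I" and [measurable]: "f \<in> borel_measurable borel" "\<And>i. i \<in> I \<Longrightarrow> B i \<in> sets borel"
    and f: "\<And>x. f x \<ge> 0" and cov: "\<And>x. f x \<noteq> 0 \<Longrightarrow> \<exists>i\<in>I. x \<in> B i"
  shows "SI UNIV f \<le> (\<Sum>i\<in>I. SI (B i) f)"
proof -
  have "SI UNIV f \<le> (\<integral>\<^sup>+x. (\<Sum>i\<in>I. ennreal (f x) * indicator (B i) x) \<partial>lborel)"
    unfolding SI_def
  proof (rule nn_integral_mono)
    fix x
    show "ennreal (f x) * indicator UNIV x \<le> (\<Sum>i\<in>I. ennreal (f x) * indicator (B i) x)"
    proof (cases "f x = 0")
      case False
      from cov[OF this] obtain j where j: "j \<in> I" "x \<in> B j" by blast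
      have "ennreal (f x) * indicator (B j) x \<le> (\<Sum>i\<in>I. ennreal (f x) * indicator (B i) x)"
        by (rule member_le_sum) (use j assms(1) in auto)
      then show ?thesis using j by simp
    qed simp
  qed
  also have "\<dots> = (\<Sum>i\<in>I. SI (B i) f)" unfolding SI_def by (rule nn_integral_sum) auto
  finally show ?thesis .
qed

context energy_reg
begin

text \<open>For short \<open>h\<close>, finitely many balls from \<open>local_besov\<close> cover
  the support of the difference, and the product rule adds only the Lipschitz bound of \<phi>, of
  order |h|^2 in the square. For longer \<open>h\<close> the triangle inequality is enough, as
  \<open>norm h powr (2 * \<alpha>)\<close> is then bounded below.\<close>

lemma besov_estimate:
  assumes \<phi>: "smooth \<phi>" and S: "compact S" "S \<subseteq> D" "\<And>x. x \<notin> S \<Longrightarrow> \<phi> x = 0"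
  shows "SI UNIV (\<lambda>x. (norm (\<phi> x *\<^sub>R V x))\<^sup>2) < \<infinity>"
    and "\<exists>C\<ge>0. \<forall>h. h \<noteq> 0 \<longrightarrow>
      SI UNIV (\<lambda>x. (norm (\<phi> (x + h) *\<^sub>R V (x + h) - \<phi> x *\<^sub>R V x))\<^sup>2) \<le> ennreal (C * norm h powr (2 * \<alpha>))"
proof -
  have cs: "csupp \<phi>" by (rule csupp_compact[OF S(1,3)])
  let ?W = "\<lambda>x. \<phi> x *\<^sub>R V x"
  obtain M where M: "M > 0" "\<And>x. \<bar>\<phi> x\<bar> \<le> M" using csupp_bounded[OF cs smooth_cont[OF \<phi>]] by blast
  have M2: "(\<phi> x)\<^sup>2 \<le> M\<^sup>2" for x using power_mono[OF M(2) abs_ge_zero, of x 2] by simp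
  note [measurable] = smooth_borel[OF \<phi>]
  obtain If where If: "If \<ge> 0" "SI UNIV f = ennreal If" by (rule SI_real[OF f_int f_nonneg])
  have pt: "(norm (?W x))\<^sup>2 \<le> M\<^sup>2 * f x" for x
  proof (cases "x \<in> S")
    case True
    have "(norm (?W x))\<^sup>2 = (\<phi> x)\<^sup>2 * (norm (V x))\<^sup>2" by (simp add: power_mult_distrib)
    also have "\<dots> \<le> M\<^sup>2 * f x" using M2 V1[of x] True S(2) by (intro mult_mono) auto
    finally show ?thesis .
  qed (use S(3) f_nonneg in auto)
  have tot: "SI UNIV (\<lambda>x. (norm (?W x))\<^sup>2) \<le> ennreal (M\<^sup>2 * If)"
  proof -
    have "SI UNIV (\<lambda>x. (norm (?W x))\<^sup>2) \<le> SI UNIV (\<lambda>x. M\<^sup>2 * f x)" by (rule SI_mono) (use pt in auto)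
    also have "\<dots> = ennreal (M\<^sup>2) * ennreal If" unfolding If(2)[symmetric] by (rule SI_cmult) auto
    finally show ?thesis using If by (simp add: ennreal_mult)
  qed
  then show "SI UNIV (\<lambda>x. (norm (?W x))\<^sup>2) < \<infinity>" by (simp add: le_less_trans)
  obtain d B where d: "d > 0" and B: "B \<ge> 0" "\<And>x h. norm h < d \<Longrightarrow> \<bar>\<phi> (x + h) - \<phi> x\<bar> \<le> B * norm h"
    using csupp_lipschitz[OF \<phi> cs] by blast
  have "\<exists>R. R > 0 \<and> cball x (6 * R) \<subseteq> D" if "x \<in> S" for x
  proof -
    obtain e where e: "e > 0" "cball x e \<subseteq> D" using D S(2) \<open>x \<in> S\<close> open_contains_cball by blast
    then show ?thesis by (intro exI[of _ "e / 6"]) auto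
  qed
  then obtain R where R: "\<And>x. x \<in> S \<Longrightarrow> R x > 0" "\<And>x. x \<in> S \<Longrightarrow> cball x (6 * R x) \<subseteq> D" by metis
  have "\<exists>C. C > 0 \<and> (\<forall>h. h \<noteq> 0 \<longrightarrow> norm h \<le> R x \<longrightarrow>
     SI (cball x (R x)) (\<lambda>y. (norm (V (y + h) - V y))\<^sup>2) \<le> ennreal (C * norm h powr (2 * \<alpha>)))" if "x \<in> S" for x
    using local_besov[OF R(1)[OF that] R(2)[OF that]] by blast
  then obtain C where C: "\<And>x. x \<in> S \<Longrightarrow> C x > 0" and est: "\<And>x h. x \<in> S \<Longrightarrow> h \<noteq> 0 \<Longrightarrow> norm h \<le> R x \<Longrightarrow>
     SI (cball x (R x)) (\<lambda>y. (norm (V (y + h) - V y))\<^sup>2) \<le> ennreal (C x * norm h powr (2 * \<alpha>))" by metis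
  \<comment> \<open>Half radii leave room: a point within \<open>r \<le> R y / 2\<close> of the half
    ball about \<open>y\<close> still lies in the ball on which the estimate holds.\<close>
  have "S \<subseteq> (\<Union>x\<in>S. ball x (R x / 2))" using R(1) by force
  then obtain I where I: "I \<subseteq> S" "finite I" and Icov: "S \<subseteq> (\<Union>x\<in>I. ball x (R x / 2))"
    using compactE_image[OF S(1), of S "\<lambda>x. ball x (R x / 2)"] by (metis open_ball)
  define r where "r = Min (insert (d / 2) ((\<lambda>x. R x / 2) ` I))"
  have r0: "r > 0" unfolding r_def using I R(1) d by (subst Min_gr_iff) auto
  have rd: "r < d" and rR: "\<And>x. x \<in> I \<Longrightarrow> r \<le> R x / 2"
  proof -
    have "r \<le> d / 2" unfolding r_def by (rule Min_le) (use I in auto)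
    then show "r < d" using d by simp
    show "r \<le> R x / 2" if "x \<in> I" for x unfolding r_def by (rule Min_le) (use I that in auto)
  qed
  define C1 where "C1 = (\<Sum>x\<in>I. 2 * M\<^sup>2 * C x + 2 * B\<^sup>2 * r powr (2 - 2 * \<alpha>) * If)"
  \<comment> \<open>\<open>C2 * r powr (2 * \<alpha>)\<close> is the bound that the triangle
    inequality gives for \<open>norm h > r\<close>.\<close>
  define C2 where "C2 = 4 * (M\<^sup>2 * If) / r powr (2 * \<alpha>)"
  have C1: "C1 \<ge> 0" unfolding C1_def using C I If by (intro sum_nonneg add_nonneg_nonneg mult_nonneg_nonneg) (auto simp: less_imp_le)
  have C2: "C2 \<ge> 0" unfolding C2_def using If by simp
  have main: "SI UNIV (\<lambda>x. (norm (?W (x + h) - ?W x))\<^sup>2) \<le> ennreal ((C1 + C2) * norm h powr (2 * \<alpha>))"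
    if h: "h \<noteq> 0" for h
  proof -
    let ?H = "norm h powr (2 * \<alpha>)" and ?\<Delta> = "\<lambda>x. (norm (?W (x + h) - ?W x))\<^sup>2"
    have sq: "(norm (a + b))\<^sup>2 \<le> 2 * (norm a)\<^sup>2 + 2 * (norm b)\<^sup>2" for a b :: 'a
    proof -
      have "(norm (a + b))\<^sup>2 \<le> (norm a + norm b)\<^sup>2" by (intro power_mono norm_triangle_ineq) simp
      also have "\<dots> \<le> 2 * (norm a)\<^sup>2 + 2 * (norm b)\<^sup>2"
        using zero_le_power2[of "norm a - norm b"] unfolding power2_diff power2_sum by simp
      finally show ?thesis .
    qed
    show ?thesis
    proof (cases "norm h \<le> r")
      case True
      have H2: "(norm h)\<^sup>2 \<le> ?H * r powr (2 - 2 * \<alpha>)"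
      proof -
        have "(norm h)\<^sup>2 = norm h powr (2 * \<alpha> + (2 - 2 * \<alpha>))" using h by simp
        also have "\<dots> = ?H * norm h powr (2 - 2 * \<alpha>)" by (rule powr_add)
        also have "\<dots> \<le> ?H * r powr (2 - 2 * \<alpha>)" using True \<alpha> by (intro mult_left_mono powr_mono2) auto
        finally show ?thesis .
      qed
      have pw: "?\<Delta> x \<le> 2 * M\<^sup>2 * (norm (V (x + h) - V x))\<^sup>2 + 2 * B\<^sup>2 * r powr (2 - 2 * \<alpha>) * ?H * f x" if x: "x \<in> D" for x
      proof -
        have "?W (x + h) - ?W x = \<phi> (x + h) *\<^sub>R (V (x + h) - V x) + (\<phi> (x + h) - \<phi> x) *\<^sub>R V x"
          by (simp add: scaleR_diff_right scaleR_diff_left)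
        then have "?\<Delta> x \<le> 2 * (norm (\<phi> (x + h) *\<^sub>R (V (x + h) - V x)))\<^sup>2 + 2 * (norm ((\<phi> (x + h) - \<phi> x) *\<^sub>R V x))\<^sup>2"
          by (simp only: sq)
        also have "\<dots> = 2 * ((\<phi> (x + h))\<^sup>2 * (norm (V (x + h) - V x))\<^sup>2) + 2 * ((\<phi> (x + h) - \<phi> x)\<^sup>2 * (norm (V x))\<^sup>2)"
          by (simp add: power_mult_distrib)
        also have "\<dots> \<le> 2 * (M\<^sup>2 * (norm (V (x + h) - V x))\<^sup>2) + 2 * ((B\<^sup>2 * (?H * r powr (2 - 2 * \<alpha>))) * f x)"
        proof (intro add_mono mult_left_mono mult_mono mult_right_mono)
          have "\<bar>\<phi> (x + h) - \<phi> x\<bar>\<^sup>2 \<le> (B * norm h)\<^sup>2" using True rd by (intro power_mono B) auto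
          also have "\<dots> \<le> B\<^sup>2 * (?H * r powr (2 - 2 * \<alpha>))" unfolding power_mult_distrib by (intro mult_left_mono H2) simp
          finally show "(\<phi> (x + h) - \<phi> x)\<^sup>2 \<le> B\<^sup>2 * (?H * r powr (2 - 2 * \<alpha>))" by simp
        qed (use M2 V1[OF x] in auto)
        also have "\<dots> = 2 * M\<^sup>2 * (norm (V (x + h) - V x))\<^sup>2 + 2 * B\<^sup>2 * r powr (2 - 2 * \<alpha>) * ?H * f x" by (simp only: mult_ac)
        finally show ?thesis .
      qed
      have one: "SI (cball y (R y)) ?\<Delta> \<le> ennreal ((2 * M\<^sup>2 * C y + 2 * B\<^sup>2 * r powr (2 - 2 * \<alpha>) * If) * ?H)" if y: "y \<in> I" for y
      proof -
        have yS: "y \<in> S" using y I by blast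
        have cD: "cball y (R y) \<subseteq> D" using subset_cball[of "R y" "6 * R y" y] R(1,2)[OF yS] by auto
        let ?b = "2 * B\<^sup>2 * r powr (2 - 2 * \<alpha>) * ?H"
        have "SI (cball y (R y)) ?\<Delta> \<le> SI (cball y (R y)) (\<lambda>x. 2 * M\<^sup>2 * (norm (V (x + h) - V x))\<^sup>2 + ?b * f x)"
          by (rule SI_mono) (use pw cD in blast)
        also have "\<dots> = SI (cball y (R y)) (\<lambda>x. 2 * M\<^sup>2 * (norm (V (x + h) - V x))\<^sup>2) + SI (cball y (R y)) (\<lambda>x. ?b * f x)"
          by (rule SI_add) (use f_nonneg in auto)
        also have "SI (cball y (R y)) (\<lambda>x. 2 * M\<^sup>2 * (norm (V (x + h) - V x))\<^sup>2) = ennreal (2 * M\<^sup>2) * SI (cball y (R y)) (\<lambda>x. (norm (V (x + h) - V x))\<^sup>2)"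
          by (rule SI_cmult) auto
        also have "SI (cball y (R y)) (\<lambda>x. ?b * f x) = ennreal ?b * SI (cball y (R y)) f" by (rule SI_cmult) auto
        also have "ennreal (2 * M\<^sup>2) * SI (cball y (R y)) (\<lambda>x. (norm (V (x + h) - V x))\<^sup>2) + ennreal ?b * SI (cball y (R y)) f
          \<le> ennreal (2 * M\<^sup>2) * ennreal (C y * ?H) + ennreal ?b * ennreal If"
          unfolding If(2)[symmetric]
          using True rR[OF y] r0 by (intro add_mono mult_left_mono est[OF yS h] SI_subset) auto
        also have "\<dots> = ennreal (2 * M\<^sup>2 * (C y * ?H) + ?b * If)"
          using C[OF yS] If(1) by (simp flip: ennreal_mult ennreal_plus)
        also have "2 * M\<^sup>2 * (C y * ?H) + ?b * If = (2 * M\<^sup>2 * C y + 2 * B\<^sup>2 * r powr (2 - 2 * \<alpha>) * If) * ?H"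
          by (simp add: algebra_simps)
        finally show ?thesis .
      qed
      have "SI UNIV ?\<Delta> \<le> (\<Sum>y\<in>I. SI (cball y (R y)) ?\<Delta>)"
      proof (rule SI_finite_cover)
        fix x assume ne: "?\<Delta> x \<noteq> 0"
        have "x \<in> S \<or> x + h \<in> S"
        proof (rule ccontr)
          assume "\<not> (x \<in> S \<or> x + h \<in> S)"
          then have "\<phi> x = 0" "\<phi> (x + h) = 0" using S(3) by auto
          with ne show False by simp
        qed
        then obtain z where z: "z \<in> S" "dist z x \<le> r"
        proof
          assume "x + h \<in> S" then show thesis using True by (intro that[of "x + h"]) (auto simp: dist_norm)
        qed (use r0 in \<open>auto intro: that[of x]\<close>)
        then obtain y where y: "y \<in> I" "z \<in> ball y (R y / 2)" using Icov by blast
        have "dist y x \<le> dist y z + dist z x" by (rule dist_triangle)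
        also have "\<dots> \<le> R y / 2 + R y / 2" using y z rR[OF y(1)] by auto
        finally show "\<exists>y\<in>I. x \<in> cball y (R y)" using y by auto
      qed (use I in auto)
      also have "\<dots> \<le> (\<Sum>y\<in>I. ennreal ((2 * M\<^sup>2 * C y + 2 * B\<^sup>2 * r powr (2 - 2 * \<alpha>) * If) * ?H))"
        by (rule sum_mono[OF one])
      also have "\<dots> = ennreal (C1 * ?H)"
        unfolding C1_def sum_distrib_right using C I If
        by (intro sum_ennreal mult_nonneg_nonneg add_nonneg_nonneg) (auto simp: less_imp_le)
      also have "\<dots> \<le> ennreal ((C1 + C2) * ?H)" using C2 by (intro ennreal_leI mult_right_mono) auto
      finally show ?thesis .
    next
      case False
      have "SI UNIV ?\<Delta> \<le> SI UNIV (\<lambda>x. 2 * (norm (?W (x + h)))\<^sup>2 + 2 * (norm (?W x))\<^sup>2)"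
      proof (rule SI_mono, intro conjI)
        show "?\<Delta> x \<le> 2 * (norm (?W (x + h)))\<^sup>2 + 2 * (norm (?W x))\<^sup>2" for x
          using sq[of "?W (x + h)" "- (?W x)"] by simp
      qed auto
      also have "\<dots> = SI UNIV (\<lambda>x. 2 * (norm (?W (x + h)))\<^sup>2) + SI UNIV (\<lambda>x. 2 * (norm (?W x))\<^sup>2)"
        by (rule SI_add) auto
      also have "SI UNIV (\<lambda>x. 2 * (norm (?W x))\<^sup>2) = ennreal 2 * SI UNIV (\<lambda>x. (norm (?W x))\<^sup>2)"
        by (rule SI_cmult) auto
      also have "SI UNIV (\<lambda>x. 2 * (norm (?W (x + h)))\<^sup>2) = ennreal 2 * SI UNIV (\<lambda>x. (norm (?W (x + h)))\<^sup>2)"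
        by (rule SI_cmult) auto
      also have "SI UNIV (\<lambda>x. (norm (?W (x + h)))\<^sup>2) = SI UNIV (\<lambda>x. (norm (?W x))\<^sup>2)"
        using SI_shift[of "\<lambda>x. (norm (?W x))\<^sup>2" UNIV h] by simp
      also have "ennreal 2 * SI UNIV (\<lambda>x. (norm (?W x))\<^sup>2) + ennreal 2 * SI UNIV (\<lambda>x. (norm (?W x))\<^sup>2)
         \<le> ennreal 2 * ennreal (M\<^sup>2 * If) + ennreal 2 * ennreal (M\<^sup>2 * If)" by (intro add_mono mult_left_mono tot) auto
      also have "\<dots> = ennreal (2 * (M\<^sup>2 * If) + 2 * (M\<^sup>2 * If))"
        using If(1) by (simp only: ennreal_mult[symmetric] ennreal_plus[symmetric] mult_nonneg_nonneg zero_le_power2 zero_le_numeral)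
      also have "2 * (M\<^sup>2 * If) + 2 * (M\<^sup>2 * If) = C2 * r powr (2 * \<alpha>)" using r0 by (simp add: C2_def)
      also have "ennreal \<dots> \<le> ennreal ((C1 + C2) * ?H)"
        using False r0 C1 C2 \<alpha> by (intro ennreal_leI mult_mono powr_mono2) auto
      finally show ?thesis .
    qed
  qed
  show "\<exists>C\<ge>0. \<forall>h. h \<noteq> 0 \<longrightarrow>
      SI UNIV (\<lambda>x. (norm (?W (x + h) - ?W x))\<^sup>2) \<le> ennreal (C * norm h powr (2 * \<alpha>))"
    by (intro exI[of _ "C1 + C2"] conjI allI impI main) (use C1 C2 in auto)
qed

end

section \<open>Lebesgue measurable data\<close>

lemma AE_lebesgue_on:
  assumes "\<Omega> \<in> sets (borel :: 'a::euclidean_space measure)"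
  shows "(AE x in lebesgue_on \<Omega>. Q x) \<longleftrightarrow> (AE x in lborel. x \<in> \<Omega> \<longrightarrow> Q x)"
  using assms by (subst AE_restrict_space_iff) (auto simp: AE_completion_iff)

text \<open>Measurability with respect to the completion is traded for Borel measurability one
  coordinate at a time. Extension by zero moves the function from \<Omega> to the whole space, where
  all estimates take place.\<close>

lemma lebesgue_on_borel_rep:
  fixes f :: "'a::euclidean_space \<Rightarrow> 'b::euclidean_space"
  assumes \<Omega>[measurable]: "\<Omega> \<in> sets borel" and f: "f \<in> borel_measurable (lebesgue_on \<Omega>)"
  obtains g where "g \<in> borel_measurable borel" "\<And>x. x \<notin> \<Omega> \<Longrightarrow> g x = 0" "AE x in lborel. x \<in> \<Omega> \<longrightarrow> g x = f x"
proof -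
  have m: "(\<lambda>x. indicat_real \<Omega> x *\<^sub>R f x) \<in> borel_measurable lebesgue"
    using f \<Omega> by (subst (asm) borel_measurable_restrict_space_iff) auto
  have "\<exists>g. g \<in> borel_measurable lborel \<and> (AE x in lborel. (indicat_real \<Omega> x *\<^sub>R f x) \<bullet> b = g x)" for b
    using completion_ex_borel_measurable_real[of "\<lambda>x. (indicat_real \<Omega> x *\<^sub>R f x) \<bullet> b" lborel] borel_measurable_inner[OF m borel_measurable_const[of b]] by auto
  then obtain G where G: "\<And>b. G b \<in> borel_measurable lborel" "\<And>b. AE x in lborel. (indicat_real \<Omega> x *\<^sub>R f x) \<bullet> b = G b x" by metis
  have [measurable]: "G b \<in> borel_measurable borel" for b using G(1)[of b] by simp
  define g where "g x = indicat_real \<Omega> x *\<^sub>R (\<Sum>b\<in>Basis. G b x *\<^sub>R b)" for x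
  have "AE x in lborel. \<forall>b\<in>Basis. (indicat_real \<Omega> x *\<^sub>R f x) \<bullet> b = G b x"
    by (intro AE_finite_allI finite_Basis G(2))
  then have "AE x in lborel. x \<in> \<Omega> \<longrightarrow> g x = f x"
  proof eventually_elim
    case (elim x)
    show ?case
    proof
      assume x: "x \<in> \<Omega>"
      have "g x = (\<Sum>b\<in>Basis. (f x \<bullet> b) *\<^sub>R b)" using elim x by (simp add: g_def)
      then show "g x = f x" by (simp add: euclidean_representation)
    qed
  qed
  moreover have "g \<in> borel_measurable borel" unfolding g_def[abs_def] by measurable
  ultimately show ?thesis by (intro that[of g]) (auto simp: g_def)
qed

lemma lebesgue_on_rep_integral:
  fixes f g :: "'a::euclidean_space \<Rightarrow> 'b::euclidean_space"
  assumes [measurable]: "\<Omega> \<in> sets borel" "g \<in> borel_measurable borel" and g: "\<And>x. x \<notin> \<Omega> \<Longrightarrow> g x = 0"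
    and ae: "AE x in lborel. x \<in> \<Omega> \<longrightarrow> g x = f x"
  shows "integral\<^sup>L (lebesgue_on \<Omega>) f = integral\<^sup>L lborel g"
    and "integrable (lebesgue_on \<Omega>) f \<longleftrightarrow> integrable lborel g"
    and "f \<in> borel_measurable (lebesgue_on \<Omega>)"
proof -
  have e: "AE x in lebesgue. g x = indicat_real \<Omega> x *\<^sub>R f x"
    unfolding AE_completion_iff using ae by eventually_elim (auto simp: indicator_def g)
  have mg: "g \<in> borel_measurable lebesgue" by (simp add: measurable_completion)
  have mf: "(\<lambda>x. indicat_real \<Omega> x *\<^sub>R f x) \<in> borel_measurable lebesgue" by (rule borel_measurable_AE[OF mg e])
  show "integral\<^sup>L (lebesgue_on \<Omega>) f = integral\<^sup>L lborel g"
    using integral_cong_AE[OF mg mf e] by (simp add: integral_restrict_space integral_completion)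
  show "integrable (lebesgue_on \<Omega>) f \<longleftrightarrow> integrable lborel g"
    using integrable_cong_AE[OF mg mf e] by (simp add: integrable_restrict_space integrable_completion)
  show "f \<in> borel_measurable (lebesgue_on \<Omega>)" using mf by (subst borel_measurable_restrict_space_iff) auto
qed

lemma absolutely_integrable_rep:
  fixes f :: "'a::euclidean_space \<Rightarrow> 'b::euclidean_space"
  assumes \<Omega>: "\<Omega> \<in> sets borel" and f: "f absolutely_integrable_on \<Omega>"
  obtains g where "g \<in> borel_measurable borel" "integrable lborel g" "\<And>x. x \<notin> \<Omega> \<Longrightarrow> g x = 0" "AE x in lborel. x \<in> \<Omega> \<longrightarrow> g x = f x"
proof -
  have i: "integrable (lebesgue_on \<Omega>) f"
    using f \<Omega> by (subst integrable_restrict_space) (auto simp: set_integrable_def)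
  obtain g where g: "g \<in> borel_measurable borel" "\<And>x. x \<notin> \<Omega> \<Longrightarrow> g x = 0" "AE x in lborel. x \<in> \<Omega> \<longrightarrow> g x = f x"
    by (rule lebesgue_on_borel_rep[OF \<Omega> borel_measurable_integrable[OF i]]) blast
  moreover have "integrable lborel g" using lebesgue_on_rep_integral(2)[OF \<Omega> g] i by simp
  ultimately show ?thesis by (rule_tac that)
qed

text \<open>Approximating \<open>F\<close> by simple functions leaves finitely many frozen
  arguments, where measurability in \<open>x\<close> is given; continuity in the second argument
  yields the limit. The null set \<open>N\<close> of exceptional sections is masked by an
  indicator.\<close>

lemma Caratheodory_measurable:
  fixes A :: "'a::euclidean_space \<Rightarrow> 'b::euclidean_space \<Rightarrow> 'c::euclidean_space"
  assumes \<Omega>: "\<Omega> \<in> sets borel" and A: "Caratheodory \<Omega> A" and F: "F \<in> borel_measurable borel"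
  shows "(\<lambda>x. A x (F x)) \<in> borel_measurable (lebesgue_on \<Omega>)"
proof -
  define B where "B x \<xi> = indicat_real \<Omega> x *\<^sub>R A x \<xi>" for x \<xi>
  have \<Omega>L: "\<Omega> \<inter> space lebesgue \<in> sets lebesgue" using \<Omega> by simp
  have B: "(\<lambda>x. B x \<xi>) \<in> borel_measurable lebesgue" for \<xi>
    using A borel_measurable_restrict_space_iff[OF \<Omega>L, of "\<lambda>x. A x \<xi>"] by (simp add: Caratheodory_def B_def)
  have "AE x in lebesgue. x \<in> \<Omega> \<longrightarrow> continuous_on UNIV (A x)"
    using A AE_restrict_space_iff[OF \<Omega>L, of "\<lambda>x. continuous_on UNIV (A x)"] by (simp add: Caratheodory_def)
  then have "AE x in lebesgue. continuous_on UNIV (B x)"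
    by eventually_elim (auto simp: B_def[abs_def] indicator_def)
  then obtain N where N: "N \<in> null_sets lebesgue" "\<And>x. x \<notin> N \<Longrightarrow> continuous_on UNIV (B x)"
    unfolding eventually_ae_filter by auto
  have mF: "F \<in> borel_measurable lebesgue" using F by (simp add: measurable_completion)
  obtain s where s: "\<And>i. simple_function lebesgue (s i)" "\<And>x. (\<lambda>i. s i x) \<longlonglongrightarrow> F x"
    using borel_measurable_implies_sequence_metric[OF mF, of 0] by auto
  have [measurable]: "N \<in> sets lebesgue" using N(1) by (simp add: null_sets_def)
  have "(\<lambda>x. indicat_real (- N) x *\<^sub>R B x (F x)) \<in> borel_measurable lebesgue"
  proof (rule borel_measurable_LIMSEQ_metric)
    fix i
    have fin: "finite (range (s i))" using simple_functionD(1)[OF s(1)] by simp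
    have m: "s i -` {y} \<in> sets lebesgue" for y using simple_functionD(2)[OF s(1), of i "{y}"] by simp
    have "B x (s i x) = (\<Sum>y\<in>range (s i). indicat_real (s i -` {y}) x *\<^sub>R B x y)" for x
    proof -
      have "(\<Sum>y\<in>range (s i). indicat_real (s i -` {y}) x *\<^sub>R B x y) = (\<Sum>y\<in>range (s i). if y = s i x then B x y else 0)"
        by (rule sum.cong) (auto simp: indicator_def)
      then show ?thesis using fin by simp
    qed
    then show "(\<lambda>x. indicat_real (- N) x *\<^sub>R B x (s i x)) \<in> borel_measurable lebesgue"
      using m B by (auto intro!: borel_measurable_scaleR borel_measurable_sum borel_measurable_indicator)
  next
    fix x
    show "(\<lambda>i. indicat_real (- N) x *\<^sub>R B x (s i x)) \<longlonglongrightarrow> indicat_real (- N) x *\<^sub>R B x (F x)"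
    proof (cases "x \<in> N")
      case False
      have "isCont (B x) (F x)" using N(2)[OF False] by (simp add: continuous_on_eq_continuous_at)
      then have "(\<lambda>i. B x (s i x)) \<longlonglongrightarrow> B x (F x)" using s(2) by (rule isCont_tendsto_compose)
      then show ?thesis by (rule tendsto_scaleR[OF tendsto_const])
    qed simp
  qed
  moreover have "AE x in lebesgue. indicat_real (- N) x *\<^sub>R B x (F x) = B x (F x)"
    using AE_not_in[OF N(1)] by eventually_elim simp
  ultimately have "(\<lambda>x. B x (F x)) \<in> borel_measurable lebesgue" by (rule borel_measurable_AE)
  then show ?thesis unfolding borel_measurable_restrict_space_iff[OF \<Omega>L] by (simp add: B_def)
qed

lemma tests_eq: "tests D = test_functions D"
proof (intro set_eqI iffI)
  fix \<phi> assume "\<phi> \<in> tests D"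
  then obtain K where K: "smooth \<phi>" "compact K" "K \<subseteq> D" "\<And>x. x \<notin> K \<Longrightarrow> \<phi> x = 0" by (auto simp: tests_def)
  have "closure {x. \<phi> x \<noteq> 0} \<subseteq> K" by (rule closure_minimal) (use K compact_imp_closed in auto)
  moreover from this have "compact (closure {x. \<phi> x \<noteq> 0})"
    using compact_Int_closed[OF K(2) closed_closure, of "{x. \<phi> x \<noteq> 0}"] by (simp add: Int_absorb1)
  ultimately show "\<phi> \<in> test_functions D" using K by (auto simp: test_functions_def smooth_def)
next
  fix \<phi> assume "\<phi> \<in> test_functions D"
  then show "\<phi> \<in> tests D"
    by (intro testsI[of _ "closure {x. \<phi> x \<noteq> 0}"]) (use closure_subset[of "{x. \<phi> x \<noteq> 0}"] in \<open>auto simp: test_functions_def smooth_def\<close>)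
qed

lemma grad_gr:
  assumes "smooth \<phi>" shows "grad \<phi> x = gr \<phi> x"
  by (simp add: vec_eq_iff grad_def gr_inner[OF assms, symmetric] inner_axis)

lemma tests_mono: "D \<subseteq> D' \<Longrightarrow> tests D \<subseteq> tests D'"
  unfolding tests_def by blast

lemma tests_outside:
  assumes "\<phi> \<in> tests D" "x \<notin> D" shows "\<phi> x = 0" "gr \<phi> x = 0"
  using assms by (auto simp: tests_def intro: gr_outside)

lemma weak_gradient_rep:
  fixes u ub :: "real^'n \<Rightarrow> real" and Du Fb :: "real^'n \<Rightarrow> real^'n"
  assumes "open \<Omega>" "O' \<subseteq> \<Omega>" and w: "has_weak_gradient \<Omega> u Du"
    and ub: "ub \<in> borel_measurable borel" "\<And>x. x \<notin> O' \<Longrightarrow> ub x = 0" "AE x in lborel. x \<in> O' \<longrightarrow> ub x = u x"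
    and Fb: "Fb \<in> borel_measurable borel" "\<And>x. x \<notin> O' \<Longrightarrow> Fb x = 0" "AE x in lborel. x \<in> O' \<longrightarrow> Fb x = Du x"
    and \<phi>: "\<phi> \<in> tests O'"
  shows "(\<integral>x. ub x *\<^sub>R gr \<phi> x \<partial>lborel) = - (\<integral>x. \<phi> x *\<^sub>R Fb x \<partial>lborel)"
proof -
  have s: "smooth \<phi>" using \<phi> by (simp add: tests_def)
  have \<Omega>: "\<Omega> \<in> sets borel" using assms(1) by simp
  note [measurable] = smooth_borel[OF s] gr_borel[OF s] ub(1) Fb(1)
  have "(LINT x|lebesgue_on \<Omega>. u x *\<^sub>R grad \<phi> x) = (\<integral>x. ub x *\<^sub>R gr \<phi> x \<partial>lborel)"
  proof (rule lebesgue_on_rep_integral(1)[OF \<Omega>])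
    show "AE x in lborel. x \<in> \<Omega> \<longrightarrow> ub x *\<^sub>R gr \<phi> x = u x *\<^sub>R grad \<phi> x"
      using ub(3) by eventually_elim (use tests_outside(2)[OF \<phi>] in \<open>auto simp: grad_gr[OF s]\<close>)
  qed (use ub(2) assms(2) in auto)
  moreover have "(LINT x|lebesgue_on \<Omega>. \<phi> x *\<^sub>R Du x) = (\<integral>x. \<phi> x *\<^sub>R Fb x \<partial>lborel)"
  proof (rule lebesgue_on_rep_integral(1)[OF \<Omega>])
    show "AE x in lborel. x \<in> \<Omega> \<longrightarrow> \<phi> x *\<^sub>R Fb x = \<phi> x *\<^sub>R Du x"
      using Fb(3) by eventually_elim (use tests_outside(1)[OF \<phi>] in auto)
  qed (use Fb(2) assms(2) in auto)
  moreover have "\<phi> \<in> test_functions \<Omega>" using \<phi> tests_mono[OF assms(2)] by (auto simp: tests_eq)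
  ultimately show ?thesis using w by (simp add: has_weak_gradient_def)
qed

text \<open>Three weak gradients of \<open>u\<close> meet in \<open>local_gradient_data\<close>: the
  one of the theorem, the one provided by \<open>weak_solution\<close> and the one on a subdomain
  provided by \<open>W1P\<close>. As functions they may differ, and \<open>tests_unique\<close>
  identifies them up to null sets.\<close>

lemma weak_gradient_unique:
  fixes u :: "real^'n \<Rightarrow> real"
  assumes \<Omega>: "open \<Omega>" "open \<Omega>'" "open D" "D \<subseteq> \<Omega>" "D \<subseteq> \<Omega>'"
    and w: "has_weak_gradient \<Omega> u F" "has_weak_gradient \<Omega>' u G"
    and u: "u absolutely_integrable_on D" and F: "F absolutely_integrable_on D" and G: "G absolutely_integrable_on D"
  shows "AE x in lborel. x \<in> D \<longrightarrow> F x = G x"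
proof -
  have D: "D \<in> sets borel" using \<Omega> by simp
  obtain ub where ub: "ub \<in> borel_measurable borel" "integrable lborel ub" "\<And>x. x \<notin> D \<Longrightarrow> ub x = 0" "AE x in lborel. x \<in> D \<longrightarrow> ub x = u x"
    by (rule absolutely_integrable_rep[OF D u]) blast
  obtain Fb where Fb: "Fb \<in> borel_measurable borel" "integrable lborel Fb" "\<And>x. x \<notin> D \<Longrightarrow> Fb x = 0" "AE x in lborel. x \<in> D \<longrightarrow> Fb x = F x"
    by (rule absolutely_integrable_rep[OF D F]) blast
  obtain Gb where Gb: "Gb \<in> borel_measurable borel" "integrable lborel Gb" "\<And>x. x \<notin> D \<Longrightarrow> Gb x = 0" "AE x in lborel. x \<in> D \<longrightarrow> Gb x = G x"
    by (rule absolutely_integrable_rep[OF D G]) blast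
  note [measurable] = Fb(1) Gb(1)
  have "AE x in lborel. x \<in> D \<longrightarrow> Fb x - Gb x = 0"
  proof (rule tests_unique[OF _ \<open>open D\<close>])
    fix K :: "(real^'n) set" assume "compact K"
    then have "K \<in> sets lborel" by (simp add: borel_compact)
    then show "integrable lborel (\<lambda>x. indicat_real K x *\<^sub>R (Fb x - Gb x))"
      by (intro integrable_mult_indicator) (use Fb(2) Gb(2) in auto)
  next
    fix \<phi> assume \<phi>: "\<phi> \<in> tests D"
    then have s: "smooth \<phi>" "csupp \<phi>" by (auto simp: tests_def intro: csupp_compact)
    have "(\<integral>x. \<phi> x *\<^sub>R Fb x \<partial>lborel) = (\<integral>x. \<phi> x *\<^sub>R Gb x \<partial>lborel)"
      using weak_gradient_rep[OF \<Omega>(1,4) w(1) ub(1,3,4) Fb(1,3,4) \<phi>] weak_gradient_rep[OF \<Omega>(2,5) w(2) ub(1,3,4) Gb(1,3,4) \<phi>] by simp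
    then show "(\<integral>x. \<phi> x *\<^sub>R (Fb x - Gb x) \<partial>lborel) = 0"
      using integrable_mult_csupp[OF smooth_cont[OF s(1)] s(2) Fb(2)] integrable_mult_csupp[OF smooth_cont[OF s(1)] s(2) Gb(2)]
      by (simp add: scaleR_diff_right)
  qed measurable
  with Fb(4) Gb(4) show ?thesis by eventually_elim auto
qed

section \<open>Oscillation of the vector field\<close>

lemma N_function_derivative:
  assumes "N_function P"
  obtains P' where "\<And>t. t \<ge> 0 \<Longrightarrow> (P has_real_derivative P' t) (at t within {0..})" "\<And>t. t > 0 \<Longrightarrow> P' t > 0"
proof -
  have "\<exists>P' P''. (\<forall>t\<ge>0. (P has_real_derivative P' t) (at t within {0..})) \<and>
     (\<forall>t>0. (P' has_real_derivative P'' t) (at t)) \<and> (\<forall>t>0. P' t > 0 \<and> P'' t > 0)"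
    using assms unfolding N_function_def by (elim conjE)
  then show thesis
  proof (elim exE conjE)
    fix P' P'' assume "\<forall>t\<ge>0. (P has_real_derivative P' t) (at t within {0..})" "\<forall>t>0. P' t > 0 \<and> P'' t > 0"
    then show thesis by (intro that[of P']) auto
  qed
qed

lemma N_function_pos:
  assumes "N_function P" "\<mu> > 0" shows "P \<mu> > 0"
proof -
  have P0: "P 0 = 0" using assms(1) by (simp add: N_function_def)
  obtain P' where d: "\<And>t. t \<ge> 0 \<Longrightarrow> (P has_real_derivative P' t) (at t within {0..})" "\<And>t. t > 0 \<Longrightarrow> P' t > 0"
    by (rule N_function_derivative[OF assms(1)]) (rule that)
  have "P 0 < P \<mu>"
  proof (rule DERIV_pos_imp_increasing_open[OF assms(2)])
    fix x :: real assume x: "0 < x" "x < \<mu>"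
    then have "at x within {0..} = at x" by (intro at_within_interior) simp
    then show "\<exists>y. DERIV P x :> y \<and> y > 0" using d[of x] x by auto
  next
    show "continuous_on {0..\<mu>} P"
      by (rule continuous_on_subset[of "{0..}"]) (use d(1) in \<open>auto intro: DERIV_continuous_on\<close>)
  qed
  then show ?thesis using P0 by simp
qed

text \<open>Multiplication by \<open>t\<close> turns the monotone quotient
  \<open>P t / t\<^sup>2\<close> into the monotone \<open>P t / t\<close>. The doubling constant is
  raised to at least 1, and \<open>max 0\<close> extends continuity and sign to the whole
  line.\<close>

lemma N_function_qf:
  assumes N: "N_function P" and mono: "mono_on {0<..} (\<lambda>t. P t / t\<^sup>2)"
  shows "\<exists>c. qf c (\<lambda>t. P (max 0 t))"
proof -
  obtain P' where d: "\<And>t. t \<ge> 0 \<Longrightarrow> (P has_real_derivative P' t) (at t within {0..})"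
    by (rule N_function_derivative[OF N]) (rule that)
  have P: "\<And>t. t \<ge> 0 \<Longrightarrow> 0 \<le> P t" "P 0 = 0" using N by (simp_all add: N_function_def)
  have "\<exists>c1>0. \<forall>t\<ge>0. P (2 * t) \<le> c1 * P t" using N unfolding N_function_def by (elim conjE)
  then obtain c1 where c1: "c1 > 0" "\<And>t. t \<ge> 0 \<Longrightarrow> P (2 * t) \<le> c1 * P t" by (elim exE conjE) simp
  have "continuous_on {0..} P" by (rule DERIV_continuous_on[OF d]) simp
  then have cont: "continuous_on UNIV (\<lambda>t. P (max 0 t))"
    by (rule continuous_on_compose2) (auto intro: continuous_intros)
  have ratio: "P s / s \<le> P t / t" if "0 < s" "s \<le> t" for s t
  proof -
    have "P s / s = P s / s\<^sup>2 * s" using that by (simp add: power2_eq_square)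
    also have "\<dots> \<le> P t / t\<^sup>2 * t"
      using mono_onD[OF mono, of s t] that P(1)[of t] by (intro mult_mono) auto
    also have "\<dots> = P t / t" using that by (simp add: power2_eq_square)
    finally show ?thesis .
  qed
  have "P (max 0 (2 * t)) \<le> max 1 c1 * P (max 0 t)" if "t \<ge> 0" for t
    using c1(2)[OF that] mult_right_mono[of c1 "max 1 c1" "P t"] P(1)[OF that] that by (simp add: max_absorb2)
  then show ?thesis using cont ratio P unfolding qf_def by (intro exI[of _ "max 1 c1"] conjI) auto
qed

lemma powr_add3_le:
  fixes a b c s :: real
  assumes "a \<ge> 0" "b \<ge> 0" "c \<ge> 0" "s > 0"
  shows "(a + b + c) powr s \<le> 3 powr s * (a powr s + b powr s + c powr s)"
proof -
  let ?m = "max a (max b c)"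
  have "(a + b + c) powr s \<le> (3 * ?m) powr s" using assms by (intro powr_mono2) auto
  also have "\<dots> = 3 powr s * ?m powr s" using assms by (intro powr_mult)
  also have "?m powr s \<le> a powr s + b powr s + c powr s"
    by (simp add: max_def add_increasing add_increasing2)
  finally show ?thesis by simp
qed

lemma avg_SI:
  fixes \<gamma> :: "'a::euclidean_space \<Rightarrow> real"
  assumes \<gamma>: "integrable lborel \<gamma>" "\<And>x. \<gamma> x \<ge> 0" and r: "r > 0"
  shows "SI (cball x r) \<gamma> = ennreal (vol TYPE('a) r * avg (cball x r) \<gamma>)" "avg (cball x r) \<gamma> \<ge> 0"
proof -
  have i: "integrable lborel (\<lambda>z. indicat_real (cball x r) z *\<^sub>R \<gamma> z)" by (rule integrable_mult_indicator) (use \<gamma> in auto)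
  have "SI (cball x r) \<gamma> = (\<integral>\<^sup>+z. ennreal (indicat_real (cball x r) z *\<^sub>R \<gamma> z) \<partial>lborel)"
    unfolding SI_def by (rule nn_integral_cong) (auto simp: indicator_def)
  also have "\<dots> = ennreal (\<integral>z. indicat_real (cball x r) z *\<^sub>R \<gamma> z \<partial>lborel)"
    by (rule nn_integral_eq_integral[OF i]) (use \<gamma> in auto)
  also have "(\<integral>z. indicat_real (cball x r) z *\<^sub>R \<gamma> z \<partial>lborel) = vol TYPE('a) r * avg (cball x r) \<gamma>"
    using r vol_pos[OF r, where 'a='a] by (simp add: avg_def measure_def emeasure_cball_vol)
  finally show "SI (cball x r) \<gamma> = ennreal (vol TYPE('a) r * avg (cball x r) \<gamma>)" .
  show "avg (cball x r) \<gamma> \<ge> 0" unfolding avg_def using \<gamma>(2) by (intro scaleR_nonneg_nonneg integral_nonneg) auto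
qed

text \<open>Fubini over displacements: each translate of \<gamma> has at most the mass of the
  enlarged ball, and the volume of the averaging ball cancels.\<close>

lemma SI_avg_le:
  fixes \<gamma> :: "'a::euclidean_space \<Rightarrow> real"
  assumes \<gamma>: "integrable lborel \<gamma>" "\<And>x. \<gamma> x \<ge> 0" and r: "r > 0"
  shows "SI (cball x0 R) (\<lambda>x. avg (cball x r) \<gamma>) \<le> SI (cball x0 (R + r)) \<gamma>"
proof -
  let ?v = "vol TYPE('a) r"
  have v: "?v > 0" by (rule vol_pos[OF r])
  note [measurable] = integrable_borel[OF \<gamma>(1)]
  have [measurable]: "(\<lambda>x. avg (cball x r) \<gamma>) \<in> borel_measurable borel" by (rule avg_borel) (use r \<gamma> in auto)
  have "ennreal ?v * SI (cball x0 R) (\<lambda>x. avg (cball x r) \<gamma>) = SI (cball x0 R) (\<lambda>x. ?v * avg (cball x r) \<gamma>)"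
    by (rule SI_cmult[symmetric]) (use v in auto)
  also have "\<dots> = (\<integral>\<^sup>+x. (\<integral>\<^sup>+z. ennreal (\<gamma> (z + x)) * indicator (cball 0 r) z * indicator (cball x0 R) x \<partial>lborel) \<partial>lborel)"
    unfolding SI_def[of "cball x0 R"]
  proof (rule nn_integral_cong)
    fix x :: 'a
    have "{z. z + x \<in> cball x r} = cball 0 r" by (auto simp: dist_norm)
    then have "ennreal (?v * avg (cball x r) \<gamma>) = SI (cball 0 r) (\<lambda>z. \<gamma> (z + x))"
      using SI_shift[of \<gamma> "cball x r" x] avg_SI(1)[OF \<gamma> r, of x] by simp
    then show "ennreal (?v * avg (cball x r) \<gamma>) * indicator (cball x0 R) x
      = (\<integral>\<^sup>+z. ennreal (\<gamma> (z + x)) * indicator (cball 0 r) z * indicator (cball x0 R) x \<partial>lborel)"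
      by (simp add: SI_def nn_integral_multc)
  qed
  also have "\<dots> = (\<integral>\<^sup>+z. (\<integral>\<^sup>+x. ennreal (\<gamma> (z + x)) * indicator (cball 0 r) z * indicator (cball x0 R) x \<partial>lborel) \<partial>lborel)"
    by (rule lborel_pair.Fubini') measurable
  also have "\<dots> \<le> (\<integral>\<^sup>+z. SI (cball x0 (R + r)) \<gamma> * indicator (cball 0 r) z \<partial>(lborel :: 'a measure))"
  proof (rule nn_integral_mono)
    fix z :: 'a
    show "(\<integral>\<^sup>+x. ennreal (\<gamma> (z + x)) * indicator (cball 0 r) z * indicator (cball x0 R) x \<partial>lborel) \<le> SI (cball x0 (R + r)) \<gamma> * indicator (cball 0 r) z"
    proof (cases "z \<in> cball 0 r")
      case True
      have "SI (cball x0 R) (\<lambda>x. \<gamma> (x + z)) \<le> SI (cball x0 (R + norm z)) \<gamma>" by (rule SI_cball_shift_le) simp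
      also have "\<dots> \<le> SI (cball x0 (R + r)) \<gamma>" using True by (intro SI_subset subset_cball) simp
      finally show ?thesis using True by (simp add: SI_def add.commute)
    qed simp
  qed
  also have "\<dots> = SI (cball x0 (R + r)) \<gamma> * ennreal ?v" using r by (simp add: nn_integral_cmult emeasure_cball_vol)
  finally show ?thesis using v by (simp add: mult.commute ennreal_mult_le_mult_iff)
qed

text \<open>The third point in \<open>osc_displacement\<close> lies within \<open>2 * norm h\<close>
  of both \<open>x\<close> and \<open>x + h\<close>, whence the leading 2 by \<alpha> \<le> 1. Its
  own weight enters the comparison with either point, so the bound
  \<open>(2 * avg (cball x (norm h)) \<gamma>) powr (1 / s)\<close> occurs twice.\<close>

definition osc_weight :: "real \<Rightarrow> real \<Rightarrow> ('a::euclidean_space \<Rightarrow> real) \<Rightarrow> 'a \<Rightarrow> 'a \<Rightarrow> real" where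
  "osc_weight \<alpha> s \<gamma> h x = 2 * norm h powr \<alpha> *
     (\<gamma> x powr (1 / s) + \<gamma> (x + h) powr (1 / s) + 2 * (2 * avg (cball x (norm h)) \<gamma>) powr (1 / s))"

lemma osc_weight_nonneg: "osc_weight \<alpha> s \<gamma> h x \<ge> 0"
  by (simp add: osc_weight_def)

lemma osc_weight_borel:
  assumes "\<gamma> \<in> borel_measurable borel" "h \<noteq> 0"
  shows "osc_weight \<alpha> s \<gamma> h \<in> borel_measurable borel"
proof -
  note [measurable] = assms(1)
  have [measurable]: "(\<lambda>x. avg (cball x (norm h)) \<gamma>) \<in> borel_measurable borel" by (rule avg_borel) (use assms in auto)
  show ?thesis unfolding osc_weight_def[abs_def] by measurable
qed

text \<open>The power \<open>s\<close> undoes \<open>1 / s\<close>, so each term integrates to a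
  multiple of the mass of \<gamma>. The 6 is the 2 of \<open>osc_weight\<close> times the 3 of
  \<open>powr_add3_le\<close>.\<close>

lemma osc_weight_integral:
  fixes \<gamma> :: "'a::euclidean_space \<Rightarrow> real"
  assumes \<gamma>: "integrable lborel \<gamma>" "\<And>x. \<gamma> x \<ge> 0" and s: "s > 0" and h: "h \<noteq> 0" "norm h \<le> R"
  shows "SI (cball x0 R) (\<lambda>x. osc_weight \<alpha> s \<gamma> h x powr s)
    \<le> ennreal (6 powr s * (2 + 2 * 2 powr s) * norm h powr (\<alpha> * s)) * SI (cball x0 (2 * R)) \<gamma>"
proof -
  note [measurable] = integrable_borel[OF \<gamma>(1)]
  have [measurable]: "(\<lambda>x. avg (cball x (norm h)) \<gamma>) \<in> borel_measurable borel" by (rule avg_borel) (use h \<gamma> in auto)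
  let ?A = "\<lambda>x. avg (cball x (norm h)) \<gamma>" and ?k = "6 powr s * norm h powr (\<alpha> * s)" and ?b = "2 powr s * 2 :: real"
  let ?I = "SI (cball x0 (2 * R)) \<gamma>"
  have A: "?A x \<ge> 0" for x by (rule avg_SI(2)[OF \<gamma>]) (use h in auto)
  have pt: "osc_weight \<alpha> s \<gamma> h x powr s \<le> ?k * (\<gamma> x + \<gamma> (x + h) + ?b * ?A x)" for x
  proof -
    have "osc_weight \<alpha> s \<gamma> h x powr s = (2 * norm h powr \<alpha>) powr s * (\<gamma> x powr (1 / s) + \<gamma> (x + h) powr (1 / s) + 2 * (2 * ?A x) powr (1 / s)) powr s"
      unfolding osc_weight_def by (rule powr_mult)
    also have "\<dots> \<le> (2 * norm h powr \<alpha>) powr s * (3 powr s * ((\<gamma> x powr (1 / s)) powr s + (\<gamma> (x + h) powr (1 / s)) powr s + (2 * (2 * ?A x) powr (1 / s)) powr s))"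
      by (intro mult_left_mono powr_add3_le) (use s in auto)
    also have "(\<gamma> x powr (1 / s)) powr s = \<gamma> x" using s \<gamma>(2) by (simp add: powr_powr)
    also have "(\<gamma> (x + h) powr (1 / s)) powr s = \<gamma> (x + h)" using s \<gamma>(2) by (simp add: powr_powr)
    also have "(2 * (2 * ?A x) powr (1 / s)) powr s = ?b * ?A x" using s A[of x] by (simp add: powr_mult powr_powr)
    also have "(2 * norm h powr \<alpha>) powr s * (3 powr s * (\<gamma> x + \<gamma> (x + h) + ?b * ?A x)) = ?k * (\<gamma> x + \<gamma> (x + h) + ?b * ?A x)"
    proof -
      have "(6::real) powr s = 2 powr s * 3 powr s" using powr_mult[of 2 3 s] by simp
      then show ?thesis by (simp add: powr_mult powr_powr)
    qed
    finally show ?thesis .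
  qed
  have "SI (cball x0 R) (\<lambda>x. osc_weight \<alpha> s \<gamma> h x powr s) \<le> SI (cball x0 R) (\<lambda>x. ?k * (\<gamma> x + \<gamma> (x + h) + ?b * ?A x))"
    by (rule SI_mono) (use pt in auto)
  also have "\<dots> = ennreal ?k * SI (cball x0 R) (\<lambda>x. \<gamma> x + \<gamma> (x + h) + ?b * ?A x)" by (rule SI_cmult) auto
  also have "\<dots> \<le> ennreal ?k * (ennreal (1 + 1 + ?b) * ?I)"
  proof (rule mult_left_mono)
    have i1: "SI (cball x0 R) \<gamma> \<le> ?I" using h by (intro SI_subset subset_cball) (use norm_ge_zero[of h] in linarith)
    have "SI (cball x0 R) (\<lambda>x. \<gamma> (x + h)) \<le> SI (cball x0 (R + norm h)) \<gamma>" by (rule SI_cball_shift_le) simp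
    also have sub: "\<dots> \<le> ?I" using h by (intro SI_subset subset_cball) simp
    finally have i2: "SI (cball x0 R) (\<lambda>x. \<gamma> (x + h)) \<le> ?I" .
    have "SI (cball x0 R) ?A \<le> SI (cball x0 (R + norm h)) \<gamma>" by (rule SI_avg_le[OF \<gamma>]) (use h in simp)
    then have i3: "SI (cball x0 R) ?A \<le> ?I" using sub by (rule order_trans)
    have "SI (cball x0 R) (\<lambda>x. \<gamma> x + \<gamma> (x + h) + ?b * ?A x)
      \<le> SI (cball x0 R) (\<lambda>x. \<gamma> x + \<gamma> (x + h)) + SI (cball x0 R) (\<lambda>x. ?b * ?A x)" by (rule SI_add_le) auto
    also have "\<dots> \<le> (SI (cball x0 R) \<gamma> + SI (cball x0 R) (\<lambda>x. \<gamma> (x + h))) + ennreal ?b * SI (cball x0 R) ?A"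
      by (intro add_mono SI_add_le eq_refl[OF SI_cmult]) auto
    also have "\<dots> \<le> (?I + ?I) + ennreal ?b * ?I" by (intro add_mono i1 i2 mult_left_mono i3) simp
    also have "\<dots> = (1 + 1 + ennreal ?b) * ?I" by (simp only: distrib_right mult_1_left)
    also have "1 + 1 + ennreal ?b = ennreal (1 + 1 + ?b)" by (simp only: ennreal_plus ennreal_1 zero_le_one add_nonneg_nonneg mult_nonneg_nonneg powr_ge_zero zero_le_numeral)
    finally show "SI (cball x0 R) (\<lambda>x. \<gamma> x + \<gamma> (x + h) + ?b * ?A x) \<le> ennreal (1 + 1 + ?b) * ?I" .
  qed simp
  also have "\<dots> = ennreal (?k * (1 + 1 + ?b)) * ?I"
    by (subst ennreal_mult) (simp_all add: mult.assoc)
  also have "?k * (1 + 1 + ?b) = 6 powr s * (2 + 2 * 2 powr s) * norm h powr (\<alpha> * s)" by simp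
  finally show ?thesis .
qed

text \<open>
  The oscillation bound holds only for almost every pair of points, hence says nothing about the
  pairs \<open>(x, x + h)\<close> for a given \<open>h\<close>. Passing through a third point near \<open>x\<close> at which the weight
  does not exceed twice its mean value repairs this.
\<close>

lemma osc_displacement:
  fixes A :: "'a::euclidean_space \<Rightarrow> 'x \<Rightarrow> 'b::real_normed_vector" and g \<gamma> :: "'a \<Rightarrow> real"
  assumes osc: "AE x in lborel. x \<in> \<Omega> \<longrightarrow> (AE y in lborel. y \<in> \<Omega> \<longrightarrow>
      (\<forall>\<xi>. norm (A x \<xi> - A y \<xi>) \<le> norm (x - y) powr \<alpha> * (g x + g y) * T \<xi>))"
    and T: "\<And>\<xi>. T \<xi> \<ge> 0" and \<alpha>: "0 \<le> \<alpha>" "\<alpha> \<le> 1" and s: "s > 0"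
    and \<gamma>: "integrable lborel \<gamma>" "\<And>x. \<gamma> x \<ge> 0" "\<And>x. x \<in> \<Omega> \<Longrightarrow> \<gamma> x \<ge> 1"
    and g: "AE x in lborel. x \<in> \<Omega> \<longrightarrow> \<bar>g x\<bar> \<le> \<gamma> x powr (1 / s)"
    and h: "h \<noteq> 0"
  shows "AE x in lborel. cball x (norm h) \<subseteq> \<Omega> \<longrightarrow> (\<forall>\<xi>. norm (A (x + h) \<xi> - A x \<xi>) \<le> osc_weight \<alpha> s \<gamma> h x * T \<xi>)"
proof -
  note [measurable] = integrable_borel[OF \<gamma>(1)]
  note osc_h = AE_shift[OF osc, of h] and g_h = AE_shift[OF g, of h]
  show ?thesis
    using osc osc_h g g_h
  proof eventually_elim
    case (elim x)
    let ?r = "norm h"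
    have r: "?r > 0" using h by simp
    let ?A = "avg (cball x ?r) \<gamma>" and ?v = "vol TYPE('a) ?r"
    let ?e = "\<lambda>z. \<gamma> z powr (1 / s)" and ?a = "(2 * ?A) powr (1 / s)"
    have v: "?v > 0" by (rule vol_pos[OF r])
    note A = avg_SI[OF \<gamma>(1,2) r, of x]
    show ?case
    proof (intro impI allI)
      \<comment> \<open>The third point may depend on \<xi>, since the exceptional set of
        \<open>x\<close> has been fixed before.\<close>
      fix \<xi> assume sub: "cball x ?r \<subseteq> \<Omega>"
      have x\<Omega>: "x \<in> \<Omega>" "x + h \<in> \<Omega>" using sub by (auto simp: subset_iff dist_norm)
      have ae: "AE z in lborel. z \<in> cball x ?r \<longrightarrow>
         norm (A x \<xi> - A z \<xi>) \<le> norm (x - z) powr \<alpha> * (g x + g z) * T \<xi> \<and>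
         norm (A (x + h) \<xi> - A z \<xi>) \<le> norm (x + h - z) powr \<alpha> * (g (x + h) + g z) * T \<xi> \<and> \<bar>g z\<bar> \<le> ?e z"
        using elim(1)[rule_format, OF x\<Omega>(1)] elim(2)[rule_format, OF x\<Omega>(2)] g
        by eventually_elim (use sub in blast)
      have "\<exists>z\<in>cball x ?r. \<gamma> z \<le> 2 * ?A \<and>
         norm (A x \<xi> - A z \<xi>) \<le> norm (x - z) powr \<alpha> * (g x + g z) * T \<xi> \<and>
         norm (A (x + h) \<xi> - A z \<xi>) \<le> norm (x + h - z) powr \<alpha> * (g (x + h) + g z) * T \<xi> \<and> \<bar>g z\<bar> \<le> ?e z"
      proof (rule ccontr)
        \<comment> \<open>Then \<gamma> is at least twice its own mean almost everywhere on the
          ball, so the mean is zero, whereas \<gamma> is at least 1 on \<Omega>.\<close>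
        assume no: "\<not> ?thesis"
        have "AE z in lborel. z \<in> cball x ?r \<longrightarrow> z \<in> cball x ?r \<and> 2 * ?A \<le> \<gamma> z"
          using ae by eventually_elim (use no in force)
        then have "SI (cball x ?r) (\<lambda>z. 2 * ?A) \<le> SI (cball x ?r) \<gamma>" by (rule SI_mono_AE)
        moreover have "SI (cball x ?r) (\<lambda>z. 2 * ?A) = ennreal (2 * ?A * ?v)"
          using v A(2) by (simp add: SI_const emeasure_cball_vol flip: ennreal_mult'')
        ultimately have "2 * ?A * ?v \<le> ?v * ?A" using v A(2) by (simp add: A(1) ennreal_le_iff)
        then have "?A = 0" using v A(2) by (simp add: mult.commute)
        have "SI (cball x ?r) (\<lambda>z. 1) \<le> SI (cball x ?r) \<gamma>" by (rule SI_mono) (use \<gamma>(3) sub in blast)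
        then show False using v \<open>?A = 0\<close> by (simp add: A(1) SI_const emeasure_cball_vol)
      qed
      then obtain z where z: "z \<in> cball x ?r" "\<gamma> z \<le> 2 * ?A"
        "norm (A x \<xi> - A z \<xi>) \<le> norm (x - z) powr \<alpha> * (g x + g z) * T \<xi>"
        "norm (A (x + h) \<xi> - A z \<xi>) \<le> norm (x + h - z) powr \<alpha> * (g (x + h) + g z) * T \<xi>" "\<bar>g z\<bar> \<le> ?e z" by blast
      have gz: "\<bar>g z\<bar> \<le> ?a"
        using z(5) powr_mono2[of "1 / s" "\<gamma> z" "2 * ?A"] z(2) \<gamma>(2) s by simp
      have gx: "\<bar>g x\<bar> \<le> ?e x" "\<bar>g (x + h)\<bar> \<le> ?e (x + h)" using elim x\<Omega> by auto
      have dist: "norm w powr \<alpha> \<le> 2 * ?r powr \<alpha>" if "norm w \<le> 2 * ?r" for w :: 'a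
      proof -
        have "norm w powr \<alpha> \<le> (2 * ?r) powr \<alpha>" using that \<alpha> by (intro powr_mono2) auto
        also have "\<dots> = 2 powr \<alpha> * ?r powr \<alpha>" by (rule powr_mult)
        also have "\<dots> \<le> 2 powr 1 * ?r powr \<alpha>" using \<alpha> by (intro mult_right_mono powr_mono) auto
        finally show ?thesis by simp
      qed
      have d: "norm (x - z) \<le> 2 * ?r" "norm (x + h - z) \<le> 2 * ?r"
      proof -
        have xz: "norm (x - z) \<le> ?r" using z(1) by (simp add: dist_norm)
        then show "norm (x - z) \<le> 2 * ?r" by (simp add: order_trans[OF _ mult_right_mono[of 1 2 ?r]])
        have "norm (x + h - z) \<le> norm (x - z) + norm h" using norm_triangle_ineq[of "x - z" h] by (simp add: algebra_simps)
        then show "norm (x + h - z) \<le> 2 * ?r" using xz by simp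
      qed
      have b1: "norm (A x \<xi> - A z \<xi>) \<le> 2 * ?r powr \<alpha> * (?e x + ?a) * T \<xi>"
      proof (rule order_trans[OF z(3)], intro mult_right_mono T)
        have "norm (x - z) powr \<alpha> * (g x + g z) \<le> norm (x - z) powr \<alpha> * (?e x + ?a)"
          using gx gz by (intro mult_left_mono) auto
        also have "\<dots> \<le> 2 * ?r powr \<alpha> * (?e x + ?a)" by (intro mult_right_mono dist d) auto
        finally show "norm (x - z) powr \<alpha> * (g x + g z) \<le> 2 * ?r powr \<alpha> * (?e x + ?a)" .
      qed
      have b2: "norm (A (x + h) \<xi> - A z \<xi>) \<le> 2 * ?r powr \<alpha> * (?e (x + h) + ?a) * T \<xi>"
      proof (rule order_trans[OF z(4)], intro mult_right_mono T)
        have "norm (x + h - z) powr \<alpha> * (g (x + h) + g z) \<le> norm (x + h - z) powr \<alpha> * (?e (x + h) + ?a)"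
          using gx gz by (intro mult_left_mono) auto
        also have "\<dots> \<le> 2 * ?r powr \<alpha> * (?e (x + h) + ?a)" by (intro mult_right_mono dist d) auto
        finally show "norm (x + h - z) powr \<alpha> * (g (x + h) + g z) \<le> 2 * ?r powr \<alpha> * (?e (x + h) + ?a)" .
      qed
      have "norm (A (x + h) \<xi> - A x \<xi>) \<le> norm (A (x + h) \<xi> - A z \<xi>) + norm (A x \<xi> - A z \<xi>)"
        using norm_triangle_ineq4[of "A (x + h) \<xi> - A z \<xi>" "A x \<xi> - A z \<xi>"] by simp
      also have "\<dots> \<le> osc_weight \<alpha> s \<gamma> h x * T \<xi>"
        using add_mono[OF b2 b1] by (simp add: osc_weight_def algebra_simps)
      finally show "norm (A (x + h) \<xi> - A x \<xi>) \<le> osc_weight \<alpha> s \<gamma> h x * T \<xi>" .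
    qed
  qed
qed

section \<open>Size of V_P and coercivity of the field\<close>

context
  fixes c \<mu> :: real and P :: "real \<Rightarrow> real"
  assumes P: "qf c P" and P_sq: "\<And>s t. 0 < s \<Longrightarrow> s \<le> t \<Longrightarrow> P s / s\<^sup>2 \<le> P t / t\<^sup>2" and \<mu>: "\<mu> > 0" and P\<mu>: "P \<mu> > 0"
begin

lemma V_P_square: "(norm (V_P \<mu> P \<xi>))\<^sup>2 = P (bracket \<mu> \<xi>) / (\<mu>\<^sup>2 + (norm \<xi>)\<^sup>2) * (norm \<xi>)\<^sup>2"
  using qf_nonneg[OF P, of "bracket \<mu> \<xi>"] by (simp add: V_P_def power_mult_distrib)

lemma V_P_le: "(norm (V_P \<mu> P \<xi>))\<^sup>2 \<le> P (bracket \<mu> \<xi>)"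
proof -
  have m: "\<mu>\<^sup>2 + (norm \<xi>)\<^sup>2 > 0" using \<mu> by (simp add: add_pos_nonneg)
  have "P (bracket \<mu> \<xi>) / (\<mu>\<^sup>2 + (norm \<xi>)\<^sup>2) * (norm \<xi>)\<^sup>2
    \<le> P (bracket \<mu> \<xi>) / (\<mu>\<^sup>2 + (norm \<xi>)\<^sup>2) * (\<mu>\<^sup>2 + (norm \<xi>)\<^sup>2)"
    using m by (intro mult_left_mono divide_nonneg_pos qf_nonneg[OF P]) auto
  then show ?thesis using m \<mu> by (simp add: V_P_square)
qed

text \<open>For \<open>\<mu> \<le> norm \<xi>\<close> the square of the bracket is at most twice
  that of \<open>norm \<xi>\<close>; otherwise the bracket is at most \<open>2 * \<mu>\<close>,
  which the constant covers.\<close>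

lemma V_P_ge: "P (bracket \<mu> \<xi>) \<le> 2 * (norm (V_P \<mu> P \<xi>))\<^sup>2 + P (2 * \<mu>)"
proof (cases "\<mu> \<le> norm \<xi>")
  case True
  have m: "\<mu>\<^sup>2 + (norm \<xi>)\<^sup>2 > 0" using \<mu> by (simp add: add_pos_nonneg)
  have "\<mu>\<^sup>2 \<le> (norm \<xi>)\<^sup>2" using True \<mu> by (intro power_mono) auto
  then have "P (bracket \<mu> \<xi>) / (\<mu>\<^sup>2 + (norm \<xi>)\<^sup>2) * (\<mu>\<^sup>2 + (norm \<xi>)\<^sup>2)
    \<le> P (bracket \<mu> \<xi>) / (\<mu>\<^sup>2 + (norm \<xi>)\<^sup>2) * (2 * (norm \<xi>)\<^sup>2)"
    using m by (intro mult_left_mono divide_nonneg_pos qf_nonneg[OF P]) auto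
  then show ?thesis using m \<mu> qf_nonneg[OF P, of "2 * \<mu>"] by (simp add: V_P_square mult_ac)
next
  case False
  have "(norm \<xi>)\<^sup>2 \<le> \<mu>\<^sup>2" using False by (intro power_mono) auto
  then have "\<mu>\<^sup>2 + (norm \<xi>)\<^sup>2 \<le> 4 * \<mu>\<^sup>2" using zero_le_power2[of \<mu>] by linarith
  then have "\<mu>\<^sup>2 + (norm \<xi>)\<^sup>2 \<le> (2 * \<mu>)\<^sup>2" by (simp add: power_mult_distrib)
  then have "bracket \<mu> \<xi> \<le> 2 * \<mu>" using \<mu> by (intro real_le_lsqrt) auto
  then have "P (bracket \<mu> \<xi>) \<le> P (2 * \<mu>)" by (intro qf_mono[OF P]) auto
  then show ?thesis by (simp add: add_increasing)
qed

text \<open>Monotonicity is used against the value \<open>a0\<close> of the field at zero, which the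
  growth condition bounds. As \<open>P\<close> grows at least quadratically from \<mu> on, the term
  linear in \<xi> is absorbed.\<close>

lemma coercive_field:
  fixes \<upsilon> \<kappa> :: real
  assumes \<upsilon>: "\<upsilon> > 0"
  shows "\<exists>K0\<ge>0. \<forall>a \<xi> :: 'a::euclidean_space. \<forall>a0.
     (a - a0) \<bullet> \<xi> \<ge> \<upsilon> * (P (bracket \<mu> \<xi>) / (\<mu>\<^sup>2 + (norm \<xi>)\<^sup>2)) * (norm \<xi>)\<^sup>2 \<longrightarrow> norm a0 \<le> B \<longrightarrow>
     a \<bullet> \<xi> \<ge> \<upsilon> / 4 * P (bracket \<mu> \<xi>) - K0"
proof -
  \<comment> \<open>The constant of the quadratic lower bound:
    \<open>p * m\<^sup>2 \<le> P m\<close> for \<open>m \<ge> \<mu>\<close>.\<close>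
  define p where "p = P \<mu> / \<mu>\<^sup>2"
  have p: "p > 0" using P\<mu> \<mu> by (simp add: p_def)
  define K0 where "K0 = B\<^sup>2 / (\<upsilon> * p) + \<upsilon> / 2 * P (2 * \<mu>)"
  have K0: "K0 \<ge> 0" unfolding K0_def using \<upsilon> p qf_nonneg[OF P] by (intro add_nonneg_nonneg mult_nonneg_nonneg divide_nonneg_pos) auto
  have main: "a \<bullet> \<xi> \<ge> \<upsilon> / 4 * P (bracket \<mu> \<xi>) - K0"
    if h: "(a - a0) \<bullet> \<xi> \<ge> \<upsilon> * (P (bracket \<mu> \<xi>) / (\<mu>\<^sup>2 + (norm \<xi>)\<^sup>2)) * (norm \<xi>)\<^sup>2" and B: "norm a0 \<le> B"
    for a a0 \<xi> :: 'a
  proof -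
    define m where "m = bracket \<mu> \<xi>"
    have m: "\<mu> \<le> m" "norm \<xi> \<le> m" unfolding m_def by (auto intro: real_le_rsqrt)
    have Pm: "p * m\<^sup>2 \<le> P m" using P_sq[OF \<mu> m(1)] m(1) \<mu> by (simp add: p_def pos_le_divide_eq)
    have "\<upsilon> * (norm (V_P \<mu> P \<xi>))\<^sup>2 \<le> (a - a0) \<bullet> \<xi>" using h by (simp add: V_P_square mult.assoc)
    moreover have "P m \<le> 2 * (norm (V_P \<mu> P \<xi>))\<^sup>2 + P (2 * \<mu>)" unfolding m_def by (rule V_P_ge)
    then have "\<upsilon> / 2 * P m \<le> \<upsilon> / 2 * (2 * (norm (V_P \<mu> P \<xi>))\<^sup>2 + P (2 * \<mu>))" using \<upsilon> by (intro mult_left_mono) auto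
    moreover have "- (a0 \<bullet> \<xi>) \<le> \<upsilon> / 4 * P m + B\<^sup>2 / (\<upsilon> * p)"
    proof -
      have "- (a0 \<bullet> \<xi>) \<le> norm a0 * norm \<xi>" using Cauchy_Schwarz_ineq2[of a0 \<xi>] by simp
      also have "\<dots> \<le> B * m" using B m order_trans[OF norm_ge_zero B] by (intro mult_mono) auto
      also have "\<dots> \<le> \<upsilon> / 4 * (p * m\<^sup>2) + B\<^sup>2 / (\<upsilon> * p)"
      proof -
        have e: "\<upsilon> * p > 0" using \<upsilon> p by simp
        have "0 \<le> (\<upsilon> * p * m / 2 - B)\<^sup>2 / (\<upsilon> * p)" using e by simp
        also have "\<dots> = \<upsilon> / 4 * (p * m\<^sup>2) + B\<^sup>2 / (\<upsilon> * p) - B * m"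
          using \<upsilon> p by (simp add: power2_eq_square field_simps)
        finally show ?thesis by simp
      qed
      also have "\<dots> \<le> \<upsilon> / 4 * P m + B\<^sup>2 / (\<upsilon> * p)" using Pm \<upsilon> by (intro add_right_mono mult_left_mono) auto
      finally show ?thesis .
    qed
    ultimately show ?thesis unfolding m_def[symmetric] K0_def by (simp add: inner_diff_left distrib_left)
  qed
  show ?thesis by (intro exI[of _ K0] conjI allI impI K0 main)
qed

end

section \<open>Localisation of the solution\<close>

lemma compact_neighbourhood:
  fixes K :: "'a::euclidean_space set"
  assumes "compact K" "open \<Omega>" "K \<subseteq> \<Omega>"
  obtains D where "open D" "K \<subseteq> D" "compact (closure D)" "closure D \<subseteq> \<Omega>"
proof -
  obtain \<zeta> K' where \<zeta>: "smooth \<zeta>" "\<And>x. 0 \<le> \<zeta> x" "\<And>x. \<zeta> x \<le> 1" "\<And>x. x \<in> K \<Longrightarrow> \<zeta> x = (1::real)"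
    "compact K'" "K' \<subseteq> \<Omega>" "\<And>x. x \<notin> K' \<Longrightarrow> \<zeta> x = 0" using cutoff_exists[OF assms] by metis
  let ?D = "{x. \<zeta> x > 0}"
  have "?D \<subseteq> K'" using \<zeta>(7) by force
  then have cl: "closure ?D \<subseteq> K'" using \<zeta>(5) by (intro closure_minimal compact_imp_closed)
  show ?thesis
  proof (rule that[of ?D])
    show "open ?D" using smooth_cont[OF \<zeta>(1), of UNIV] by (intro open_Collect_less) auto
    show "K \<subseteq> ?D" using \<zeta>(4) by auto
    show "compact (closure ?D)" using compact_Int_closed[OF \<zeta>(5) closed_closure, of ?D] cl by (simp add: Int_absorb1)
    show "closure ?D \<subseteq> \<Omega>" using cl \<zeta>(6) by blast
  qed
qed

lemma gr_eq_0:
  assumes "open D" "x \<in> D" "\<And>y. y \<in> D \<Longrightarrow> \<zeta> y = c"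
  shows "gr \<zeta> x = 0"
proof -
  have "((\<lambda>y. c) has_derivative (\<lambda>v. 0)) (at x)" by simp
  then have "(\<zeta> has_derivative (\<lambda>v. 0)) (at x)" by (rule has_derivative_transform_within_open[OF _ assms(1,2)]) (simp add: assms(3))
  then show ?thesis by (simp add: gr_def dd_eq)
qed

text \<open>Each of the nested neighbourhoods has its purpose: membership in \<open>W1P\<close> is
  used on \<Omega>0, the gradients are integrable and can be compared on \<Omega>1, and on
  \<open>D\<close> the cut-off is 1, so that nothing is changed there.\<close>

lemma local_gradient_data:
  fixes \<Omega> :: "(real^'n) set"
  assumes P: "qf c P" and S: "compact S" "open \<Omega>" "S \<subseteq> \<Omega>" and u: "u \<in> W1P_loc P \<Omega>"
    and w: "has_weak_gradient \<Omega> u Du" "has_weak_gradient \<Omega> u Dw"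
  obtains D U F where "open D" "S \<subseteq> D" "compact (closure D)" "closure D \<subseteq> \<Omega>" "wgrad U F"
    "orlicz P U" "orlicz P F"
    "AE x in lborel. x \<in> D \<longrightarrow> F x = Du x \<and> F x = Dw x"
proof -
  obtain \<Omega>0 where \<Omega>0: "open \<Omega>0" "S \<subseteq> \<Omega>0" "compact (closure \<Omega>0)" "closure \<Omega>0 \<subseteq> \<Omega>" using compact_neighbourhood[OF S] by metis
  obtain \<Omega>1 where \<Omega>1: "open \<Omega>1" "S \<subseteq> \<Omega>1" "compact (closure \<Omega>1)" "closure \<Omega>1 \<subseteq> \<Omega>0" using compact_neighbourhood[OF S(1) \<Omega>0(1,2)] by metis
  obtain D where D: "open D" "S \<subseteq> D" "compact (closure D)" "closure D \<subseteq> \<Omega>1" using compact_neighbourhood[OF S(1) \<Omega>1(1,2)] by metis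
  have sub: "\<Omega>1 \<subseteq> \<Omega>0" "\<Omega>0 \<subseteq> \<Omega>" "\<Omega>1 \<subseteq> \<Omega>" using \<Omega>0(4) \<Omega>1(4) closure_subset by blast+
  have \<Omega>1b: "\<Omega>1 \<in> sets borel" using \<Omega>1 by simp
  have restr: "f absolutely_integrable_on \<Omega>1" if "f absolutely_integrable_on T" "\<Omega>1 \<subseteq> T" for T and f :: "real^'n \<Rightarrow> 'z::euclidean_space"
    by (rule set_integrable_subset[OF that(1)]) (use \<Omega>1 that in auto)
  have loc: "f absolutely_integrable_on \<Omega>1" if "locally_integrable T f" "closure \<Omega>1 \<subseteq> T" for T and f :: "real^'n \<Rightarrow> 'z::euclidean_space"
    by (rule restr[OF _ closure_subset]) (use that \<Omega>1(3) in \<open>auto simp: locally_integrable_def\<close>)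
  have "u \<in> W1P P \<Omega>0" using u \<Omega>0 by (simp add: W1P_loc_def)
  then obtain Dv where uO: "u absolutely_integrable_on \<Omega>0" "(\<lambda>x. P \<bar>u x\<bar>) absolutely_integrable_on \<Omega>0"
    and wv: "has_weak_gradient \<Omega>0 u Dv" and Pv: "(\<lambda>x. P \<bar>norm (Dv x)\<bar>) absolutely_integrable_on \<Omega>0"
    by (auto simp: W1P_def Orlicz_space_def)
  have cl\<Omega>: "closure \<Omega>1 \<subseteq> \<Omega>" using \<Omega>1(4) sub by blast
  have u1: "u absolutely_integrable_on \<Omega>1" by (rule restr[OF uO(1) sub(1)])
  have Du1: "Du absolutely_integrable_on \<Omega>1" by (rule loc[OF _ cl\<Omega>]) (use w(1) in \<open>simp add: has_weak_gradient_def\<close>)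
  have Dw1: "Dw absolutely_integrable_on \<Omega>1" by (rule loc[OF _ cl\<Omega>]) (use w(2) in \<open>simp add: has_weak_gradient_def\<close>)
  have Dv1: "Dv absolutely_integrable_on \<Omega>1" by (rule loc[OF _ \<Omega>1(4)]) (use wv in \<open>simp add: has_weak_gradient_def\<close>)
  have uv: "AE x in lborel. x \<in> \<Omega>1 \<longrightarrow> Du x = Dv x" by (rule weak_gradient_unique[OF S(2) \<Omega>0(1) \<Omega>1(1) sub(3,1) w(1) wv u1 Du1 Dv1])
  have uw: "AE x in lborel. x \<in> \<Omega>1 \<longrightarrow> Du x = Dw x" by (rule weak_gradient_unique[OF S(2) S(2) \<Omega>1(1) sub(3,3) w u1 Du1 Dw1])
  obtain ub where ub: "ub \<in> borel_measurable borel" "integrable lborel ub" "\<And>x. x \<notin> \<Omega>1 \<Longrightarrow> ub x = 0" "AE x in lborel. x \<in> \<Omega>1 \<longrightarrow> ub x = u x"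
    by (rule absolutely_integrable_rep[OF \<Omega>1b u1]) blast
  obtain Fb where Fb: "Fb \<in> borel_measurable borel" "integrable lborel Fb" "\<And>x. x \<notin> \<Omega>1 \<Longrightarrow> Fb x = 0" "AE x in lborel. x \<in> \<Omega>1 \<longrightarrow> Fb x = Du x"
    by (rule absolutely_integrable_rep[OF \<Omega>1b Du1]) blast
  note [measurable] = ub(1) Fb(1) qf_borel[OF P]
  have P0: "P 0 = 0" by (rule qf_zero[OF P])
  have on1: "integrable (lebesgue_on \<Omega>1) f" if "f absolutely_integrable_on \<Omega>0" for f :: "real^'n \<Rightarrow> real"
    using restr[OF that sub(1)] \<Omega>1b by (subst integrable_restrict_space) (auto simp: set_integrable_def)
  have Pub: "orlicz P ub"
  proof (subst lebesgue_on_rep_integral(2)[OF \<Omega>1b, symmetric])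
    show "AE x in lborel. x \<in> \<Omega>1 \<longrightarrow> P (norm (ub x)) = P \<bar>u x\<bar>" using ub(4) by eventually_elim auto
    show "integrable (lebesgue_on \<Omega>1) (\<lambda>x. P \<bar>u x\<bar>)" by (rule on1[OF uO(2)])
  qed (use ub(3) P0 in auto)
  have PFb: "orlicz P Fb"
  proof (subst lebesgue_on_rep_integral(2)[OF \<Omega>1b, symmetric])
    show "AE x in lborel. x \<in> \<Omega>1 \<longrightarrow> P (norm (Fb x)) = P \<bar>norm (Dv x)\<bar>" using Fb(4) uv by eventually_elim auto
    show "integrable (lebesgue_on \<Omega>1) (\<lambda>x. P \<bar>norm (Dv x)\<bar>)" by (rule on1[OF Pv])
  qed (use Fb(3) P0 in auto)
  obtain \<zeta> K' where \<zeta>: "smooth \<zeta>" "\<And>x. 0 \<le> \<zeta> x" "\<And>x. \<zeta> x \<le> 1" "\<And>x. x \<in> closure D \<Longrightarrow> \<zeta> x = (1::real)"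
    "compact K'" "K' \<subseteq> \<Omega>1" "\<And>x. x \<notin> K' \<Longrightarrow> \<zeta> x = 0" using cutoff_exists[OF D(3) \<Omega>1(1) D(4)] by metis
  have cs: "csupp \<zeta>" by (rule csupp_compact[OF \<zeta>(5,7)])
  note [measurable] = smooth_borel[OF \<zeta>(1)] gr_borel[OF \<zeta>(1)]
  obtain B where B: "B > 0" "\<And>x. norm (gr \<zeta> x) \<le> B"
  proof -
    have "compact (gr \<zeta> ` K')" by (intro compact_continuous_image gr_continuous \<zeta>)
    then obtain B where B: "\<And>y. y \<in> gr \<zeta> ` K' \<Longrightarrow> norm y \<le> B" using compact_imp_bounded bounded_iff by metis
    have "gr \<zeta> x = 0" if "x \<notin> K'" for x by (rule gr_outside[OF \<zeta>(5) _ that]) (rule \<zeta>(7))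
    then have "norm (gr \<zeta> x) \<le> max 1 B" for x
      using B[of "gr \<zeta> x"] by (cases "x \<in> K'") auto
    then show thesis by (intro that[of "max 1 B"]) auto
  qed
  show ?thesis
  proof (rule that[of D "\<lambda>x. \<zeta> x * ub x" "\<lambda>x. \<zeta> x *\<^sub>R Fb x + ub x *\<^sub>R gr \<zeta> x"])
    show "closure D \<subseteq> \<Omega>" using D(4) sub by blast
    show "wgrad (\<lambda>x. \<zeta> x * ub x) (\<lambda>x. \<zeta> x *\<^sub>R Fb x + ub x *\<^sub>R gr \<zeta> x)"
    proof (rule wgrad_cutoff[OF \<zeta>(1) cs ub(2) Fb(2)])
      fix \<phi> :: "real^'n \<Rightarrow> real" and v assume \<phi>: "smooth \<phi>" "csupp \<phi>"
      have s: "smooth (\<lambda>x. \<zeta> x * \<phi> x)" "csupp (\<lambda>x. \<zeta> x * \<phi> x)" by (intro smooth_mult csupp_mult(1) \<zeta>(1) cs \<phi>)+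
      have t: "(\<lambda>x. \<zeta> x * \<phi> x) \<in> tests \<Omega>1" by (rule testsI[OF s(1) \<zeta>(5,6)]) (simp add: \<zeta>(7))
      have i1: "integrable lborel (\<lambda>x. ub x *\<^sub>R gr (\<lambda>x. \<zeta> x * \<phi> x) x)"
        unfolding gr_def scaleR_sum_right scaleR_scaleR
        by (intro integrable_sum integrable_scaleR_left)
          (use integrable_mult_csupp[OF smooth_cont[OF smooth_dd[OF s(1)]] csupp_dd[OF s(2)] ub(2)] in \<open>simp add: mult.commute\<close>)
      have i2: "integrable lborel (\<lambda>x. (\<zeta> x * \<phi> x) *\<^sub>R Fb x)" by (rule integrable_mult_csupp[OF smooth_cont[OF s(1)] s(2) Fb(2)])
      have "(\<integral>x. ub x *\<^sub>R gr (\<lambda>x. \<zeta> x * \<phi> x) x \<partial>lborel) \<bullet> v = - (\<integral>x. (\<zeta> x * \<phi> x) *\<^sub>R Fb x \<partial>lborel) \<bullet> v"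
        using weak_gradient_rep[OF S(2) sub(3) w(1) ub(1,3,4) Fb(1,3,4) t] by simp
      then show "(\<integral>x. ub x * dd (\<lambda>x. \<zeta> x * \<phi> x) x v \<partial>lborel) = - (\<integral>x. \<zeta> x * \<phi> x * (Fb x \<bullet> v) \<partial>lborel)"
        using integral_inner_left[OF i1, of v] integral_inner_left[OF i2, of v] by (simp add: gr_inner[OF s(1)])
    qed
    show "orlicz P (\<lambda>x. \<zeta> x * ub x)"
      by (rule orlicz_bound[OF P _ Pub zero_le_one]) (use \<zeta>(2,3) in \<open>auto simp: abs_mult intro!: mult_left_le_one_le\<close>)
    show "orlicz P (\<lambda>x. \<zeta> x *\<^sub>R Fb x + ub x *\<^sub>R gr \<zeta> x)"
    proof (rule orlicz_add[OF P])
      show "orlicz P (\<lambda>x. \<zeta> x *\<^sub>R Fb x)"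
        by (rule orlicz_bound[OF P _ PFb zero_le_one]) (use \<zeta>(2,3) in \<open>auto intro!: mult_left_le_one_le\<close>)
      show "orlicz P (\<lambda>x. ub x *\<^sub>R gr \<zeta> x)"
        by (rule orlicz_bound[OF P _ Pub less_imp_le[OF B(1)]]) (use B(2) in \<open>auto simp: mult.commute[of B] intro!: mult_left_mono\<close>)
    qed measurable
    show "AE x in lborel. x \<in> D \<longrightarrow> \<zeta> x *\<^sub>R Fb x + ub x *\<^sub>R gr \<zeta> x = Du x \<and> \<zeta> x *\<^sub>R Fb x + ub x *\<^sub>R gr \<zeta> x = Dw x"
      using Fb(4) uw
    proof eventually_elim
      case (elim x)
      have "\<zeta> x *\<^sub>R Fb x + ub x *\<^sub>R gr \<zeta> x = Fb x \<and> x \<in> \<Omega>1" if "x \<in> D"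
        using that \<zeta>(4) closure_subset D(4) gr_eq_0[OF D(1) that, of \<zeta> 1] by (auto simp: subset_iff)
      then show ?case using elim by auto
    qed
  qed (use D in auto)
qed

section \<open>Besov regularity\<close>

lemma Besov_I:
  fixes v w :: "'a::euclidean_space \<Rightarrow> 'b::euclidean_space"
  assumes w[measurable]: "w \<in> borel_measurable borel" and ae: "AE x in lborel. w x = v x"
    and fin: "SI UNIV (\<lambda>x. (norm (w x))\<^sup>2) < \<infinity>" and C: "C \<ge> 0"
    and est: "\<And>h. h \<noteq> 0 \<Longrightarrow> SI UNIV (\<lambda>x. (norm (w (x + h) - w x))\<^sup>2) \<le> ennreal (C * norm h powr (2 * \<alpha>))"
  shows "v \<in> Besov \<alpha> 2"
proof -
  have aeL: "AE x in lebesgue. w x = v x" using ae by (simp add: AE_completion_iff)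
  have mw: "w \<in> borel_measurable lebesgue" by (simp add: measurable_completion)
  have mv: "v \<in> borel_measurable lebesgue" by (rule borel_measurable_AE[OF mw aeL])
  have i: "integrable lborel (\<lambda>x. (norm (w x))\<^sup>2)"
    using fin by (intro integrableI_nonneg) (auto simp: SI_def)
  have "integrable lebesgue (\<lambda>x. norm (v x) powr 2)"
  proof (rule integrable_cong_AE_imp)
    show "integrable lebesgue (\<lambda>x. (norm (w x))\<^sup>2)" using i by (subst integrable_completion) auto
    show "(\<lambda>x. norm (v x) powr 2) \<in> borel_measurable lebesgue" using mv by measurable
    show "AE x in lebesgue. (norm (w x))\<^sup>2 = norm (v x) powr 2" using aeL by eventually_elim simp
  qed
  then have L: "v \<in> Lp_space 2 UNIV" using mv by (simp add: Lp_space_def lebesgue_on_UNIV_eq)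
  have "(LINT x|lebesgue. norm (v (x + h) - v x) powr 2 / norm h powr (\<alpha> * 2)) powr (1 / 2) \<le> C powr (1 / 2)"
    if h: "h \<noteq> 0" for h
  proof -
    let ?f = "\<lambda>x. (norm (w (x + h) - w x))\<^sup>2 / norm h powr (2 * \<alpha>)"
    have H: "norm h powr (2 * \<alpha>) > 0" using h by simp
    have ae': "AE x in lebesgue. ?f x = norm (v (x + h) - v x) powr 2 / norm h powr (\<alpha> * 2)"
      unfolding AE_completion_iff using ae AE_shift[OF ae, of h] by eventually_elim (simp add: mult.commute)
    have mf: "?f \<in> borel_measurable lebesgue" by (rule measurable_completion) measurable
    have "(LINT x|lebesgue. norm (v (x + h) - v x) powr 2 / norm h powr (\<alpha> * 2)) = (LINT x|lebesgue. ?f x)"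
      by (rule integral_cong_AE[OF mf borel_measurable_AE[OF mf ae'] ae', symmetric])
    also have "\<dots> = (\<integral>x. ?f x \<partial>lborel)" by (rule integral_completion) measurable
    also have "\<dots> = enn2real (\<integral>\<^sup>+x. ennreal (?f x) \<partial>lborel)" by (rule integral_eq_nn_integral) auto
    also have "\<dots> \<le> C"
    proof (rule enn2real_leI[OF C])
      have "(\<integral>\<^sup>+x. ennreal (?f x) \<partial>lborel) = SI UNIV (\<lambda>x. inverse (norm h powr (2 * \<alpha>)) * (norm (w (x + h) - w x))\<^sup>2)"
        by (simp add: SI_def field_simps)
      also have "\<dots> = ennreal (inverse (norm h powr (2 * \<alpha>))) * SI UNIV (\<lambda>x. (norm (w (x + h) - w x))\<^sup>2)"
        by (rule SI_cmult) auto
      also have "\<dots> \<le> ennreal (inverse (norm h powr (2 * \<alpha>))) * ennreal (C * norm h powr (2 * \<alpha>))"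
        by (intro mult_left_mono est h) simp
      also have "\<dots> = ennreal C" using H C by (simp flip: ennreal_mult)
      finally show "(\<integral>\<^sup>+x. ennreal (?f x) \<partial>lborel) \<le> ennreal C" .
    qed
    finally have "(LINT x|lebesgue. norm (v (x + h) - v x) powr 2 / norm h powr (\<alpha> * 2)) \<le> C" .
    then show ?thesis by (intro powr_mono2 integral_nonneg) auto
  qed
  then have "bdd_above ((\<lambda>h. (LINT x|lebesgue. norm (v (x + h) - v x) powr 2 / norm h powr (\<alpha> * 2)) powr (1 / 2)) ` (- {0}))"
    by (intro bdd_aboveI2[where M="C powr (1 / 2)"]) auto
  with L show ?thesis by (simp add: Besov_def)
qed

text \<open>The geometric condition becomes a strict inequality for a continuous function of
  \<open>x\<close>, which makes \<open>G\<close> in \<open>regularity_qf\<close> Borel. Boundedness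
  keeps the complement nonempty, so that \<open>infdist\<close> is a true distance.\<close>

lemma infdist_ball:
  assumes "open \<Omega>" "bounded \<Omega>"
  shows "norm h < infdist x (- \<Omega>) \<longleftrightarrow> cball x (norm h) \<subseteq> (\<Omega> :: 'a::euclidean_space set)"
proof
  have ne: "- \<Omega> \<noteq> {}" using assms(2) not_bounded_UNIV by (metis double_compl Compl_empty_eq)
  show "cball x (norm h) \<subseteq> \<Omega>" if "norm h < infdist x (- \<Omega>)"
    using that infdist_le[of _ "- \<Omega>" x] by force
  show "norm h < infdist x (- \<Omega>)" if "cball x (norm h) \<subseteq> \<Omega>"
  proof (rule ccontr)
    assume n: "\<not> ?thesis"
    obtain y where "y \<in> - \<Omega>" "infdist x (- \<Omega>) = dist x y"
      using infdist_attains_inf[of "- \<Omega>" x] ne assms(1) by (auto simp: closed_def)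
    then show False using n that by (auto simp: subset_iff)
  qed
qed

text \<open>With the N-function reduced to \<open>qf\<close> and the monotone quadratic quotient,
  what remains is to cut off the solution near the support of a single test function and to verify
  the assumptions of \<open>energy\<close> and \<open>energy_reg\<close>.\<close>

lemma regularity_qf:
  fixes \<Omega> :: "(real^'n) set" and A :: "real^'n \<Rightarrow> real^'n \<Rightarrow> real^'n"
  assumes dim: "CARD('n) \<ge> 2" and \<Omega>: "open \<Omega>" "bounded \<Omega>" and \<alpha>: "0 < \<alpha>" "\<alpha> < 1" and \<mu>: "0 < \<mu>"
    and P: "qf c P" and P_sq: "\<And>s t. 0 < s \<Longrightarrow> s \<le> t \<Longrightarrow> P s / s\<^sup>2 \<le> P t / t\<^sup>2" and P1: "P 1 = 1" and P\<mu>: "P \<mu> > 0"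
    and Cv: "Cv > 0" and Vup: "\<And>\<xi> \<eta> :: real^'n. (norm (V_P \<mu> P \<xi> - V_P \<mu> P \<eta>))\<^sup>2
      \<le> Cv * (P (sqrt (\<mu>\<^sup>2 + (norm \<xi>)\<^sup>2 + (norm \<eta>)\<^sup>2)) / (\<mu>\<^sup>2 + (norm \<xi>)\<^sup>2 + (norm \<eta>)\<^sup>2) * (norm (\<xi> - \<eta>))\<^sup>2)"
    and Car: "Caratheodory \<Omega> A" and \<upsilon>: "\<upsilon> > 0" and L: "L > 0" and \<kappa>: "\<kappa> > 0"
    and A1: "AE x in lborel. x \<in> \<Omega> \<longrightarrow> (\<forall>\<xi> \<eta>. (A x \<xi> - A x \<eta>) \<bullet> (\<xi> - \<eta>)
          \<ge> \<upsilon> * (P (sqrt (\<mu>\<^sup>2 + (norm \<xi>)\<^sup>2 + (norm \<eta>)\<^sup>2)) / (\<mu>\<^sup>2 + (norm \<xi>)\<^sup>2 + (norm \<eta>)\<^sup>2)) * (norm (\<xi> - \<eta>))\<^sup>2)"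
    and A2: "AE x in lborel. x \<in> \<Omega> \<longrightarrow> (\<forall>\<xi> \<eta>. norm (A x \<xi> - A x \<eta>)
          \<le> L * (P (sqrt (\<mu>\<^sup>2 + (norm \<xi>)\<^sup>2 + (norm \<eta>)\<^sup>2)) / (\<mu>\<^sup>2 + (norm \<xi>)\<^sup>2 + (norm \<eta>)\<^sup>2)) * norm (\<xi> - \<eta>))"
    and A3: "AE x in lborel. x \<in> \<Omega> \<longrightarrow> (\<forall>\<xi>. norm (A x \<xi>) \<le> \<kappa> * (P (bracket \<mu> \<xi>) / bracket \<mu> \<xi>))"
    and g: "g \<in> Lp_space (real CARD('n) / \<alpha>) \<Omega>"
    and osc: "AE x in lborel. x \<in> \<Omega> \<longrightarrow> (AE y in lborel. y \<in> \<Omega> \<longrightarrow> (\<forall>\<xi>. norm (A x \<xi> - A y \<xi>)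
          \<le> norm (x - y) powr \<alpha> * (g x + g y) * (P (bracket \<mu> \<xi>) / bracket \<mu> \<xi>)))"
    and ws: "weak_solution P A \<Omega> u" and wg: "has_weak_gradient \<Omega> u Du"
  shows "(\<lambda>x. V_P \<mu> P (Du x)) \<in> Besov_loc \<alpha> 2 \<Omega>"
  unfolding Besov_loc_def
proof (intro CollectI ballI)
  fix \<phi> assume "\<phi> \<in> test_functions \<Omega>"
  then have "\<phi> \<in> tests \<Omega>" by (simp add: tests_eq)
  then obtain S where \<phi>: "smooth \<phi>" and S: "compact S" "S \<subseteq> \<Omega>" "\<And>x. x \<notin> S \<Longrightarrow> \<phi> x = 0" by (auto simp: tests_def)
  obtain Dw where uW: "u \<in> W1P_loc P \<Omega>" and wDw: "has_weak_gradient \<Omega> u Dw"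
    and sol: "\<And>\<psi>. \<psi> \<in> test_functions \<Omega> \<Longrightarrow> (LINT x|lebesgue_on \<Omega>. A x (Dw x) \<bullet> grad \<psi> x) = 0"
    using ws by (auto simp: weak_solution_def)
  obtain D U F where D: "open D" "S \<subseteq> D" "compact (closure D)" "closure D \<subseteq> \<Omega>" and wUF: "wgrad U F"
    and PU: "orlicz P U" and PF: "orlicz P F"
    and FD: "AE x in lborel. x \<in> D \<longrightarrow> F x = Du x \<and> F x = Dw x"
    by (rule local_gradient_data[OF P S(1) \<Omega>(1) S(2) uW wg wDw])
  have D\<Omega>: "D \<subseteq> \<Omega>" using D(4) closure_subset by blast
  have Db: "D \<in> sets borel" and \<Omega>b: "\<Omega> \<in> sets borel" using D(1) \<Omega>(1) by simp_all
  note [measurable] = Db \<Omega>b wgradD(4)[OF wUF] qf_borel[OF P]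
  obtain a' where a': "a' \<in> borel_measurable borel" "AE x in lborel. x \<in> \<Omega> \<longrightarrow> a' x = A x (F x)"
    by (rule lebesgue_on_borel_rep[OF \<Omega>b Caratheodory_measurable[OF \<Omega>b Car wgradD(4)[OF wUF]]]) blast
  define a where "a x = indicat_real D x *\<^sub>R a' x" for x
  have aA: "AE x in lborel. x \<in> D \<longrightarrow> a x = A x (F x)"
    using a'(2) by eventually_elim (use D\<Omega> in \<open>auto simp: a_def\<close>)
  have a_meas: "a \<in> borel_measurable borel" unfolding a_def[abs_def] using a'(1) by measurable
  define T where "T \<xi> = P (bracket \<mu> \<xi>) / bracket \<mu> \<xi>" for \<xi> :: "real^'n"
  have T0: "T \<xi> \<ge> 0" for \<xi> unfolding T_def using qf_nonneg[OF P] by simp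
  \<comment> \<open>The bracket of the zero vector is \<mu>, so the growth condition bounds the
    field at zero by \<open>\<kappa> * (P \<mu> / \<mu>)\<close>.\<close>
  have "\<exists>K0\<ge>0. \<forall>a \<xi> :: real^'n. \<forall>a0.
     (a - a0) \<bullet> \<xi> \<ge> \<upsilon> * (P (bracket \<mu> \<xi>) / (\<mu>\<^sup>2 + (norm \<xi>)\<^sup>2)) * (norm \<xi>)\<^sup>2 \<longrightarrow> norm a0 \<le> \<kappa> * (P \<mu> / \<mu>) \<longrightarrow>
     a \<bullet> \<xi> \<ge> \<upsilon> / 4 * P (bracket \<mu> \<xi>) - K0"
    by (rule coercive_field[OF P P_sq \<mu> P\<mu> \<upsilon>])
  then obtain K0 where K0: "K0 \<ge> 0" and coer: "\<forall>a \<xi> :: real^'n. \<forall>a0.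
     (a - a0) \<bullet> \<xi> \<ge> \<upsilon> * (P (bracket \<mu> \<xi>) / (\<mu>\<^sup>2 + (norm \<xi>)\<^sup>2)) * (norm \<xi>)\<^sup>2 \<longrightarrow> norm a0 \<le> \<kappa> * (P \<mu> / \<mu>) \<longrightarrow>
     a \<bullet> \<xi> \<ge> \<upsilon> / 4 * P (bracket \<mu> \<xi>) - K0"
    by (elim exE conjE)
  have E: "energy c P \<mu> D U F a \<kappa> (\<upsilon> / 4) K0"
  proof
    show "integrable lborel (\<lambda>x. indicat_real D x * P (bracket \<mu> (F x)))"
    proof (rule integrable_bound)
      have "emeasure lborel D < \<infinity>"
        using bounded_subset[OF \<Omega>(2) D\<Omega>] by (rule emeasure_bounded_finite)
      then have "integrable lborel (indicat_real D)" by (intro integrable_real_indicator) auto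
      then show "integrable lborel (\<lambda>x. c * (P \<mu> * indicat_real D x + P (norm (F x))))"
        by (intro integrable_mult_right integrable_add PF)
      have "indicat_real D x * P (bracket \<mu> (F x)) \<le> c * (P \<mu> * indicat_real D x + P (norm (F x)))" for x
      proof (cases "x \<in> D")
        case True
        have "bracket \<mu> (F x) \<le> \<mu> + norm (F x)" using \<mu> by (intro real_le_lsqrt) (auto simp: power2_sum)
        then have "P (bracket \<mu> (F x)) \<le> P (\<mu> + norm (F x))" by (intro qf_mono[OF P]) auto
        also have "\<dots> \<le> c * (P \<mu> + P (norm (F x)))" using \<mu> by (intro qf_add[OF P]) auto
        finally show ?thesis using True by simp
      qed (use qf_c[OF P] qf_nonneg[OF P] in auto)
      then show "AE x in lborel. norm (indicat_real D x * P (bracket \<mu> (F x))) \<le> norm (c * (P \<mu> * indicat_real D x + P (norm (F x))))"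
        using qf_nonneg[OF P] by (intro AE_I2) (simp add: order_trans[OF _ abs_ge_self])
    qed measurable
    show "AE x in lborel. x \<in> D \<longrightarrow> norm (a x) \<le> \<kappa> * (P (bracket \<mu> (F x)) / bracket \<mu> (F x))"
      using aA A3 by eventually_elim (use D\<Omega> in auto)
    show "AE x in lborel. x \<in> D \<longrightarrow> a x \<bullet> F x \<ge> \<upsilon> / 4 * P (bracket \<mu> (F x)) - K0"
      using aA A1 A3
    proof eventually_elim
      case (elim x)
      show ?case
      proof
        assume x: "x \<in> D"
        then have x\<Omega>: "x \<in> \<Omega>" using D\<Omega> by blast
        have "(A x (F x) - A x 0) \<bullet> F x \<ge> \<upsilon> * (P (bracket \<mu> (F x)) / (\<mu>\<^sup>2 + (norm (F x))\<^sup>2)) * (norm (F x))\<^sup>2"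
          using elim(2)[rule_format, OF x\<Omega>, of "F x" 0] by simp
        moreover have "norm (A x 0) \<le> \<kappa> * (P \<mu> / \<mu>)" using elim(3)[rule_format, OF x\<Omega>, of 0] \<mu> by simp
        ultimately show "a x \<bullet> F x \<ge> \<upsilon> / 4 * P (bracket \<mu> (F x)) - K0"
          using coer[rule_format, of "F x" "A x (F x)" "A x 0"] elim(1) x by simp
      qed
    qed
    fix \<psi> assume \<psi>: "\<psi> \<in> tests D"
    then have s: "smooth \<psi>" by (simp add: tests_def)
    have "(LINT x|lebesgue_on \<Omega>. A x (Dw x) \<bullet> grad \<psi> x) = (\<integral>x. a x \<bullet> gr \<psi> x \<partial>lborel)"
    proof (rule lebesgue_on_rep_integral(1)[OF \<Omega>b])
      show "(\<lambda>x. a x \<bullet> gr \<psi> x) \<in> borel_measurable borel" by (intro borel_measurable_inner a_meas gr_borel s)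
      show "a x \<bullet> gr \<psi> x = 0" if "x \<notin> \<Omega>" for x using that D\<Omega> by (auto simp: a_def indicator_def)
      show "AE x in lborel. x \<in> \<Omega> \<longrightarrow> a x \<bullet> gr \<psi> x = A x (Dw x) \<bullet> grad \<psi> x"
        using aA FD
      proof eventually_elim
        case (elim x)
        show ?case
        proof (cases "x \<in> D")
          case True
          then have "F x = Dw x" "a x = A x (F x)" using elim by auto
          then have "a x = A x (Dw x)" by (simp only:)
          then show ?thesis by (simp add: grad_gr[OF s])
        next
          case False then show ?thesis using tests_outside(2)[OF \<psi> False] by (simp add: grad_gr[OF s])
        qed
      qed
    qed
    then show "(\<integral>x. a x \<bullet> gr \<psi> x \<partial>lborel) = 0" using sol[of \<psi>] \<psi> tests_mono[OF D\<Omega>] by (auto simp: tests_eq)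
  qed (use P P_sq P1 \<mu> P\<mu> D(1) wUF PU PF a_meas \<kappa> \<upsilon> K0 in \<open>auto simp: a_def\<close>)
  then interpret e: energy c P \<mu> D U F a \<kappa> "\<upsilon> / 4" K0 .
  define s where "s = real CARD('n) / \<alpha>"
  have s: "s > 0" using \<alpha> by (simp add: s_def)
  obtain gb where gb: "gb \<in> borel_measurable borel" "\<And>x. x \<notin> \<Omega> \<Longrightarrow> gb x = 0" "AE x in lborel. x \<in> \<Omega> \<longrightarrow> gb x = g x"
    by (rule lebesgue_on_borel_rep[OF \<Omega>b, of g]) (use g in \<open>auto simp: Lp_space_def\<close>)
  note [measurable] = gb(1)
  \<comment> \<open>The indicator keeps the mean values in \<open>osc_displacement\<close> positive.\<close>
  define \<gamma> where "\<gamma> x = \<bar>gb x\<bar> powr s + indicat_real \<Omega> x" for x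
  have \<gamma>: "integrable lborel \<gamma>" "\<And>x. \<gamma> x \<ge> 0" "\<And>x. x \<in> \<Omega> \<Longrightarrow> \<gamma> x \<ge> 1"
  proof -
    have "integrable lborel (\<lambda>x. \<bar>gb x\<bar> powr s)"
    proof (subst lebesgue_on_rep_integral(2)[OF \<Omega>b, symmetric])
      show "AE x in lborel. x \<in> \<Omega> \<longrightarrow> \<bar>gb x\<bar> powr s = norm (g x) powr s" using gb(3) by eventually_elim auto
      show "integrable (lebesgue_on \<Omega>) (\<lambda>x. norm (g x) powr s)" using g by (simp add: Lp_space_def s_def)
    qed (use gb(2) in auto)
    moreover have "integrable lborel (indicat_real \<Omega>)"
      using emeasure_bounded_finite[OF \<Omega>(2)] by (intro integrable_real_indicator) auto
    ultimately show "integrable lborel \<gamma>" unfolding \<gamma>_def[abs_def] by (rule integrable_add)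
  qed (auto simp: \<gamma>_def)
  have g\<gamma>: "AE x in lborel. x \<in> \<Omega> \<longrightarrow> \<bar>g x\<bar> \<le> \<gamma> x powr (1 / s)"
    using gb(3)
  proof eventually_elim
    case (elim x)
    have "\<bar>gb x\<bar> = (\<bar>gb x\<bar> powr s) powr (1 / s)" using s by (simp add: powr_powr)
    also have "\<dots> \<le> \<gamma> x powr (1 / s)" using s by (intro powr_mono2) (auto simp: \<gamma>_def)
    finally show ?case using elim by auto
  qed
  \<comment> \<open>Near the boundary, where the third point may leave \<open>\<Omega>\<close>, only the growth of \<open>A\<close> is used.\<close>
  define G where "G h x = (if h \<noteq> 0 \<and> norm h < infdist x (- \<Omega>) then min (2 * \<kappa>) (osc_weight \<alpha> s \<gamma> h x) else 2 * \<kappa>)" for h x :: "real^'n"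
  have G: "G h \<in> borel_measurable borel" "0 \<le> G h x" "G h x \<le> 2 * \<kappa>" for h x
  proof -
    show "G h \<in> borel_measurable borel"
    proof (cases "h = 0")
      case False
      have [measurable]: "osc_weight \<alpha> s \<gamma> h \<in> borel_measurable borel" using \<gamma>(1) False by (intro osc_weight_borel) auto
      have [measurable]: "(\<lambda>x. infdist x (- \<Omega>)) \<in> borel_measurable borel"
        by (intro borel_measurable_continuous_onI continuous_intros)
      show ?thesis unfolding G_def[abs_def] by measurable
    qed (simp add: G_def[abs_def])
    show "0 \<le> G h x" "G h x \<le> 2 * \<kappa>" using \<kappa> osc_weight_nonneg[of \<alpha> s \<gamma> h x] by (auto simp: G_def)
  qed
  have Gint: "SI (cball x0 R) (\<lambda>x. G h x powr (real DIM(real^'n) / \<alpha>))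
      \<le> ennreal (6 powr s * (2 + 2 * 2 powr s) * norm h ^ DIM(real^'n)) * SI (cball x0 (2 * R)) \<gamma>"
    if h: "h \<noteq> 0" "norm h \<le> R" and RD: "cball x0 (2 * R) \<subseteq> D" for h x0 R
  proof -
    have "SI (cball x0 R) (\<lambda>x. G h x powr s) \<le> SI (cball x0 R) (\<lambda>x. osc_weight \<alpha> s \<gamma> h x powr s)"
    proof (rule SI_mono, intro conjI)
      fix x assume x: "x \<in> cball x0 R"
      have "cball x (norm h) \<subseteq> cball x0 (2 * R)"
      proof
        fix y assume "y \<in> cball x (norm h)"
        then show "y \<in> cball x0 (2 * R)" using x h dist_triangle[of x0 y x] by auto
      qed
      then have "norm h < infdist x (- \<Omega>)" using RD D\<Omega> by (subst infdist_ball[OF \<Omega>]) blast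
      then show "G h x powr s \<le> osc_weight \<alpha> s \<gamma> h x powr s"
        using G(2)[of h x] s h by (intro powr_mono2) (auto simp: G_def)
    qed simp
    also have "\<dots> \<le> ennreal (6 powr s * (2 + 2 * 2 powr s) * norm h powr (\<alpha> * s)) * SI (cball x0 (2 * R)) \<gamma>"
      by (rule osc_weight_integral[OF \<gamma>(1,2) s h])
    also have "\<alpha> * s = real CARD('n)" using \<alpha> by (simp add: s_def)
    also have "norm h powr real CARD('n) = norm h ^ CARD('n)" using h by (simp add: powr_realpow)
    finally show ?thesis by (simp add: s_def)
  qed
  have str: "AE x in lborel. e.structure_at \<upsilon> L (G h) h x"
    if h: "h \<noteq> 0" for h
  proof -
    have disp: "AE x in lborel. cball x (norm h) \<subseteq> \<Omega> \<longrightarrow> (\<forall>\<xi>. norm (A (x + h) \<xi> - A x \<xi>) \<le> osc_weight \<alpha> s \<gamma> h x * T \<xi>)"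
      by (rule osc_displacement[OF osc[folded T_def] T0 _ _ s \<gamma> g\<gamma> h]) (use \<alpha> in auto)
    show ?thesis
      using aA AE_shift[OF aA, of h] AE_shift[OF A1, of h] AE_shift[OF A2, of h] A3 AE_shift[OF A3, of h] disp
    proof eventually_elim
      case (elim x)
      show ?case
        unfolding e.structure_at_def
      proof (intro impI)
        assume x: "x \<in> D" "x + h \<in> D"
        then have x\<Omega>: "x \<in> \<Omega>" "x + h \<in> \<Omega>" using D\<Omega> by auto
        let ?\<xi> = "F (x + h)" and ?\<eta> = "F x"
        have Mh2: "(e.Mh h x)\<^sup>2 = \<mu>\<^sup>2 + (norm ?\<eta>)\<^sup>2 + (norm ?\<xi>)\<^sup>2" unfolding e.Mh_def by (intro real_sqrt_pow2) simp
        have qe: "P (sqrt (\<mu>\<^sup>2 + (norm ?\<xi>)\<^sup>2 + (norm ?\<eta>)\<^sup>2)) / (\<mu>\<^sup>2 + (norm ?\<xi>)\<^sup>2 + (norm ?\<eta>)\<^sup>2) = e.q h x"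
          unfolding e.q_def Mh2 unfolding e.Mh_def by (simp only: add_ac)
        \<comment> \<open>The square of \<open>T\<close> is \<open>P m\<close> times
          \<open>P m / m\<^sup>2\<close> at the bracket \<open>m\<close> of \<open>F x\<close>. This
          bracket is at most \<open>Mh h x\<close>, so the second factor is at most
          \<open>q\<close>, while the first is \<open>f\<close>.\<close>
        have T_le: "T ?\<eta> \<le> sqrt (e.f x) * sqrt (e.q h x)"
        proof -
          have "(T ?\<eta>)\<^sup>2 = P (e.m x) * (P (e.m x) / (e.m x)\<^sup>2)" by (simp add: T_def e.m_def power_divide power2_eq_square)
          also have "\<dots> \<le> e.f x * e.q h x"
          proof (intro mult_mono)
            show "P (e.m x) / (e.m x)\<^sup>2 \<le> e.q h x" unfolding e.q_def by (intro P_sq e.m_pos) (simp add: e.m_def e.Mh_def)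
          qed (use e.f_D[OF x(1)] qf_nonneg[OF P] in auto)
          finally have "T ?\<eta> \<le> sqrt (e.f x * e.q h x)" by (rule real_le_rsqrt)
          then show ?thesis by (simp add: real_sqrt_mult)
        qed
        have "norm (A (x + h) ?\<eta> - A x ?\<eta>) \<le> G h x * T ?\<eta>"
        proof -
          have k: "norm (A (x + h) ?\<eta> - A x ?\<eta>) \<le> 2 * \<kappa> * T ?\<eta>"
            using norm_triangle_ineq4[of "A (x + h) ?\<eta>" "A x ?\<eta>"] elim(5)[rule_format, OF x\<Omega>(1), of ?\<eta>] elim(6)[rule_format, OF x\<Omega>(2), of ?\<eta>]
            by (simp add: T_def)
          show ?thesis
          proof (cases "norm h < infdist x (- \<Omega>)")
            case True
            then have "cball x (norm h) \<subseteq> \<Omega>" by (simp only: infdist_ball[OF \<Omega>])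
            then have "norm (A (x + h) ?\<eta> - A x ?\<eta>) \<le> osc_weight \<alpha> s \<gamma> h x * T ?\<eta>" using elim(7) by blast
            then show ?thesis using k True h by (simp add: G_def min_def)
          qed (use k in \<open>simp add: G_def\<close>)
        qed
        also have "\<dots> \<le> G h x * (sqrt (e.f x) * sqrt (e.q h x))" by (intro mult_left_mono T_le G)
        finally have osc': "norm (A (x + h) ?\<eta> - A x ?\<eta>) \<le> G h x * sqrt (e.f x) * sqrt (e.q h x)" by (simp add: mult.assoc)
        have ae: "a x = A x ?\<eta>" "a (x + h) = A (x + h) ?\<xi>" using elim(1,2) x by auto
        \<comment> \<open>First the gradient argument changes at the fixed point
          \<open>x + h\<close>, then the point at the fixed gradient \<open>F x\<close>: the former
          is governed by monotonicity and growth, the latter by the oscillation bound.\<close>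
        have split: "a (x + h) - a x = (A (x + h) ?\<xi> - A (x + h) ?\<eta>) + (A (x + h) ?\<eta> - A x ?\<eta>)" by (simp add: ae)
        have m: "\<upsilon> * e.q h x * (norm (?\<xi> - ?\<eta>))\<^sup>2 \<le> (A (x + h) ?\<xi> - A (x + h) ?\<eta>) \<bullet> (?\<xi> - ?\<eta>)"
          using elim(3)[rule_format, OF x\<Omega>(2), of ?\<xi> ?\<eta>] unfolding qe .
        have l: "norm (A (x + h) ?\<xi> - A (x + h) ?\<eta>) \<le> L * e.q h x * norm (?\<xi> - ?\<eta>)"
          using elim(4)[rule_format, OF x\<Omega>(2), of ?\<xi> ?\<eta>] unfolding qe .
        have "- ((A (x + h) ?\<eta> - A x ?\<eta>) \<bullet> (?\<xi> - ?\<eta>)) \<le> norm (A (x + h) ?\<eta> - A x ?\<eta>) * norm (?\<xi> - ?\<eta>)"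
          using Cauchy_Schwarz_ineq2[of "A (x + h) ?\<eta> - A x ?\<eta>" "?\<xi> - ?\<eta>"] by linarith
        also have "\<dots> \<le> G h x * sqrt (e.f x) * sqrt (e.q h x) * norm (?\<xi> - ?\<eta>)" by (intro mult_right_mono osc') simp
        finally show "\<upsilon> * e.q h x * (norm (?\<xi> - ?\<eta>))\<^sup>2 - G h x * sqrt (e.f x) * sqrt (e.q h x) * norm (?\<xi> - ?\<eta>)
            \<le> (a (x + h) - a x) \<bullet> (?\<xi> - ?\<eta>) \<and>
          norm (a (x + h) - a x) \<le> L * e.q h x * norm (?\<xi> - ?\<eta>) + G h x * sqrt (e.f x) * sqrt (e.q h x)"
          unfolding split inner_add_left using m norm_triangle_mono[OF l osc'] by linarith
      qed
    qed
  qed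
  define V where "V x = V_P \<mu> P (F x)" for x
  have mV: "V \<in> borel_measurable borel" unfolding V_def[abs_def] V_P_def by measurable
  have Vle: "(norm (V_P \<mu> P \<xi>))\<^sup>2 \<le> P (bracket \<mu> \<xi>)" for \<xi> :: "real^'n" by (rule V_P_le[OF P P_sq \<mu> P\<mu>])
  have Vge: "P (bracket \<mu> \<xi>) \<le> 2 * (norm (V_P \<mu> P \<xi>))\<^sup>2 + P (2 * \<mu>)" for \<xi> :: "real^'n" by (rule V_P_ge[OF P P_sq \<mu> P\<mu>])
  interpret r: energy_reg c P \<mu> D U F a \<kappa> "\<upsilon> / 4" K0 \<upsilon> L \<alpha> Cv "P (2 * \<mu>)" "6 powr s * (2 + 2 * 2 powr s)" "2 * \<kappa>" V \<gamma> G
  proof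
    show "DIM(real^'n) \<ge> 2" using dim by simp
    show "6 powr s * (2 + 2 * 2 powr s) > 0" by (intro mult_pos_pos add_pos_nonneg) auto
    show "(norm (V x))\<^sup>2 \<le> e.f x" if "x \<in> D" for x
      using Vle[of "F x"] e.f_D[OF that] by (simp add: V_def e.m_def)
    show "e.f x \<le> 2 * (norm (V x))\<^sup>2 + P (2 * \<mu>)" if "x \<in> D" for x
      using Vge[of "F x"] e.f_D[OF that] by (simp add: V_def e.m_def)
    show "(norm (V (x + h) - V x))\<^sup>2 \<le> Cv * (e.q h x * (norm (F (x + h) - F x))\<^sup>2)" for x h
    proof -
      have "(e.Mh h x)\<^sup>2 = \<mu>\<^sup>2 + (norm (F x))\<^sup>2 + (norm (F (x + h)))\<^sup>2" unfolding e.Mh_def by (intro real_sqrt_pow2) simp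
      then have "e.q h x = P (sqrt (\<mu>\<^sup>2 + (norm (F x))\<^sup>2 + (norm (F (x + h)))\<^sup>2)) / (\<mu>\<^sup>2 + (norm (F x))\<^sup>2 + (norm (F (x + h)))\<^sup>2)"
        unfolding e.q_def by (simp add: e.Mh_def)
      then show ?thesis using Vup[of "F x" "F (x + h)"] by (simp add: V_def norm_minus_commute)
    qed
  qed (assumption | rule Gint str | (use \<alpha> \<upsilon> L Cv \<kappa> mV \<gamma> G qf_nonneg[OF P] in \<open>auto; fail\<close>))+
  note be = r.besov_estimate[OF \<phi> S(1) D(2) S(3)]
  obtain C where C: "C \<ge> 0" and est: "\<And>h. h \<noteq> 0 \<Longrightarrow>
      SI UNIV (\<lambda>x. (norm (\<phi> (x + h) *\<^sub>R V (x + h) - \<phi> x *\<^sub>R V x))\<^sup>2) \<le> ennreal (C * norm h powr (2 * \<alpha>))"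
    using be(2) by blast
  show "(\<lambda>x. \<phi> x *\<^sub>R V_P \<mu> P (Du x)) \<in> Besov \<alpha> 2"
  proof (rule Besov_I[of "\<lambda>x. \<phi> x *\<^sub>R V x", OF _ _ be(1) C est])
    show "(\<lambda>x. \<phi> x *\<^sub>R V x) \<in> borel_measurable borel" by (intro borel_measurable_scaleR smooth_borel[OF \<phi>] mV)
    show "AE x in lborel. \<phi> x *\<^sub>R V x = \<phi> x *\<^sub>R V_P \<mu> P (Du x)"
      using FD
    proof eventually_elim
      case (elim x)
      then show ?case using S(3)[of x] D(2) by (cases "x \<in> D") (auto simp: V_def)
    qed
  qed
qed

theorem theorem1p1:
  fixes \<Omega> :: "(real^'n) set"
    and \<alpha> \<mu> \<upsilon> L \<kappa> :: real
    and P :: "real \<Rightarrow> real"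
    and A :: "real^'n \<Rightarrow> real^'n \<Rightarrow> real^'n"
    and g u :: "real^'n \<Rightarrow> real"
    and Du :: "real^'n \<Rightarrow> real^'n"
  assumes "CARD('n) \<ge> 2"
    and "open \<Omega>" and "bounded \<Omega>"
    and "0 < \<alpha>" and "\<alpha> < 1" and "0 < \<mu>" and "\<mu> < 1"
    and "N_function P"
    and P1: "comparable_on ({0..} \<times> {0..}) (\<lambda>(s, t). P (s * t)) (\<lambda>(s, t). P s * P t)"
      "comparable_on ({0..} \<times> {0..}) (\<lambda>(s, t). complementary P (s * t))
         (\<lambda>(s, t). complementary P s * complementary P t)"
      "mono_on {0<..} (\<lambda>t. P t / t\<^sup>2)"
    and P2: "\<exists>C>0. \<forall>\<xi> \<eta> :: real^'n. \<xi> \<noteq> \<eta> \<longrightarrow>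
        inverse C * (P (sqrt (\<mu>\<^sup>2 + (norm \<xi>)\<^sup>2 + (norm \<eta>)\<^sup>2)) / (\<mu>\<^sup>2 + (norm \<xi>)\<^sup>2 + (norm \<eta>)\<^sup>2))
          \<le> (norm (V_P \<mu> P \<xi> - V_P \<mu> P \<eta>))\<^sup>2 / (norm (\<xi> - \<eta>))\<^sup>2 \<and>
        (norm (V_P \<mu> P \<xi> - V_P \<mu> P \<eta>))\<^sup>2 / (norm (\<xi> - \<eta>))\<^sup>2
          \<le> C * (P (sqrt (\<mu>\<^sup>2 + (norm \<xi>)\<^sup>2 + (norm \<eta>)\<^sup>2)) / (\<mu>\<^sup>2 + (norm \<xi>)\<^sup>2 + (norm \<eta>)\<^sup>2))"
    and "Caratheodory \<Omega> A"
    and "\<upsilon> > 0" and "L > 0" and "\<kappa> > 0"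
    and A1: "AE x in lebesgue_on \<Omega>. \<forall>\<xi> \<eta>.
        (A x \<xi> - A x \<eta>) \<bullet> (\<xi> - \<eta>)
          \<ge> \<upsilon> * (P (sqrt (\<mu>\<^sup>2 + (norm \<xi>)\<^sup>2 + (norm \<eta>)\<^sup>2)) / (\<mu>\<^sup>2 + (norm \<xi>)\<^sup>2 + (norm \<eta>)\<^sup>2))
              * (norm (\<xi> - \<eta>))\<^sup>2"
    and A2: "AE x in lebesgue_on \<Omega>. \<forall>\<xi> \<eta>.
        norm (A x \<xi> - A x \<eta>)
          \<le> L * (P (sqrt (\<mu>\<^sup>2 + (norm \<xi>)\<^sup>2 + (norm \<eta>)\<^sup>2)) / (\<mu>\<^sup>2 + (norm \<xi>)\<^sup>2 + (norm \<eta>)\<^sup>2))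
              * norm (\<xi> - \<eta>)"
    and A3: "AE x in lebesgue_on \<Omega>. \<forall>\<xi>.
        norm (A x \<xi>) \<le> \<kappa> * (P (sqrt (\<mu>\<^sup>2 + (norm \<xi>)\<^sup>2)) / sqrt (\<mu>\<^sup>2 + (norm \<xi>)\<^sup>2))"
    and "g \<in> Lp_space (real CARD('n) / \<alpha>) \<Omega>"
    and "AE x in lebesgue_on \<Omega>. AE y in lebesgue_on \<Omega>. \<forall>\<xi>.
        norm (A x \<xi> - A y \<xi>)
          \<le> norm (x - y) powr \<alpha> * (g x + g y)
              * (P (sqrt (\<mu>\<^sup>2 + (norm \<xi>)\<^sup>2)) / sqrt (\<mu>\<^sup>2 + (norm \<xi>)\<^sup>2))"
    and "weak_solution P A \<Omega> u"
    and "has_weak_gradient \<Omega> u Du"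
  shows "(\<lambda>x. V_P \<mu> P (Du x)) \<in> Besov_loc \<alpha> 2 \<Omega>"
proof -
  \<comment> \<open>\<open>P\<close> is arbitrary at negative arguments.\<close>
  define Q where "Q t = P (max 0 t)" for t
  note N = \<open>N_function P\<close> and mono = P1(3)
  have Q: "Q t = P t" if "t \<ge> 0" for t using that by (simp add: Q_def max_absorb2)
  have VQ: "V_P \<mu> P \<xi> = V_P \<mu> Q \<xi>" for \<xi> :: "real^'n" by (simp add: V_P_def Q)
  obtain c where qf: "qf c Q" using N_function_qf[OF N mono] unfolding Q_def[abs_def] by (elim exE)
  have \<Omega>b: "\<Omega> \<in> sets borel" using \<open>open \<Omega>\<close> by simp
  from P2 obtain C where C: "C > 0" and P2': "\<And>\<xi> \<eta> :: real^'n. \<xi> \<noteq> \<eta> \<Longrightarrow>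
    (norm (V_P \<mu> P \<xi> - V_P \<mu> P \<eta>))\<^sup>2 / (norm (\<xi> - \<eta>))\<^sup>2
          \<le> C * (P (sqrt (\<mu>\<^sup>2 + (norm \<xi>)\<^sup>2 + (norm \<eta>)\<^sup>2)) / (\<mu>\<^sup>2 + (norm \<xi>)\<^sup>2 + (norm \<eta>)\<^sup>2))"
    by (elim exE conjE) simp
  \<comment> \<open>The Orlicz conditions evaluate the N-function at absolute values only, where
    \<open>P\<close> and \<open>Q\<close> agree.\<close>
  have "weak_solution Q A \<Omega> u"
    using \<open>weak_solution P A \<Omega> u\<close>
    by (simp add: weak_solution_def W1P_loc_def W1P_def Orlicz_space_def Q)
  \<comment> \<open>Multiplying out the quotient also admits the case
    \<open>\<xi> = \<eta>\<close>.\<close>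
  moreover have "(norm (V_P \<mu> Q \<xi> - V_P \<mu> Q \<eta>))\<^sup>2
      \<le> C * (Q (sqrt (\<mu>\<^sup>2 + (norm \<xi>)\<^sup>2 + (norm \<eta>)\<^sup>2)) / (\<mu>\<^sup>2 + (norm \<xi>)\<^sup>2 + (norm \<eta>)\<^sup>2) * (norm (\<xi> - \<eta>))\<^sup>2)"
    for \<xi> \<eta> :: "real^'n"
    using P2'[of \<xi> \<eta>] unfolding VQ[symmetric]
    by (cases "\<xi> = \<eta>") (auto simp: Q pos_divide_le_eq mult.assoc)
  moreover have "Q s / s\<^sup>2 \<le> Q t / t\<^sup>2" if "0 < s" "s \<le> t" for s t
    using mono_onD[OF mono, of s t] that by (simp add: Q)
  moreover have "Q 1 = 1" "Q \<mu> > 0" using N N_function_pos[OF N \<open>0 < \<mu>\<close>] \<open>0 < \<mu>\<close> by (simp_all add: Q N_function_def)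
  ultimately have "(\<lambda>x. V_P \<mu> Q (Du x)) \<in> Besov_loc \<alpha> 2 \<Omega>"
    using assms A1 A2 A3 C qf
    by (intro regularity_qf[where P=Q and A=A and g=g and u=u and L=L and \<kappa>=\<kappa> and \<upsilon>=\<upsilon> and Cv=C and c=c])
      (simp_all add: AE_lebesgue_on[OF \<Omega>b] Q)
  then show ?thesis by (simp add: VQ)
qed

end
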